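(* Let $\mathbb{F}$ be a finite field of characteristic $p$. Let $\eta_1,\dots,\eta_n \in \mathbb{F}_p[y]$ be additive polynomials and $r_1,\dots,r_n$ distinct positive integers not divisible by $p$, and let $P(y) = \sum_{i=1}^n \eta_i(y^{r_i}) \in \mathbb{F}_p[y]$. The following are equivalent: (i) $P$ is good for irrational equidistribution; (ii) for every totally ergodic measure-preserving $\mathbb{F}[t]$-system $(X,\mathcal{X},\mu,(T_y)_{y\in\mathbb{F}[t]})$, every Følner sequence $(\Phi_N)$ in $\mathbb{F}[t]$ and every $f\in L^2(\mu)$, $\lim_{N\to\infty}\mathbb{E}_{y\in\Phi_N}T_{P(y)}f = \int_X f\,d\mu$ in $L^2(\mu)$; (iii) there exist additive polynomials $\zeta_1,\dots,\zeta_n\in\mathbb{F}_p[y]$ and $a\in\mathbb{F}_p^\times$ with $\sum_{i=1}^n (\eta_i\circ\zeta_i)(y) = ay$; (iv) $\sup_{\|f\|_{L^2(\mathbb{F}[t]_Q)}=1}\|\mathbb{E}_{y\in\mathbb{F}[t]_Q}f(x+P(y))-\mathbb{E}_{z\in\mathbb{F}[t]_Q}f(z)\|_{L^2(\mathbb{F}[t]_Q)}\to 0$ as $\mathrm{lpf}(Q)\to\infty$ over monic $Q\in\mathbb{F}[t]$; (v) there exist $C_1,C_2,\gamma>0$ such that for every monic $Q$ with $\mathrm{lpf}(Q)\ge C_1$ the supremum in (iv) is at most $C_2\,\mathrm{lpf}(Q)^{-\gamma}$; (vi) there exists $C>0$ such that for every monic $Q$ with $\mathrm{lpf}(Q)\ge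 C$, $H_Q = \mathbb{F}[t]_Q$, where $H_Q=\sum_{i=1}^n H_{i,Q}$ and $H_{i,Q}=\eta_i(\mathbb{F}[t]_Q)$; (vii) for every $\delta>0$ there is $N>0$ such that if $Q$ is monic with $\mathrm{lpf}(Q)\ge N$ and $A,B\subseteq\mathbb{F}[t]_Q$ satisfy $|A||B|\ge\delta|Q|^2$, then there are $x,y\in\mathbb{F}[t]_Q$ with $x\in A$ and $x+P(y)\in B$; (viii) there exist $C_1,C_2,\gamma>0$ such that for every monic $Q$ with $\mathrm{lpf}(Q)\ge C_1$ and all $A,B\subseteq\mathbb{F}[t]_Q$, $\big||\{(x,y)\in\mathbb{F}[t]_Q^2:x\in A,\ x+P(y)\in B\}|-|A||B|\big|\le C_2|A|^{1/2}|B|^{1/2}|Q|\,\mathrm{lpf}(Q)^{-\gamma}$.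
   Context: A polynomial $\eta$ is additive if $\eta(x+y)=\eta(x)+\eta(y)$ identically (equivalently $\eta(y)=\sum_j c_jy^{p^j}$). $\mathbb{F}[t]_Q=\mathbb{F}[t]/Q\mathbb{F}[t]$; $|Q|=|\mathbb{F}|^{\deg Q}$; for $Q=Q_1^{s_1}\cdots Q_r^{s_r}$ (distinct monic irreducibles), $\mathrm{lpf}(Q)=\min_i|Q_i|$. $L^2$ norms are in $x$, $\|f\|_{L^2(S)}=(\mathbb{E}_{x\in S}|f(x)|^2)^{1/2}$, $\mathbb{E}$ = average. $\mathbb{F}((t^{-1}))$ = formal Laurent series in $t^{-1}$ over $\mathbb{F}$, $\mathbb{F}((t^{-1}))/\mathbb{F}[t]$ compact with Haar probability $m$. Følner sequence: finite nonempty $\Phi_N\subseteq\mathbb{F}[t]$ with $|(\Phi_N+n)\triangle\Phi_N|/|\Phi_N|\to0$ for all $n$. $a:\mathbb{F}[t]\to\mathbb{F}((t^{-1}))$ is well-distributed mod $\mathbb{F}[t]$ if $\lim_N\mathbb{E}_{n\in\Phi_N}g(a(n))=\int g\,dm$ for all continuous $g$ and all Følner sequences; $P$ is good for irrational equidistribution if $(P(n)\alpha)_n$ is well-distributed mod $\mathbb{F}[t]$ for all $\alpha\in\mathbb{F}((t^{-1}))\setminus\mathbb{F}(t)$. A measure-preserving $\mathbb{F}[t]$-system is a probability space with a measure-preserving action of $(\mathbb{F}[t],+)$ (acting on $L^2$ by composition); it is totally ergodic if $(T_{my})_{y}$ is ergodic for each $m\neq0$. *)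

theory Defs
  imports
    "HOL-Probability.Probability"
    "HOL-Computational_Algebra.Computational_Algebra"
begin

section \<open>Polynomials over the prime field\<close>

text \<open>Throughout, \<open>\<F>\<close> is a type \<^typ>\<open>'a\<close> of class \<^class>\<open>finite_field\<close> and \<open>\<F>[t]\<close> is \<^typ>\<open>'a poly\<close>.
  The same type also carries the one-variable polynomials \<open>P(y)\<close>; the value of \<open>P\<close> at
  \<open>y \<in> \<F>[t]\<close>, again an element of \<open>\<F>[t]\<close>, is \<open>P \<circ>\<^sub>p y\<close>.\<close>

text \<open>The copy of \<open>\<F>\<^sub>p\<close> inside \<open>\<F>\<close>: the multiples of \<open>1\<close>.\<close>

definition prime_field :: "'a::finite_field set" where
  "prime_field = range of_nat"

definition prime_field_polys :: "'a::finite_field poly set" where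
  "prime_field_polys = {f. \<forall>i. coeff f i \<in> prime_field}"

text \<open>Additivity is the identity \<open>\<eta>(X + Y) = \<eta>(X) + \<eta>(Y)\<close> in \<open>\<F>[X][Y]\<close>, not merely an identity
  of functions on the finite field.\<close>

definition additive_poly :: "'a::finite_field poly \<Rightarrow> bool" where
  "additive_poly \<eta> \<longleftrightarrow>
    (let X = [:[:0, 1:]:];
         Y = [:0, 1:];
         ev = (\<lambda>z :: 'a poly poly. poly (map_poly (\<lambda>c. [:[:c:]:]) \<eta>) z)
     in ev (X + Y) = ev X + ev Y)"


section \<open>Averages, norms and the rings \<open>\<F>[t]/Q\<F>[t]\<close>\<close>

definition average :: "'i set \<Rightarrow> ('i \<Rightarrow> 'b::field) \<Rightarrow> 'b" where
  "average S f = (\<Sum>x\<in>S. f x) / of_nat (card S)"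

text \<open>\<open>\<F>[t]\<^sub>Q\<close> is represented by the reduced representatives of the residue classes
  (for \<open>Q \<noteq> 0\<close>: the polynomials of degree less than \<open>deg Q\<close>, and \<open>0\<close>); the result of a
  ring operation is to be reduced \<open>mod Q\<close>.\<close>

definition residue_ring :: "'a::finite_field poly \<Rightarrow> 'a poly set" where
  "residue_ring Q = range (\<lambda>x. x mod Q)"

definition poly_abs :: "'a::finite_field poly \<Rightarrow> nat" where
  "poly_abs Q = CARD('a) ^ degree Q"

text \<open>The constant \<open>Q = 1\<close>, which has no prime factor, is excluded.\<close>

definition moduli :: "'a::finite_field poly set" where
  "moduli = {Q. lead_coeff Q = 1 \<and> degree Q > 0}"

definition lpf :: "'a::finite_field poly \<Rightarrow> nat" where
  "lpf Q = Min (poly_abs ` {R. lead_coeff R = 1 \<and> irreducible R \<and> R dvd Q})"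

definition L2_norm_residue :: "'a::finite_field poly \<Rightarrow> ('a poly \<Rightarrow> complex) \<Rightarrow> real" where
  "L2_norm_residue Q f = sqrt (average (residue_ring Q) (\<lambda>x. (cmod (f x))\<^sup>2))"

text \<open>The set below is bounded above (by \<open>2\<close>) and nonempty, so this is a genuine supremum.\<close>

definition mean_deviation :: "'a::finite_field poly \<Rightarrow> 'a poly \<Rightarrow> real" where
  "mean_deviation P Q =
    (SUP f \<in> {f. L2_norm_residue Q f = 1}.
       L2_norm_residue Q (\<lambda>x.
         average (residue_ring Q) (\<lambda>y. f ((x + P \<circ>\<^sub>p y) mod Q)) - average (residue_ring Q) f))"

definition image_subgroup :: "'a::finite_field poly \<Rightarrow> 'a poly \<Rightarrow> 'a poly set" where
  "image_subgroup Q \<eta> = (\<lambda>y. (\<eta> \<circ>\<^sub>p y) mod Q) ` residue_ring Q"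

definition sum_image_subgroups :: "'a::finite_field poly \<Rightarrow> (nat \<Rightarrow> 'a poly) \<Rightarrow> nat \<Rightarrow> 'a poly set" where
  "sum_image_subgroups Q \<eta> n =
    {(\<Sum>i=1..n. h i) mod Q | h. \<forall>i\<in>{1..n}. h i \<in> image_subgroup Q (\<eta> i)}"


section \<open>Folner sequences\<close>

definition folner :: "(nat \<Rightarrow> 'a::finite_field poly set) \<Rightarrow> bool" where
  "folner \<Phi> \<longleftrightarrow>
    (\<forall>N. finite (\<Phi> N) \<and> \<Phi> N \<noteq> {}) \<and>
    (\<forall>n. (\<lambda>N. real (card (sym_diff ((\<lambda>x. x + n) ` \<Phi> N) (\<Phi> N))) / real (card (\<Phi> N)))
           \<longlonglongrightarrow> 0)"


section \<open>The compact group \<open>\<F>((t\<^sup>-\<^sup>1))/\<F>[t]\<close>\<close>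

text \<open>\<open>\<F>((t\<^sup>-\<^sup>1))\<close> is \<^typ>\<open>'a fls\<close>, whose formal variable \<^const>\<open>fls_X\<close> plays the role of
  \<open>t\<^sup>-\<^sup>1\<close>; hence \<open>t\<close> is \<^const>\<open>fls_X_inv\<close>.\<close>

definition fls_of_poly :: "'a::field poly \<Rightarrow> 'a fls" where
  "fls_of_poly p = poly (map_poly fls_const p) fls_X_inv"

lemma fls_of_poly_0: "fls_of_poly 0 = 0"
  by (simp add: fls_of_poly_def)

lemma zero_in_range_fls_of_poly: "0 \<in> range fls_of_poly"
  using rangeI[of fls_of_poly 0] by (simp add: fls_of_poly_0)

lemma fls_of_poly_add: "fls_of_poly (p + q) = fls_of_poly p + fls_of_poly q"
proof -
  have "map_poly fls_const (p + q) = map_poly fls_const p + map_poly fls_const q"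
    by (rule poly_eqI) (simp add: coeff_map_poly fls_plus_const)
  thus ?thesis
    by (simp add: fls_of_poly_def)
qed

lemma fls_of_poly_minus: "fls_of_poly (- p) = - fls_of_poly p"
  using fls_of_poly_add[of p "- p"] by (simp add: fls_of_poly_0 eq_neg_iff_add_eq_0 add.commute)

definition rational_fls :: "'a::field fls set" where
  "rational_fls = {fls_of_poly u / fls_of_poly v | u v. v \<noteq> 0}"

quotient_type (overloaded) 'a laurent_torus =
  "'a::field fls" / "\<lambda>f g. f - g \<in> range fls_of_poly"
proof (rule equivpI)
  show "reflp (\<lambda>f g :: 'a fls. f - g \<in> range fls_of_poly)"
    by (rule reflpI) (simp add: zero_in_range_fls_of_poly)
  show "symp (\<lambda>f g :: 'a fls. f - g \<in> range fls_of_poly)"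
  proof (rule sympI)
    fix f g :: "'a fls"
    assume "f - g \<in> range fls_of_poly"
    then obtain p where p: "f - g = fls_of_poly p" by blast
    have "g - f = fls_of_poly (- p)" by (simp add: fls_of_poly_minus flip: p)
    thus "g - f \<in> range fls_of_poly" by blast
  qed
  show "transp (\<lambda>f g :: 'a fls. f - g \<in> range fls_of_poly)"
  proof (rule transpI)
    fix f g h :: "'a fls"
    assume "f - g \<in> range fls_of_poly" "g - h \<in> range fls_of_poly"
    then obtain p q where pq: "f - g = fls_of_poly p" "g - h = fls_of_poly q" by blast
    have "f - h = fls_of_poly (p + q)" by (simp add: fls_of_poly_add flip: pq)
    thus "f - h \<in> range fls_of_poly" by blast
  qed
qed

instantiation laurent_torus :: (field) ab_group_add
begin

lift_definition zero_laurent_torus :: "'a laurent_torus" is 0 .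

lift_definition plus_laurent_torus :: "'a laurent_torus \<Rightarrow> 'a laurent_torus \<Rightarrow> 'a laurent_torus"
  is "(+)"
proof -
  fix f f' g g' :: "'a fls"
  assume "f - f' \<in> range fls_of_poly" "g - g' \<in> range fls_of_poly"
  then obtain p q where "f - f' = fls_of_poly p" "g - g' = fls_of_poly q" by blast
  hence "f + g - (f' + g') = fls_of_poly (p + q)"
    by (metis add_diff_add fls_of_poly_add)
  thus "f + g - (f' + g') \<in> range fls_of_poly" by blast
qed

lift_definition uminus_laurent_torus :: "'a laurent_torus \<Rightarrow> 'a laurent_torus" is uminus
proof -
  fix f g :: "'a fls"
  assume "f - g \<in> range fls_of_poly"
  then obtain p where p: "f - g = fls_of_poly p" by blast
  have "- f - - g = fls_of_poly (- p)" by (simp add: fls_of_poly_minus flip: p)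
  thus "- f - - g \<in> range fls_of_poly" by blast
qed

definition minus_laurent_torus :: "'a laurent_torus \<Rightarrow> 'a laurent_torus \<Rightarrow> 'a laurent_torus" where
  "minus_laurent_torus x y = x + (- y)"

instance
proof
  fix x y z :: "'a laurent_torus"
  note refl = zero_in_range_fls_of_poly
  show "x + y + z = x + (y + z)" by transfer (simp add: refl algebra_simps)
  show "x + y = y + x" by transfer (simp add: refl algebra_simps)
  show "0 + x = x" by transfer (simp add: refl)
  show "- x + x = 0" by transfer (simp add: refl)
  show "x - y = x + - y" by (simp add: minus_laurent_torus_def)
qed

end

text \<open>The quotient topology of the \<open>t\<^sup>-\<^sup>1\<close>-adic topology on \<^typ>\<open>'a fls\<close>.\<close>

instantiation laurent_torus :: (field) topological_space
begin

definition open_laurent_torus :: "'a laurent_torus set \<Rightarrow> bool" where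
  "open_laurent_torus U \<longleftrightarrow> open (abs_laurent_torus -` U)"

instance
proof
  fix K :: "'a laurent_torus set set"
  assume "\<forall>S\<in>K. open S"
  thus "open (\<Union>K)"
    by (auto simp: open_laurent_torus_def vimage_Union)
qed (auto simp: open_laurent_torus_def vimage_Int)

end

definition is_haar_probability :: "'a::finite_field laurent_torus measure \<Rightarrow> bool" where
  "is_haar_probability M \<longleftrightarrow>
    prob_space M \<and> sets M = sets borel \<and> (\<forall>c. distr M borel (\<lambda>x. x + c) = M)"

definition haar :: "'a::finite_field laurent_torus measure" where
  "haar = (THE M. is_haar_probability M)"

definition well_distributed :: "('a::finite_field poly \<Rightarrow> 'a fls) \<Rightarrow> bool" where
  "well_distributed a \<longleftrightarrow>
    (\<forall>(g :: 'a laurent_torus \<Rightarrow> complex) \<Phi>. continuous_on UNIV g \<and> folner \<Phi> \<longrightarrow>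
      (\<lambda>N. average (\<Phi> N) (\<lambda>n. g (abs_laurent_torus (a n)))) \<longlonglongrightarrow> (\<integral>x. g x \<partial>haar))"

definition good_for_irrational_equidistribution :: "'a::finite_field poly \<Rightarrow> bool" where
  "good_for_irrational_equidistribution P \<longleftrightarrow>
    (\<forall>\<alpha>. \<alpha> \<notin> rational_fls \<longrightarrow> well_distributed (\<lambda>n. fls_of_poly (P \<circ>\<^sub>p n) * \<alpha>))"


section \<open>Measure-preserving \<open>\<F>[t]\<close>-systems\<close>

definition mp_system :: "'x measure \<Rightarrow> ('a::finite_field poly \<Rightarrow> 'x \<Rightarrow> 'x) \<Rightarrow> bool" where
  "mp_system M T \<longleftrightarrow>
    prob_space M \<and>
    (\<forall>y. T y \<in> measurable M M \<and> distr M M (T y) = M) \<and>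
    (\<forall>x\<in>space M. T 0 x = x) \<and>
    (\<forall>y z. \<forall>x\<in>space M. T (y + z) x = T y (T z x))"

definition ergodic_action :: "'x measure \<Rightarrow> ('a::finite_field poly \<Rightarrow> 'x \<Rightarrow> 'x) \<Rightarrow> bool" where
  "ergodic_action M T \<longleftrightarrow>
    (\<forall>A\<in>sets M. (\<forall>y. T y -` A \<inter> space M = A) \<longrightarrow> measure M A = 0 \<or> measure M A = 1)"

definition totally_ergodic :: "'x measure \<Rightarrow> ('a::finite_field poly \<Rightarrow> 'x \<Rightarrow> 'x) \<Rightarrow> bool" where
  "totally_ergodic M T \<longleftrightarrow>
    mp_system M T \<and> (\<forall>m. m \<noteq> 0 \<longrightarrow> ergodic_action M (\<lambda>y. T (m * y)))"

definition square_integrable :: "'x measure \<Rightarrow> ('x \<Rightarrow> complex) \<Rightarrow> bool" where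
  "square_integrable M f \<longleftrightarrow>
    f \<in> borel_measurable M \<and> integrable M (\<lambda>x. (cmod (f x))\<^sup>2)"

definition L2_norm :: "'x measure \<Rightarrow> ('x \<Rightarrow> complex) \<Rightarrow> real" where
  "L2_norm M f = sqrt (\<integral>x. (cmod (f x))\<^sup>2 \<partial>M)"

definition polynomial_averages_converge ::
    "'x measure \<Rightarrow> ('a::finite_field poly \<Rightarrow> 'x \<Rightarrow> 'x) \<Rightarrow> 'a poly \<Rightarrow> bool" where
  "polynomial_averages_converge M T P \<longleftrightarrow>
    (\<forall>\<Phi> f. folner \<Phi> \<and> square_integrable M f \<longrightarrow>
      (\<lambda>N. L2_norm M (\<lambda>x. average (\<Phi> N) (\<lambda>y. f (T (P \<circ>\<^sub>p y) x)) - (\<integral>z. f z \<partial>M)))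
        \<longlonglongrightarrow> 0)"

text \<open>A property of all systems can only be quantified over the probability spaces on one type
  \<^typ>\<open>'x\<close> at a time; the argument of type \<^typ>\<open>'x itself\<close> selects that type.\<close>

definition averages_converge_on_type :: "'x itself \<Rightarrow> 'a::finite_field poly \<Rightarrow> bool" where
  "averages_converge_on_type TYPE('x) P \<longleftrightarrow>
    (\<forall>(M :: 'x measure) (T :: 'a poly \<Rightarrow> 'x \<Rightarrow> 'x).
       totally_ergodic M T \<longrightarrow> polynomial_averages_converge M T P)"

end

theory Submission
  imports Defs
begin

text \<open>Fix a nontrivial additive character of \<open>\<F>\<close>. Every condition reduces to exponential sums
  \<open>\<psi>(L(P(y)))\<close> with \<open>L : \<F>[t] \<rightarrow> \<F>\<close> additive, where \<open>L\<close> is either irrational (conditions (i), (ii)) or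
  nonzero and periodic modulo \<open>Q\<close> (conditions (iv)--(viii)). Absorbing powers of the characteristic
  turns \<open>L(P(y))\<close> into \<open>\<Sum>\<^sub>s L\<^sub>s(y\<^sup>s)\<close> with exponents \<open>s\<close> prime to \<open>p\<close>, and Weyl differencing bounds the sum as
  soon as one \<open>L\<^sub>s\<close> is nontrivial. If all were trivial, condition (iii) would make \<open>L\<close> itself trivial.

  Conversely, the additive polynomials \<open>\<Sum> \<eta>\<^sub>i \<circ> \<zeta>\<^sub>i\<close> form a right ideal under composition, and right ideals
  are principal. When (iii) fails, its generator \<open>d\<close> has degree greater than one and is a common left factor of the \<open>\<eta>\<^sub>i\<close>, so
  \<open>P = d \<circ> P'\<close>; moduli \<open>Q\<close> and irrational \<open>\<alpha>\<close> annihilated by \<open>d\<close> then contradict each of the other conditions.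

  For condition (ii), the \<open>L\<^sup>2\<close> norms of the averages are computed by a spectral measure on the torus,
  and total ergodicity means that this measure does not charge the rational points.\<close>

section \<open>An additive character of the finite field\<close>

text \<open>Two obstacles arise from characteristic p. Binomial coefficients may vanish, so
  differencing tracks the exponent R - 1, where R choose (R - 1) = R is a unit. Absorbing powers of
  p sends several sources (r, a) to one exponent j, where they could cancel; shifts along p^B-th
  powers separate them as different powers of the shift parameter, and counting zeros leaves
  boundedly many useless shifts.

  Both kinds of sums are treated at once by working modulo null functionals: all functionals modulo
  rational ones, or period \<pi> W modulo period W with \<pi> prime. The quotient must be
  torsion-free and must survive Frobenius twists, and null functionals must be silenced by a common
  shift. For finite moduli the twists fail when \<pi> divides W; there an expansion to first order
  in W v is exact, and stationary phase replaces differencing. The saving in lpf(Q) comes from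
  |\<pi>| \<ge> lpf(Q), since |\<pi>| limits the number of incongruent shifts.\<close>

lemma of_nat_inverse_in_prime_field:
  fixes x :: "'a::finite_field"
  assumes "x = of_nat k" "x \<noteq> 0"
  obtains l where "of_nat l * x = 1"
proof -
  have c: "card (UNIV :: 'a set) \<ge> 2"
  proof -
    have "card {0, 1 :: 'a} \<le> card (UNIV :: 'a set)" by (rule card_mono) auto
    thus ?thesis by simp
  qed
  define n where "n = card (UNIV :: 'a set) - 2"
  have "x ^ (n + 2) = x"
    using finite_field_power_card_eq_same[of x] c le_add_diff_inverse2[of 2 "CARD('a)"]
    by (simp add: n_def del: le_add_diff_inverse2)
  hence "x * (x ^ n * x) = x * 1" by (simp add: mult_ac power_add power2_eq_square)
  hence "x ^ n * x = 1" using assms(2) by (metis mult_cancel_left)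
  moreover have "x ^ n = of_nat (k ^ n)" by (simp add: assms(1))
  ultimately show ?thesis using that by metis
qed

text \<open>A hyperplane takes the place of the kernel of the trace: an additive subgroup H maximal
  among those that miss 1 is a complement of the line of multiples of 1. So x lies in k + H for some
  k unique modulo p, and x is sent to exp(2 pi i k / p).\<close>

lemma ex_nontrivial_additive_character:
  "\<exists>\<psi> :: 'a::finite_field \<Rightarrow> complex.
     (\<forall>x y. \<psi> (x + y) = \<psi> x * \<psi> y) \<and> (\<forall>x. cmod (\<psi> x) = 1) \<and> \<psi> 1 \<noteq> 1"
proof -
  define p where "p = CHAR('a)"
  have p: "prime p" "of_nat p = (0 :: 'a)" by (auto simp: p_def)
  define \<H> :: "'a set set" where "\<H> = {H. 0 \<in> H \<and> (\<forall>x\<in>H. \<forall>y\<in>H. x + y \<in> H) \<and> 1 \<notin> H}"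
  have "{0} \<in> \<H>" by (auto simp: \<H>_def)
  moreover have "finite \<H>" by simp
  ultimately obtain H where H: "H \<in> \<H>" and Hmax: "\<And>H'. H' \<in> \<H> \<Longrightarrow> H \<subseteq> H' \<Longrightarrow> H' = H"
    using finite_has_maximal2[of \<H> "{0}"] by blast
  have H0: "0 \<in> H" and Hadd: "\<And>x y. x \<in> H \<Longrightarrow> y \<in> H \<Longrightarrow> x + y \<in> H" and H1: "1 \<notin> H"
    using H by (auto simp: \<H>_def)
  have Hmul: "of_nat k * x \<in> H" if "x \<in> H" for k x
    by (induction k) (use that H0 Hadd in \<open>auto simp: algebra_simps\<close>)
  have Hneg: "- x \<in> H" if "x \<in> H" for x
  proof -
    have "of_nat (p - 1) * x = - x"
      using p prime_gt_0_nat[of p] by (simp add: of_nat_diff)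
    thus ?thesis using Hmul[OF that, of "p - 1"] by simp
  qed
  have ex: "\<exists>k. x - of_nat k \<in> H" for x
  proof (cases "x \<in> H")
    case True
    thus ?thesis by (intro exI[of _ 0]) auto
  next
    case False
    define H' where "H' = {h + of_nat k * x | h k. h \<in> H}"
    have sub: "H \<subseteq> H'"
    proof
      fix h assume "h \<in> H"
      hence "h + of_nat 0 * x \<in> H'" unfolding H'_def by blast
      thus "h \<in> H'" by simp
    qed
    have xin: "x \<in> H'"
    proof -
      have "0 + of_nat 1 * x \<in> H'" unfolding H'_def using H0 by blast
      thus ?thesis by simp
    qed
    have add: "u + v \<in> H'" if uv: "u \<in> H'" "v \<in> H'" for u v
    proof -
      from uv obtain h k h' k' where "u = h + of_nat k * x" "v = h' + of_nat k' * x"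
        "h \<in> H" "h' \<in> H" unfolding H'_def by blast
      hence "u + v = (h + h') + of_nat (k + k') * x" "h + h' \<in> H"
        using Hadd by (auto simp: algebra_simps)
      thus ?thesis unfolding H'_def by blast
    qed
    have "1 \<in> H'"
    proof (rule ccontr)
      assume "1 \<notin> H'"
      hence "H' \<in> \<H>" using sub H0 add by (auto simp: \<H>_def)
      hence "H' = H" using Hmax sub by blast
      thus False using xin False by simp
    qed
    \<comment> \<open>Enlarging H by x must reach 1. The coefficient k is a unit because 1 is not in
      H, and dividing by it writes x as a multiple of 1 plus an element of H.\<close>
    then obtain h k where hk: "1 = h + of_nat k * x" "h \<in> H" unfolding H'_def by blast
    have "of_nat k \<noteq> (0 :: 'a)" using hk H1 by auto
    then obtain l where l: "of_nat l * of_nat k = (1 :: 'a)"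
      using of_nat_inverse_in_prime_field by metis
    have "x = of_nat l * (of_nat k * x)" using l by (simp add: mult.assoc[symmetric])
    moreover have "of_nat k * x = 1 - h" using hk(1) by (simp add: eq_diff_eq add.commute)
    ultimately have "x = of_nat l * (1 - h)" by simp
    hence "x - of_nat l = of_nat l * (- h)" by (simp add: right_diff_distrib)
    thus ?thesis using Hmul[OF Hneg[OF hk(2)], of l] by (intro exI[of _ l]) simp
  qed
  have uniq: "of_nat k = (of_nat l :: 'a)" if "x - of_nat k \<in> H" "x - of_nat l \<in> H" for x k l
  proof (rule ccontr)
    assume ne: "of_nat k \<noteq> (of_nat l :: 'a)"
    have "(x - of_nat l) + - (x - of_nat k) \<in> H" by (intro Hadd Hneg that)
    hence d: "of_nat k - of_nat l \<in> H" by simp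
    \<comment> \<open>A nonzero multiple of 1 inside H could be scaled to 1.
      \<open>(p - 1) * l\<close> stands for -l, which keeps the difference in the form
      \<open>of_nat m\<close>.\<close>
    define m where "m = k + (p - 1) * l"
    have "of_nat (p - 1) = (- 1 :: 'a)"
      using p prime_gt_0_nat[of p] by (simp add: of_nat_diff)
    hence m: "of_nat m = (of_nat k - of_nat l :: 'a)" by (simp add: m_def)
    obtain j where "of_nat j * (of_nat m :: 'a) = 1"
      using of_nat_inverse_in_prime_field[of "of_nat m :: 'a" m] m ne by auto
    thus False using Hmul[OF d, of j] m H1 by simp
  qed
  define \<psi> where "\<psi> x = cis (2 * pi * real (SOME k. x - of_nat k \<in> H) / real p)" for x :: 'a
  have \<psi>: "\<psi> x = cis (2 * pi * real k / real p)" if "x - of_nat k \<in> H" for x k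
  proof -
    define l where "l = (SOME k. x - of_nat k \<in> H)"
    have "x - of_nat l \<in> H" unfolding l_def by (rule someI[of _ k]) (fact that)
    hence "of_nat k = (of_nat l :: 'a)" using uniq that by blast
    hence "k mod p = l mod p"
    proof (induction k l rule: linorder_wlog)
      case (le k l)
      hence "of_nat (l - k) = (0 :: 'a)" by (simp add: of_nat_diff)
      hence "p dvd l - k" by (simp add: p_def of_nat_eq_0_iff_char_dvd)
      thus ?case using le by (metis mod_eq_dvd_iff_nat)
    qed auto
    moreover have red: "cis (2 * pi * real n / real p) = cis (2 * pi * real (n mod p) / real p)" for n
    proof -
      have p0: "real p > 0" using p(1) prime_gt_0_nat by simp
      have "real n = real p * real (n div p) + real (n mod p)"
        by (metis mult_div_mod_eq of_nat_add of_nat_mult)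
      hence "2 * pi * real n / real p = 2 * pi * real (n div p) + 2 * pi * real (n mod p) / real p"
        using p0 by (simp add: field_simps)
      hence "cis (2 * pi * real n / real p)
           = cis (2 * pi * real (n div p)) * cis (2 * pi * real (n mod p) / real p)"
        by (simp only: cis_mult)
      moreover have "cis (2 * pi * real (n div p)) = 1"
        by (metis Ints_of_nat cis_multiple_2pi)
      ultimately show ?thesis by (metis mult_1)
    qed
    ultimately show ?thesis
      unfolding \<psi>_def l_def[symmetric] by (metis red)
  qed
  have "\<psi> (x + y) = \<psi> x * \<psi> y" for x y
  proof -
    obtain k l where "x - of_nat k \<in> H" "y - of_nat l \<in> H" using ex by blast
    moreover from this have "(x + y) - of_nat (k + l) \<in> H"
      using Hadd[of "x - of_nat k" "y - of_nat l"] by (simp add: algebra_simps)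
    ultimately show ?thesis
      using \<psi>[of x k] \<psi>[of y l] \<psi>[of "x + y" "k + l"]
      by (simp add: cis_mult algebra_simps add_divide_distrib)
  qed
  moreover have "cmod (\<psi> x) = 1" for x by (simp add: \<psi>_def)
  moreover have "\<psi> 1 \<noteq> 1"
  proof -
    have "\<psi> 1 = cis (2 * pi * real 1 / real p)" by (rule \<psi>) (simp add: H0)
    moreover have "cis (2 * pi / real p) \<noteq> 1"
    proof
      assume "cis (2 * pi / real p) = 1"
      then have "cos (2 * pi / real p) = 1" by (metis cis.sel(1) one_complex.sel(1))
      then obtain n :: int where n: "2 * pi / real p = real_of_int n * 2 * pi"
        by (auto simp: cos_one_2pi_int)
      have "real p \<ge> 2" using prime_ge_2_nat[OF p(1)] by simp
      hence "1 / real p = real_of_int n" "0 < 1 / real p" "1 / real p < 1"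
        using n by (auto simp: field_simps)
      thus False by auto
    qed
    ultimately show ?thesis by simp
  qed
  ultimately show ?thesis by (intro exI[of _ \<psi>]) auto
qed

definition base_char :: "'a::finite_field \<Rightarrow> complex" ("\<psi>") where
  "\<psi> = (SOME e. (\<forall>x y. e (x + y) = e x * e y) \<and> (\<forall>x. cmod (e x) = 1) \<and> e 1 \<noteq> 1)"

lemma base_char:
  fixes x y :: "'a::finite_field"
  shows psi_add: "\<psi> (x + y) = \<psi> x * \<psi> y"
    and norm_psi [simp]: "cmod (\<psi> x) = 1"
    and psi_1: "\<psi> (1 :: 'a) \<noteq> 1"
  using someI_ex[OF ex_nontrivial_additive_character[where 'a = 'a], folded base_char_def]
  by blast+

lemma psi_nonzero [simp]: "\<psi> x \<noteq> 0"
  using norm_psi[of x] by (metis norm_zero zero_neq_one)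

lemma psi_0 [simp]: "\<psi> 0 = 1"
  using psi_add[of 0 0] psi_nonzero by (simp add: mult_cancel_left1)

lemma psi_uminus: "\<psi> (- x) = cnj (\<psi> x)"
proof -
  have "\<psi> (- x) * \<psi> x = 1" by (simp flip: psi_add)
  moreover have "cnj (\<psi> x) * \<psi> x = 1"
    by (simp add: complex_norm_square[symmetric] mult.commute[of "cnj _"])
  ultimately show ?thesis by (metis mult_cancel_right psi_nonzero)
qed

lemma psi_diff: "\<psi> (x - y) = \<psi> x * cnj (\<psi> y)"
  using psi_add[of x "- y"] by (simp add: psi_uminus)

lemma psi_sum: "finite A \<Longrightarrow> \<psi> (\<Sum>i\<in>A. f i) = (\<Prod>i\<in>A. \<psi> (f i))"
  by (induction A rule: finite_induct) (auto simp: psi_add)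

lemma psi_mult_cnj [simp]: "\<psi> x * cnj (\<psi> x) = 1" "cnj (\<psi> x) * \<psi> x = 1"
  by (simp_all add: complex_norm_square[symmetric] mult.commute[of "cnj _"])

lemma psi_nontrivial_multiple:
  assumes "x \<noteq> 0"
  obtains c where "\<psi> (c * x) \<noteq> 1"
  using psi_1 that[of "inverse x"] assms by auto

text \<open>Translation by \<open>z0\<close> permutes S and multiplies the sum by
  \<open>e z0\<close>. This is the source of all orthogonality relations over finite subgroups
  below.\<close>

lemma sum_multiplicative_eq_0:
  fixes e :: "'b::ab_group_add \<Rightarrow> complex"
  assumes "finite S" "\<And>z. z \<in> S \<Longrightarrow> z0 + z \<in> S"
    and "\<And>z. z \<in> S \<Longrightarrow> e (z0 + z) = e z0 * e z" and "e z0 \<noteq> 1"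
  shows "(\<Sum>z\<in>S. e z) = 0"
proof -
  have "(+) z0 ` S = S"
    by (rule card_subset_eq) (use assms in \<open>auto simp: card_image\<close>)
  hence "(\<Sum>z\<in>S. e z) = (\<Sum>z\<in>(+) z0 ` S. e z)" by simp
  also have "\<dots> = (\<Sum>z\<in>S. e (z0 + z))" by (subst sum.reindex) auto
  also have "\<dots> = e z0 * (\<Sum>z\<in>S. e z)"
    by (simp add: assms sum_distrib_left)
  finally show ?thesis using assms(4) by (metis mult_cancel_right1)
qed

section \<open>Additive functionals on polynomials\<close>

abbreviation additive_map :: "('b::ab_group_add \<Rightarrow> 'c::ab_group_add) \<Rightarrow> bool" where
  "additive_map \<equiv> Modules.additive"

lemma additive_comp: "additive_map f \<Longrightarrow> additive_map g \<Longrightarrow> additive_map (\<lambda>z. f (g z))"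
  by (simp add: Modules.additive_def)

lemma additive_plus: "additive_map f \<Longrightarrow> additive_map g \<Longrightarrow> additive_map (\<lambda>z. f z + g z :: 'b::ab_group_add)"
  by (simp add: Modules.additive_def algebra_simps)

lemma additive_uminus: "additive_map f \<Longrightarrow> additive_map (\<lambda>z. - f z)"
  by (simp add: Modules.additive_def)

lemma additive_const_0: "additive_map (\<lambda>z. 0)"
  by (simp add: Modules.additive_def)

lemma frobenius_poly_add:
  fixes x y :: "'a::finite_field poly"
  shows "(x + y) ^ (CHAR('a) ^ a) = x ^ (CHAR('a) ^ a) + y ^ (CHAR('a) ^ a)"
  by (rule freshmans_dream') auto

lemma frobenius_field_add:
  fixes x y :: "'a::finite_field"
  shows "(x + y) ^ (CHAR('a) ^ a) = x ^ (CHAR('a) ^ a) + y ^ (CHAR('a) ^ a)"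
  by (rule freshmans_dream') auto

lemma additive_frobenius_poly: "additive_map (\<lambda>z :: 'a::finite_field poly. c * z ^ (CHAR('a) ^ a))"
  by (simp add: Modules.additive_def frobenius_poly_add algebra_simps)

lemma frobenius_poly_diff:
  fixes x y :: "'a::finite_field poly"
  shows "(x - y) ^ (CHAR('a) ^ a) = x ^ (CHAR('a) ^ a) - y ^ (CHAR('a) ^ a)"
  using additive.diff[OF additive_frobenius_poly[of 1 a], of x y] by simp

lemma frobenius_field_bij: "bij (\<lambda>x :: 'a::finite_field. x ^ (CHAR('a) ^ a))"
proof -
  have "inj (\<lambda>x :: 'a. x ^ (CHAR('a) ^ a))"
  proof (rule injI)
    fix x y :: 'a assume eq: "x ^ (CHAR('a) ^ a) = y ^ (CHAR('a) ^ a)"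
    have "additive_map (\<lambda>z :: 'a. z ^ (CHAR('a) ^ a))"
      by (simp add: Modules.additive_def frobenius_field_add)
    from additive.diff[OF this, of x y] eq have "(x - y) ^ (CHAR('a) ^ a) = 0" by simp
    thus "x = y" by simp
  qed
  thus ?thesis by (simp add: bij_def finite_UNIV_inj_surj)
qed

text \<open>Phrased by coefficients, so that 0 is no exception. These finite subgroups exhaust F[t]
  and serve as residue systems, as a Folner sequence and as the duals of the groups of digit
  prefixes.\<close>

definition polys_below :: "nat \<Rightarrow> 'a::zero poly set" where
  "polys_below n = {z. \<forall>i\<ge>n. coeff z i = 0}"

lemma polys_below_0 [simp]: "polys_below 0 = {0}"
  by (auto simp: polys_below_def poly_eq_iff)

lemma polys_below_Suc: "polys_below (Suc n) = (\<lambda>(c, z). pCons c z) ` (UNIV \<times> polys_below n)"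
proof (intro equalityI subsetI)
  fix z :: "'a poly" assume z: "z \<in> polys_below (Suc n)"
  obtain c w where cw: "z = pCons c w" by (cases z)
  have "w \<in> polys_below n"
    unfolding polys_below_def
  proof safe
    fix i assume "n \<le> i"
    hence "coeff z (Suc i) = 0" using z by (simp add: polys_below_def)
    thus "coeff w i = 0" by (simp add: cw)
  qed
  thus "z \<in> (\<lambda>(c, z). pCons c z) ` (UNIV \<times> polys_below n)" using cw by auto
next
  fix z :: "'a poly" assume "z \<in> (\<lambda>(c, z). pCons c z) ` (UNIV \<times> polys_below n)"
  then obtain c w where "z = pCons c w" "w \<in> polys_below n" by auto
  thus "z \<in> polys_below (Suc n)"
    by (auto simp: polys_below_def coeff_pCons split: nat.split)
qed

lemma inj_on_pCons: "inj_on (\<lambda>(c, z). pCons c z) A"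
  by (auto simp: inj_on_def)

lemma finite_polys_below [simp]: "finite (polys_below n :: 'a::{finite,zero} poly set)"
  by (induction n) (auto simp: polys_below_Suc)

lemma card_polys_below: "card (polys_below n :: 'a::{finite,zero} poly set) = CARD('a) ^ n"
  by (induction n)
     (simp_all add: polys_below_Suc card_image[OF inj_on_pCons] card_cartesian_product)

lemma zero_in_polys_below [simp]: "0 \<in> polys_below n"
  by (simp add: polys_below_def)

lemma polys_below_nonempty [simp]: "polys_below n \<noteq> {}"
  using zero_in_polys_below by blast

lemma polys_below_add: "x \<in> polys_below n \<Longrightarrow> y \<in> polys_below n \<Longrightarrow> x + y \<in> polys_below n"
  by (simp add: polys_below_def)

lemma polys_below_diff: "x \<in> polys_below n \<Longrightarrow> y \<in> polys_below n \<Longrightarrow> x - y \<in> polys_below n"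
  for x y :: "'a::ab_group_add poly"
  by (simp add: polys_below_def)

lemma polys_below_mono: "m \<le> n \<Longrightarrow> polys_below m \<subseteq> polys_below n"
  by (auto simp: polys_below_def)

lemma mem_polys_below_degree: "z \<in> polys_below (Suc (degree z))"
  by (auto simp: polys_below_def coeff_eq_0)

lemma degree_less_imp_polys_below: "degree z < n \<Longrightarrow> z \<in> polys_below n"
  by (auto simp: polys_below_def coeff_eq_0)

lemma polys_below_degree: "z \<in> polys_below n \<Longrightarrow> z = 0 \<or> degree z < n"
  by (rule ccontr) (auto simp: polys_below_def not_less)

lemma mod_eq_self_iff_polys_below:
  fixes z Q :: "'a::field poly"
  assumes "degree Q > 0"
  shows "z mod Q = z \<longleftrightarrow> z \<in> polys_below (degree Q)"
proof
  assume "z \<in> polys_below (degree Q)"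
  thus "z mod Q = z" using polys_below_degree[of z "degree Q"] by (auto simp: mod_poly_less)
next
  have "Q \<noteq> 0" using assms by auto
  moreover assume "z mod Q = z"
  ultimately have "z = 0 \<or> degree z < degree Q"
    using degree_mod_less[of Q z] by simp
  thus "z \<in> polys_below (degree Q)" by (auto intro: degree_less_imp_polys_below)
qed

lemma residue_ring_eq:
  assumes "degree Q > 0"
  shows "residue_ring Q = polys_below (degree (Q :: 'a::finite_field poly))"
proof -
  have "z \<in> residue_ring Q \<longleftrightarrow> z mod Q = z" for z
    unfolding residue_ring_def by (auto intro: rev_image_eqI[of z])
  thus ?thesis using mod_eq_self_iff_polys_below[OF assms] by auto
qed

text \<open>Division with remainder by an element of least degree. It is applied to ideals of Bezout
  combinations and to the ideal of common periods of a family of functionals.\<close>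

lemma principal_ideal_poly:
  fixes I :: "'a::field poly set"
  assumes "w0 \<in> I" "w0 \<noteq> 0"
    and add: "\<And>x y. x \<in> I \<Longrightarrow> y \<in> I \<Longrightarrow> x + y \<in> I"
    and mult: "\<And>x c. x \<in> I \<Longrightarrow> c * x \<in> I"
  obtains W where "W \<in> I" "W \<noteq> 0" "\<And>w. w \<in> I \<Longrightarrow> W dvd w"
proof -
  obtain W where W: "W \<in> I" "W \<noteq> 0" and Wmin: "\<And>w. w \<in> I \<Longrightarrow> w \<noteq> 0 \<Longrightarrow> degree W \<le> degree w"
    using ex_has_least_nat[of "\<lambda>w. w \<in> I \<and> w \<noteq> 0" w0 degree] assms(1,2) by blast
  have "W dvd w" if "w \<in> I" for w
  proof -
    have "w mod W = w + (- (w div W)) * W" by (simp add: minus_div_mult_eq_mod[symmetric])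
    hence "w mod W \<in> I" using add[OF that mult[OF W(1), of "- (w div W)"]] by simp
    moreover have "w mod W = 0 \<or> degree (w mod W) < degree W"
      using degree_mod_less[OF W(2)] by blast
    ultimately show ?thesis using Wmin[of "w mod W"] by (metis dvd_eq_mod_eq_0 not_le)
  qed
  thus ?thesis using that W by blast
qed

text \<open>The generator of the ideal (u, \<pi>) divides the irreducible \<pi> and is not divisible
  by it, hence is a unit.\<close>

lemma irreducible_poly_bezout:
  fixes \<pi> u :: "'a::field poly"
  assumes "irreducible \<pi>" "\<not> \<pi> dvd u"
  obtains x y where "x * u + y * \<pi> = 1"
proof -
  define I where "I = {x * u + y * \<pi> | x y. True}"
  have "0 * u + 1 * \<pi> \<in> I" "1 * u + 0 * \<pi> \<in> I" unfolding I_def by blast+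
  hence mem: "\<pi> \<in> I" "u \<in> I" by simp_all
  have "x + y \<in> I" if xy: "x \<in> I" "y \<in> I" for x y
  proof -
    from xy obtain a b c d where "x = a * u + b * \<pi>" "y = c * u + d * \<pi>" unfolding I_def by blast
    hence "x + y = (a + c) * u + (b + d) * \<pi>" by (simp add: algebra_simps)
    thus ?thesis unfolding I_def by blast
  qed
  moreover have "c * x \<in> I" if x: "x \<in> I" for c x
  proof -
    from x obtain a b where "x = a * u + b * \<pi>" unfolding I_def by blast
    hence "c * x = (c * a) * u + (c * b) * \<pi>" by (simp add: algebra_simps)
    thus ?thesis unfolding I_def by blast
  qed
  moreover have "\<pi> \<noteq> 0" using assms(1) by auto
  ultimately obtain W where W: "W \<in> I" "\<And>w. w \<in> I \<Longrightarrow> W dvd w"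
    using principal_ideal_poly[OF mem(1)] by blast
  have "W dvd \<pi>" "W dvd u" using W mem by auto
  moreover from this have "\<not> \<pi> dvd W" using assms(2) dvd_trans by blast
  ultimately have "W dvd 1" using irreducibleD'[OF assms(1), of W] by blast
  then obtain V where "1 = W * V" by (elim dvdE)
  moreover obtain x y where "W = x * u + y * \<pi>" using W unfolding I_def by blast
  ultimately have "(V * x) * u + (V * y) * \<pi> = 1" by (simp add: algebra_simps)
  thus ?thesis using that by blast
qed


section \<open>Elimination\<close>

text \<open>\<open>C\<close> modulo the null functionals \<open>N\<close> is a module over F[t],
  with c acting as L |-> L(c z), that is moreover stable under Frobenius twists. \<open>Z\<close>
  collects the scalars that are allowed to be zero divisors: {0} for rational functionals, the
  multiples of a prime \<pi> for periodic ones.\<close>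

locale functional_pair =
  fixes C N :: "('a::finite_field poly \<Rightarrow> 'a) set" and Z :: "'a poly set"
  assumes C_additive: "L \<in> C \<Longrightarrow> additive_map L"
    and C_zero: "(\<lambda>_. 0) \<in> C"
    and C_plus: "L \<in> C \<Longrightarrow> M \<in> C \<Longrightarrow> (\<lambda>z. L z + M z) \<in> C"
    and C_twist: "L \<in> C \<Longrightarrow> (\<lambda>z. L (c * z ^ (CHAR('a) ^ a))) \<in> C"
    and N_subset: "L \<in> N \<Longrightarrow> L \<in> C"
    and N_zero: "(\<lambda>_. 0) \<in> N"
    and N_plus: "L \<in> N \<Longrightarrow> M \<in> N \<Longrightarrow> (\<lambda>z. L z + M z) \<in> N"
    and N_uminus: "L \<in> N \<Longrightarrow> (\<lambda>z. - L z) \<in> N"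
    and N_twist: "L \<in> N \<Longrightarrow> (\<lambda>z. L (c * z ^ (CHAR('a) ^ a))) \<in> N"
    and torsion_free: "L \<in> C \<Longrightarrow> u \<notin> Z \<Longrightarrow> (\<lambda>z. L (u * z)) \<in> N \<Longrightarrow> L \<in> N"
begin

lemma C_mult: "L \<in> C \<Longrightarrow> (\<lambda>z. L (c * z)) \<in> C"
  using C_twist[of L c 0] by simp

lemma N_mult: "L \<in> N \<Longrightarrow> (\<lambda>z. L (c * z)) \<in> N"
  using N_twist[of L c 0] by simp

lemma C_sum: "finite I \<Longrightarrow> (\<And>i. i \<in> I \<Longrightarrow> f i \<in> C) \<Longrightarrow> (\<lambda>z. \<Sum>i\<in>I. f i z) \<in> C"
  by (induction I rule: finite_induct) (auto simp: C_zero C_plus)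

lemma N_sum: "finite I \<Longrightarrow> (\<And>i. i \<in> I \<Longrightarrow> f i \<in> N) \<Longrightarrow> (\<lambda>z. \<Sum>i\<in>I. f i z) \<in> N"
  by (induction I rule: finite_induct) (auto simp: N_zero N_plus)

lemma N_diff: "L \<in> N \<Longrightarrow> M \<in> N \<Longrightarrow> (\<lambda>z. L z - M z) \<in> N"
  using N_plus[OF _ N_uminus, of L M] by simp

text \<open>A polynomial in \<open>u\<close> of degree \<open>D\<close> with coefficients in the torsion-free module \<open>C/N\<close>
  that has more than \<open>D\<close> zeros is the zero polynomial.\<close>

lemma elimination:
  assumes "\<forall>k\<le>D. f k \<in> C" and "finite V" and "card V > D"
    and "\<forall>u\<in>V. \<forall>v\<in>V. u \<noteq> v \<longrightarrow> u - v \<notin> Z"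
    and "\<forall>u\<in>V. (\<lambda>z. \<Sum>k\<le>D. f k (u ^ k * z)) \<in> N"
  shows "\<forall>k\<le>D. f k \<in> N"
  using assms
proof (induction D arbitrary: f V)
  case 0
  then obtain u where "u \<in> V" by fastforce
  with 0 show ?case by auto
next
  case (Suc D)
  from Suc.prems(2,3) obtain u0 where u0: "u0 \<in> V" by fastforce
  define V' where "V' = V - {u0}"
  \<comment> \<open>Synthetic division: the \<open>g l\<close> are the coefficients of the quotient
    of f(u) - f(u0) by u - u0, a polynomial of degree D that vanishes modulo \<open>N\<close> at the
    remaining points.\<close>
  define g where "g = (\<lambda>l z. \<Sum>k\<in>{Suc l..Suc D}. f k (u0 ^ (k - Suc l) * z))"
  have add: "additive_map (f k)" if "k \<le> Suc D" for k
    using C_additive Suc.prems(1) that by blast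
  have gC: "g l \<in> C" for l
    unfolding g_def using Suc.prems(1) by (intro C_sum C_mult) auto
  have gV: "(\<lambda>z. \<Sum>l\<le>D. g l (u ^ l * z)) \<in> N" if u: "u \<in> V'" for u
  proof -
    define M where "M = (\<lambda>z. \<Sum>l\<le>D. g l (u ^ l * z))"
    have MC: "M \<in> C" unfolding M_def by (intro C_sum C_mult gC) auto
    have eq: "(\<lambda>z. M ((u - u0) * z))
            = (\<lambda>z. (\<Sum>k\<le>Suc D. f k (u ^ k * z)) - (\<Sum>k\<le>Suc D. f k (u0 ^ k * z)))"
    proof
      fix z
      have "f k (u ^ k * z) - f k (u0 ^ k * z)
          = (\<Sum>i<k. f k (u0 ^ (k - Suc i) * (u ^ i * ((u - u0) * z))))" if "k \<le> Suc D" for k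
      proof -
        have "f k (u ^ k * z) - f k (u0 ^ k * z) = f k ((u ^ k - u0 ^ k) * z)"
          by (simp add: additive.diff[OF add[OF that], symmetric] left_diff_distrib)
        also have "(u ^ k - u0 ^ k) * z = (\<Sum>i<k. u0 ^ (k - Suc i) * (u ^ i * ((u - u0) * z)))"
          by (simp add: power_diff_sumr2 sum_distrib_left sum_distrib_right mult_ac)
        finally show ?thesis by (simp add: additive.sum[OF add[OF that]])
      qed
      hence "(\<Sum>k\<le>Suc D. f k (u ^ k * z)) - (\<Sum>k\<le>Suc D. f k (u0 ^ k * z))
          = (\<Sum>k\<le>Suc D. \<Sum>i<k. f k (u0 ^ (k - Suc i) * (u ^ i * ((u - u0) * z))))"
        unfolding sum_subtractf[symmetric] by (intro sum.cong) auto
      also have "\<dots> = (\<Sum>i<Suc D. \<Sum>k\<in>{Suc i..Suc D}. f k (u0 ^ (k - Suc i) * (u ^ i * ((u - u0) * z))))"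
        by (rule sum.nested_swap')
      also have "\<dots> = M ((u - u0) * z)"
        by (simp only: M_def g_def lessThan_Suc_atMost)
      finally show "M ((u - u0) * z)
          = (\<Sum>k\<le>Suc D. f k (u ^ k * z)) - (\<Sum>k\<le>Suc D. f k (u0 ^ k * z))" ..
    qed
    have "(\<lambda>z. M ((u - u0) * z)) \<in> N"
      unfolding eq using Suc.prems(5) u u0 V'_def by (intro N_diff) auto
    moreover have "u - u0 \<notin> Z" using Suc.prems(4) u u0 V'_def by auto
    ultimately show ?thesis using torsion_free[OF MC] unfolding M_def by blast
  qed
  have "card V' > D" using Suc.prems(2,3) u0 by (simp add: V'_def)
  moreover have "finite V'" "\<forall>u\<in>V'. \<forall>v\<in>V'. u \<noteq> v \<longrightarrow> u - v \<notin> Z"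
    using Suc.prems(2,4) by (auto simp: V'_def)
  ultimately have gN: "\<forall>l\<le>D. g l \<in> N"
    by (intro Suc.IH[of g V']) (simp_all add: gC gV)
  \<comment> \<open>The coefficients of f are recovered from those of the quotient from the top
    down; the constant term then follows by evaluating at \<open>u0\<close>.\<close>
  have pos: "f k \<in> N" if "k \<ge> 1" "k \<le> Suc D" for k
    using that
  proof (induction "Suc D - k" arbitrary: k rule: less_induct)
    case less
    have "Suc (k - 1) = k" "{k..Suc D} = insert k {Suc k..Suc D}" using less.prems by auto
    hence "g (k - 1) = (\<lambda>z. f k z + (\<Sum>j\<in>{Suc k..Suc D}. f j (u0 ^ (j - k) * z)))"
      by (simp add: g_def del: sum.cl_ivl_Suc)
    hence eq: "f k = (\<lambda>z. g (k - 1) z - (\<Sum>j\<in>{Suc k..Suc D}. f j (u0 ^ (j - k) * z)))"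
      by auto
    have "g (k - 1) \<in> N" using gN less.prems by auto
    moreover have "(\<lambda>z. \<Sum>j\<in>{Suc k..Suc D}. f j (u0 ^ (j - k) * z)) \<in> N"
      using less.prems by (intro N_sum N_mult less.hyps) auto
    ultimately show ?case by (subst eq) (rule N_diff)
  qed
  have "f 0 \<in> N"
  proof -
    have s0: "(\<Sum>k\<le>Suc D. f k (u0 ^ k * z)) = f 0 z + (\<Sum>k\<in>{1..Suc D}. f k (u0 ^ k * z))" for z
    proof -
      have "{..Suc D} = insert 0 {1..Suc D}" by auto
      thus ?thesis by (simp del: sum.cl_ivl_Suc sum.atMost_Suc)
    qed
    have eq: "f 0 = (\<lambda>z. (\<Sum>k\<le>Suc D. f k (u0 ^ k * z)) - (\<Sum>k\<in>{1..Suc D}. f k (u0 ^ k * z)))"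
      by (rule ext) (simp only: s0 add_diff_cancel_right')
    have "(\<lambda>z. \<Sum>k\<le>Suc D. f k (u0 ^ k * z)) \<in> N" using Suc.prems(5) u0 by blast
    moreover have "(\<lambda>z. \<Sum>k\<in>{1..Suc D}. f k (u0 ^ k * z)) \<in> N"
      using pos by (intro N_sum N_mult) auto
    ultimately show ?thesis by (subst eq) (rule N_diff)
  qed
  show ?case
  proof (intro allI impI)
    fix k assume "k \<le> Suc D"
    thus "f k \<in> N" using pos[of k] \<open>f 0 \<in> N\<close> by (cases "k = 0") auto
  qed
qed

text \<open>Elimination for a sparse polynomial: distinct summands sit at distinct exponents, and
  the missing exponents carry the zero functional.\<close>

lemma elimination_inj:
  assumes I: "finite I" "inj_on n I" "\<And>i. i \<in> I \<Longrightarrow> n i \<le> (D :: nat)" "\<And>i. i \<in> I \<Longrightarrow> f i \<in> C"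
    and V: "finite V" "card V > D" "\<forall>u\<in>V. \<forall>v\<in>V. u \<noteq> v \<longrightarrow> u - v \<notin> Z"
    and N: "\<And>u. u \<in> V \<Longrightarrow> (\<lambda>z. \<Sum>i\<in>I. f i (u ^ n i * z)) \<in> N"
    and i: "i \<in> I"
  shows "f i \<in> N"
proof -
  define g where "g k = (if k \<in> n ` I then f (the_inv_into I n k) else (\<lambda>_. 0))" for k
  have g: "g (n j) = f j" if "j \<in> I" for j
    using that I(2) by (simp add: g_def the_inv_into_f_f)
  have "\<forall>k\<le>D. g k \<in> C"
    using I(4) g C_zero by (auto simp: g_def the_inv_into_f_f[OF I(2)])
  moreover have "(\<Sum>k\<le>D. g k (u ^ k * z)) = (\<Sum>i\<in>I. f i (u ^ n i * z))" for u z
  proof -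
    have "(\<Sum>k\<le>D. g k (u ^ k * z)) = (\<Sum>k\<in>n ` I. g k (u ^ k * z))"
      using I(1,3) by (intro sum.mono_neutral_right) (auto simp: g_def)
    also have "\<dots> = (\<Sum>i\<in>I. g (n i) (u ^ n i * z))"
      using I(2) by (simp add: sum.reindex)
    finally show ?thesis by (simp add: g)
  qed
  ultimately have "\<forall>k\<le>D. g k \<in> N"
    using elimination[of D g V] V N by simp
  hence "g (n i) \<in> N" using I(3) i by blast
  thus ?thesis by (simp add: g i)
qed

end


section \<open>Polynomial phases and their differences\<close>

definition phase_exponents :: "nat \<Rightarrow> nat \<Rightarrow> nat set" where
  "phase_exponents p B = {r. 1 \<le> r \<and> r \<le> B \<and> \<not> p dvd r}"

text \<open>The normal form of a polynomial phase: a term in y^(p^a s) belongs to the exponent s,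
  since z |-> z^(p^a) is additive. The bound B stays fixed while the phase is differenced.\<close>

definition phase :: "nat \<Rightarrow> (nat \<Rightarrow> 'a::finite_field poly \<Rightarrow> 'a) \<Rightarrow> 'a poly \<Rightarrow> 'a" where
  "phase B L y = (\<Sum>r\<in>phase_exponents CHAR('a) B. L r (y ^ r))"

text \<open>The functional attached to \<open>y\<^sup>j\<close> in \<open>phase B L (y + h) - phase B L y\<close>: it collects all terms
  in \<open>y\<^sup>k\<close> with \<open>k = p\<^sup>a j\<close>, as \<open>z \<mapsto> z\<^bsup>p\<^sup>a\<^esup>\<close> is additive.\<close>

definition phase_derivative ::
    "nat \<Rightarrow> (nat \<Rightarrow> 'a::finite_field poly \<Rightarrow> 'a) \<Rightarrow> 'a poly \<Rightarrow> nat \<Rightarrow> 'a poly \<Rightarrow> 'a" where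
  "phase_derivative B L h j z =
    (\<Sum>r\<in>phase_exponents CHAR('a) B. \<Sum>a\<le>B. if CHAR('a) ^ a * j < r
       then L r (of_nat (r choose (CHAR('a) ^ a * j)) * h ^ (r - CHAR('a) ^ a * j) * z ^ (CHAR('a) ^ a))
       else 0)"

lemma finite_phase_exponents [simp]: "finite (phase_exponents p B)"
  by (rule finite_subset[of _ "{..B}"]) (auto simp: phase_exponents_def)

lemma prime_power_cofactor_unique:
  fixes p a b i j :: nat
  assumes "p ^ a * i = p ^ b * j" "\<not> p dvd i" "\<not> p dvd j" "p > 0"
  shows "a = b \<and> i = j"
  using assms
proof (induction a b arbitrary: i j rule: linorder_wlog)
  case (le a b)
  have "p ^ b = p ^ a * p ^ (b - a)" using le(1) by (simp add: power_add[symmetric])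
  hence eq: "i = p ^ (b - a) * j" using le by (simp add: mult.assoc)
  have "b - a = 0"
  proof (rule ccontr)
    assume "b - a \<noteq> 0"
    then obtain n where "b - a = Suc n" using not0_implies_Suc by blast
    hence "p dvd i" using eq by simp
    thus False using le by simp
  qed
  thus ?case using eq le(1) by simp
next
  case (sym a b)
  from sym(1)[of j i] sym(2-) show ?case by simp
qed

text \<open>Every k with 1 \<le> k < r is p^a j for exactly one j prime to p. The range a \<le> B
  suffices because a < p^a \<le> k < r \<le> B.\<close>

lemma bij_betw_phase_exponents:
  assumes p: "prime p" and r: "r \<in> phase_exponents p B"
  shows "bij_betw (\<lambda>(j, a). p ^ a * j) {(j, a) \<in> phase_exponents p B \<times> {..B}. p ^ a * j < r} {1..<r}"
proof (rule bij_betw_imageI)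
  have p0: "p > 0" using p prime_gt_0_nat by blast
  show "inj_on (\<lambda>(j, a). p ^ a * j) {(j, a) \<in> phase_exponents p B \<times> {..B}. p ^ a * j < r}"
  proof (rule inj_onI)
    fix x y
    assume x: "x \<in> {(j, a) \<in> phase_exponents p B \<times> {..B}. p ^ a * j < r}"
      and y: "y \<in> {(j, a) \<in> phase_exponents p B \<times> {..B}. p ^ a * j < r}"
      and eq: "(\<lambda>(j, a). p ^ a * j) x = (\<lambda>(j, a). p ^ a * j) y"
    obtain j a i b where xy: "x = (j, a)" "y = (i, b)" by (cases x, cases y)
    have "p ^ a * j = p ^ b * i" "\<not> p dvd j" "\<not> p dvd i"
      using x y eq by (auto simp: xy phase_exponents_def)
    from prime_power_cofactor_unique[OF this p0] show "x = y" by (simp add: xy)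
  qed
  show "(\<lambda>(j, a). p ^ a * j) ` {(j, a) \<in> phase_exponents p B \<times> {..B}. p ^ a * j < r} = {1..<r}"
  proof (intro equalityI subsetI)
    fix k assume k: "k \<in> {1..<r}"
    hence "k \<noteq> 0" by simp
    moreover have "\<not> is_unit p" using p by auto
    ultimately obtain j where j: "k = p ^ multiplicity p k * j" "\<not> p dvd j"
      using multiplicity_decompose'[of k p] by metis
    define a where "a = multiplicity p k"
    have "j \<noteq> 0" using j(2) by (intro notI) simp
    have le: "p ^ a * 1 \<le> p ^ a * j" "1 * j \<le> p ^ a * j"
      using \<open>j \<noteq> 0\<close> p0 by (intro mult_le_mono; simp)+
    have "a < p ^ a" using p by (intro power_gt_expt) (use prime_gt_1_nat in auto)
    moreover have "p ^ a * j < r" "r \<le> B" using k r j(1) by (auto simp: phase_exponents_def a_def)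
    ultimately have "a \<le> B" "j \<le> B" using le by linarith+
    hence "(j, a) \<in> {(j, a) \<in> phase_exponents p B \<times> {..B}. p ^ a * j < r}"
      using j k \<open>j \<noteq> 0\<close> by (auto simp: phase_exponents_def a_def)
    moreover have "k = (\<lambda>(j, a). p ^ a * j) (j, a)" using j(1) by (simp add: a_def)
    ultimately show "k \<in> (\<lambda>(j, a). p ^ a * j) ` {(j, a) \<in> phase_exponents p B \<times> {..B}. p ^ a * j < r}"
      by (rule rev_image_eqI)
  qed (use p0 in \<open>auto simp: phase_exponents_def\<close>)
qed

text \<open>In the binomial expansion of (y + h)^r the outer terms give the two phases at y and h,
  and the inner ones regroup by their part prime to p. Phases with bound B are thus closed under
  differencing, up to a constant.\<close>

lemma phase_add:
  fixes L :: "nat \<Rightarrow> 'a::finite_field poly \<Rightarrow> 'a"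
  assumes L: "\<And>r. additive_map (L r)"
  shows "phase B L (y + h) = phase B L y + phase B L h + phase B (phase_derivative B L h) y"
proof -
  define p where "p = CHAR('a)"
  define E where "E = phase_exponents p B"
  have p: "prime p" by (simp add: p_def)
  define F where "F = (\<lambda>r k. L r (of_nat (r choose k) * h ^ (r - k) * y ^ k))"
  have finE [simp]: "finite E" by (simp add: E_def)
  have "L r ((y + h) ^ r) = L r (y ^ r) + L r (h ^ r)
          + (\<Sum>j\<in>E. \<Sum>a\<le>B. if p ^ a * j < r then F r (p ^ a * j) else 0)" if r: "r \<in> E" for r
  proof -
    have r1: "r \<ge> 1" using r by (simp add: E_def phase_exponents_def)
    have split: "{..r} = insert 0 (insert r {1..<r})" using r1 by auto
    have "(y + h) ^ r = (\<Sum>k\<le>r. of_nat (r choose k) * y ^ k * h ^ (r - k))"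
      by (rule binomial_ring)
    also have "\<dots> = h ^ r + (y ^ r + (\<Sum>k\<in>{1..<r}. of_nat (r choose k) * y ^ k * h ^ (r - k)))"
      unfolding split using r1 by simp
    finally have "L r ((y + h) ^ r) = L r (h ^ r) + (L r (y ^ r) +
        (\<Sum>k\<in>{1..<r}. L r (of_nat (r choose k) * y ^ k * h ^ (r - k))))"
      by (simp add: additive.add[OF L] additive.sum[OF L])
    hence "L r ((y + h) ^ r) = L r (y ^ r) + L r (h ^ r) + (\<Sum>k\<in>{1..<r}. F r k)"
      by (simp add: F_def mult_ac add_ac)
    also have "(\<Sum>k\<in>{1..<r}. F r k)
        = (\<Sum>(j, a)\<in>{(j, a) \<in> E \<times> {..B}. p ^ a * j < r}. F r (p ^ a * j))"
      using sum.reindex_bij_betw[OF bij_betw_phase_exponents[OF p, of r B], of "F r"] r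
      by (simp add: E_def case_prod_unfold)
    also have "\<dots> = (\<Sum>(j, a)\<in>E \<times> {..B}. if p ^ a * j < r then F r (p ^ a * j) else 0)"
      by (intro sum.mono_neutral_cong_left) (auto split: if_splits)
    also have "\<dots> = (\<Sum>j\<in>E. \<Sum>a\<le>B. if p ^ a * j < r then F r (p ^ a * j) else 0)"
      by (rule sum.cartesian_product[symmetric])
    finally show ?thesis .
  qed
  hence "phase B L (y + h) = (\<Sum>r\<in>E. L r (y ^ r) + L r (h ^ r)
          + (\<Sum>j\<in>E. \<Sum>a\<le>B. if p ^ a * j < r then F r (p ^ a * j) else 0))"
    by (simp add: phase_def E_def p_def)
  also have "\<dots> = phase B L y + phase B L h +
      (\<Sum>r\<in>E. \<Sum>j\<in>E. \<Sum>a\<le>B. if p ^ a * j < r then F r (p ^ a * j) else 0)"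
    by (simp add: sum.distrib phase_def E_def p_def)
  also have "(\<Sum>r\<in>E. \<Sum>j\<in>E. \<Sum>a\<le>B. if p ^ a * j < r then F r (p ^ a * j) else 0)
      = (\<Sum>j\<in>E. \<Sum>r\<in>E. \<Sum>a\<le>B. if p ^ a * j < r then F r (p ^ a * j) else 0)"
    by (rule sum.swap)
  also have "\<dots> = phase B (phase_derivative B L h) y"
  proof -
    have "(y ^ j) ^ (CHAR('a) ^ a) = y ^ (CHAR('a) ^ a * j)" for a j
      by (simp add: power_mult[symmetric] mult.commute)
    thus ?thesis by (simp only: phase_def phase_derivative_def E_def p_def F_def)
  qed
  finally show ?thesis .
qed


section \<open>Van der Corput's inequality\<close>

text \<open>The relation limsup x \<le> e in a form that also makes sense for constant sequences,
  through which averages over a single residue ring are treated.\<close>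

definition limsup_le :: "(nat \<Rightarrow> real) \<Rightarrow> real \<Rightarrow> bool" where
  "limsup_le x e \<longleftrightarrow> (\<forall>e'>e. eventually (\<lambda>N. x N < e') sequentially)"

lemma limsup_le_mono: "limsup_le x e \<Longrightarrow> e \<le> e' \<Longrightarrow> limsup_le x e'"
  by (auto simp: limsup_le_def)

lemma limsup_le_tendsto_0: "(x \<longlongrightarrow> 0) sequentially \<Longrightarrow> limsup_le (\<lambda>N. cmod (x N)) 0"
  using order_tendstoD(2)[OF tendsto_norm[of x 0 sequentially]] by (auto simp: limsup_le_def)

lemma limsup_le_transfer:
  assumes "limsup_le (\<lambda>N. cmod (x N)) e" "(\<lambda>N. y N - x N) \<longlonglongrightarrow> (0 :: complex)"
  shows "limsup_le (\<lambda>N. cmod (y N)) e"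
  unfolding limsup_le_def
proof safe
  fix e' assume "e < e'"
  then obtain e1 where e1: "e < e1" "e1 < e'" using dense by blast
  have "eventually (\<lambda>N. cmod (y N - x N) < e' - e1) sequentially"
    using order_tendstoD(2)[OF tendsto_norm[OF assms(2)], of "e' - e1"] e1 by simp
  moreover have "eventually (\<lambda>N. cmod (x N) < e1) sequentially"
    using assms(1) e1 by (auto simp: limsup_le_def)
  ultimately show "eventually (\<lambda>N. cmod (y N) < e') sequentially"
  proof eventually_elim
    case (elim N)
    have "cmod (y N) \<le> cmod (x N) + cmod (y N - x N)"
      using norm_triangle_ineq[of "x N" "y N - x N"] by simp
    thus ?case using elim by simp
  qed
qed

lemma average_cmult: "average S (\<lambda>x. c * f x) = c * average S f"
  by (simp add: average_def sum_distrib_left)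

lemma average_sum: "average S (\<lambda>x. \<Sum>i\<in>I. f i x) = (\<Sum>i\<in>I. average S (f i))"
  unfolding average_def by (subst sum.swap) (simp add: sum_divide_distrib)

lemma average_cong: "(\<And>x. x \<in> S \<Longrightarrow> f x = g x) \<Longrightarrow> average S f = average S g"
  unfolding average_def by (metis (mono_tags, lifting) sum.cong)

lemma average_const:
  fixes c :: complex
  assumes "finite S" "S \<noteq> {}" shows "average S (\<lambda>_. c) = c"
  using assms by (simp add: average_def card_gt_0_iff)

lemma norm_average_le:
  assumes "finite S" "S \<noteq> {}" "\<And>x. x \<in> S \<Longrightarrow> cmod (f x) \<le> c"
  shows "cmod (average S f) \<le> c"
proof -
  have "cmod (\<Sum>x\<in>S. f x) \<le> card S * c"
    using sum_norm_bound[of S f c] assms by simp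
  thus ?thesis using assms(1,2)
    by (simp add: average_def norm_divide pos_divide_le_eq card_gt_0_iff mult.commute)
qed

lemma norm_average_squared_le:
  assumes "finite S" "S \<noteq> {}"
  shows "(cmod (average S f))\<^sup>2 \<le> average S (\<lambda>x. (cmod (f x))\<^sup>2)"
proof -
  have c: "real (card S) > 0" using assms by (simp add: card_gt_0_iff)
  have "(cmod (\<Sum>x\<in>S. f x))\<^sup>2 \<le> (\<Sum>x\<in>S. cmod (f x))\<^sup>2"
    by (intro power_mono norm_sum) auto
  also have "\<dots> \<le> (\<Sum>x\<in>S. (cmod (f x))\<^sup>2) * card S"
    by (rule sum_squared_le_sum_of_squares)
  finally have "(cmod (\<Sum>x\<in>S. f x))\<^sup>2 / (card S)\<^sup>2 \<le> (\<Sum>x\<in>S. (cmod (f x))\<^sup>2) * card S / (card S)\<^sup>2"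
    by (rule divide_right_mono) auto
  thus ?thesis using c by (simp add: average_def norm_divide power_divide power2_eq_square)
qed

text \<open>Replacing f by its mean over the shifts \<open>h u\<close> does not change the averages
  in the limit; expanding the square of that mean gives 1 / card U from the diagonal and at most e
  from the rest. The shifts form an arbitrary finite set, so that they can be chosen with all
  differences good.\<close>

lemma van_der_corput:
  fixes f :: "'b::ab_group_add \<Rightarrow> complex" and h :: "'u \<Rightarrow> 'b"
  assumes fin: "\<And>N. finite (\<Phi> N)" "\<And>N. \<Phi> N \<noteq> {}"
    and U: "finite U" "U \<noteq> {}" and e: "e \<ge> 0"
    and f1: "\<And>y. cmod (f y) = 1"
    and inv: "\<And>u. u \<in> U \<Longrightarrow> (\<lambda>N. average (\<Phi> N) (\<lambda>y. f (y + h u)) - average (\<Phi> N) f) \<longlonglongrightarrow> 0"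
    and pairs: "\<And>u v. u \<in> U \<Longrightarrow> v \<in> U \<Longrightarrow> u \<noteq> v \<Longrightarrow>
      limsup_le (\<lambda>N. cmod (average (\<Phi> N) (\<lambda>y. f (y + h u) * cnj (f (y + h v))))) e"
  shows "limsup_le (\<lambda>N. cmod (average (\<Phi> N) f)) (sqrt (1 / card U + e))"
  unfolding limsup_le_def
proof safe
  fix e' assume e': "sqrt (1 / card U + e) < e'"
  define k where "k = real (card U)"
  have k: "k > 0" using U by (simp add: k_def card_gt_0_iff)
  obtain e1 where e1: "sqrt (1 / k + e) < e1" "e1 < e'" using e' dense k_def by blast
  have e1pos: "e1 > 0" using e1(1) k e by (smt (verit) real_sqrt_ge_zero divide_nonneg_pos)
  have "1 / k + e < e1\<^sup>2"
    using e1(1) k e e1pos by (metis real_sqrt_less_iff real_sqrt_abs abs_of_pos)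
  \<comment> \<open>Chosen so that the final bound (k + k^2 d) / k^2 equals e1^2.\<close>
  define d where "d = e1\<^sup>2 - 1 / k"
  have d: "e < d" using \<open>1 / k + e < e1\<^sup>2\<close> by (simp add: d_def)
  define g where "g y = (\<Sum>u\<in>U. f (y + h u)) / of_real k" for y
  have "eventually (\<lambda>N. \<forall>u\<in>U. \<forall>v\<in>U. u \<noteq> v \<longrightarrow>
      cmod (average (\<Phi> N) (\<lambda>y. f (y + h u) * cnj (f (y + h v)))) < d) sequentially"
    using pairs d U(1) unfolding limsup_le_def
    by (intro eventually_ball_finite ballI) (auto intro: eventually_mono)
  moreover have "(\<lambda>N. average (\<Phi> N) g - average (\<Phi> N) f) \<longlonglongrightarrow> 0"
  proof -
    have "average (\<Phi> N) g - average (\<Phi> N) f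
        = (\<Sum>u\<in>U. average (\<Phi> N) (\<lambda>y. f (y + h u)) - average (\<Phi> N) f) / of_real k" for N
    proof -
      have "average (\<Phi> N) g = (\<Sum>u\<in>U. average (\<Phi> N) (\<lambda>y. f (y + h u))) / of_real k"
        using average_cmult[of "\<Phi> N" "1 / of_real k" "\<lambda>y. \<Sum>u\<in>U. f (y + h u)"]
        by (simp add: g_def[abs_def] average_sum)
      thus ?thesis using k by (simp add: sum_subtractf diff_divide_distrib k_def)
    qed
    moreover have "(\<lambda>N. (\<Sum>u\<in>U. average (\<Phi> N) (\<lambda>y. f (y + h u)) - average (\<Phi> N) f) / of_real k)
        \<longlonglongrightarrow> (\<Sum>u\<in>U. 0) / of_real k"
      by (intro tendsto_divide tendsto_sum inv tendsto_const) (use k in auto)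
    ultimately show ?thesis by simp
  qed
  hence "eventually (\<lambda>N. cmod (average (\<Phi> N) g - average (\<Phi> N) f) < e' - e1) sequentially"
    using order_tendstoD(2)[OF tendsto_norm, of _ 0 sequentially "e' - e1"] e1 by simp
  ultimately show "eventually (\<lambda>N. cmod (average (\<Phi> N) f) < e') sequentially"
  proof eventually_elim
    case (elim N)
    define S where "S = \<Phi> N"
    have S: "finite S" "S \<noteq> {}" using fin by (auto simp: S_def)
    define A where "A u v = average S (\<lambda>y. f (y + h u) * cnj (f (y + h v)))" for u v
    have A: "cmod (A u v) \<le> (if u = v then 1 else 0) + d" if "u \<in> U" "v \<in> U" for u v
    proof (cases "u = v")
      case True
      have "cmod (A u v) \<le> 1" unfolding A_def
        by (rule norm_average_le) (use S f1 in \<open>auto simp: norm_mult\<close>)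
      thus ?thesis using True d e by simp
    next
      case False
      thus ?thesis using elim(1) that by (force simp: A_def S_def)
    qed
    have gg: "of_real ((cmod (g y))\<^sup>2) = (\<Sum>u\<in>U. \<Sum>v\<in>U. f (y + h u) * cnj (f (y + h v))) / of_real (k\<^sup>2)" for y
      unfolding complex_norm_square g_def by (simp add: sum_product power2_eq_square)
    have "of_real (average S (\<lambda>y. (cmod (g y))\<^sup>2)) = average S (\<lambda>y. complex_of_real ((cmod (g y))\<^sup>2))"
      by (simp add: average_def)
    also have "\<dots> = average S (\<lambda>y. (1 / of_real (k\<^sup>2)) * (\<Sum>u\<in>U. \<Sum>v\<in>U. f (y + h u) * cnj (f (y + h v))))"
      by (simp only: gg) simp
    also have "\<dots> = (1 / of_real (k\<^sup>2)) * (\<Sum>u\<in>U. \<Sum>v\<in>U. A u v)"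
      by (simp only: average_cmult average_sum A_def)
    finally have eq: "complex_of_real (average S (\<lambda>y. (cmod (g y))\<^sup>2))
        = (1 / of_real (k\<^sup>2)) * (\<Sum>u\<in>U. \<Sum>v\<in>U. A u v)" .
    have "average S (\<lambda>y. (cmod (g y))\<^sup>2) \<le> cmod (complex_of_real (average S (\<lambda>y. (cmod (g y))\<^sup>2)))"
      by simp
    also have "\<dots> = (1 / k\<^sup>2) * cmod (\<Sum>u\<in>U. \<Sum>v\<in>U. A u v)"
      unfolding eq using k by (simp add: norm_mult norm_divide norm_power)
    also have "cmod (\<Sum>u\<in>U. \<Sum>v\<in>U. A u v) \<le> (\<Sum>u\<in>U. \<Sum>v\<in>U. (if u = v then 1 else 0) + d)"
      by (intro sum_norm_le A)
    also have "\<dots> = k + k\<^sup>2 * d"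
      using U by (simp add: sum.distrib k_def power2_eq_square algebra_simps)
    finally have "average S (\<lambda>y. (cmod (g y))\<^sup>2) \<le> (1 / k\<^sup>2) * (k + k\<^sup>2 * d)"
      using k by (simp add: mult_left_mono divide_right_mono)
    also have "\<dots> = e1\<^sup>2" using k by (simp add: d_def field_simps power2_eq_square)
    finally have "(cmod (average S g))\<^sup>2 \<le> e1\<^sup>2"
      using norm_average_squared_le[OF S, of g] by linarith
    hence "cmod (average S g) \<le> e1" using e1pos by (simp add: power2_le_iff_abs_le)
    moreover have "cmod (average S f) \<le> cmod (average S g) + cmod (average S g - average S f)"
      using norm_triangle_ineq4[of "average S g" "average S g - average S f"] by simp
    ultimately show ?case using elim(2) by (simp add: S_def)
  qed
qed


section \<open>Weyl sums over exponents prime to the characteristic\<close>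

text \<open>The bound after n uses of van der Corput's inequality with K shifts each. It starts at 0
  because for the exponent 1 the averages tend to zero.\<close>

primrec weyl_bound :: "nat \<Rightarrow> nat \<Rightarrow> real" where
  "weyl_bound K 0 = 0"
| "weyl_bound K (Suc n) = sqrt (1 / K + weyl_bound K n)"

lemma weyl_bound_nonneg: "weyl_bound K n \<ge> 0"
  by (induction n) auto

lemma weyl_bound_Suc_ge: "weyl_bound K n \<le> weyl_bound K (Suc n)"
  by (induction n) auto

lemma weyl_bound_mono: "m \<le> n \<Longrightarrow> weyl_bound K m \<le> weyl_bound K n"
  using lift_Suc_mono_le[of "weyl_bound K" m n] weyl_bound_Suc_ge by blast

text \<open>Each square root halves the exponent of K. The crude factor n absorbs the term 1 / K,
  which is at most K^(-1/2^n), and the square root of the accumulated factor.\<close>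

lemma weyl_bound_le:
  assumes "K > 0"
  shows "weyl_bound K n \<le> n * real K powr (- (1 / 2 ^ n))"
proof (induction n)
  case (Suc n)
  define x where "x = real K powr (- (1 / 2 ^ n))"
  have K: "real K \<ge> 1" using assms by simp
  have "1 / real K = real K powr (- 1)" using K by (simp add: powr_minus_divide)
  also have "\<dots> \<le> x" unfolding x_def using K by (intro powr_mono) auto
  finally have "1 / real K + weyl_bound K n \<le> real (Suc n) * x"
    using Suc.IH by (simp add: x_def algebra_simps)
  hence "weyl_bound K (Suc n) \<le> sqrt (real (Suc n) * x)" by simp
  also have "\<dots> = sqrt (real (Suc n)) * sqrt x" by (rule real_sqrt_mult)
  finally have "weyl_bound K (Suc n) \<le> sqrt (real (Suc n)) * sqrt x" .
  moreover have "sqrt (real (Suc n)) * sqrt x \<le> real (Suc n) * sqrt x"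
  proof (rule mult_right_mono)
    show "sqrt (real (Suc n)) \<le> real (Suc n)"
      by (rule real_le_lsqrt) (auto simp: power2_eq_square)
  qed (simp add: x_def)
  moreover have "sqrt x = real K powr (- (1 / 2 ^ Suc n))"
    using K by (simp add: x_def powr_half_sqrt[symmetric] powr_powr mult.commute)
  ultimately show ?case by (simp only: order_trans)
qed auto

context functional_pair
begin

definition incongruent :: "'a poly set \<Rightarrow> bool" where
  "incongruent V \<longleftrightarrow> (\<forall>u\<in>V. \<forall>v\<in>V. u \<noteq> v \<longrightarrow> u - v \<notin> Z)"

lemma C_if: "L \<in> C \<Longrightarrow> (\<lambda>z. if P then L z else 0) \<in> C"
  using C_zero by (cases P) auto

lemma N_if: "(P \<Longrightarrow> L \<in> N) \<Longrightarrow> (\<lambda>z. if P then L z else 0) \<in> N"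
  using N_zero by (cases P) auto

lemma phase_derivative_in_C:
  assumes "\<And>r. L r \<in> C"
  shows "phase_derivative B L h j \<in> C"
  unfolding phase_derivative_def[abs_def] using assms by (intro C_sum C_if C_twist) auto

text \<open>A source r contributes to j only through p^a j < r, which forces r > j. Hence
  differencing lowers the largest exponent that is not null.\<close>

lemma phase_derivative_in_N:
  assumes "\<And>r. r \<in> phase_exponents CHAR('a) B \<Longrightarrow> r > j \<Longrightarrow> L r \<in> N"
  shows "phase_derivative B L h j \<in> N"
proof -
  have "r > j" if "CHAR('a) ^ a * j < r" for r a
  proof -
    have "1 * j \<le> CHAR('a) ^ a * j" by (intro mult_le_mono) (simp_all add: Suc_leI)
    thus ?thesis using that by linarith
  qed
  thus ?thesis unfolding phase_derivative_def[abs_def]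
    using assms by (intro N_sum N_if N_twist) auto
qed

text \<open>Along the shift h u^(p^B), the source (r, a) carries the factor u^(p^B (r - p^a j)),
  which is the p^a-th power of u^n with n = p^(B-a) (r - p^a j). So the scalar u^n acts on the
  functional of that source. As n + p^B j = p^(B-a) r and p does not divide r, different sources
  have different n, and elimination applies with degree p^B B.\<close>

lemma card_null_derivatives_le:
  fixes h :: "'a poly" and L :: "nat \<Rightarrow> 'a poly \<Rightarrow> 'a" and j :: nat
  defines "p \<equiv> CHAR('a)"
  defines "f \<equiv> (\<lambda>(r, a) z. L r (of_nat (r choose (p ^ a * j)) * h ^ (r - p ^ a * j) * z ^ (p ^ a)))"
  assumes L: "\<And>r. L r \<in> C"
    and r0: "r0 \<in> phase_exponents p B" "a0 \<le> B" "p ^ a0 * j < r0" "f (r0, a0) \<notin> N"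
    and V: "finite V" "incongruent V" "\<And>u. u \<in> V \<Longrightarrow> phase_derivative B L (h * u ^ (p ^ B)) j \<in> N"
  shows "card V \<le> p ^ B * B"
proof (rule ccontr)
  assume "\<not> card V \<le> p ^ B * B"
  define E where "E = phase_exponents p B"
  define I where "I = {(r, a) \<in> E \<times> {..B}. p ^ a * j < r}"
  define n where "n = (\<lambda>(r, a). p ^ (B - a) * (r - p ^ a * j))"
  have p0: "p > 0" by (simp add: p_def)
  have finI: "finite I" by (rule finite_subset[of _ "E \<times> {..B}"]) (auto simp: I_def E_def)
  have pB: "p ^ (B - a) * p ^ a = p ^ B" if "a \<le> B" for a
    using that by (simp flip: power_add)
  have n_eq: "p ^ (B - a) * r = n (r, a) + p ^ B * j" if "(r, a) \<in> I" for r a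
  proof -
    have "p ^ (B - a) * (p ^ a * j) = p ^ B * j" using pB[of a] that by (simp add: I_def flip: mult.assoc)
    moreover have "p ^ (B - a) * (p ^ a * j) \<le> p ^ (B - a) * r"
      using that by (intro mult_le_mono) (auto simp: I_def)
    moreover have "n (r, a) = p ^ (B - a) * r - p ^ (B - a) * (p ^ a * j)"
      by (simp add: n_def diff_mult_distrib2)
    ultimately show ?thesis by linarith
  qed
  have inj: "inj_on n I"
  proof (rule inj_onI)
    fix x y assume xy: "x \<in> I" "y \<in> I" "n x = n y"
    obtain r a s b where [simp]: "x = (r, a)" "y = (s, b)" by (cases x, cases y)
    have "p ^ (B - a) * r = p ^ (B - b) * s" using xy n_eq[of r a] n_eq[of s b] by simp
    moreover have "\<not> p dvd r" "\<not> p dvd s" using xy by (auto simp: I_def E_def phase_exponents_def)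
    ultimately have "B - a = B - b" "r = s" using prime_power_cofactor_unique p0 by blast+
    thus "x = y" using xy by (auto simp: I_def)
  qed
  have "n i \<le> p ^ B * B" if "i \<in> I" for i
  proof -
    obtain r a where [simp]: "i = (r, a)" by (cases i)
    have "r \<le> B" using that by (auto simp: I_def E_def phase_exponents_def)
    have "n i \<le> p ^ (B - a) * r" using n_eq[of r a] that by simp
    also have "\<dots> \<le> p ^ B * B" using \<open>r \<le> B\<close> p0 by (intro mult_le_mono power_increasing) auto
    finally show ?thesis .
  qed
  moreover have "f i \<in> C" if "i \<in> I" for i
    unfolding f_def p_def case_prod_unfold by (intro C_twist L)
  moreover have "(\<lambda>z. \<Sum>i\<in>I. f i (u ^ n i * z)) \<in> N" if "u \<in> V" for u
  proof -
    have term_eq: "f (r, a) (u ^ n (r, a) * z)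
        = L r (of_nat (r choose (p ^ a * j)) * (h * u ^ (p ^ B)) ^ (r - p ^ a * j) * z ^ (p ^ a))"
      if "a \<le> B" for r a z
    proof -
      have "(u ^ n (r, a)) ^ (p ^ a) = (u ^ (p ^ B)) ^ (r - p ^ a * j)"
      proof -
        have "n (r, a) * p ^ a = (p ^ (B - a) * p ^ a) * (r - p ^ a * j)"
          by (simp add: n_def mult_ac)
        thus ?thesis by (simp only: pB[OF that] flip: power_mult)
      qed
      thus ?thesis by (simp add: f_def power_mult_distrib mult_ac)
    qed
    have "phase_derivative B L (h * u ^ (p ^ B)) j = (\<lambda>z. \<Sum>i\<in>I. f i (u ^ n i * z))"
    proof
      fix z
      have "phase_derivative B L (h * u ^ (p ^ B)) j z
          = (\<Sum>r\<in>E. \<Sum>a\<le>B. if p ^ a * j < r then f (r, a) (u ^ n (r, a) * z) else 0)"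
        unfolding phase_derivative_def E_def p_def[symmetric]
        by (intro sum.cong refl if_cong) (simp_all add: term_eq)
      also have "\<dots> = (\<Sum>(r, a)\<in>E \<times> {..B}. if p ^ a * j < r then f (r, a) (u ^ n (r, a) * z) else 0)"
        by (rule sum.cartesian_product)
      also have "\<dots> = (\<Sum>i\<in>I. f i (u ^ n i * z))"
        by (intro sum.mono_neutral_cong_right) (auto simp: I_def E_def split: if_splits)
      finally show "phase_derivative B L (h * u ^ (p ^ B)) j z = (\<Sum>i\<in>I. f i (u ^ n i * z))" .
    qed
    thus ?thesis using V(3)[OF that] by simp
  qed
  moreover have "(r0, a0) \<in> I" using r0 by (auto simp: I_def E_def)
  ultimately have "f (r0, a0) \<in> N"
    using elimination_inj[OF finI inj, of "p ^ B * B" f V "(r0, a0)"] V(1,2) \<open>\<not> card V \<le> p ^ B * B\<close>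
    by (auto simp: incongruent_def)
  thus False using r0 by blast
qed

text \<open>Greedy choice: after k elements at most k (2 D + 1) candidates are lost, namely the
  chosen ones and, for each of them, D candidates for either sign of the difference, as
  \<open>bad\<close> need not be symmetric.\<close>

lemma ex_good_difference_set:
  fixes bad :: "'a poly \<Rightarrow> bool"
  assumes X: "finite X" "incongruent X"
    and bad: "\<And>V. finite V \<Longrightarrow> incongruent V \<Longrightarrow> \<forall>u\<in>V. bad u \<Longrightarrow> card V \<le> D"
    and K: "K * (2 * D + 1) \<le> card X"
  shows "\<exists>U\<subseteq>X. card U = K \<and> (\<forall>u\<in>U. \<forall>v\<in>U. u \<noteq> v \<longrightarrow> \<not> bad (u - v))"
  using K
proof (induction K)
  case 0
  thus ?case by (intro exI[of _ "{}"]) auto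
next
  case (Suc k)
  then obtain U where U: "U \<subseteq> X" "card U = k" "\<forall>u\<in>U. \<forall>v\<in>U. u \<noteq> v \<longrightarrow> \<not> bad (u - v)"
    by auto
  have finU: "finite U" using U(1) X(1) finite_subset by blast
  have c1: "card {x\<in>X. bad (x - u)} \<le> D" for u
  proof -
    have "card ((\<lambda>x. x - u) ` {x\<in>X. bad (x - u)}) \<le> D"
      using X by (intro bad) (auto simp: incongruent_def)
    thus ?thesis by (simp add: card_image inj_on_def)
  qed
  have c2: "card {x\<in>X. bad (u - x)} \<le> D" for u
  proof -
    have "u - x - (u - y) = y - x" for x y by simp
    hence "card ((\<lambda>x. u - x) ` {x\<in>X. bad (u - x)}) \<le> D"
      using X by (intro bad) (auto simp: incongruent_def)
    thus ?thesis by (simp add: card_image inj_on_def)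
  qed
  define A1 A2 where "A1 = (\<Union>u\<in>U. {x\<in>X. bad (x - u)})" and "A2 = (\<Union>u\<in>U. {x\<in>X. bad (u - x)})"
  have "card A1 \<le> (\<Sum>u\<in>U. card {x\<in>X. bad (x - u)})" unfolding A1_def by (rule card_UN_le[OF finU])
  also have "\<dots> \<le> k * D" using sum_bounded_above[of U _ D] c1 U(2) by auto
  finally have a1: "card A1 \<le> k * D" .
  have "card A2 \<le> (\<Sum>u\<in>U. card {x\<in>X. bad (u - x)})" unfolding A2_def by (rule card_UN_le[OF finU])
  also have "\<dots> \<le> k * D" using sum_bounded_above[of U _ D] c2 U(2) by auto
  finally have a2: "card A2 \<le> k * D" .
  have "card (U \<union> (A1 \<union> A2)) \<le> card U + (card A1 + card A2)"
    using card_Un_le[of U "A1 \<union> A2"] card_Un_le[of A1 A2] by linarith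
  also have "\<dots> \<le> k + (k * D + k * D)" using a1 a2 U(2) by linarith
  also have "\<dots> < Suc k * (2 * D + 1)" by (simp add: algebra_simps)
  also have "\<dots> \<le> card X" by (rule Suc.prems)
  finally have "\<not> X \<subseteq> U \<union> (A1 \<union> A2)"
    using card_mono[of "U \<union> (A1 \<union> A2)" X] finU X(1) by (auto simp: A1_def A2_def)
  then obtain x where x: "x \<in> X" "x \<notin> U" "x \<notin> A1" "x \<notin> A2" by blast
  show ?case
  proof (intro exI[of _ "insert x U"] conjI)
    show "\<forall>u\<in>insert x U. \<forall>v\<in>insert x U. u \<noteq> v \<longrightarrow> \<not> bad (u - v)"
      using U(3) x by (auto simp: A1_def A2_def)
  qed (use x U finU in auto)
qed

end

text \<open>\<open>faithful\<close> is for the inductive step, where the coefficient at j is seen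
  only through a twist z |-> z^(p^a). \<open>separating\<close> is for the end of the induction: a
  shift seen by L, all multiples of which are invisible to the finitely many null functionals that
  remain.\<close>

locale weyl_pair = functional_pair +
  assumes faithful: "L \<in> C \<Longrightarrow> (\<And>h. (\<lambda>z. L (h * z ^ (CHAR('a) ^ a))) \<in> N) \<Longrightarrow> L \<in> N"
    and separating: "L \<in> C \<Longrightarrow> L \<notin> N \<Longrightarrow> finite S \<Longrightarrow> S \<subseteq> N \<Longrightarrow>
      \<exists>h. \<psi> (L h) \<noteq> 1 \<and> (\<forall>M\<in>S. \<forall>w. \<psi> (M (h * w)) = 1)"
begin

text \<open>The induction is on the largest exponent \<open>R\<close> whose functional is not null. With
  \<open>R - 1 = p\<^sup>a j\<close>, \<open>p \<nmid> j\<close>, the coefficient of \<open>y\<^sup>j\<close> in the difference of the phase along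
  \<open>h u\<^bsup>p\<^sup>B\<^esup>\<close> is a polynomial in \<open>u\<close> with distinct exponents for distinct sources, so
  for most \<open>u\<close> it is not null.\<close>

theorem weyl_sum_limsup:
  fixes \<Phi> :: "nat \<Rightarrow> 'a poly set"
  defines "p \<equiv> CHAR('a)"
  assumes \<Phi>: "\<And>N. finite (\<Phi> N)" "\<And>N. \<Phi> N \<noteq> {}"
    and inv: "\<And>L h. (\<And>r. L r \<in> C) \<Longrightarrow>
      (\<lambda>N. average (\<Phi> N) (\<lambda>y. \<psi> (phase B L (y + h))) - average (\<Phi> N) (\<lambda>y. \<psi> (phase B L y)))
        \<longlonglongrightarrow> 0"
    and X: "finite X" "incongruent X" "K * (2 * (p ^ B * B) + 1) \<le> card X" and K: "K > 0"
    and L: "\<And>r. L r \<in> C"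
    and R: "R \<in> phase_exponents p B" "L R \<notin> N"
      "\<And>r. r \<in> phase_exponents p B \<Longrightarrow> R < r \<Longrightarrow> L r \<in> N"
  shows "limsup_le (\<lambda>N. cmod (average (\<Phi> N) (\<lambda>y. \<psi> (phase B L y)))) (weyl_bound K (R - 1))"
  using L R
proof (induction R arbitrary: L rule: less_induct)
  case (less R)
  note L = less.prems(1) and R = less.prems(2-4)
  define E where "E = phase_exponents p B"
  have p: "prime p" by (simp add: p_def)
  have add: "additive_map (L r)" for r using L C_additive by blast
  have finE: "finite E" by (simp add: E_def)
  have R1: "R \<ge> 1" "R \<le> B" "\<not> p dvd R" using R(1) by (auto simp: phase_exponents_def)
  show ?case
  proof (cases "R = 1")
    case True
    have "L r \<in> N" if "r \<in> E - {1}" for r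
      using that R(3)[of r] True by (cases "r = 0") (auto simp: E_def phase_exponents_def)
    hence "L ` (E - {1}) \<subseteq> N" by blast
    moreover have "L 1 \<notin> N" "finite (L ` (E - {1}))" using R(2) True finE by auto
    \<comment> \<open>Since (y + h)^r - y^r is a multiple of h, the shift by h changes the null
      terms not at all and the linear term by the factor \<psi>(L 1 h) \<noteq> 1, so asymptotic
      invariance forces the averages to zero.\<close>
    ultimately obtain h where h: "\<psi> (L 1 h) \<noteq> 1" "\<And>r w. r \<in> E - {1} \<Longrightarrow> \<psi> (L r (h * w)) = 1"
      using separating[OF L] by (metis imageI)
    define f where "f y = \<psi> (phase B L y)" for y
    have 1: "1 \<in> E" using R(1) True by (simp add: E_def)
    have f_eq: "f y = \<psi> (L 1 y) * (\<Prod>r\<in>E-{1}. \<psi> (L r (y ^ r)))" for y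
      using finE 1 by (simp add: f_def phase_def E_def[symmetric] p_def[symmetric] psi_sum
          prod.remove[of E 1])
    have "\<psi> (L r ((y + h) ^ r)) = \<psi> (L r (y ^ r))" if r: "r \<in> E - {1}" for y r
    proof -
      have "(y + h) ^ r = y ^ r + h * (\<Sum>i<r. y ^ (r - Suc i) * (y + h) ^ i)"
        using power_diff_sumr2[of "y + h" r y] by (simp add: algebra_simps)
      thus ?thesis by (simp add: additive.add[OF add] psi_add h(2)[OF r])
    qed
    hence shift: "f (y + h) = \<psi> (L 1 h) * f y" for y
      by (simp add: f_eq additive.add[OF add] psi_add)
    have "(\<lambda>N. average (\<Phi> N) (\<lambda>y. f (y + h)) - average (\<Phi> N) f) \<longlonglongrightarrow> 0"
      using inv[of L h, OF L] by (simp add: f_def[abs_def])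
    moreover have "average (\<Phi> N) (\<lambda>y. f (y + h)) - average (\<Phi> N) f
        = (\<psi> (L 1 h) - 1) * average (\<Phi> N) f" for N
      by (simp only: shift average_cmult left_diff_distrib mult_1)
    ultimately have "(\<lambda>N. (\<psi> (L 1 h) - 1) * average (\<Phi> N) f) \<longlonglongrightarrow> 0" by simp
    hence "(\<lambda>N. 1 / (\<psi> (L 1 h) - 1) * ((\<psi> (L 1 h) - 1) * average (\<Phi> N) f))
        \<longlonglongrightarrow> 1 / (\<psi> (L 1 h) - 1) * 0"
      by (rule tendsto_mult_left)
    hence "(\<lambda>N. average (\<Phi> N) f) \<longlonglongrightarrow> 0" using h(1) by simp
    from limsup_le_tendsto_0[OF this] show ?thesis
      using True by (simp add: f_def[abs_def])
  next
    case False
    hence R2: "R \<ge> 2" using R1 by simp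
    define a where "a = multiplicity p (R - 1)"
    have "R - 1 \<noteq> 0" "\<not> is_unit p" using R2 p by auto
    then obtain j where j: "R - 1 = p ^ a * j" "\<not> p dvd j"
      unfolding a_def using multiplicity_decompose'[of "R - 1" p] by metis
    have j0: "j \<noteq> 0" using j(2) by (intro notI) simp
    have p0: "p > 0" using p prime_gt_0_nat by blast
    have le: "p ^ a * 1 \<le> p ^ a * j" "1 * j \<le> p ^ a * j"
      using j0 p0 by (intro mult_le_mono; simp)+
    have "a < p ^ a" using p by (intro power_gt_expt) (use prime_gt_1_nat in auto)
    hence aj: "a \<le> B" "j \<le> B" "j < R" "p ^ a * j < R" using le j(1) R1 R2 by linarith+
    have jE: "j \<in> E" using aj j0 j(2) by (auto simp: E_def phase_exponents_def)
    \<comment> \<open>The source (R, a) enters at j with the coefficient R choose (R - 1) = R, a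
      unit as p does not divide R, and with the first power of the shift.\<close>
    have cRj: "R - p ^ a * j = 1" "R choose (p ^ a * j) = R"
    proof -
      show "R - p ^ a * j = 1" using j(1) R2 by linarith
      have "R choose (R - 1) = R" using binomial_symmetric[of 1 R] R1 by simp
      thus "R choose (p ^ a * j) = R" using j(1) by simp
    qed
    have "\<exists>h. (\<lambda>z. L R (of_nat R * h * z ^ (p ^ a))) \<notin> N"
    proof (rule ccontr)
      assume *: "\<nexists>h. (\<lambda>z. L R (of_nat R * h * z ^ (p ^ a))) \<notin> N"
      have "(of_nat R :: 'a) \<noteq> 0" using R1(3) by (simp add: p_def of_nat_eq_0_iff_char_dvd)
      hence "of_nat R * ([:inverse (of_nat R):] * h) = h" for h :: "'a poly"
        by (simp add: of_nat_poly flip: mult.assoc one_pCons)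
      hence "(\<lambda>z. L R (h * z ^ (p ^ a))) \<in> N" for h
        using * by metis
      hence "L R \<in> N" using faithful[of "L R" a] L by (simp add: p_def)
      thus False using R(2) by simp
    qed
    then obtain h0 where h0: "(\<lambda>z. L R (of_nat R * h0 * z ^ (p ^ a))) \<notin> N" by blast
    define bad where "bad u \<longleftrightarrow> phase_derivative B L (h0 * u ^ (p ^ B)) j \<in> N" for u
    have bad_le: "card V \<le> p ^ B * B" if "finite V" "incongruent V" "\<forall>u\<in>V. bad u" for V
      using card_null_derivatives_le[of L R B a j h0 V] that L R(1) aj h0 cRj
      by (simp add: p_def bad_def)
    from ex_good_difference_set[OF X(1,2) bad_le X(3)]
    obtain U where U: "U \<subseteq> X" "card U = K" "\<forall>u\<in>U. \<forall>v\<in>U. u \<noteq> v \<longrightarrow> \<not> bad (u - v)" by blast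
    have finU: "finite U" using U(1) X(1) finite_subset by blast
    have U0: "U \<noteq> {}" using U(2) K by auto
    define f where "f y = \<psi> (phase B L y)" for y
    define hh where "hh u = h0 * u ^ (p ^ B)" for u
    have "limsup_le (\<lambda>N. cmod (average (\<Phi> N) (\<lambda>y. f (y + hh u) * cnj (f (y + hh v)))))
            (weyl_bound K (R - 2))" if uv: "u \<in> U" "v \<in> U" "u \<noteq> v" for u v
    proof -
      define k where "k = hh u - hh v"
      \<comment> \<open>The shifts run along p^B-th powers, which are additive in u, so the
        difference of two shifts has the same form with u - v.\<close>
      have k: "k = h0 * (u - v) ^ (p ^ B)"
        by (simp add: k_def hh_def p_def frobenius_poly_diff right_diff_distrib)
      define M where "M = phase_derivative B L k"
      have MC: "M r \<in> C" for r unfolding M_def using L by (rule phase_derivative_in_C)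
      have "M j \<notin> N" using U(3) uv by (simp add: M_def k bad_def)
      \<comment> \<open>The derivative is not null at j because u - v is good, so a largest exponent
        that is not null exists; it lies below R and the induction hypothesis applies with R' - 1
        \<le> R - 2.\<close>
      define R' where "R' = Max {r \<in> E. M r \<notin> N}"
      have "{r \<in> E. M r \<notin> N} \<noteq> {}" "finite {r \<in> E. M r \<notin> N}"
        using jE \<open>M j \<notin> N\<close> finE by auto
      hence R'in: "R' \<in> {r \<in> E. M r \<notin> N}" unfolding R'_def by (intro Max_in)
      have R'max: "M r \<in> N" if "r \<in> E" "R' < r" for r
      proof (rule ccontr)
        assume "M r \<notin> N"
        hence "r \<le> R'" unfolding R'_def using that(1) finE by (intro Max_ge) auto
        thus False using that(2) by simp
      qed
      have "M r \<in> N" if "r \<ge> R" for r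
        unfolding M_def by (rule phase_derivative_in_N) (use R(3) that in \<open>auto simp: p_def\<close>)
      hence "R' < R" using R'in linorder_not_less[of R' R] by auto
      have "limsup_le (\<lambda>N. cmod (average (\<Phi> N) (\<lambda>y. \<psi> (phase B M y)))) (weyl_bound K (R' - 1))"
        by (rule less.IH[OF \<open>R' < R\<close> MC]) (use R'in R'max in \<open>auto simp: E_def\<close>)
      hence "limsup_le (\<lambda>N. cmod (average (\<Phi> N) (\<lambda>y. \<psi> (phase B M y)))) (weyl_bound K (R - 2))"
        by (rule limsup_le_mono) (use \<open>R' < R\<close> in \<open>auto intro: weyl_bound_mono\<close>)
      from limsup_le_transfer[OF this inv[of M "hh v", OF MC]]
      have lim: "limsup_le (\<lambda>N. cmod (average (\<Phi> N) (\<lambda>y. \<psi> (phase B M (y + hh v)))))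
          (weyl_bound K (R - 2))" .
      have "f (y + hh u) * cnj (f (y + hh v)) = \<psi> (phase B L k) * \<psi> (phase B M (y + hh v))" for y
      proof -
        have "y + hh u = (y + hh v) + k" by (simp add: k_def)
        hence "phase B L (y + hh u)
            = phase B L (y + hh v) + phase B L k + phase B M (y + hh v)"
          unfolding M_def by (simp only: phase_add[OF add])
        thus ?thesis by (simp add: f_def psi_add mult_ac)
      qed
      thus ?thesis using lim by (simp add: average_cmult norm_mult)
    qed
    moreover have "(\<lambda>N. average (\<Phi> N) (\<lambda>y. f (y + hh u)) - average (\<Phi> N) f) \<longlonglongrightarrow> 0" for u
      using inv[of L "hh u", OF L] by (simp add: f_def[abs_def])
    ultimately have "limsup_le (\<lambda>N. cmod (average (\<Phi> N) f)) (sqrt (1 / card U + weyl_bound K (R - 2)))"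
      using finU U0 \<Phi> by (intro van_der_corput[where h = hh]) (auto simp: f_def weyl_bound_nonneg)
    moreover have "sqrt (1 / card U + weyl_bound K (R - 2)) = weyl_bound K (R - 1)"
    proof -
      have "R - 1 = Suc (R - 2)" using R2 by simp
      thus ?thesis by (simp add: U(2))
    qed
    ultimately show ?thesis by (simp add: f_def[abs_def])
  qed
qed

end


section \<open>Rational and periodic functionals\<close>

text \<open>Only the character \<psi> o L has to be trivial on the multiples of W; L itself may take
  nonzero values there in the kernel of \<psi>.\<close>

definition periodic :: "'a::finite_field poly \<Rightarrow> ('a poly \<Rightarrow> 'a) \<Rightarrow> bool" where
  "periodic W L \<longleftrightarrow> (\<forall>z. \<psi> (L (W * z)) = 1)"

text \<open>The character \<psi> o L factors through a finite quotient F[t]/(W); for pairings with a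
  torus point this means that the point is rational.\<close>

definition rational_functional :: "('a::finite_field poly \<Rightarrow> 'a) \<Rightarrow> bool" where
  "rational_functional L \<longleftrightarrow> (\<exists>W. W \<noteq> 0 \<and> periodic W L)"

lemma periodic_zero: "periodic W (\<lambda>_. 0)"
  by (simp add: periodic_def)

lemma periodic_plus: "periodic W L \<Longrightarrow> periodic W M \<Longrightarrow> periodic W (\<lambda>z. L z + M z)"
  by (simp add: periodic_def psi_add)

lemma periodic_uminus: "periodic W L \<Longrightarrow> periodic W (\<lambda>z. - L z)"
  by (simp add: periodic_def psi_uminus)

lemma periodic_dvd: "periodic W L \<Longrightarrow> W dvd V \<Longrightarrow> periodic V L"
  by (auto simp: periodic_def mult.assoc elim!: dvdE)

lemma periodicD: "periodic W L \<Longrightarrow> W dvd z \<Longrightarrow> \<psi> (L z) = 1"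
  by (auto simp: periodic_def elim!: dvdE)

lemma periodic_twist:
  fixes L :: "'a::finite_field poly \<Rightarrow> 'a"
  assumes "periodic W L"
  shows "periodic W (\<lambda>z. L (c * z ^ (CHAR('a) ^ a)))"
  unfolding periodic_def
proof
  fix z :: "'a poly"
  have "W dvd (W * z) ^ (CHAR('a) ^ a)" by (rule dvd_trans[of _ "W * z"]) (auto intro: dvd_power)
  thus "\<psi> (L (c * (W * z) ^ (CHAR('a) ^ a))) = 1"
    by (intro periodicD[OF assms]) simp
qed

lemma additive_twist:
  fixes L :: "'a::finite_field poly \<Rightarrow> 'a"
  shows "additive_map L \<Longrightarrow> additive_map (\<lambda>z. L (c * z ^ (CHAR('a) ^ a)))"
  by (rule additive_comp[OF _ additive_frobenius_poly])

lemma additive_const_mult: "additive_map (\<lambda>z :: 'b::ring. c * z)"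
  by (simp add: Modules.additive_def algebra_simps)

text \<open>F is perfect, so c has a q-th root. Thus F[t] is spanned over its q-th powers by 1, t,
  ..., t^(q-1), and a statement about all twists needs only these finitely many multipliers.\<close>

lemma monom_as_twisted:
  fixes c :: "'a::finite_field" and a :: nat
  defines "q \<equiv> CHAR('a) ^ a"
  obtains w where "monom c i = monom 1 (i mod q) * w ^ q"
proof -
  obtain c' where c': "c = c' ^ q"
    using frobenius_field_bij[where ?'a = 'a and a = a] unfolding q_def bij_def surj_def by blast
  have "monom c i = monom 1 (i mod q) * (monom c' (i div q)) ^ q"
    by (simp add: monom_power mult_monom c' mult.commute)
  thus ?thesis using that by blast
qed

lemma poly_multiplicative_trivial:
  fixes f :: "'a::field poly \<Rightarrow> complex"
  assumes "\<And>x y. f (x + y) = f x * f y" "f 0 = 1" "\<And>c i. f (monom c i) = 1"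
  shows "f w = 1"
proof -
  have "f (\<Sum>i\<in>A. g i) = (\<Prod>i\<in>A. f (g i))" if "finite A" for A :: "nat set" and g
    using that by (induction A rule: finite_induct) (auto simp: assms)
  from this[of "{..degree w}" "\<lambda>i. monom (coeff w i) i"] show ?thesis
    by (simp add: poly_as_sum_of_monoms assms)
qed

lemma rational_zero: "rational_functional (\<lambda>_. 0)"
  unfolding rational_functional_def using periodic_zero[of 1] by (intro exI[of _ 1]) simp

lemma rational_uminus: "rational_functional L \<Longrightarrow> rational_functional (\<lambda>z. - L z)"
  unfolding rational_functional_def using periodic_uminus by blast

lemma rational_twist:
  fixes L :: "'a::finite_field poly \<Rightarrow> 'a"
  shows "rational_functional L \<Longrightarrow> rational_functional (\<lambda>z. L (c * z ^ (CHAR('a) ^ a)))"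
  unfolding rational_functional_def using periodic_twist by blast

text \<open>Periods multiply: V W is a period of a sum, and if W is a period of z |-> L(u z), then u
  W is one of L. Hence only u = 0 has to be excluded.\<close>

lemma functional_pair_rational:
  "functional_pair {L :: 'a::finite_field poly \<Rightarrow> 'a. additive_map L}
     {L. additive_map L \<and> rational_functional L} {0}"
proof (unfold_locales, goal_cases)
  case (7 L M)
  then obtain V W where "V \<noteq> 0" "W \<noteq> 0" "periodic V L" "periodic W M"
    by (auto simp: rational_functional_def)
  hence "periodic (V * W) (\<lambda>z. L z + M z)" "V * W \<noteq> 0"
    by (auto intro!: periodic_plus intro: periodic_dvd)
  hence "rational_functional (\<lambda>z. L z + M z)" unfolding rational_functional_def by blast
  thus ?case using 7 by (simp add: additive_plus)
next
  case (10 L u)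
  then obtain W where "W \<noteq> 0" "periodic W (\<lambda>z. L (u * z))" by (auto simp: rational_functional_def)
  hence "periodic (u * W) L" "u * W \<noteq> 0" using 10 by (auto simp: periodic_def mult.assoc)
  hence "rational_functional L" unfolding rational_functional_def by blast
  thus ?case using 10 by simp
next
  case (4 L c a)
  thus ?case using additive_twist[of L c a] by simp
next
  case (9 L c a)
  thus ?case using additive_twist[of L c a] rational_twist[of L c a] by simp
qed (auto simp: additive.add additive_plus additive_uminus additive_const_0
       rational_zero rational_uminus)

text \<open>For \<open>faithful\<close>, the product V of the periods belonging to the multipliers
  t^i with i < q yields the period V^q of L. For \<open>separating\<close>, h is a multiple of the
  product of the periods of the given null functionals.\<close>

lemma weyl_pair_rational:
  "weyl_pair {L :: 'a::finite_field poly \<Rightarrow> 'a. additive_map L}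
     {L. additive_map L \<and> rational_functional L} {0}"
proof (intro weyl_pair.intro functional_pair_rational weyl_pair_axioms.intro, goal_cases)
  case (1 L a)
  define q where "q = CHAR('a) ^ a"
  have q0: "q > 0" by (simp add: q_def)
  have "\<exists>W. W \<noteq> 0 \<and> periodic W (\<lambda>z. L (h * z ^ q))" for h
    using 1(2)[of h] by (simp add: rational_functional_def q_def)
  then obtain W where W: "\<And>h. W h \<noteq> 0" "\<And>h. periodic (W h) (\<lambda>z. L (h * z ^ q))" by metis
  define V where "V = (\<Prod>i<q. W (monom 1 i))"
  have V0: "V \<noteq> 0" by (simp add: V_def W)
  have "\<psi> (L (V ^ q * w)) = 1" for w
  proof (rule poly_multiplicative_trivial[of "\<lambda>w. \<psi> (L (V ^ q * w))"])
    fix c :: 'a and i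
    obtain w where w: "monom c i = monom 1 (i mod q) * w ^ q"
      using monom_as_twisted[of c i a] unfolding q_def by blast
    have "V ^ q * monom c i = monom 1 (i mod q) * (V * w) ^ q"
      by (simp only: w power_mult_distrib mult_ac)
    moreover have "W (monom 1 (i mod q)) dvd V" unfolding V_def
      using q0 by (intro dvd_prodI) auto
    ultimately show "\<psi> (L (V ^ q * monom c i)) = 1"
      using periodicD[OF W(2)[of "monom 1 (i mod q)"], of "V * w"] by simp
  qed (use 1(1) in \<open>simp_all add: distrib_left additive.add additive.zero psi_add\<close>)
  hence "periodic (V ^ q) L" "V ^ q \<noteq> 0" using V0 by (auto simp: periodic_def)
  hence "rational_functional L" unfolding rational_functional_def by blast
  thus ?case using 1(1) by simp
next
  case (2 L S)
  hence "\<forall>M\<in>S. \<exists>W. W \<noteq> 0 \<and> periodic W M" by (auto simp: rational_functional_def)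
  then obtain W where W: "\<And>M. M \<in> S \<Longrightarrow> W M \<noteq> 0" "\<And>M. M \<in> S \<Longrightarrow> periodic (W M) M" by metis
  define V where "V = (\<Prod>M\<in>S. W M)"
  have "V \<noteq> 0" using 2(3) W by (simp add: V_def)
  hence "\<not> periodic V L" using 2 by (auto simp: rational_functional_def)
  then obtain z where "\<psi> (L (V * z)) \<noteq> 1" by (auto simp: periodic_def)
  moreover have "\<psi> (M (V * z * w)) = 1" if "M \<in> S" for M w
  proof -
    have "W M dvd V" unfolding V_def using 2(3) that by (intro dvd_prodI)
    thus ?thesis using W(2)[OF that] by (intro periodicD[of "W M"]) auto
  qed
  ultimately show ?case by blast
qed

text \<open>If x u + y \<pi> = 1, then W z is congruent to u (W x z) modulo \<pi> W; so scalars
  prime to \<pi> act injectively.\<close>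

lemma functional_pair_periodic:
  fixes \<pi> W :: "'a::finite_field poly"
  assumes "irreducible \<pi>"
  shows "functional_pair {L. additive_map L \<and> periodic (\<pi> * W) L}
     {L. additive_map L \<and> periodic W L} {u. \<pi> dvd u}"
proof (unfold_locales, goal_cases)
  case (10 L u)
  hence "\<not> \<pi> dvd u" by simp
  then obtain x y where xy: "x * u + y * \<pi> = 1" using irreducible_poly_bezout assms by metis
  have "periodic W L"
    unfolding periodic_def
  proof
    fix z
    have "W * z = u * (W * (x * z)) + \<pi> * W * (y * z)"
      using arg_cong[OF xy, of "\<lambda>t. t * (W * z)"] by (simp add: algebra_simps)
    hence "\<psi> (L (W * z)) = \<psi> (L (u * (W * (x * z)))) * \<psi> (L (\<pi> * W * (y * z)))"
      using 10(1) by (simp add: additive.add psi_add)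
    thus "\<psi> (L (W * z)) = 1" using 10 by (simp add: periodic_def)
  qed
  thus ?case using 10 by simp
next
  case (4 L c a)
  thus ?case using additive_twist[of L c a] periodic_twist[of _ L c a] by simp
next
  case (9 L c a)
  thus ?case using additive_twist[of L c a] periodic_twist[of _ L c a] by simp
next
  case (5 L)
  thus ?case using periodic_dvd[of W L "\<pi> * W"] by simp
qed (auto simp: additive.add additive_plus additive_uminus additive_const_0 periodic_zero
       periodic_plus periodic_uminus)

text \<open>As W is invertible modulo \<pi>, W z is congruent to (x z) W^q modulo \<pi> W for some
  x, and the twisted functionals determine L on the multiples of W. If \<pi> divided W, then for q >
  1 the power W^q would be a multiple of \<pi> W and the twists would carry no information.\<close>

lemma weyl_pair_periodic:
  fixes \<pi> W :: "'a::finite_field poly"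
  assumes \<pi>: "irreducible \<pi>" "\<not> \<pi> dvd W"
  shows "weyl_pair {L. additive_map L \<and> periodic (\<pi> * W) L}
     {L. additive_map L \<and> periodic W L} {u. \<pi> dvd u}"
proof (intro weyl_pair.intro functional_pair_periodic weyl_pair_axioms.intro, goal_cases)
  case (2 L a)
  define q where "q = CHAR('a) ^ a"
  have q: "q = Suc (q - 1)" by (simp add: q_def)
  have "\<exists>x y. x * W ^ m + y * \<pi> = 1" for m
  proof (induction m)
    case 0
    show ?case by (intro exI[of _ 1] exI[of _ 0]) simp
  next
    case (Suc m)
    then obtain x y where xy: "x * W ^ m + y * \<pi> = 1" by blast
    obtain u v where uv: "u * W + v * \<pi> = 1" using irreducible_poly_bezout \<pi> by metis
    have "(u * W + v * \<pi>) * (x * W ^ m + y * \<pi>) = 1" by (simp only: xy uv mult_1)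
    hence "(u * x) * W ^ Suc m + (u * W * y + v * x * W ^ m + v * y * \<pi>) * \<pi> = 1"
      by (simp add: algebra_simps)
    thus ?case by blast
  qed
  then obtain x y where xy: "x * W ^ (q - 1) + y * \<pi> = 1" by blast
  have "periodic W L"
    unfolding periodic_def
  proof
    fix z
    have "W * z = (x * z) * (W * 1) ^ q + \<pi> * W * (y * z)"
      using arg_cong[OF xy, of "\<lambda>t. t * (W * z)"]
      by (subst q) (simp add: algebra_simps)
    hence "\<psi> (L (W * z)) = \<psi> (L ((x * z) * (W * 1) ^ q)) * \<psi> (L (\<pi> * W * (y * z)))"
      using 2(1) by (simp add: additive.add psi_add)
    moreover have "\<psi> (L ((x * z) * (W * 1) ^ q)) = 1"
      using 2(2)[of "x * z"] unfolding periodic_def q_def by blast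
    ultimately show "\<psi> (L (W * z)) = 1" using 2(1) by (simp add: periodic_def)
  qed
  thus ?case using 2(1) by simp
next
  case (3 L S)
  then obtain z where "\<psi> (L (W * z)) \<noteq> 1" by (auto simp: periodic_def)
  moreover have "\<psi> (M (W * z * w)) = 1" if "M \<in> S" for M w
    using 3(4) that by (auto intro: periodicD)
  ultimately show ?case by blast
qed (rule assms)


section \<open>Averages along Folner sequences\<close>

lemma folner_average_shift:
  fixes f :: "'a::finite_field poly \<Rightarrow> complex"
  assumes \<Phi>: "folner \<Phi>" and f: "\<And>y. cmod (f y) \<le> 1"
  shows "(\<lambda>N. average (\<Phi> N) (\<lambda>y. f (y + h)) - average (\<Phi> N) f) \<longlonglongrightarrow> 0"
proof (rule Lim_null_comparison)
  let ?S = "\<lambda>N. (\<lambda>x. x + h) ` \<Phi> N"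
  show "(\<lambda>N. real (card (sym_diff (?S N) (\<Phi> N))) / real (card (\<Phi> N))) \<longlonglongrightarrow> 0"
    using \<Phi> unfolding folner_def by blast
  show "\<forall>\<^sub>F N in sequentially. cmod (average (\<Phi> N) (\<lambda>y. f (y + h)) - average (\<Phi> N) f)
      \<le> real (card (sym_diff (?S N) (\<Phi> N))) / real (card (\<Phi> N))"
  proof (intro always_eventually allI)
    fix N
    have fin: "finite (\<Phi> N)" "finite (?S N)" using \<Phi> by (auto simp: folner_def)
    have "(\<Sum>y\<in>\<Phi> N. f (y + h)) = (\<Sum>y\<in>?S N. f y)"
      by (subst sum.reindex) (auto simp: inj_on_def)
    also have "\<dots> - (\<Sum>y\<in>\<Phi> N. f y) = (\<Sum>y\<in>?S N - \<Phi> N. f y) - (\<Sum>y\<in>\<Phi> N - ?S N. f y)"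
      using fin sum.Int_Diff[of "?S N" f "\<Phi> N"] sum.Int_Diff[of "\<Phi> N" f "?S N"]
      by (simp add: Int_commute)
    also have "cmod \<dots> \<le> cmod (\<Sum>y\<in>?S N - \<Phi> N. f y) + cmod (\<Sum>y\<in>\<Phi> N - ?S N. f y)"
      by (rule norm_triangle_ineq4)
    also have "\<dots> \<le> real (card (?S N - \<Phi> N)) * 1 + real (card (\<Phi> N - ?S N)) * 1"
      by (intro add_mono sum_norm_bound f)
    also have "\<dots> = real (card (sym_diff (?S N) (\<Phi> N)))"
      using fin by (subst card_Un_disjoint) auto
    finally show "cmod (average (\<Phi> N) (\<lambda>y. f (y + h)) - average (\<Phi> N) f)
      \<le> real (card (sym_diff (?S N) (\<Phi> N))) / real (card (\<Phi> N))"
      by (simp add: average_def divide_right_mono norm_divide flip: diff_divide_distrib)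
  qed
qed

lemma le_card_polys_below: "m \<le> card (polys_below m :: 'a::finite_field poly set)"
proof -
  have "m < CARD('a) ^ m"
    using power_gt_expt[of "CARD('a)" m] card_mono[of "UNIV :: 'a set" "{0, 1}"] by simp
  thus ?thesis by (simp add: card_polys_below)
qed

text \<open>Here any two distinct polynomials are incongruent, so the supply of shifts is unlimited;
  K is arbitrary and the Weyl bound tends to 0.\<close>

theorem irrational_phase_average:
  fixes L :: "nat \<Rightarrow> 'a::finite_field poly \<Rightarrow> 'a"
  assumes \<Phi>: "folner \<Phi>" and L: "\<And>r. additive_map (L r)"
    and r0: "r0 \<in> phase_exponents CHAR('a) B" "\<not> rational_functional (L r0)"
  shows "(\<lambda>N. average (\<Phi> N) (\<lambda>y. \<psi> (phase B L y))) \<longlonglongrightarrow> 0"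
proof -
  interpret weyl_pair "{L :: 'a poly \<Rightarrow> 'a. additive_map L}"
    "{L. additive_map L \<and> rational_functional L}" "{0}"
    by (rule weyl_pair_rational)
  define E where "E = {r \<in> phase_exponents CHAR('a) B. \<not> rational_functional (L r)}"
  define R where "R = Max E"
  have fin: "finite E" by (simp add: E_def)
  have "R \<in> E" unfolding R_def using r0 fin by (intro Max_in) (auto simp: E_def)
  have Rmax: "rational_functional (L r)" if "r \<in> phase_exponents CHAR('a) B" "R < r" for r
  proof (rule ccontr)
    assume "\<not> rational_functional (L r)"
    hence "r \<le> R" unfolding R_def using that(1) fin by (intro Max_ge) (auto simp: E_def)
    thus False using that(2) by simp
  qed
  have inv: "(\<lambda>N. average (\<Phi> N) (\<lambda>y. \<psi> (phase B M (y + h))) - average (\<Phi> N) (\<lambda>y. \<psi> (phase B M y)))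
      \<longlonglongrightarrow> 0" for M h
    using folner_average_shift[OF \<Phi>, of "\<lambda>y. \<psi> (phase B M y)" h] by simp
  have bound: "limsup_le (\<lambda>N. cmod (average (\<Phi> N) (\<lambda>y. \<psi> (phase B L y)))) (weyl_bound K (R - 1))"
    if K: "K > 0" for K
  proof (rule weyl_sum_limsup[where X = "polys_below (K * (2 * (CHAR('a) ^ B * B) + 1))"])
    show "K * (2 * (CHAR('a) ^ B * B) + 1)
        \<le> card (polys_below (K * (2 * (CHAR('a) ^ B * B) + 1)) :: 'a poly set)"
      by (rule le_card_polys_below)
  qed (use \<Phi> L \<open>R \<in> E\<close> Rmax K inv in
        \<open>auto simp: folner_def incongruent_def E_def\<close>)
  have "(\<lambda>K. real (R - 1) * real K powr (- (1 / 2 ^ (R - 1)))) \<longlonglongrightarrow> real (R - 1) * 0"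
    by (intro tendsto_mult tendsto_const tendsto_neg_powr filterlim_real_sequentially) auto
  hence to0: "(\<lambda>K. real (R - 1) * real K powr (- (1 / 2 ^ (R - 1)))) \<longlonglongrightarrow> 0" by simp
  show ?thesis
  proof (rule tendsto_norm_zero_cancel, rule order_tendstoI)
    fix e :: real assume "0 < e"
    hence "\<forall>\<^sub>F K in sequentially. real (R - 1) * real K powr (- (1 / 2 ^ (R - 1))) < e \<and> K > 0"
      using order_tendstoD(2)[OF to0] eventually_gt_at_top[of 0] by (intro eventually_conj) auto
    then obtain K where K: "real (R - 1) * real K powr (- (1 / 2 ^ (R - 1))) < e" "K > 0"
      using eventually_happens' sequentially_bot by blast
    hence "weyl_bound K (R - 1) < e" using weyl_bound_le[of K "R - 1"] by linarith
    thus "\<forall>\<^sub>F N in sequentially. cmod (average (\<Phi> N) (\<lambda>y. \<psi> (phase B L y))) < e"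
      using bound[OF K(2)] by (auto simp: limsup_le_def)
  qed (auto intro!: always_eventually less_le_trans[OF _ norm_ge_zero])
qed


section \<open>Averages over residue rings\<close>

lemma mem_residue_ring: "z \<in> residue_ring Q \<longleftrightarrow> z mod Q = z"
  unfolding residue_ring_def by (auto intro: rev_image_eqI[of z])

lemma mod_in_residue_ring [simp]: "z mod Q \<in> residue_ring Q"
  by (simp add: residue_ring_def)

lemma residue_ring_facts:
  assumes "Q \<in> moduli"
  shows finite_residue_ring: "finite (residue_ring (Q :: 'a::finite_field poly))"
    and card_residue_ring: "card (residue_ring Q) = poly_abs Q"
    and residue_ring_nonempty: "residue_ring Q \<noteq> {}"
  using assms residue_ring_eq[of Q] by (auto simp: moduli_def card_polys_below poly_abs_def)

lemma sum_residue_shift: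
  fixes f :: "'a::finite_field poly \<Rightarrow> 'b::comm_monoid_add"
  assumes "\<And>x. f (x mod Q) = f x"
  shows "(\<Sum>y\<in>residue_ring Q. f (y + h)) = (\<Sum>y\<in>residue_ring Q. f y)"
proof -
  have "(y - h + h) mod Q = y mod Q" for y by simp
  thus ?thesis
    by (intro sum.reindex_bij_witness[of _ "\<lambda>y. (y - h) mod Q" "\<lambda>y. (y + h) mod Q"])
       (auto simp: mod_diff_left_eq mod_add_left_eq mem_residue_ring assms)
qed

lemma average_residue_shift:
  fixes f :: "'a::finite_field poly \<Rightarrow> complex"
  assumes "\<And>x. f (x mod Q) = f x"
  shows "average (residue_ring Q) (\<lambda>y. f (y + h)) = average (residue_ring Q) f"
  using sum_residue_shift[of f Q h, OF assms] by (simp add: average_def)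

lemma psi_additive_mod:
  fixes L :: "'a::finite_field poly \<Rightarrow> 'a"
  assumes "additive_map L" "periodic W L" "W dvd x - y"
  shows "\<psi> (L x) = \<psi> (L y)"
proof -
  have "x = y + (x - y)" by simp
  hence "\<psi> (L x) = \<psi> (L y) * \<psi> (L (x - y))"
    using additive.add[OF assms(1)] by (metis psi_add)
  thus ?thesis using periodicD[OF assms(2,3)] by simp
qed

lemma dvd_mod_diff: "Q dvd x mod Q - (x :: 'a::field poly)"
  by (metis dvd_minus_mod dvd_diff_commute)

lemma psi_phase_mod:
  fixes L :: "nat \<Rightarrow> 'a::finite_field poly \<Rightarrow> 'a"
  assumes "\<And>r. additive_map (L r)" "\<And>r. periodic W (L r)" "W dvd x - y"
  shows "\<psi> (phase B L x) = \<psi> (phase B L y)"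
proof -
  have "W dvd x ^ r - y ^ r" for r
    using assms(3) by (simp add: power_diff_sumr2)
  thus ?thesis unfolding phase_def
    by (simp add: psi_sum) (intro prod.cong refl psi_additive_mod[of _ W] assms)
qed

lemma average_additive_char_eq_0:
  fixes L :: "'a::finite_field poly \<Rightarrow> 'a"
  assumes L: "additive_map L" "periodic Q L" and z: "\<psi> (L z) \<noteq> 1"
  shows "average (residue_ring Q) (\<lambda>v. \<psi> (L v)) = 0"
proof -
  have "average (residue_ring Q) (\<lambda>v. \<psi> (L (v + z))) = average (residue_ring Q) (\<lambda>v. \<psi> (L v))"
    by (rule average_residue_shift) (rule psi_additive_mod[OF L dvd_mod_diff])
  moreover have "average (residue_ring Q) (\<lambda>v. \<psi> (L (v + z)))
      = \<psi> (L z) * average (residue_ring Q) (\<lambda>v. \<psi> (L v))"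
    by (simp add: additive.add[OF L(1)] psi_add mult.commute[of _ "\<psi> (L z)"] average_cmult)
  ultimately show ?thesis using z by (metis mult_cancel_right1)
qed

section \<open>Monic irreducible divisors and the least prime factor\<close>

lemma ex_monic_irreducible_dvd:
  fixes W :: "'a::field poly"
  assumes "W \<noteq> 0" "\<not> is_unit W"
  obtains \<pi> where "irreducible \<pi>" "\<pi> dvd W" "lead_coeff \<pi> = 1"
proof -
  obtain V where V: "V dvd W" "\<not> is_unit V"
    and min: "\<And>U. U dvd W \<Longrightarrow> \<not> is_unit U \<Longrightarrow> degree V \<le> degree U"
    using ex_has_least_nat[of "\<lambda>V. V dvd W \<and> \<not> is_unit V" W degree] assms(2) by auto
  have V0: "V \<noteq> 0" using V(1) assms(1) by auto
  have irr: "irreducible V"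
  proof (rule irreducibleI)
    fix a b assume ab: "V = a * b"
    show "is_unit a \<or> is_unit b"
    proof (rule ccontr)
      assume *: "\<not> (is_unit a \<or> is_unit b)"
      have "a dvd W" using V(1) ab by (meson dvd_mult_left)
      hence "degree V \<le> degree a" using min * by blast
      moreover have "degree V = degree a + degree b" using ab V0 by (simp add: degree_mult_eq)
      ultimately have "degree b = 0" by simp
      moreover have "b \<noteq> 0" using ab V0 by auto
      ultimately show False using * by (simp add: is_unit_iff_degree)
    qed
  qed (use V0 V in auto)
  define \<pi> where "\<pi> = smult (inverse (lead_coeff V)) V"
  have c: "inverse (lead_coeff V) \<noteq> 0" using V0 by simp
  have "\<pi> dvd V" "V dvd \<pi>" using c by (simp_all add: \<pi>_def smult_dvd_iff dvd_smult)
  have "irreducible \<pi>"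
  proof (rule irreducibleI)
    fix a b assume "\<pi> = a * b"
    moreover have "V = smult (lead_coeff V) \<pi>" using V0 by (simp add: \<pi>_def)
    ultimately have Vab: "V = smult (lead_coeff V) a * b" by simp
    have "is_unit (smult (lead_coeff V) a) \<or> is_unit b" by (rule irreducibleD[OF irr Vab])
    moreover have "is_unit a" if "is_unit (smult (lead_coeff V) a)"
      by (rule dvd_trans[OF _ that]) (simp add: dvd_smult)
    ultimately show "is_unit a \<or> is_unit b" by blast
  qed (use V0 V \<open>V dvd \<pi>\<close> \<open>\<pi> dvd V\<close> dvd_trans c in \<open>auto simp: \<pi>_def\<close>)
  moreover have "lead_coeff \<pi> = 1" using V0 by (simp add: \<pi>_def)
  ultimately show ?thesis using that \<open>\<pi> dvd V\<close> V(1) dvd_trans by blast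
qed

lemma monic_irreducible_divisors:
  assumes Q: "Q \<in> moduli"
  shows "finite {R :: 'a::finite_field poly. lead_coeff R = 1 \<and> irreducible R \<and> R dvd Q}"
    and "{R :: 'a poly. lead_coeff R = 1 \<and> irreducible R \<and> R dvd Q} \<noteq> {}"
proof -
  have "Q \<noteq> 0" using Q by (auto simp: moduli_def)
  hence Q0: "Q \<noteq> 0" "\<not> is_unit Q" using Q by (auto simp: moduli_def is_unit_iff_degree)
  have "R \<in> polys_below (Suc (degree Q))" if "R dvd Q" for R
    using dvd_imp_degree_le[OF that] Q0 by (intro degree_less_imp_polys_below) simp
  thus "finite {R. lead_coeff R = 1 \<and> irreducible R \<and> R dvd Q}"
    by (intro finite_subset[OF _ finite_polys_below[of "Suc (degree Q)"]]) auto
  show "{R :: 'a poly. lead_coeff R = 1 \<and> irreducible R \<and> R dvd Q} \<noteq> {}"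
    using ex_monic_irreducible_dvd[OF Q0] by blast
qed

lemma lpf_le:
  assumes "Q \<in> moduli" "lead_coeff \<pi> = 1" "irreducible \<pi>" "\<pi> dvd Q"
  shows "lpf Q \<le> poly_abs \<pi>"
  unfolding lpf_def using monic_irreducible_divisors[OF assms(1)] assms by (intro Min_le) auto

lemma lpf_gt_iff:
  assumes "Q \<in> moduli"
  shows "m < lpf Q \<longleftrightarrow> (\<forall>\<pi>. lead_coeff \<pi> = 1 \<longrightarrow> irreducible \<pi> \<longrightarrow> \<pi> dvd Q \<longrightarrow> m < poly_abs \<pi>)"
  unfolding lpf_def using monic_irreducible_divisors[OF assms] by (subst Min_gr_iff) auto

lemma lpf_pos: "Q \<in> moduli \<Longrightarrow> lpf Q > 0"
  by (subst lpf_gt_iff) (auto simp: poly_abs_def)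


section \<open>Periodic phases: stationary phase and Weyl sums modulo Q\<close>

lemma power_add_expansion:
  fixes y t :: "'b::comm_ring_1"
  shows "t\<^sup>2 dvd (y + t) ^ r - (y ^ r + of_nat r * y ^ (r - 1) * t)"
proof (induction r)
  case (Suc r)
  then obtain s where s: "(y + t) ^ r - (y ^ r + of_nat r * y ^ (r - 1) * t) = t\<^sup>2 * s"
    by (elim dvdE)
  have y: "of_nat r * y ^ (r - 1) * y = of_nat r * y ^ r" by (cases r) auto
  have "(y + t) ^ r = y ^ r + of_nat r * y ^ (r - 1) * t + t\<^sup>2 * s"
    using s by (simp add: algebra_simps)
  hence "(y + t) ^ Suc r = y ^ Suc r + (of_nat r * y ^ (r - 1) * y) * t + y ^ r * t
      + t\<^sup>2 * (s * y + s * t + of_nat r * y ^ (r - 1))"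
    by (simp add: algebra_simps power2_eq_square)
  also have "\<dots> = y ^ Suc r + of_nat (Suc r) * y ^ r * t
      + t\<^sup>2 * (s * y + s * t + of_nat r * y ^ (r - 1))"
    unfolding y by (simp add: algebra_simps)
  finally show ?case by simp
qed auto

text \<open>Writing y as y mod \<pi> plus a multiple of \<pi> shows that each class modulo \<pi>
  contains at most |Q| / |\<pi>| reduced residues.\<close>

lemma card_residue_classes_le:
  fixes \<pi> Q :: "'a::finite_field poly"
  assumes \<pi>: "\<pi> dvd Q" "degree \<pi> > 0" and Q: "Q \<in> moduli"
    and S: "S \<subseteq> residue_ring Q" "card ((\<lambda>y. y mod \<pi>) ` S) \<le> m"
  shows "card S * poly_abs \<pi> \<le> m * poly_abs Q"
proof -
  have Q0: "Q \<noteq> 0" "degree Q > 0" using Q by (auto simp: moduli_def)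
  have \<pi>0: "\<pi> \<noteq> 0" using \<pi> Q0 by auto
  have le: "degree \<pi> \<le> degree Q" using \<pi> Q0 by (simp add: dvd_imp_degree_le)
  define e where "e = degree Q - degree \<pi>"
  have fin: "finite S" using S(1) finite_residue_ring[OF Q] finite_subset by blast
  have "y div \<pi> \<in> polys_below e" if "y \<in> S" for y
  proof -
    have "y \<in> polys_below (degree Q)" using that S(1) residue_ring_eq[OF Q0(2)] by blast
    hence "y = 0 \<or> degree y < degree Q" by (rule polys_below_degree)
    moreover have "degree (y div \<pi>) + degree \<pi> = degree y" if "y div \<pi> \<noteq> 0"
    proof -
      have "degree (\<pi> * (y div \<pi>)) = degree \<pi> + degree (y div \<pi>)"
        using that \<pi>0 by (rule degree_mult_eq[rotated])
      moreover have "degree (y mod \<pi>) < degree \<pi>"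
        using degree_mod_less[OF \<pi>0, of y] \<pi>(2) by auto
      ultimately have "degree (\<pi> * (y div \<pi>) + y mod \<pi>) = degree \<pi> + degree (y div \<pi>)"
        by (subst degree_add_eq_left) auto
      thus ?thesis by simp
    qed
    ultimately show ?thesis
      using le unfolding e_def by (cases "y div \<pi> = 0") (auto intro!: degree_less_imp_polys_below)
  qed
  hence "S \<subseteq> (\<lambda>(c, k). c + \<pi> * k) ` (((\<lambda>y. y mod \<pi>) ` S) \<times> polys_below e)"
    by (force simp: mod_mult_div_eq)
  hence "card S \<le> card ((\<lambda>(c, k). c + \<pi> * k) ` (((\<lambda>y. y mod \<pi>) ` S) \<times> polys_below e))"
    using fin by (intro card_mono) auto
  also have "\<dots> \<le> card (((\<lambda>y. y mod \<pi>) ` S) \<times> (polys_below e :: 'a poly set))"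
    using fin by (intro card_image_le) auto
  also have "\<dots> \<le> m * CARD('a) ^ e"
    using S(2) by (simp add: card_cartesian_product card_polys_below)
  finally have "card S * poly_abs \<pi> \<le> m * CARD('a) ^ e * poly_abs \<pi>" by simp
  also have "\<dots> = m * poly_abs Q"
    using le by (simp add: e_def poly_abs_def mult.assoc flip: power_add)
  finally show ?thesis .
qed

text \<open>If \<open>\<pi>\<^sup>2\<close> divides the common period \<open>W = \<pi> W'\<close>, then averaging over the shifts by \<open>W' v\<close>
  only sees the derivative of the phase, which is null at few residues modulo \<open>\<pi>\<close>.\<close>

lemma stationary_phase_average:
  fixes L :: "nat \<Rightarrow> 'a::finite_field poly \<Rightarrow> 'a"
  assumes Q: "Q \<in> moduli" and \<pi>: "irreducible \<pi>" "lead_coeff \<pi> = 1" "\<pi> dvd W" "\<pi> * W dvd Q"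
    and L: "\<And>r. additive_map (L r)" "\<And>r. periodic (\<pi> * W) (L r)"
    and r0: "r0 \<in> phase_exponents CHAR('a) B" "\<not> periodic W (L r0)"
  shows "cmod (average (residue_ring Q) (\<lambda>y. \<psi> (phase B L y))) \<le> B / poly_abs \<pi>"
proof -
  interpret functional_pair "{L. additive_map L \<and> periodic (\<pi> * W) L}"
    "{L. additive_map L \<and> periodic W L}" "{u. \<pi> dvd u}"
    by (rule functional_pair_periodic) fact
  define E where "E = phase_exponents CHAR('a) B"
  have finE: "finite E" by (simp add: E_def)
  define f where "f y = \<psi> (phase B L y)" for y
  \<comment> \<open>\<open>g y\<close> is the formal derivative of the phase at y as a functional of
    the increment, and \<open>S\<close> is the set of stationary points. As \<pi> divides W, (W v)^2
    is a multiple of the common period \<pi> W, so the first-order expansion in W v is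
    exact.\<close>
  define g where "g y = (\<lambda>z. \<Sum>r\<in>E. L r (of_nat r * y ^ (r - 1) * z))" for y
  define S where "S = {y \<in> residue_ring Q. periodic W (g y)}"
  have LQ: "periodic Q (L r)" for r using L(2) \<pi>(4) periodic_dvd by blast
  have \<pi>Q: "\<pi> dvd Q" using \<pi>(4) by (meson dvd_mult_left)
  have deg: "degree \<pi> > 0"
    using \<pi>(1) irreducible_not_unit[OF \<pi>(1)] by (cases "\<pi> = 0") (auto simp: is_unit_iff_degree)
  have g_add: "additive_map (g y)" for y
    unfolding g_def Modules.additive_def by (simp add: distrib_left additive.add[OF L(1)] sum.distrib)
  have g_C: "periodic (\<pi> * W) (g y)" for y
  proof -
    have "g y \<in> {L. additive_map L \<and> periodic (\<pi> * W) L}"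
      unfolding g_def by (intro C_sum C_mult finE) (use L in auto)
    thus ?thesis by simp
  qed
  have g_Q: "periodic Q (\<lambda>v. g y (W * v))" for y
  proof -
    have "periodic Q (g y)" using periodic_dvd[OF g_C \<pi>(4)] .
    thus ?thesis by (auto simp: periodic_def mult.left_commute[of W])
  qed
  have shift: "f (y + W * v) = f y * \<psi> (g y (W * v))" for y v
  proof -
    have "\<psi> (L r ((y + W * v) ^ r))
        = \<psi> (L r (y ^ r)) * \<psi> (L r (of_nat r * y ^ (r - 1) * (W * v)))" for r
    proof -
      obtain k where k: "W = \<pi> * k" using \<pi>(3) by (elim dvdE)
      have "(W * v)\<^sup>2 = \<pi> * W * (k * v * v)"
        by (subst (1) k) (simp add: power2_eq_square k mult_ac)
      hence "\<pi> * W dvd (W * v)\<^sup>2" by (rule dvdI)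
      from dvd_trans[OF this power_add_expansion]
      have "\<psi> (L r ((y + W * v) ^ r)) = \<psi> (L r (y ^ r + of_nat r * y ^ (r - 1) * (W * v)))"
        by (rule psi_additive_mod[OF L])
      thus ?thesis by (simp add: additive.add[OF L(1)] psi_add)
    qed
    thus ?thesis using finE
      by (simp add: f_def phase_def g_def E_def[symmetric] psi_sum prod.distrib)
  qed
  have avg0: "average (residue_ring Q) (\<lambda>v. \<psi> (g y (W * v))) = 0" if np: "\<not> periodic W (g y)" for y
  proof -
    obtain z where "\<psi> (g y (W * z)) \<noteq> 1" using np unfolding periodic_def by blast
    thus ?thesis
      using average_additive_char_eq_0[OF _ g_Q, of y z] additive_comp[OF g_add additive_const_mult]
      by blast
  qed
  note fin = finite_residue_ring[OF Q] residue_ring_nonempty[OF Q]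
  have f_mod: "f (x mod Q) = f x" for x
    unfolding f_def using L(1) LQ dvd_mod_diff by (rule psi_phase_mod)
  have "average (residue_ring Q) f
      = average (residue_ring Q) (\<lambda>v. average (residue_ring Q) (\<lambda>y. f (y + W * v)))"
    using average_residue_shift[of f Q, OF f_mod] average_const[OF fin] by simp
  also have "\<dots> = average (residue_ring Q) (\<lambda>v. average (residue_ring Q) (\<lambda>y. f y * \<psi> (g y (W * v))))"
    by (simp only: shift)
  also have "\<dots> = average (residue_ring Q) (\<lambda>y. f y * average (residue_ring Q) (\<lambda>v. \<psi> (g y (W * v))))"
    unfolding average_def
    by (simp add: sum_distrib_left flip: sum_divide_distrib) (subst sum.swap, simp)
  finally have avg: "average (residue_ring Q) f
      = average (residue_ring Q) (\<lambda>y. f y * average (residue_ring Q) (\<lambda>v. \<psi> (g y (W * v))))" .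
  have "cmod (average (residue_ring Q) f) \<le> card S / poly_abs Q"
  proof -
    have "cmod (f y * average (residue_ring Q) (\<lambda>v. \<psi> (g y (W * v)))) \<le> of_bool (y \<in> S)"
      if "y \<in> residue_ring Q" for y
    proof (cases "periodic W (g y)")
      case True
      thus ?thesis using that norm_average_le[OF fin, of "\<lambda>v. \<psi> (g y (W * v))" 1]
        by (simp add: S_def f_def norm_mult)
    qed (simp add: avg0)
    hence "cmod (\<Sum>y\<in>residue_ring Q. f y * average (residue_ring Q) (\<lambda>v. \<psi> (g y (W * v))))
        \<le> (\<Sum>y\<in>residue_ring Q. of_bool (y \<in> S))"
      by (rule sum_norm_le)
    also have "\<dots> = card S"
    proof -
      have "residue_ring Q \<inter> S = S" by (auto simp: S_def)
      thus ?thesis using fin(1) by (simp add: sum.If_cases of_bool_def)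
    qed
    finally show ?thesis
      unfolding avg by (simp add: average_def norm_divide card_residue_ring[OF Q] divide_right_mono)
  qed
  also have "\<dots> \<le> B / poly_abs \<pi>"
  proof -
    define V where "V = (\<lambda>y. y mod \<pi>) ` S"
    \<comment> \<open>The derivative is a polynomial in y with the distinct exponents r - 1. More
      than B incongruent stationary points would make z |-> L r0 (r0 z) null, and the factor r0 can
      be removed because it is a nonzero constant of F.\<close>
    have "card V \<le> B"
    proof (rule ccontr)
      assume "\<not> card V \<le> B"
      have "v mod \<pi> = v" if "v \<in> V" for v using that by (auto simp: V_def)
      hence incong: "\<forall>u\<in>V. \<forall>v\<in>V. u \<noteq> v \<longrightarrow> u - v \<notin> {u. \<pi> dvd u}"
        by (metis mem_Collect_eq mod_eq_dvd_iff)
      have "g u \<in> {L. additive_map L \<and> periodic W L}" if u: "u \<in> V" for u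
      proof -
        obtain y where y: "y \<in> S" "u = y mod \<pi>" using u by (auto simp: V_def)
        have "periodic W (g u)"
          unfolding periodic_def
        proof
          fix z
          have "\<psi> (L r (of_nat r * u ^ (r - 1) * (W * z)))
              = \<psi> (L r (of_nat r * y ^ (r - 1) * (W * z)))" for r
          proof (rule psi_additive_mod[OF L])
            have "\<pi> dvd u ^ (r - 1) - y ^ (r - 1)"
              using dvd_mod_diff[of \<pi> y] by (simp add: power_diff_sumr2 y(2))
            hence "\<pi> * W dvd (u ^ (r - 1) - y ^ (r - 1)) * (W * (of_nat r * z))"
              by (intro mult_dvd_mono) auto
            thus "\<pi> * W dvd of_nat r * u ^ (r - 1) * (W * z) - of_nat r * y ^ (r - 1) * (W * z)"
              by (simp add: algebra_simps)
          qed
          hence "\<psi> (g u (W * z)) = \<psi> (g y (W * z))" using finE by (simp add: g_def psi_sum)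
          thus "\<psi> (g u (W * z)) = 1" using y(1) by (simp add: S_def periodic_def)
        qed
        thus ?thesis using g_add by simp
      qed
      moreover have "finite V" unfolding V_def S_def using fin(1) by simp
      moreover have "inj_on (\<lambda>r. r - 1) E" by (auto simp: inj_on_def E_def phase_exponents_def)
      moreover have "r - 1 \<le> B" if "r \<in> E" for r using that by (auto simp: E_def phase_exponents_def)
      ultimately have "(\<lambda>z. L r0 (of_nat r0 * z)) \<in> {L. additive_map L \<and> periodic W L}"
        using elimination_inj[of E "\<lambda>r. r - 1" B "\<lambda>r z. L r (of_nat r * z)" V r0]
          \<open>\<not> card V \<le> B\<close> incong finE r0(1) L C_mult
        by (simp add: g_def E_def mult.assoc)
      moreover have "(of_nat r0 :: 'a poly) \<notin> {u. \<pi> dvd u}"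
      proof
        assume "(of_nat r0 :: 'a poly) \<in> {u. \<pi> dvd u}"
        hence "\<pi> dvd [:of_nat r0:]" by (simp add: of_nat_poly)
        moreover have "(of_nat r0 :: 'a) \<noteq> 0"
          using r0(1) by (auto simp: phase_exponents_def of_nat_eq_0_iff_char_dvd)
        ultimately show False using deg dvd_imp_degree_le[of \<pi> "[:of_nat r0:]"] by simp
      qed
      ultimately have "L r0 \<in> {L. additive_map L \<and> periodic W L}"
        using L by (intro torsion_free[of "L r0" "of_nat r0"]) auto
      thus False using r0(2) by simp
    qed
    hence "card S * poly_abs \<pi> \<le> B * poly_abs Q"
      using card_residue_classes_le[OF \<pi>Q deg Q, of S B] by (auto simp: V_def S_def)
    hence "real (card S) * poly_abs \<pi> \<le> real B * poly_abs Q"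
      by (metis of_nat_le_iff of_nat_mult)
    thus ?thesis by (simp add: field_simps poly_abs_def)
  qed
  finally show ?thesis by (simp add: f_def[abs_def])
qed


lemma limsup_le_const: "limsup_le (\<lambda>N. x) e \<Longrightarrow> x \<le> e"
  by (rule ccontr) (auto simp: limsup_le_def eventually_sequentially not_le)

text \<open>The asymptotic theorem is used for the constant sequence of sets
  \<open>residue_ring Q\<close>, where shift invariance is exact. The residues modulo \<pi> are the
  available shifts, so K is limited by |\<pi>|.\<close>

lemma weyl_phase_average:
  fixes L :: "nat \<Rightarrow> 'a::finite_field poly \<Rightarrow> 'a"
  assumes Q: "Q \<in> moduli" and \<pi>: "irreducible \<pi>" "\<not> \<pi> dvd W" "\<pi> * W dvd Q"
    and L: "\<And>r. additive_map (L r)" "\<And>r. periodic (\<pi> * W) (L r)"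
    and r0: "r0 \<in> phase_exponents CHAR('a) B" "\<not> periodic W (L r0)"
    and K: "K > 0" "K * (2 * (CHAR('a) ^ B * B) + 1) \<le> poly_abs \<pi>"
  shows "cmod (average (residue_ring Q) (\<lambda>y. \<psi> (phase B L y))) \<le> B * real K powr (- (1 / 2 ^ B))"
proof -
  interpret weyl_pair "{L. additive_map L \<and> periodic (\<pi> * W) L}"
    "{L. additive_map L \<and> periodic W L}" "{u. \<pi> dvd u}"
    by (rule weyl_pair_periodic) fact+
  define E where "E = {r \<in> phase_exponents CHAR('a) B. \<not> periodic W (L r)}"
  define R where "R = Max E"
  have fin: "finite E" by (simp add: E_def)
  have "R \<in> E" unfolding R_def using r0 fin by (intro Max_in) (auto simp: E_def)
  have Rmax: "periodic W (L r)" if "r \<in> phase_exponents CHAR('a) B" "R < r" for r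
  proof (rule ccontr)
    assume "\<not> periodic W (L r)"
    hence "r \<le> R" unfolding R_def using that(1) fin by (intro Max_ge) (auto simp: E_def)
    thus False using that(2) by simp
  qed
  have inv: "average (residue_ring Q) (\<lambda>y. \<psi> (phase B M (y + h)))
      = average (residue_ring Q) (\<lambda>y. \<psi> (phase B M y))"
    if "\<And>r. additive_map (M r) \<and> periodic (\<pi> * W) (M r)" for M h
  proof (rule average_residue_shift)
    fix x
    have "periodic Q (M r)" for r using that \<pi>(3) periodic_dvd by blast
    thus "\<psi> (phase B M (x mod Q)) = \<psi> (phase B M x)"
      using that dvd_mod_diff by (intro psi_phase_mod) auto
  qed
  have "degree \<pi> > 0"
    using \<pi>(1) irreducible_not_unit[OF \<pi>(1)] by (cases "\<pi> = 0") (auto simp: is_unit_iff_degree)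
  have X: "incongruent (polys_below (degree \<pi>))"
    unfolding incongruent_def
  proof (intro ballI impI)
    fix u v :: "'a poly"
    assume "u \<in> polys_below (degree \<pi>)" "v \<in> polys_below (degree \<pi>)" "u \<noteq> v"
    hence "u - v \<noteq> 0" "degree (u - v) < degree \<pi>"
      using polys_below_degree[OF polys_below_diff] by auto
    thus "u - v \<notin> {u. \<pi> dvd u}" using dvd_imp_degree_le[of \<pi> "u - v"] by auto
  qed
  have "limsup_le (\<lambda>N. cmod (average (residue_ring Q) (\<lambda>y. \<psi> (phase B L y)))) (weyl_bound K (R - 1))"
  proof (rule weyl_sum_limsup[where X = "polys_below (degree \<pi>)"])
    show "K * (2 * (CHAR('a) ^ B * B) + 1) \<le> card (polys_below (degree \<pi>) :: 'a poly set)"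
      using K(2) by (simp add: card_polys_below poly_abs_def)
    show "(\<lambda>N. average (residue_ring Q) (\<lambda>y. \<psi> (phase B M (y + h)))
        - average (residue_ring Q) (\<lambda>y. \<psi> (phase B M y))) \<longlonglongrightarrow> 0"
      if "\<And>r. M r \<in> {L. additive_map L \<and> periodic (\<pi> * W) L}" for M h
      using inv[of M h] that by simp
  qed (use X Q K L Rmax \<open>R \<in> E\<close> finite_residue_ring[OF Q] residue_ring_nonempty[OF Q] in
        \<open>auto simp: E_def\<close>)
  hence "cmod (average (residue_ring Q) (\<lambda>y. \<psi> (phase B L y))) \<le> weyl_bound K (R - 1)"
    by (rule limsup_le_const)
  also have "\<dots> \<le> (R - 1) * real K powr (- (1 / 2 ^ (R - 1)))" by (rule weyl_bound_le) fact
  also have "\<dots> \<le> B * real K powr (- (1 / 2 ^ B))"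
  proof (rule mult_mono)
    have "R \<le> B" using \<open>R \<in> E\<close> by (auto simp: E_def phase_exponents_def)
    thus "real (R - 1) \<le> real B" by simp
    have "1 / 2 ^ B \<le> (1 / 2 ^ (R - 1) :: real)"
      using \<open>R \<le> B\<close> by (intro divide_left_mono power_increasing) auto
    thus "real K powr (- (1 / 2 ^ (R - 1))) \<le> real K powr (- (1 / 2 ^ B))"
      using K(1) by (intro powr_mono) auto
  qed auto
  finally show ?thesis .
qed

text \<open>Let V generate the ideal of common periods, \<pi> be a prime factor of V and V = \<pi>
  W. By minimality of V some functional does not have period W, and since \<pi> divides Q, |\<pi>|
  is at least lpf(Q). Whether \<pi> divides W decides between stationary phase and Weyl
  sums.\<close>

theorem periodic_phase_average_bound:
  "\<exists>c \<gamma>. c > 0 \<and> \<gamma> > 0 \<and>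
     (\<forall>Q\<in>moduli. \<forall>L :: nat \<Rightarrow> 'a::finite_field poly \<Rightarrow> 'a.
        (\<forall>r. additive_map (L r)) \<longrightarrow> (\<forall>r. periodic Q (L r)) \<longrightarrow>
        (\<exists>r\<in>phase_exponents CHAR('a) B. \<not> periodic 1 (L r)) \<longrightarrow>
        cmod (average (residue_ring Q) (\<lambda>y. \<psi> (phase B L y))) \<le> c * real (lpf Q) powr (- \<gamma>))"
proof -
  define \<gamma> :: real where "\<gamma> = 1 / 2 ^ B"
  define m where "m = 2 * (CHAR('a) ^ B * B) + 1"
  \<comment> \<open>The factor 2 m pays for rounding |\<pi>| / m down to K, the factor B is that of
    the Weyl bound, and the 1 covers primes with |\<pi>| < m.\<close>
  define c where "c = 2 * real m * (real B + 1)"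
  have \<gamma>: "0 < \<gamma>" "\<gamma> \<le> 1" by (auto simp: \<gamma>_def)
  have m: "real m \<ge> 1" by (simp add: m_def)
  have c: "c \<ge> 2 * real m" "c \<ge> 2 * real m * real B" "c \<ge> real B"
  proof -
    show "c \<ge> 2 * real m" "c \<ge> 2 * real m * real B" using m by (auto simp: c_def algebra_simps)
    have "1 * real B \<le> 2 * real m * real B" using m by (intro mult_right_mono) auto
    thus "c \<ge> real B" using \<open>c \<ge> 2 * real m * real B\<close> by simp
  qed
  show ?thesis
  proof (rule exI[of _ c], rule exI[of _ \<gamma>], intro conjI ballI allI impI)
    fix Q :: "'a poly" and L :: "nat \<Rightarrow> 'a poly \<Rightarrow> 'a"
    assume Q: "Q \<in> moduli" and L: "\<forall>r. additive_map (L r)" "\<forall>r. periodic Q (L r)"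
      and nontriv: "\<exists>r\<in>phase_exponents CHAR('a) B. \<not> periodic 1 (L r)"
    \<comment> \<open>Functionals outside the exponent set are replaced by zero, lest they enlarge
      the common period.\<close>
    define L' where "L' r = (if r \<in> phase_exponents CHAR('a) B then L r else (\<lambda>_. 0))" for r
    define J where "J = {w. \<forall>r. periodic w (L' r)}"
    have L': "additive_map (L' r)" "periodic Q (L' r)" for r
      using L by (auto simp: L'_def additive_const_0 periodic_zero)
    have phase_eq: "phase B L' y = phase B L y" for y
      unfolding phase_def by (intro sum.cong) (auto simp: L'_def)
    have "Q \<in> J" "Q \<noteq> 0" using L' Q by (auto simp: J_def moduli_def)
    moreover have "x + y \<in> J" if "x \<in> J" "y \<in> J" for x y
      using that by (auto simp: J_def periodic_def distrib_right additive.add[OF L'(1)] psi_add)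
    moreover have "a * x \<in> J" if "x \<in> J" for x a
      using that unfolding J_def by (auto intro: periodic_dvd)
    ultimately obtain V where V: "V \<in> J" "V \<noteq> 0" "\<And>w. w \<in> J \<Longrightarrow> V dvd w"
      using principal_ideal_poly[of Q J] by metis
    have "1 \<notin> J" using nontriv by (auto simp: J_def L'_def)
    hence "\<not> is_unit V" using V unfolding J_def by (auto intro: periodic_dvd)
    then obtain \<pi> where \<pi>: "irreducible \<pi>" "\<pi> dvd V" "lead_coeff \<pi> = 1"
      using ex_monic_irreducible_dvd V(2) by metis
    then obtain W where W: "V = \<pi> * W" by (elim dvdE)
    have \<pi>0: "\<pi> \<noteq> 0" "W \<noteq> 0" using W V(2) by auto
    have "degree \<pi> > 0"
      using \<pi>(1) irreducible_not_unit[OF \<pi>(1)] by (cases "\<pi> = 0") (auto simp: is_unit_iff_degree)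
    have "W \<notin> J"
    proof
      assume "W \<in> J"
      hence "degree V \<le> degree W" using V(3) \<pi>0 by (intro dvd_imp_degree_le)
      thus False using \<open>degree \<pi> > 0\<close> \<pi>0 by (simp add: W degree_mult_eq)
    qed
    then obtain r0 where r0: "r0 \<in> phase_exponents CHAR('a) B" "\<not> periodic W (L' r0)"
      using periodic_zero by (auto simp: J_def L'_def split: if_splits)
    have VQ: "\<pi> * W dvd Q" using V(3)[OF \<open>Q \<in> J\<close>] W by simp
    hence \<pi>Q: "\<pi> dvd Q" by (meson dvd_mult_left)
    have perV: "periodic (\<pi> * W) (L' r)" for r using V(1) W by (simp add: J_def)
    define x where "x = real (lpf Q)"
    define pa where "pa = poly_abs \<pi>"
    have x: "1 \<le> x" "x \<le> real pa"
      using lpf_pos[OF Q] lpf_le[OF Q \<pi>(3,1) \<pi>Q] by (auto simp: x_def pa_def)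
    have "cmod (average (residue_ring Q) (\<lambda>y. \<psi> (phase B L' y))) \<le> c * x powr (- \<gamma>)"
    proof (cases "\<pi> dvd W")
      case True
      have "cmod (average (residue_ring Q) (\<lambda>y. \<psi> (phase B L' y))) \<le> B / pa"
        unfolding pa_def by (rule stationary_phase_average[where L = L', OF Q \<pi>(1,3) True VQ L'(1) perV r0])
      also have "\<dots> \<le> B * x powr (- 1)"
        using x by (simp add: powr_minus_divide frac_le)
      also have "\<dots> \<le> c * x powr (- \<gamma>)"
        using c x \<gamma> by (intro mult_mono powr_mono) auto
      finally show ?thesis .
    next
      case False
      show ?thesis
      proof (cases "pa < m")
        \<comment> \<open>There are too few residues modulo \<pi> for even one shift to be
          guaranteed, but then lpf(Q) \<le> m and the trivial bound 1 is at most m / lpf(Q).\<close>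
        case True
        have "cmod (average (residue_ring Q) (\<lambda>y. \<psi> (phase B L' y))) \<le> 1"
          using finite_residue_ring[OF Q] residue_ring_nonempty[OF Q] by (intro norm_average_le) auto
        also have "1 \<le> real m * real m powr (- 1)" using m by (simp add: powr_minus_divide)
        also have "\<dots> \<le> real m * x powr (- 1)"
          using x True m by (intro mult_left_mono powr_mono2') auto
        also have "\<dots> \<le> c * x powr (- \<gamma>)"
          using c x \<gamma> m by (intro mult_mono powr_mono) auto
        finally show ?thesis .
      next
        case False
        define K where "K = pa div m"
        have m0: "m > 0" by (simp add: m_def)
        have K: "K > 0" "K * m \<le> pa"
          using False m0 by (auto simp: K_def div_greater_zero_iff)
        have "pa < (K + 1) * m" using m0 by (simp add: K_def mult.commute dividend_less_times_div)
        also have "\<dots> \<le> (2 * K) * m" using K(1) by (intro mult_right_mono) auto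
        finally have "real pa \<le> 2 * real m * real K"
          by (metis less_imp_le mult.assoc mult.commute of_nat_le_iff of_nat_mult of_nat_numeral)
        hence "x \<le> 2 * real m * real K" using x by simp
        hence "x / (2 * real m) \<le> real K" using m by (simp add: field_simps)
        hence "real K powr (- \<gamma>) \<le> (x / (2 * real m)) powr (- \<gamma>)"
          using x m \<gamma> by (intro powr_mono2') auto
        also have "\<dots> = x powr (- \<gamma>) * (2 * real m) powr \<gamma>"
          using x m by (simp add: powr_divide powr_minus_divide)
        also have "\<dots> \<le> x powr (- \<gamma>) * (2 * real m) powr 1"
          using m \<gamma> by (intro mult_left_mono powr_mono) auto
        finally have Kb: "real K powr (- \<gamma>) \<le> x powr (- \<gamma>) * (2 * real m)" using m by simp
        have "cmod (average (residue_ring Q) (\<lambda>y. \<psi> (phase B L' y))) \<le> B * real K powr (- \<gamma>)"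
          unfolding \<gamma>_def
          by (rule weyl_phase_average[where L = L', OF Q \<pi>(1) \<open>\<not> \<pi> dvd W\<close> VQ L'(1) perV r0 K(1)])
             (use K(2) in \<open>simp add: m_def pa_def\<close>)
        also have "\<dots> \<le> B * (x powr (- \<gamma>) * (2 * real m))" using Kb by (intro mult_left_mono) auto
        also have "\<dots> = (2 * real m * real B) * x powr (- \<gamma>)" by simp
        also have "\<dots> \<le> c * x powr (- \<gamma>)" using c(2) by (intro mult_right_mono) auto
        finally show ?thesis .
      qed
    qed
    thus "cmod (average (residue_ring Q) (\<lambda>y. \<psi> (phase B L y))) \<le> c * real (lpf Q) powr (- \<gamma>)"
      by (simp add: phase_eq x_def)
  qed (use \<gamma> c m in auto)
qed


section \<open>Additive polynomials\<close>

text \<open>The coefficient of X^q in (1 + X)^(q j) = (1 + X^q)^j, for q = p^a: a case of Lucas'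
  congruence.\<close>

lemma choose_prime_power_mod:
  fixes p :: nat
  assumes p: "CHAR('a::finite_field) = p" and "j \<ge> 1"
  shows "of_nat (p ^ a * j choose p ^ a) = (of_nat j :: 'a)"
proof -
  define q where "q = p ^ a"
  have q: "q > 0" using CHAR_pos[where 'a = 'a] p by (simp add: q_def)
  have frob: "[:1, 1 :: 'a:] ^ q = 1 + monom 1 q"
  proof -
    have "[:1, 1 :: 'a:] = 1 + monom 1 1" by (simp add: monom_altdef one_pCons)
    hence "[:1, 1 :: 'a:] ^ q = 1 ^ q + (monom 1 1) ^ q"
      using frobenius_poly_add[of 1 "monom (1 :: 'a) 1" a] p by (simp add: q_def)
    thus ?thesis by (simp add: monom_power)
  qed
  have "of_nat (q * j choose q) = coeff ([:1, 1 :: 'a:] ^ (q * j)) q"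
    using assms(2) q by (subst coeff_linear_poly_power) auto
  also have "[:1, 1 :: 'a:] ^ (q * j) = (monom 1 q + 1) ^ j"
    by (simp add: power_mult frob add.commute)
  also have "\<dots> = (\<Sum>b\<le>j. of_nat (j choose b) * monom 1 q ^ b * 1 ^ (j - b))"
    by (rule binomial_ring)
  also have "coeff \<dots> q = (\<Sum>b\<le>j. if b = 1 then of_nat (j choose b) else 0)"
    unfolding coeff_sum using q
    by (intro sum.cong) (auto simp: monom_power of_nat_monom mult_monom coeff_monom)
  also have "\<dots> = of_nat j" using assms(2) by simp
  finally show ?thesis by (simp add: q_def)
qed

definition frobenius_supported :: "'a::finite_field poly \<Rightarrow> bool" where
  "frobenius_supported f \<longleftrightarrow> (\<forall>i. coeff f i \<noteq> 0 \<longrightarrow> (\<exists>j. i = CHAR('a) ^ j))"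

text \<open>The mixed coefficients of f(X + Y) vanish, that is, f_i times (i choose k) is zero for 0
  < k < i. If i = q j with q the exact power of p in i, then k = q is mixed unless j = 1, while i
  choose q equals j in F, which is nonzero.\<close>

lemma additive_poly_iff:
  fixes f :: "'a::finite_field poly"
  shows "additive_poly f \<longleftrightarrow> frobenius_supported f"
proof -
  define X Y :: "'a poly poly" where "X = [:[:0, 1:]:]" and "Y = [:0, 1:]"
  define ev where "ev z = poly (map_poly (\<lambda>c. [:[:c:]:]) f) z" for z :: "'a poly poly"
  have ev: "ev z = (\<Sum>i\<le>degree f. [:[:coeff f i:]:] * z ^ i)" for z
    unfolding ev_def poly_altdef by (subst degree_map_poly) (auto simp: coeff_map_poly)
  have ap: "additive_poly f \<longleftrightarrow> ev (X + Y) = ev X + ev Y"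
    by (simp add: additive_poly_def X_def Y_def ev_def Let_def)
  show ?thesis
  proof
    assume f: "frobenius_supported f"
    have "[:[:coeff f i:]:] * (X + Y) ^ i = [:[:coeff f i:]:] * X ^ i + [:[:coeff f i:]:] * Y ^ i" for i
    proof (cases "coeff f i = 0")
      case False
      then obtain j where "i = CHAR('a) ^ j" using f by (auto simp: frobenius_supported_def)
      moreover have "(X + Y) ^ (CHAR('a) ^ j) = X ^ (CHAR('a) ^ j) + Y ^ (CHAR('a) ^ j)"
        by (rule freshmans_dream'[of _ j]) auto
      ultimately show ?thesis by (simp add: algebra_simps)
    qed auto
    thus "additive_poly f" unfolding ap ev by (simp add: sum.distrib)
  next
    assume "additive_poly f"
    hence eq: "ev (X + Y) = ev X + ev Y" by (simp add: ap)
    have XY: "X + Y = [:[:0, 1:], 1:]" by (simp add: X_def Y_def)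
    have cXY: "coeff (coeff ((X + Y) ^ i) k) l = (if i = k + l then of_nat (i choose k) else 0)" for i k l
    proof (cases "k \<le> i")
      case True
      have "coeff ((X + Y) ^ i) k = of_nat (i choose k) * [:0, 1:] ^ (i - k)"
        unfolding XY using True by (subst coeff_linear_poly_power) auto
      also have "\<dots> = monom (of_nat (i choose k)) (i - k)"
        by (simp add: monom_altdef of_nat_poly)
      finally show ?thesis using True by (auto simp: coeff_monom)
    next
      case False
      have "degree ((X + Y) ^ i) \<le> i"
        unfolding XY by (rule order_trans[OF degree_power_le]) simp
      thus ?thesis using False by (simp add: coeff_eq_0)
    qed
    have cX: "coeff (coeff (X ^ i) k) l = (if k = 0 \<and> l = i then 1 else 0)" for i k l
    proof -
      have "X ^ i = [:monom 1 i:]" by (induction i) (auto simp: X_def monom_Suc one_pCons monom_0)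
      thus ?thesis by (cases k) auto
    qed
    have cY: "coeff (coeff (Y ^ i) k) l = (if k = i \<and> l = 0 then 1 else 0)" for i k l
    proof -
      have "Y ^ i = monom 1 i" by (simp add: Y_def monom_altdef)
      thus ?thesis by (auto simp: coeff_1)
    qed
    have cc: "coeff (coeff (ev z) k) l = (\<Sum>i\<le>degree f. coeff f i * coeff (coeff (z ^ i) k) l)" for z k l
      unfolding ev by (simp add: coeff_sum)
    have zero: "coeff f (k + l) * of_nat ((k + l) choose k) = 0" if "k > 0" "l > 0" for k l
    proof -
      have "coeff (coeff (ev (X + Y)) k) l = 0"
        unfolding eq coeff_add cc using that by (simp add: cX cY)
      moreover have "coeff (coeff (ev (X + Y)) k) l = coeff f (k + l) * of_nat ((k + l) choose k)"
        unfolding cc cXY by (auto simp: if_distrib[of "\<lambda>t. _ * t"] coeff_eq_0 not_le cong: if_cong)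
      ultimately show ?thesis by simp
    qed
    have c0: "coeff f 0 = 0"
    proof -
      have "coeff (coeff (ev (X + Y)) 0) 0 = coeff f 0" "coeff (coeff (ev X) 0) 0 = coeff f 0"
        "coeff (coeff (ev Y) 0) 0 = coeff f 0"
        unfolding cc cXY cX cY by (auto simp: if_distrib[of "\<lambda>t. _ * t"] cong: if_cong)
      hence "coeff f 0 + coeff f 0 = coeff f 0 + 0" by (simp only: eq coeff_add add_0_right)
      thus ?thesis by (simp only: add_left_cancel)
    qed
    show "frobenius_supported f"
      unfolding frobenius_supported_def
    proof (intro allI impI)
      fix i assume i: "coeff f i \<noteq> 0"
      define p where "p = CHAR('a)"
      have "i \<noteq> 0" "\<not> is_unit p" using i c0 by (auto simp: p_def intro: ccontr)
      then obtain j where j: "i = p ^ multiplicity p i * j" "\<not> p dvd j"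
        using multiplicity_decompose'[of i p] by metis
      define q where "q = p ^ multiplicity p i"
      have q: "q > 0" by (simp add: q_def p_def)
      have "j \<ge> 1" using j(2) by (cases j) auto
      have "j = 1"
      proof (rule ccontr)
        assume "j \<noteq> 1"
        hence "j \<ge> 2" using \<open>j \<ge> 1\<close> by simp
        hence "q * 2 \<le> i" using j(1) by (simp add: q_def[symmetric])
        hence "coeff f i * of_nat (i choose q) = 0" using zero[of q "i - q"] q by simp
        moreover have "of_nat (i choose q) = (of_nat j :: 'a)"
          using choose_prime_power_mod[where 'a = 'a and p = p and j = j and a = "multiplicity p i"]
            \<open>j \<ge> 1\<close> j(1) by (simp add: q_def p_def)
        ultimately show False using i j(2) by (simp add: of_nat_eq_0_iff_char_dvd p_def)
      qed
      thus "\<exists>j. i = CHAR('a) ^ j" using j(1) by (auto simp: p_def)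
    qed
  qed
qed


section \<open>The prime field and composition of additive polynomials\<close>

lemma prime_field_closed:
  fixes x y :: "'a::finite_field"
  shows prime_field_0 [simp]: "(0 :: 'a) \<in> prime_field" and prime_field_1 [simp]: "(1 :: 'a) \<in> prime_field"
    and prime_field_add: "x \<in> prime_field \<Longrightarrow> y \<in> prime_field \<Longrightarrow> x + y \<in> prime_field"
    and prime_field_mult: "x \<in> prime_field \<Longrightarrow> y \<in> prime_field \<Longrightarrow> x * y \<in> prime_field"
    and prime_field_uminus: "x \<in> prime_field \<Longrightarrow> - x \<in> prime_field"
    and prime_field_inverse: "x \<in> prime_field \<Longrightarrow> inverse x \<in> prime_field"
proof -
  show 0: "0 \<in> (prime_field :: 'a set)" by (auto simp: prime_field_def intro: image_eqI[of _ _ 0])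
  show "1 \<in> (prime_field :: 'a set)" by (auto simp: prime_field_def intro: image_eqI[of _ _ 1])
  show "x + y \<in> prime_field" if "x \<in> prime_field" "y \<in> prime_field"
    using that unfolding prime_field_def by (metis (mono_tags, lifting) imageE of_nat_add rangeI)
  have mult: "x * y \<in> prime_field" if "x \<in> prime_field" "y \<in> prime_field" for x y :: 'a
    using that unfolding prime_field_def by (metis (mono_tags, lifting) imageE of_nat_mult rangeI)
  thus "x * y \<in> prime_field" if "x \<in> prime_field" "y \<in> prime_field" using that .
  have "of_nat (CHAR('a) - 1) = (- 1 :: 'a)"
    using CHAR_pos[where 'a = 'a] by (simp add: of_nat_diff Suc_leI)
  hence "- 1 \<in> (prime_field :: 'a set)" unfolding prime_field_def by (metis rangeI)
  thus "- x \<in> prime_field" if "x \<in> prime_field" using mult[of "- 1" x] that by simp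
  show "inverse x \<in> prime_field" if "x \<in> prime_field"
  proof (cases "x = 0")
    case False
    from that obtain k where "x = of_nat k" by (auto simp: prime_field_def)
    then obtain l where "of_nat l * x = 1" using of_nat_inverse_in_prime_field False by metis
    hence "inverse x = of_nat l" by (metis inverse_unique mult.commute)
    thus ?thesis by (auto simp: prime_field_def)
  qed (simp add: 0)
qed

lemma prime_field_power: "x \<in> prime_field \<Longrightarrow> x ^ n \<in> prime_field"
  by (induction n) (auto intro: prime_field_mult)

lemma prime_field_frobenius:
  fixes x :: "'a::finite_field"
  assumes "x \<in> prime_field"
  shows "x ^ (CHAR('a) ^ a) = x"
proof -
  obtain k where "x = of_nat k" using assms by (auto simp: prime_field_def)
  moreover have "(of_nat k :: 'a) ^ (CHAR('a) ^ a) = of_nat k"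
  proof (induction k)
    case (Suc k)
    thus ?case using frobenius_field_add[of "1 :: 'a" "of_nat k" a] by simp
  qed simp
  ultimately show ?thesis by simp
qed

lemma smult_sum_right: "smult c (\<Sum>i\<in>A. f i) = (\<Sum>i\<in>A. smult c (f i))"
  for c :: "'a::comm_semiring_0"
  by (induction A rule: infinite_finite_induct) (simp_all add: smult_add_right)

lemma pcompose_as_sum: "f \<circ>\<^sub>p z = (\<Sum>i\<le>degree f. smult (coeff f i) (z ^ i))"
  for f z :: "'a::comm_semiring_1 poly"
proof -
  have "degree (map_poly (\<lambda>x. [:x:]) f) = degree f" by (rule degree_map_poly) simp
  thus ?thesis by (simp add: pcompose_altdef poly_altdef coeff_map_poly)
qed

lemma frobenius_supported_additive:
  fixes f :: "'a::finite_field poly"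
  assumes "frobenius_supported f"
  shows "additive_map (\<lambda>z. f \<circ>\<^sub>p z)"
  unfolding Modules.additive_def
proof (intro allI)
  fix x y :: "'a poly"
  have "smult (coeff f i) ((x + y) ^ i) = smult (coeff f i) (x ^ i) + smult (coeff f i) (y ^ i)" for i
  proof (cases "coeff f i = 0")
    case False
    then obtain j where "i = CHAR('a) ^ j" using assms by (auto simp: frobenius_supported_def)
    thus ?thesis by (simp add: frobenius_poly_add smult_add_right)
  qed simp
  thus "f \<circ>\<^sub>p (x + y) = f \<circ>\<^sub>p x + f \<circ>\<^sub>p y" by (simp add: pcompose_as_sum sum.distrib)
qed

definition additive_polys :: "'a::finite_field poly set" where
  "additive_polys = {f \<in> prime_field_polys. frobenius_supported f}"

lemma additive_polys_0: "0 \<in> additive_polys"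
  by (simp add: additive_polys_def prime_field_polys_def frobenius_supported_def)

lemma additive_polys_X: "[:0, 1:] \<in> additive_polys"
  by (auto simp: additive_polys_def prime_field_polys_def frobenius_supported_def coeff_pCons
        split: nat.splits intro!: exI[of _ 0])

lemma additive_polys_add: "f \<in> additive_polys \<Longrightarrow> g \<in> additive_polys \<Longrightarrow> f + g \<in> additive_polys"
  by (auto simp: additive_polys_def prime_field_polys_def frobenius_supported_def intro: prime_field_add)
     (metis add_0)

lemma additive_polys_smult: "c \<in> prime_field \<Longrightarrow> f \<in> additive_polys \<Longrightarrow> smult c f \<in> additive_polys"
  by (auto simp: additive_polys_def prime_field_polys_def frobenius_supported_def intro: prime_field_mult)

lemma additive_polys_sum: "(\<And>i. i \<in> A \<Longrightarrow> f i \<in> additive_polys) \<Longrightarrow> (\<Sum>i\<in>A. f i) \<in> additive_polys"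
  by (induction A rule: infinite_finite_induct) (auto intro: additive_polys_add additive_polys_0)

lemma coeff_frobenius_power:
  fixes f :: "'a::finite_field poly"
  defines "p \<equiv> CHAR('a)"
  shows "coeff (f ^ (p ^ a)) k = (if p ^ a dvd k then coeff f (k div p ^ a) ^ (p ^ a) else 0)"
proof -
  define q where "q = p ^ a"
  have q: "q > 0" by (simp add: q_def p_def)
  have "f ^ q = (\<Sum>i\<le>degree f. monom (coeff f i) i) ^ q" by (simp add: poly_as_sum_of_monoms)
  also have "\<dots> = (\<Sum>i\<le>degree f. monom (coeff f i) i ^ q)"
    unfolding q_def p_def by (rule freshmans_dream_sum'[of _ a]) auto
  finally have "coeff (f ^ q) k = (\<Sum>i\<le>degree f. if i * q = k then coeff f i ^ q else 0)"
    by (simp add: coeff_sum monom_power coeff_monom)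
  also have "\<dots> = (if q dvd k then coeff f (k div q) ^ q else 0)"
  proof (cases "q dvd k")
    case True
    then obtain i0 where i0: "k = i0 * q" by (metis dvd_def mult.commute)
    have "(\<Sum>i\<le>degree f. if i * q = k then coeff f i ^ q else 0)
        = (\<Sum>i\<le>degree f. if i = i0 then coeff f i ^ q else 0)"
      using q by (intro sum.cong) (auto simp: i0)
    also have "\<dots> = coeff f i0 ^ q" using q by (auto simp: coeff_eq_0)
    finally show ?thesis using q True by (simp add: i0)
  qed (auto intro!: sum.neutral)
  finally show ?thesis by (simp add: q_def)
qed

lemma additive_polys_frobenius_power:
  fixes f :: "'a::finite_field poly"
  assumes "f \<in> additive_polys"
  shows "f ^ (CHAR('a) ^ a) \<in> additive_polys"
proof -
  have "\<exists>j. k = CHAR('a) ^ j" if k: "coeff (f ^ (CHAR('a) ^ a)) k \<noteq> 0" for k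
  proof -
    from k have "CHAR('a) ^ a dvd k" "coeff f (k div CHAR('a) ^ a) \<noteq> 0"
      by (auto simp: coeff_frobenius_power power_0_left split: if_splits)
    then obtain j where "k div CHAR('a) ^ a = CHAR('a) ^ j" "CHAR('a) ^ a dvd k"
      using assms by (auto simp: additive_polys_def frobenius_supported_def)
    hence "k = CHAR('a) ^ (a + j)" by (metis dvd_mult_div_cancel power_add)
    thus ?thesis by blast
  qed
  moreover have "coeff (f ^ (CHAR('a) ^ a)) k \<in> prime_field" for k
    using assms by (auto simp: coeff_frobenius_power additive_polys_def prime_field_polys_def
        intro: prime_field_power)
  ultimately show ?thesis
    by (auto simp: additive_polys_def prime_field_polys_def frobenius_supported_def)
qed

lemma additive_polys_pcompose:
  fixes f g :: "'a::finite_field poly"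
  assumes f: "f \<in> additive_polys" and g: "g \<in> additive_polys"
  shows "f \<circ>\<^sub>p g \<in> additive_polys"
  unfolding pcompose_as_sum
proof (rule additive_polys_sum)
  fix i
  show "smult (coeff f i) (g ^ i) \<in> additive_polys"
  proof (cases "coeff f i = 0")
    case False
    then obtain j where "i = CHAR('a) ^ j" using f by (auto simp: additive_polys_def frobenius_supported_def)
    moreover have "coeff f i \<in> prime_field" using f by (simp add: additive_polys_def prime_field_polys_def)
    ultimately show ?thesis using g
      by (auto intro!: additive_polys_smult additive_polys_frobenius_power)
  qed (simp add: additive_polys_0)
qed

text \<open>Frobenius fixes the coefficients, as they lie in the prime field. This commutation makes
  the set of sums \<Sum> \<eta>_i o \<zeta>_i stable under p-th powers and turns d^q into d o X^q in
  the division below.\<close>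

lemma pcompose_frobenius_power:
  fixes f :: "'a::finite_field poly"
  assumes "f \<in> prime_field_polys"
  shows "f \<circ>\<^sub>p (z ^ (CHAR('a) ^ a)) = (f \<circ>\<^sub>p z) ^ (CHAR('a) ^ a)"
proof -
  define q where "q = CHAR('a) ^ a"
  have "(f \<circ>\<^sub>p z) ^ q = (\<Sum>i\<le>degree f. smult (coeff f i) (z ^ i) ^ q)"
    unfolding pcompose_as_sum q_def by (rule freshmans_dream_sum'[of _ a]) auto
  also have "\<dots> = (\<Sum>i\<le>degree f. smult (coeff f i) ((z ^ q) ^ i))"
  proof (intro sum.cong refl)
    fix i
    have "coeff f i ^ q = coeff f i"
      using assms prime_field_frobenius by (auto simp: prime_field_polys_def q_def)
    thus "smult (coeff f i) (z ^ i) ^ q = smult (coeff f i) ((z ^ q) ^ i)"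
      by (simp add: smult_power power_mult[symmetric] mult.commute)
  qed
  finally show ?thesis by (simp add: pcompose_as_sum q_def)
qed

lemma pcompose_smult_prime_field:
  fixes f :: "'a::finite_field poly"
  assumes f: "frobenius_supported f" and c: "c \<in> prime_field"
  shows "f \<circ>\<^sub>p (smult c z) = smult c (f \<circ>\<^sub>p z)"
  unfolding pcompose_as_sum smult_sum_right
proof (intro sum.cong refl)
  fix i
  show "smult (coeff f i) (smult c z ^ i) = smult c (smult (coeff f i) (z ^ i))"
  proof (cases "coeff f i = 0")
    case False
    then obtain j where "i = CHAR('a) ^ j" using f by (auto simp: frobenius_supported_def)
    hence "c ^ i = c" using prime_field_frobenius[OF c] by simp
    thus ?thesis by (simp add: smult_power mult.commute)
  qed simp
qed

lemma additive_polys_supported: "f \<in> additive_polys \<Longrightarrow> frobenius_supported f"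
  by (simp add: additive_polys_def)

lemma additive_polys_degree:
  fixes f :: "'a::finite_field poly"
  assumes "f \<in> additive_polys" "f \<noteq> 0"
  obtains b where "degree f = CHAR('a) ^ b"
proof -
  have "coeff f (degree f) \<noteq> 0" using assms(2) by simp
  hence "\<exists>b. degree f = CHAR('a) ^ b"
    using assms(1) unfolding additive_polys_def frobenius_supported_def by blast
  thus ?thesis using that by blast
qed

text \<open>The additive polynomials over the prime field form a left Euclidean ring under composition;
  \<open>d\<close> is a generator of the right ideal generated by the \<open>\<eta> i\<close>, except that \<open>X\<^sup>p\<close> is taken
  if that ideal is zero.\<close>

lemma common_left_factor:
  fixes \<eta> :: "nat \<Rightarrow> 'a::finite_field poly"
  assumes \<eta>: "\<And>i. i \<in> {1..n} \<Longrightarrow> \<eta> i \<in> additive_polys"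
    and no: "\<not> (\<exists>\<zeta> a. (\<forall>i\<in>{1..n}. \<zeta> i \<in> additive_polys) \<and> a \<in> prime_field \<and> a \<noteq> 0 \<and>
                 (\<Sum>i=1..n. \<eta> i \<circ>\<^sub>p \<zeta> i) = monom a 1)"
  obtains d \<xi> where "frobenius_supported d" "degree d > 1" "\<And>i. i \<in> {1..n} \<Longrightarrow> \<eta> i = d \<circ>\<^sub>p \<xi> i"
proof -
  define p where "p = CHAR('a)"
  have p: "p > 1" using prime_gt_1_nat[of p] by (simp add: p_def)
  define I where "I = {\<Sum>i=1..n. \<eta> i \<circ>\<^sub>p \<zeta> i | \<zeta>. \<forall>i\<in>{1..n}. \<zeta> i \<in> additive_polys}"
  have I_mem: "(\<Sum>i=1..n. \<eta> i \<circ>\<^sub>p \<zeta> i) \<in> I" if "\<forall>i\<in>{1..n}. \<zeta> i \<in> additive_polys" for \<zeta>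
    using that unfolding I_def by blast
  have I_sub: "I \<subseteq> additive_polys"
    using \<eta> by (auto simp: I_def intro!: additive_polys_sum additive_polys_pcompose)
  have add: "additive_map (\<lambda>z. \<eta> i \<circ>\<^sub>p z)" if "i \<in> {1..n}" for i
    using frobenius_supported_additive additive_polys_supported \<eta> that by blast
  have I_add: "u + v \<in> I" if "u \<in> I" "v \<in> I" for u v
  proof -
    from that obtain \<zeta> \<zeta>' where z: "u = (\<Sum>i=1..n. \<eta> i \<circ>\<^sub>p \<zeta> i)" "v = (\<Sum>i=1..n. \<eta> i \<circ>\<^sub>p \<zeta>' i)"
      "\<forall>i\<in>{1..n}. \<zeta> i \<in> additive_polys" "\<forall>i\<in>{1..n}. \<zeta>' i \<in> additive_polys"
      unfolding I_def by blast
    have "u + v = (\<Sum>i=1..n. \<eta> i \<circ>\<^sub>p (\<zeta> i + \<zeta>' i))"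
      unfolding z sum.distrib[symmetric] by (intro sum.cong) (auto simp: additive.add[OF add])
    moreover have "\<forall>i\<in>{1..n}. \<zeta> i + \<zeta>' i \<in> additive_polys" using z by (auto intro: additive_polys_add)
    ultimately show ?thesis using I_mem[of "\<lambda>i. \<zeta> i + \<zeta>' i"] by simp
  qed
  have I_mult: "smult c (u ^ (p ^ a)) \<in> I" if u: "u \<in> I" and c: "c \<in> prime_field" for u c a
  proof -
    from u obtain \<zeta> where z: "u = (\<Sum>i=1..n. \<eta> i \<circ>\<^sub>p \<zeta> i)" "\<forall>i\<in>{1..n}. \<zeta> i \<in> additive_polys"
      unfolding I_def by blast
    have "u ^ (p ^ a) = (\<Sum>i=1..n. (\<eta> i \<circ>\<^sub>p \<zeta> i) ^ (p ^ a))"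
      unfolding z p_def by (rule freshmans_dream_sum'[of _ a]) auto
    hence "smult c (u ^ (p ^ a)) = (\<Sum>i=1..n. smult c ((\<eta> i \<circ>\<^sub>p \<zeta> i) ^ (p ^ a)))"
      by (simp add: smult_sum_right)
    also have "\<dots> = (\<Sum>i=1..n. \<eta> i \<circ>\<^sub>p (smult c (\<zeta> i ^ (p ^ a))))"
    proof (intro sum.cong refl)
      fix i assume i: "i \<in> {1..n}"
      hence "\<eta> i \<in> prime_field_polys" "frobenius_supported (\<eta> i)"
        using \<eta> by (auto simp: additive_polys_def)
      thus "smult c ((\<eta> i \<circ>\<^sub>p \<zeta> i) ^ (p ^ a)) = \<eta> i \<circ>\<^sub>p (smult c (\<zeta> i ^ (p ^ a)))"
        using c by (simp add: pcompose_smult_prime_field pcompose_frobenius_power p_def)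
    qed
    moreover have "\<forall>i\<in>{1..n}. smult c (\<zeta> i ^ (p ^ a)) \<in> additive_polys"
      using z c by (auto simp: p_def intro!: additive_polys_smult additive_polys_frobenius_power)
    ultimately show ?thesis using I_mem[of "\<lambda>i. smult c (\<zeta> i ^ (p ^ a))"] by simp
  qed
  have \<eta>I: "\<eta> i \<in> I" if i: "i \<in> {1..n}" for i
  proof -
    have "\<eta> j \<circ>\<^sub>p (if j = i then [:0, 1:] else 0) = (if j = i then \<eta> i else 0)" if "j \<in> {1..n}" for j
      using additive.zero[OF add[OF that]] by simp
    hence "(\<Sum>j=1..n. \<eta> j \<circ>\<^sub>p (if j = i then [:0, 1:] else 0)) = (\<Sum>j=1..n. if j = i then \<eta> i else 0)"
      by (intro sum.cong) auto
    also have "\<dots> = \<eta> i" using i by simp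
    finally have "\<eta> i = (\<Sum>j=1..n. \<eta> j \<circ>\<^sub>p (if j = i then [:0, 1:] else 0))" ..
    moreover have "\<forall>j\<in>{1..n}. (if j = i then [:0, 1:] else 0) \<in> (additive_polys :: 'a poly set)"
      using additive_polys_0 additive_polys_X by auto
    ultimately show ?thesis using I_mem[of "\<lambda>j. if j = i then [:0, 1:] else 0"] by metis
  qed
  show ?thesis
  proof (cases "I \<subseteq> {0}")
    case True
    have "\<eta> i = monom 1 p \<circ>\<^sub>p 0" if "i \<in> {1..n}" for i
    proof -
      have "\<eta> i = 0" using True \<eta>I[OF that] by blast
      thus ?thesis using p by (simp add: pcompose_0')
    qed
    moreover have "frobenius_supported (monom (1 :: 'a) p)"
      by (auto simp: frobenius_supported_def p_def intro!: exI[of _ 1])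
    ultimately show ?thesis using that[of "monom 1 p" "\<lambda>_. 0"] p by (simp add: degree_monom_eq)
  next
    case False
    then obtain d where d: "d \<in> I" "d \<noteq> 0" and dmin: "\<And>w. w \<in> I \<Longrightarrow> w \<noteq> 0 \<Longrightarrow> degree d \<le> degree w"
      using ex_has_least_nat[of "\<lambda>w. w \<in> I \<and> w \<noteq> 0" _ degree] by blast
    have dA: "d \<in> additive_polys" using d(1) I_sub by blast
    have d_add: "additive_map (\<lambda>z. d \<circ>\<^sub>p z)"
      using frobenius_supported_additive additive_polys_supported dA by blast
    obtain b where b: "degree d = p ^ b" using additive_polys_degree[OF dA d(2)] by (auto simp: p_def)
    \<comment> \<open>A generator of degree 1 is a y with a in the prime field, so that its
      representation in the ideal would be the excluded identity.\<close>
    have "b \<noteq> 0"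
    proof
      assume "b = 0"
      have supp: "i = 1" if ci: "coeff d i \<noteq> 0" for i
      proof -
        have "i \<le> 1" using le_degree[OF ci] b \<open>b = 0\<close> by simp
        moreover obtain j where "i = p ^ j"
          using ci dA by (auto simp: additive_polys_def frobenius_supported_def p_def)
        moreover have "p ^ j \<ge> 1" using p by simp
        ultimately show ?thesis by linarith
      qed
      have "d = monom (coeff d 1) 1"
        by (rule poly_eqI) (use supp in \<open>auto simp: coeff_monom\<close>)
      moreover have "coeff d 1 \<noteq> 0" using b \<open>b = 0\<close> d(2) by (metis leading_coeff_0_iff power_0)
      moreover have "coeff d 1 \<in> prime_field" using dA by (auto simp: additive_polys_def prime_field_polys_def)
      moreover obtain \<zeta> where "d = (\<Sum>i=1..n. \<eta> i \<circ>\<^sub>p \<zeta> i)" "\<forall>i\<in>{1..n}. \<zeta> i \<in> additive_polys"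
        using d(1) unfolding I_def by blast
      ultimately show False using no by metis
    qed
    have div: "\<exists>\<xi>. w = d \<circ>\<^sub>p \<xi>" if "w \<in> I" for w
      using that
    proof (induction "degree w" arbitrary: w rule: less_induct)
      case less
      show ?case
      proof (cases "w = 0")
        case True
        thus ?thesis using additive.zero[OF d_add] by metis
      next
        case False
        have wA: "w \<in> additive_polys" using less.prems I_sub by blast
        obtain a where a: "degree w = p ^ a" using additive_polys_degree[OF wA False] by (auto simp: p_def)
        have "p ^ b \<le> p ^ a" using dmin[OF less.prems False] a b by simp
        hence "b \<le> a" using p by simp
        \<comment> \<open>Degrees of nonzero elements are powers of p, so q is one too. The leading
          term of w is cancelled by a multiple of d^q = d o X^q, which stays in the ideal and has d
          as left factor.\<close>
        define q where "q = p ^ (a - b)"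
        have q: "degree d * q = degree w" using \<open>b \<le> a\<close> by (simp add: a b q_def flip: power_add)
        define c where "c = lead_coeff w * inverse (lead_coeff d ^ q)"
        have c: "c \<in> prime_field" "- c \<in> prime_field" using wA dA unfolding c_def
          by (auto intro!: prime_field_mult prime_field_inverse prime_field_power prime_field_uminus
              simp: additive_polys_def prime_field_polys_def)
        define w' where "w' = w + smult (- c) (d ^ q)"
        have "w' \<in> I" unfolding w'_def q_def by (intro I_add I_mult less.prems d c)
        have lc: "c \<noteq> 0" "c * lead_coeff d ^ q = lead_coeff w" using False d(2) by (auto simp: c_def)
        define e where "e = smult (- c) (d ^ q)"
        have de: "degree e = degree w" using lc(1) q d(2) by (simp add: e_def degree_power_eq mult.commute)
        have "lead_coeff e = - lead_coeff w"
          by (simp only: e_def lead_coeff_smult lead_coeff_power mult_minus_left lc(2))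
        hence "coeff e (degree w) = - lead_coeff w" by (simp only: de)
        hence "coeff w' (degree w) = 0" by (simp only: w'_def e_def[symmetric] coeff_add right_minus)
        moreover have "degree w' \<le> degree w"
          unfolding w'_def e_def[symmetric] by (rule degree_add_le) (simp_all add: de)
        ultimately have "w' = 0 \<or> degree w' < degree w"
          by (metis eq_zero_or_degree_less)
        then obtain \<xi>' where \<xi>': "w' = d \<circ>\<^sub>p \<xi>'"
          using less.hyps[of w'] \<open>w' \<in> I\<close> additive.zero[OF d_add] by metis
        have "d \<circ>\<^sub>p (smult c ([:0, 1:] ^ q)) = smult c (d ^ q)"
          using dA c by (simp add: pcompose_smult_prime_field pcompose_frobenius_power q_def p_def
              additive_polys_def)
        hence "w = d \<circ>\<^sub>p (\<xi>' + smult c ([:0, 1:] ^ q))"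
          by (simp add: additive.add[OF d_add] \<xi>'[symmetric] w'_def)
        thus ?thesis by blast
      qed
    qed
    have "\<forall>i\<in>{1..n}. \<exists>\<xi>. \<eta> i = d \<circ>\<^sub>p \<xi>" using div \<eta>I by blast
    then obtain \<xi> where "\<forall>i\<in>{1..n}. \<eta> i = d \<circ>\<^sub>p \<xi> i" by metis
    moreover have "degree d > 1" using b \<open>b \<noteq> 0\<close> p one_less_power[of p b] by simp
    ultimately show ?thesis using that[of d \<xi>] additive_polys_supported[OF dA] by blast
  qed
qed


section \<open>Fourier analysis on residue rings\<close>

text \<open>For monic Q this is the coefficient of t^(-1) in the Laurent expansion of m z / Q, the
  residue pairing of F[t]/(Q) with itself. Composed with \<psi> it yields the characters of the
  ring, indexed by m.\<close>

definition residue_functional :: "'a::finite_field poly \<Rightarrow> 'a poly \<Rightarrow> 'a poly \<Rightarrow> 'a" where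
  "residue_functional Q m z = coeff ((m * z) mod Q) (degree Q - 1)"

lemma residue_functional_commute: "residue_functional Q m z = residue_functional Q z m"
  by (simp add: residue_functional_def mult.commute)

lemma residue_functional_0 [simp]: "residue_functional Q 0 z = 0"
  by (simp add: residue_functional_def)

lemma residue_functional_additive: "additive_map (residue_functional Q m)"
  by (simp add: Modules.additive_def residue_functional_def distrib_left poly_mod_add_left)

lemma residue_functional_periodic: "periodic Q (residue_functional Q m)"
proof -
  have "m * (Q * z) mod Q = 0" for z by (simp add: mult.left_commute)
  thus ?thesis by (simp add: periodic_def residue_functional_def)
qed

text \<open>A monomial m lifts the leading term of z mod Q exactly to degree deg Q - 1, so that no
  reduction takes place and the pairing reads off that leading coefficient.\<close>

lemma residue_functional_nondegenerate:
  assumes Q: "Q \<in> moduli" and z: "\<not> Q dvd z"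
  obtains m where "\<psi> (residue_functional Q m z) \<noteq> 1"
proof -
  define w where "w = z mod Q"
  have Q0: "Q \<noteq> 0" "degree Q > 0" using Q by (auto simp: moduli_def)
  have w: "w \<noteq> 0" "degree w < degree Q"
    using z degree_mod_less[OF Q0(1), of z] by (auto simp: w_def dvd_eq_mod_eq_0)
  obtain c where c: "\<psi> (c * lead_coeff w) \<noteq> 1"
    using psi_nontrivial_multiple[of "lead_coeff w"] w(1) by auto
  have c0: "c \<noteq> 0" using c by auto
  define m where "m = monom c (degree Q - 1 - degree w)"
  have "degree (m * w) = degree Q - 1"
    using w c0 by (simp add: m_def degree_mult_eq degree_monom_eq)
  hence "(m * z) mod Q = m * w"
    using Q0 unfolding w_def by (metis diff_less mod_mult_right_eq mod_poly_less zero_less_one)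
  hence "residue_functional Q m z = coeff (m * w) (degree (m * w))"
    by (simp add: residue_functional_def \<open>degree (m * w) = degree Q - 1\<close>)
  also have "\<dots> = c * lead_coeff w"
    by (simp only: lead_coeff_mult) (simp add: m_def degree_monom_eq c0)
  finally show ?thesis using that c by metis
qed

lemma average_residue_functional:
  assumes Q: "Q \<in> moduli"
  shows "average (residue_ring Q) (\<lambda>m. \<psi> (residue_functional Q m z)) = of_bool (Q dvd z)"
proof (cases "Q dvd z")
  case True
  hence "\<psi> (residue_functional Q m z) = 1" for m
    using residue_functional_periodic periodicD by blast
  thus ?thesis using True average_const[OF finite_residue_ring[OF Q] residue_ring_nonempty[OF Q]] by simp
next
  case False
  obtain m where "\<psi> (residue_functional Q z m) \<noteq> 1"
    using residue_functional_nondegenerate[OF Q False] residue_functional_commute by metis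
  from average_additive_char_eq_0[OF residue_functional_additive residue_functional_periodic this]
  show ?thesis using False by (simp add: residue_functional_commute[of Q _ z])
qed

lemma residue_ring_dvd_diff_iff:
  assumes "x \<in> residue_ring Q" "y \<in> residue_ring Q"
  shows "Q dvd x - y \<longleftrightarrow> x = y"
  using assms by (metis mem_residue_ring mod_eq_dvd_iff)

lemma average_residue_functional_diff:
  assumes Q: "Q \<in> moduli" and "x \<in> residue_ring Q" "y \<in> residue_ring Q"
  shows "average (residue_ring Q)
    (\<lambda>m. \<psi> (residue_functional Q m x) * cnj (\<psi> (residue_functional Q m y))) = of_bool (x = y)"
  using average_residue_functional[OF Q, of "x - y"] assms(2,3)
  by (simp add: additive.diff[OF residue_functional_additive] psi_diff residue_ring_dvd_diff_iff)

lemma parseval_residue: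
  fixes c :: "'a::finite_field poly \<Rightarrow> complex"
  assumes Q: "Q \<in> moduli"
  shows "average (residue_ring Q)
      (\<lambda>x. (cmod (\<Sum>m\<in>residue_ring Q. c m * \<psi> (residue_functional Q m x)))\<^sup>2)
    = (\<Sum>m\<in>residue_ring Q. (cmod (c m))\<^sup>2)"
proof -
  let ?G = "residue_ring Q"
  have "complex_of_real (average ?G (\<lambda>x. (cmod (\<Sum>m\<in>?G. c m * \<psi> (residue_functional Q m x)))\<^sup>2))
      = average ?G (\<lambda>x. (\<Sum>m\<in>?G. c m * \<psi> (residue_functional Q m x)) *
          cnj (\<Sum>m\<in>?G. c m * \<psi> (residue_functional Q m x)))"
    by (simp only: average_def of_real_divide of_real_sum of_real_of_nat_eq complex_norm_square)
  also have "\<dots> = average ?G (\<lambda>x. \<Sum>m\<in>?G. \<Sum>k\<in>?G. (c m * cnj (c k)) *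
        (\<psi> (residue_functional Q x m) * cnj (\<psi> (residue_functional Q x k))))"
    by (simp add: sum_product residue_functional_commute[of Q _ x for x] mult_ac cong: average_cong)
  also have "\<dots> = (\<Sum>m\<in>?G. \<Sum>k\<in>?G. (c m * cnj (c k)) * of_bool (m = k))"
    unfolding average_sum average_cmult
    by (intro sum.cong refl) (simp add: average_residue_functional_diff[OF Q])
  also have "\<dots> = (\<Sum>m\<in>?G. c m * cnj (c m))"
    using finite_residue_ring[OF Q] by (simp add: of_bool_def if_distrib[of "\<lambda>t. _ * t"] cong: if_cong)
  also have "\<dots> = complex_of_real (\<Sum>m\<in>?G. (cmod (c m))\<^sup>2)"
    by (simp only: of_real_sum complex_norm_square)
  finally show ?thesis by (simp only: of_real_eq_iff)
qed

definition residue_fourier :: "'a::finite_field poly \<Rightarrow> ('a poly \<Rightarrow> complex) \<Rightarrow> 'a poly \<Rightarrow> complex" where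
  "residue_fourier Q f m = average (residue_ring Q) (\<lambda>x. f x * cnj (\<psi> (residue_functional Q m x)))"

lemma residue_fourier_inversion:
  assumes Q: "Q \<in> moduli" and x: "x \<in> residue_ring Q"
  shows "f x = (\<Sum>m\<in>residue_ring Q. residue_fourier Q f m * \<psi> (residue_functional Q m x))"
proof -
  let ?G = "residue_ring Q"
  note fin = finite_residue_ring[OF Q] residue_ring_nonempty[OF Q]
  have "(\<Sum>m\<in>?G. residue_fourier Q f m * \<psi> (residue_functional Q m x))
      = (\<Sum>m\<in>?G. \<Sum>y\<in>?G. f y * (\<psi> (residue_functional Q m x) * cnj (\<psi> (residue_functional Q m y)))
          / of_nat (card ?G))"
    unfolding residue_fourier_def average_def sum_divide_distrib sum_distrib_right
    by (intro sum.cong refl) simp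
  also have "\<dots> = (\<Sum>y\<in>?G. \<Sum>m\<in>?G. f y * (\<psi> (residue_functional Q m x) * cnj (\<psi> (residue_functional Q m y)))
          / of_nat (card ?G))"
    by (rule sum.swap)
  also have "\<dots> = (\<Sum>y\<in>?G. f y * average ?G (\<lambda>m. \<psi> (residue_functional Q m x) * cnj (\<psi> (residue_functional Q m y))))"
    by (simp add: average_def sum_distrib_left sum_divide_distrib)
  also have "\<dots> = (\<Sum>y\<in>?G. f y * of_bool (x = y))"
    by (intro sum.cong refl) (simp add: average_residue_functional_diff[OF Q x])
  also have "\<dots> = f x"
    using fin x by (simp add: of_bool_def if_distrib[of "\<lambda>t. _ * t"] cong: if_cong)
  finally show ?thesis ..
qed

definition deviation :: "'a::finite_field poly \<Rightarrow> 'a poly \<Rightarrow> ('a poly \<Rightarrow> complex) \<Rightarrow> 'a poly \<Rightarrow> complex" where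
  "deviation P Q f x =
     average (residue_ring Q) (\<lambda>y. f ((x + P \<circ>\<^sub>p y) mod Q)) - average (residue_ring Q) f"

text \<open>Averaging over the translates x + P(y) is diagonal in the Fourier basis, with eigenvalue
  \<open>s m\<close> at m; subtracting the mean removes m = 0, and Parseval bounds the rest.\<close>

lemma L2_deviation_le:
  fixes P Q :: "'a::finite_field poly"
  assumes Q: "Q \<in> moduli" and e: "e \<ge> 0"
    and S: "\<And>m. m \<in> residue_ring Q \<Longrightarrow> m \<noteq> 0 \<Longrightarrow>
      cmod (average (residue_ring Q) (\<lambda>y. \<psi> (residue_functional Q m (P \<circ>\<^sub>p y)))) \<le> e"
  shows "L2_norm_residue Q (deviation P Q f) \<le> e * L2_norm_residue Q f"
proof -
  let ?G = "residue_ring Q"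
  note fin = finite_residue_ring[OF Q] residue_ring_nonempty[OF Q]
  define F where "F = residue_fourier Q f"
  define s where "s m = average ?G (\<lambda>y. \<psi> (residue_functional Q m (P \<circ>\<^sub>p y)))" for m
  define c where "c m = (if m = 0 then 0 else F m * s m)" for m
  have s0: "s 0 = 1" using average_const[OF fin] by (simp add: s_def)
  have zero: "0 \<in> ?G" by (simp add: mem_residue_ring)
  have dev: "deviation P Q f x = (\<Sum>m\<in>?G. c m * \<psi> (residue_functional Q m x))" for x
  proof -
    have "f ((x + P \<circ>\<^sub>p y) mod Q)
        = (\<Sum>m\<in>?G. (F m * \<psi> (residue_functional Q m x)) * \<psi> (residue_functional Q m (P \<circ>\<^sub>p y)))" for y
    proof -
      have "\<psi> (residue_functional Q m ((x + P \<circ>\<^sub>p y) mod Q))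
          = \<psi> (residue_functional Q m x) * \<psi> (residue_functional Q m (P \<circ>\<^sub>p y))" for m
      proof -
        have "\<psi> (residue_functional Q m ((x + P \<circ>\<^sub>p y) mod Q)) = \<psi> (residue_functional Q m (x + P \<circ>\<^sub>p y))"
          by (rule psi_additive_mod[OF residue_functional_additive residue_functional_periodic dvd_mod_diff])
        thus ?thesis by (simp add: additive.add[OF residue_functional_additive] psi_add)
      qed
      thus ?thesis
        using residue_fourier_inversion[OF Q, of "(x + P \<circ>\<^sub>p y) mod Q" f] by (simp add: F_def mult.assoc)
    qed
    hence "average ?G (\<lambda>y. f ((x + P \<circ>\<^sub>p y) mod Q))
        = (\<Sum>m\<in>?G. F m * \<psi> (residue_functional Q m x) * s m)"
      by (simp add: average_sum average_cmult s_def)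
    also have "\<dots> = F 0 + (\<Sum>m\<in>?G-{0}. F m * \<psi> (residue_functional Q m x) * s m)"
      using fin(1) zero by (simp add: sum.remove[of ?G 0] s0)
    also have "(\<Sum>m\<in>?G-{0}. F m * \<psi> (residue_functional Q m x) * s m)
        = (\<Sum>m\<in>?G. c m * \<psi> (residue_functional Q m x))"
      using fin(1) by (intro sum.mono_neutral_cong_left) (auto simp: c_def)
    also have "F 0 = average ?G f" by (simp add: F_def residue_fourier_def)
    finally show ?thesis by (simp add: deviation_def)
  qed
  have "average ?G (\<lambda>x. (cmod (deviation P Q f x))\<^sup>2) = (\<Sum>m\<in>?G. (cmod (c m))\<^sup>2)"
    unfolding dev by (rule parseval_residue[OF Q])
  also have "\<dots> \<le> (\<Sum>m\<in>?G. e\<^sup>2 * (cmod (F m))\<^sup>2)"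
  proof (rule sum_mono)
    fix m assume m: "m \<in> ?G"
    show "(cmod (c m))\<^sup>2 \<le> e\<^sup>2 * (cmod (F m))\<^sup>2"
    proof (cases "m = 0")
      case False
      have "cmod (c m) = cmod (s m) * cmod (F m)" using False by (simp add: c_def norm_mult)
      also have "\<dots> \<le> e * cmod (F m)" using S[OF m False] by (intro mult_right_mono) (auto simp: s_def)
      finally show ?thesis by (metis norm_ge_zero power_mono power_mult_distrib)
    qed (simp add: c_def)
  qed
  also have "\<dots> = e\<^sup>2 * average ?G (\<lambda>x. (cmod (\<Sum>m\<in>?G. F m * \<psi> (residue_functional Q m x)))\<^sup>2)"
    unfolding parseval_residue[OF Q] by (simp add: sum_distrib_left)
  also have "average ?G (\<lambda>x. (cmod (\<Sum>m\<in>?G. F m * \<psi> (residue_functional Q m x)))\<^sup>2)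
      = average ?G (\<lambda>x. (cmod (f x))\<^sup>2)"
    by (intro average_cong) (simp add: F_def residue_fourier_inversion[OF Q, of _ f, symmetric])
  finally have "sqrt (average ?G (\<lambda>x. (cmod (deviation P Q f x))\<^sup>2))
      \<le> sqrt (e\<^sup>2 * average ?G (\<lambda>x. (cmod (f x))\<^sup>2))" by simp
  thus ?thesis using e by (simp add: L2_norm_residue_def real_sqrt_mult)
qed

lemma L2_norm_residue_unimodular:
  assumes Q: "Q \<in> moduli" and "\<And>x. cmod (f x) = 1"
  shows "L2_norm_residue Q f = 1"
  using finite_residue_ring[OF Q] residue_ring_nonempty[OF Q]
  by (simp add: L2_norm_residue_def average_def assms(2) card_gt_0_iff)

lemma L2_norm_residue_nonneg: "L2_norm_residue Q f \<ge> 0"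
  by (simp add: L2_norm_residue_def average_def sum_nonneg)

lemma mean_deviation_le:
  fixes P Q :: "'a::finite_field poly"
  assumes Q: "Q \<in> moduli" and e: "e \<ge> 0"
    and S: "\<And>m. m \<in> residue_ring Q \<Longrightarrow> m \<noteq> 0 \<Longrightarrow>
      cmod (average (residue_ring Q) (\<lambda>y. \<psi> (residue_functional Q m (P \<circ>\<^sub>p y)))) \<le> e"
  shows "mean_deviation P Q \<le> e"
  unfolding mean_deviation_def
proof (rule cSUP_least)
  show "{f. L2_norm_residue Q f = 1} \<noteq> {}" using L2_norm_residue_unimodular[OF Q, of "\<lambda>_. 1"] by auto
  fix f assume "f \<in> {f. L2_norm_residue Q f = 1}"
  thus "L2_norm_residue Q (\<lambda>x. average (residue_ring Q) (\<lambda>y. f ((x + P \<circ>\<^sub>p y) mod Q))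
      - average (residue_ring Q) f) \<le> e"
    using L2_deviation_le[OF Q e S, of f] by (simp add: deviation_def[abs_def])
qed

lemma mean_deviation_ge:
  fixes P Q :: "'a::finite_field poly"
  assumes Q: "Q \<in> moduli" and f: "L2_norm_residue Q f = 1"
  shows "mean_deviation P Q \<ge> L2_norm_residue Q (deviation P Q f)"
  unfolding mean_deviation_def deviation_def[abs_def]
proof (rule cSUP_upper)
  \<comment> \<open>Exponential sums are at most 1 in absolute value, and the preceding bound with e
    = 1 shows that the supremum is taken over a bounded set.\<close>
  have "cmod (average (residue_ring Q) (\<lambda>y. \<psi> (residue_functional Q m (P \<circ>\<^sub>p y)))) \<le> 1" for m
    using finite_residue_ring[OF Q] residue_ring_nonempty[OF Q] by (intro norm_average_le) auto
  from L2_deviation_le[OF Q zero_le_one this]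
  have le: "L2_norm_residue Q (deviation P Q g) \<le> L2_norm_residue Q g" for g by simp
  show "bdd_above ((\<lambda>f. L2_norm_residue Q (\<lambda>x. average (residue_ring Q) (\<lambda>y. f ((x + P \<circ>\<^sub>p y) mod Q))
      - average (residue_ring Q) f)) ` {f. L2_norm_residue Q f = 1})"
  proof (rule bdd_aboveI2)
    fix g assume "g \<in> {f. L2_norm_residue Q f = 1}"
    thus "L2_norm_residue Q (\<lambda>x. average (residue_ring Q) (\<lambda>y. g ((x + P \<circ>\<^sub>p y) mod Q))
        - average (residue_ring Q) g) \<le> 1"
      using le[of g] by (simp add: deviation_def[abs_def])
  qed
qed (use f in auto)

lemma mean_deviation_nonneg: "Q \<in> moduli \<Longrightarrow> mean_deviation P Q \<ge> 0"
  using mean_deviation_ge[of Q "\<lambda>_. 1" P] L2_norm_residue_unimodular[of Q "\<lambda>_. 1"]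
    L2_norm_residue_nonneg[of Q "deviation P Q (\<lambda>_. 1)"] by simp

text \<open>The left side is |Q| times the sum over A of the deviation of the indicator of B.
  Cauchy-Schwarz over A gives the factor sqrt |A|, and the norm of the indicator gives sqrt
  |B|.\<close>

lemma correlation_count_le:
  fixes P Q :: "'a::finite_field poly"
  assumes Q: "Q \<in> moduli" and e: "e \<ge> 0"
    and S: "\<And>m. m \<in> residue_ring Q \<Longrightarrow> m \<noteq> 0 \<Longrightarrow>
      cmod (average (residue_ring Q) (\<lambda>y. \<psi> (residue_functional Q m (P \<circ>\<^sub>p y)))) \<le> e"
    and A: "A \<subseteq> residue_ring Q" and B: "B \<subseteq> residue_ring Q"
  shows "\<bar>real (card {(x, y). x \<in> residue_ring Q \<and> y \<in> residue_ring Q \<and>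
              x \<in> A \<and> (x + P \<circ>\<^sub>p y) mod Q \<in> B}) - real (card A) * real (card B)\<bar>
         \<le> e * sqrt (real (card A)) * sqrt (real (card B)) * real (poly_abs Q)"
proof -
  let ?G = "residue_ring Q"
  note fin = finite_residue_ring[OF Q]
  define q where "q = real (poly_abs Q)"
  have q: "q > 0" by (simp add: q_def poly_abs_def)
  have cardG: "real (card ?G) = q" by (simp add: card_residue_ring[OF Q] q_def)
  have finAB: "finite A" "finite B" using A B fin finite_subset by auto
  define f :: "'a poly \<Rightarrow> complex" where "f x = of_bool (x \<in> B)" for x
  define N where "N x = card {y \<in> ?G. (x + P \<circ>\<^sub>p y) mod Q \<in> B}" for x
  have "{(x, y). x \<in> ?G \<and> y \<in> ?G \<and> x \<in> A \<and> (x + P \<circ>\<^sub>p y) mod Q \<in> B}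
      = Sigma A (\<lambda>x. {y \<in> ?G. (x + P \<circ>\<^sub>p y) mod Q \<in> B})" using A by auto
  hence count: "card {(x, y). x \<in> ?G \<and> y \<in> ?G \<and> x \<in> A \<and> (x + P \<circ>\<^sub>p y) mod Q \<in> B} = (\<Sum>x\<in>A. N x)"
    using finAB fin by (simp add: N_def)
  have sum_ind: "(\<Sum>x\<in>T. of_bool (R x)) = (of_nat (card {x \<in> T. R x}) :: complex)" if "finite T"
    for T :: "'a poly set" and R
    using that by (simp add: of_bool_def sum.If_cases Int_def)
  have dev: "deviation P Q f x = (of_nat (N x) - of_nat (card B)) / of_real q" for x
  proof -
    have "{x \<in> ?G. x \<in> B} = B" using B by auto
    moreover have "of_nat (card ?G) = complex_of_real q" by (metis cardG of_real_of_nat_eq)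
    ultimately show ?thesis using sum_ind[OF fin]
      by (simp add: deviation_def average_def f_def N_def diff_divide_distrib)
  qed
  have "real (\<Sum>x\<in>A. N x) - real (card A) * real (card B) = q * (\<Sum>x\<in>A. (real (N x) - real (card B)) / q)"
    using q by (simp add: sum_distrib_left sum_subtractf)
  hence "\<bar>real (\<Sum>x\<in>A. N x) - real (card A) * real (card B)\<bar>
      = q * \<bar>\<Sum>x\<in>A. (real (N x) - real (card B)) / q\<bar>" using q by (simp add: abs_mult)
  also have "\<bar>\<Sum>x\<in>A. (real (N x) - real (card B)) / q\<bar> \<le> (\<Sum>x\<in>A. cmod (deviation P Q f x))"
  proof (rule order_trans[OF sum_abs], rule sum_mono)
    fix x
    have "deviation P Q f x = complex_of_real ((real (N x) - real (card B)) / q)" by (simp add: dev)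
    thus "\<bar>(real (N x) - real (card B)) / q\<bar> \<le> cmod (deviation P Q f x)" by (simp only: norm_of_real)
  qed
  also have "(\<Sum>x\<in>A. cmod (deviation P Q f x)) \<le> sqrt (card A) * (e * sqrt (card B))"
  proof -
    have "(\<Sum>x\<in>A. cmod (deviation P Q f x))\<^sup>2 \<le> (\<Sum>x\<in>A. (cmod (deviation P Q f x))\<^sup>2) * card A"
      by (rule sum_squared_le_sum_of_squares)
    hence "(\<Sum>x\<in>A. cmod (deviation P Q f x)) \<le> sqrt ((\<Sum>x\<in>A. (cmod (deviation P Q f x))\<^sup>2) * card A)"
      by (simp add: real_le_rsqrt)
    also have "\<dots> \<le> sqrt ((\<Sum>x\<in>?G. (cmod (deviation P Q f x))\<^sup>2) * card A)"
      using A fin by (intro real_sqrt_le_mono mult_right_mono sum_mono2) auto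
    also have "\<dots> = sqrt (card A) * sqrt (\<Sum>x\<in>?G. (cmod (deviation P Q f x))\<^sup>2)"
      by (simp add: real_sqrt_mult)
    also have "sqrt (\<Sum>x\<in>?G. (cmod (deviation P Q f x))\<^sup>2) = sqrt q * L2_norm_residue Q (deviation P Q f)"
      using q by (simp add: L2_norm_residue_def average_def cardG flip: real_sqrt_mult)
    also have "L2_norm_residue Q (deviation P Q f) \<le> e * L2_norm_residue Q f"
      by (rule L2_deviation_le[OF Q e S])
    also have "L2_norm_residue Q f = sqrt (card B / q)"
    proof -
      have "{x \<in> ?G. x \<in> B} = B" using B by auto
      moreover have "(cmod (f x))\<^sup>2 = of_bool (x \<in> B)" for x by (simp add: f_def)
      moreover have "(\<Sum>x\<in>?G. of_bool (x \<in> B)) = real (card {x \<in> ?G. x \<in> B})"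
        using fin by (simp add: of_bool_def sum.If_cases Int_def)
      ultimately show ?thesis by (simp add: L2_norm_residue_def average_def cardG)
    qed
    also have "sqrt q * (e * sqrt (card B / q)) = e * sqrt (card B)"
      using q by (simp add: real_sqrt_divide)
    finally show ?thesis using q by (simp add: mult_left_mono)
  qed
  finally have "\<bar>real (\<Sum>x\<in>A. N x) - real (card A) * real (card B)\<bar>
      \<le> q * (sqrt (card A) * (e * sqrt (card B)))" using q by (simp add: mult_left_mono)
  thus ?thesis by (simp only: count q_def mult_ac)
qed


section \<open>Sums of additive polynomials in powers\<close>

lemma dvd_pcompose:
  fixes f z :: "'a::comm_ring_1 poly"
  assumes "coeff f 0 = 0"
  shows "z dvd f \<circ>\<^sub>p z"
proof -
  obtain a g where "f = pCons a g" by (cases f)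
  thus ?thesis using assms by (simp add: pcompose_pCons)
qed

lemma frobenius_supported_coeff_0: "frobenius_supported (f :: 'a::finite_field poly) \<Longrightarrow> coeff f 0 = 0"
  by (auto simp: frobenius_supported_def)

lemma pcompose_monom_1: "monom 1 k \<circ>\<^sub>p y = y ^ k" for y :: "'a::comm_semiring_1 poly"
  by (induction k) (auto simp: monom_Suc pcompose_pCons pcompose_1 monom_0 one_pCons[symmetric])

lemma pcompose_linear_monom: "monom a 1 \<circ>\<^sub>p w = smult a w" for w :: "'a::comm_ring_1 poly"
proof -
  have "monom a 1 = smult a (monom 1 1)" by (simp add: smult_monom)
  thus ?thesis by (simp only: pcompose_smult pcompose_monom_1 power_one_right)
qed

locale separable_sum =
  fixes \<eta> :: "nat \<Rightarrow> 'a::finite_field poly" and r :: "nat \<Rightarrow> nat" and n :: nat and P :: "'a poly"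
  assumes \<eta>: "\<And>i. i \<in> {1..n} \<Longrightarrow> \<eta> i \<in> additive_polys"
    and r: "\<And>i. i \<in> {1..n} \<Longrightarrow> r i > 0 \<and> \<not> CHAR('a) dvd r i"
    and r_inj: "inj_on r {1..n}"
    and P: "P = (\<Sum>i=1..n. \<eta> i \<circ>\<^sub>p monom 1 (r i))"
begin

text \<open>Condition (iii), in the form against which all the others are compared.\<close>

definition generates :: bool where
  "generates \<longleftrightarrow> (\<exists>\<zeta> a. (\<forall>i\<in>{1..n}. \<zeta> i \<in> additive_polys) \<and> a \<in> prime_field \<and> a \<noteq> 0 \<and>
     (\<Sum>i=1..n. \<eta> i \<circ>\<^sub>p \<zeta> i) = monom a 1)"

lemma P_pcompose: "P \<circ>\<^sub>p y = (\<Sum>i=1..n. \<eta> i \<circ>\<^sub>p (y ^ r i))"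
  by (simp add: P pcompose_sum pcompose_assoc[symmetric] pcompose_monom_1)

lemma \<eta>_additive: "i \<in> {1..n} \<Longrightarrow> additive_map (\<lambda>z. \<eta> i \<circ>\<^sub>p z)"
  using frobenius_supported_additive additive_polys_supported \<eta> by blast

text \<open>The functionals L_s of L o P. The sum over i with a condition defines them for all s:
  the exponents are distinct, so at most one term survives, and none if s is not among the
  \<open>r i\<close>.\<close>

definition pullback :: "('a poly \<Rightarrow> 'a) \<Rightarrow> nat \<Rightarrow> 'a poly \<Rightarrow> 'a" where
  "pullback L s z = (\<Sum>i=1..n. if r i = s then L (\<eta> i \<circ>\<^sub>p z) else 0)"

lemma pullback_additive:
  assumes "additive_map L"
  shows "additive_map (pullback L s)"
proof -
  have "L (\<eta> i \<circ>\<^sub>p (x + y)) = L (\<eta> i \<circ>\<^sub>p x) + L (\<eta> i \<circ>\<^sub>p y)" if "i \<in> {1..n}" for i x y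
    using additive.add[OF \<eta>_additive[OF that]] additive.add[OF assms] by simp
  thus ?thesis unfolding pullback_def Modules.additive_def sum.distrib[symmetric]
    by (intro allI sum.cong) auto
qed

lemma pullback_eq: "i \<in> {1..n} \<Longrightarrow> pullback L (r i) z = L (\<eta> i \<circ>\<^sub>p z)"
proof -
  assume i: "i \<in> {1..n}"
  have "(\<Sum>j=1..n. if r j = r i then L (\<eta> j \<circ>\<^sub>p z) else 0) = (\<Sum>j=1..n. if j = i then L (\<eta> j \<circ>\<^sub>p z) else 0)"
    using r_inj i by (intro sum.cong) (auto dest: inj_onD)
  thus ?thesis using i by (simp add: pullback_def)
qed

text \<open>The inserted 0 gives \<open>Max\<close> a value when n = 0.\<close>

definition exponent_bound :: nat where
  "exponent_bound = Max (insert 0 (r ` {1..n}))"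

lemma r_in_exponents: "i \<in> {1..n} \<Longrightarrow> r i \<in> phase_exponents CHAR('a) exponent_bound"
  using r[of i] by (auto simp: phase_exponents_def exponent_bound_def Suc_le_eq)

lemma phase_pullback:
  assumes "additive_map L"
  shows "phase exponent_bound (pullback L) y = L (P \<circ>\<^sub>p y)"
proof -
  have "phase exponent_bound (pullback L) y
      = (\<Sum>i=1..n. \<Sum>s\<in>phase_exponents CHAR('a) exponent_bound. if r i = s then L (\<eta> i \<circ>\<^sub>p (y ^ s)) else 0)"
    unfolding phase_def pullback_def by (rule sum.swap)
  also have "\<dots> = (\<Sum>i=1..n. L (\<eta> i \<circ>\<^sub>p (y ^ r i)))"
    by (intro sum.cong refl) (use r_in_exponents in auto)
  finally show ?thesis by (simp add: P_pcompose additive.sum[OF assms])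
qed

lemma pullback_periodic:
  assumes "periodic W L"
  shows "periodic W (pullback L s)"
proof -
  have "W dvd \<eta> i \<circ>\<^sub>p (W * z)" if "i \<in> {1..n}" for i z
  proof -
    have "coeff (\<eta> i) 0 = 0" using frobenius_supported_coeff_0 additive_polys_supported \<eta> that by blast
    from dvd_pcompose[OF this, of "W * z"] show ?thesis by (meson dvd_mult_left)
  qed
  hence "\<psi> (if r i = s then L (\<eta> i \<circ>\<^sub>p (W * z)) else 0) = 1" if "i \<in> {1..n}" for i z
    using periodicD[OF assms] that by simp
  thus ?thesis by (simp add: periodic_def pullback_def psi_sum)
qed

text \<open>The identity of (iii) at w = W x / a writes W x as \<Sum> \<eta>_i(\<zeta>_i(w)), where
  each \<zeta>_i(w) is a multiple of W. So L on multiples of W is controlled by its pullbacks on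
  multiples of W.\<close>

lemma periodic_if_pullbacks_periodic:
  assumes g: generates and L: "additive_map L"
    and per: "\<And>i. i \<in> {1..n} \<Longrightarrow> periodic W (pullback L (r i))"
  shows "periodic W L"
proof -
  from g obtain \<zeta> a where z: "\<And>i. i \<in> {1..n} \<Longrightarrow> \<zeta> i \<in> additive_polys" and a: "a \<noteq> 0"
    and sum: "(\<Sum>i=1..n. \<eta> i \<circ>\<^sub>p \<zeta> i) = monom a 1" unfolding generates_def by blast
  show ?thesis
    unfolding periodic_def
  proof
    fix x
    define w where "w = smult (inverse a) (W * x)"
    have "W * x = monom a 1 \<circ>\<^sub>p w" using a by (simp only: pcompose_linear_monom) (simp add: w_def)
    also have "\<dots> = (\<Sum>i=1..n. \<eta> i \<circ>\<^sub>p (\<zeta> i \<circ>\<^sub>p w))"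
      by (simp only: sum[symmetric] pcompose_sum pcompose_assoc)
    finally have "L (W * x) = (\<Sum>i=1..n. L (\<eta> i \<circ>\<^sub>p (\<zeta> i \<circ>\<^sub>p w)))"
      by (simp add: additive.sum[OF L])
    moreover have "\<psi> (L (\<eta> i \<circ>\<^sub>p (\<zeta> i \<circ>\<^sub>p w))) = 1" if i: "i \<in> {1..n}" for i
    proof -
      have "coeff (\<zeta> i) 0 = 0" using frobenius_supported_coeff_0 additive_polys_supported z i by blast
      hence "w dvd \<zeta> i \<circ>\<^sub>p w" by (rule dvd_pcompose)
      moreover have "W dvd w" by (simp add: w_def dvd_smult)
      ultimately show ?thesis using periodicD[OF per[OF i]] i by (simp add: pullback_eq dvd_trans)
    qed
    ultimately show "\<psi> (L (W * x)) = 1" by (simp add: psi_sum)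
  qed
qed

theorem irrational_average:
  assumes g: generates and L: "additive_map L" "\<not> rational_functional L" and \<Phi>: "folner \<Phi>"
  shows "(\<lambda>N. average (\<Phi> N) (\<lambda>y. \<psi> (L (P \<circ>\<^sub>p y)))) \<longlonglongrightarrow> 0"
proof -
  have "\<exists>i\<in>{1..n}. \<not> rational_functional (pullback L (r i))"
  proof (rule ccontr)
    assume "\<not> ?thesis"
    hence "\<forall>i\<in>{1..n}. \<exists>W. W \<noteq> 0 \<and> periodic W (pullback L (r i))" by (auto simp: rational_functional_def)
    then obtain W where W: "\<And>i. i \<in> {1..n} \<Longrightarrow> W i \<noteq> 0 \<and> periodic (W i) (pullback L (r i))" by metis
    \<comment> \<open>If all pullbacks were rational, the product of their periods would be a common
      period and hence a period of L.\<close>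
    define V where "V = (\<Prod>i=1..n. W i)"
    have "V \<noteq> 0" using W by (simp add: V_def)
    moreover have "periodic V (pullback L (r i))" if "i \<in> {1..n}" for i
    proof -
      have "W i dvd V" unfolding V_def using that by (intro dvd_prodI) auto
      with W[OF that] show ?thesis using periodic_dvd by blast
    qed
    ultimately show False
      using periodic_if_pullbacks_periodic[OF g L(1)] L(2) by (auto simp: rational_functional_def)
  qed
  then obtain i where "i \<in> {1..n}" "\<not> rational_functional (pullback L (r i))" by blast
  from irrational_phase_average[where L = "pullback L", OF \<Phi> pullback_additive[OF L(1)] r_in_exponents[OF this(1)] this(2)]
  show ?thesis by (simp add: phase_pullback[OF L(1)])
qed

theorem residue_character_sum_bound:
  assumes g: generates
  shows "\<exists>c \<gamma>. c > 0 \<and> \<gamma> > 0 \<and> (\<forall>Q\<in>moduli. \<forall>m\<in>residue_ring Q. m \<noteq> 0 \<longrightarrow>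
    cmod (average (residue_ring Q) (\<lambda>y. \<psi> (residue_functional Q m (P \<circ>\<^sub>p y)))) \<le> c * real (lpf Q) powr (- \<gamma>))"
proof -
  obtain c \<gamma> where c: "c > 0" "\<gamma> > 0" and bound: "\<And>Q L. Q \<in> moduli \<Longrightarrow>
        (\<forall>s. additive_map (L s)) \<Longrightarrow> (\<forall>s. periodic Q (L s)) \<Longrightarrow>
        (\<exists>s\<in>phase_exponents CHAR('a) exponent_bound. \<not> periodic 1 (L s)) \<Longrightarrow>
        cmod (average (residue_ring Q) (\<lambda>y. \<psi> (phase exponent_bound (L :: nat \<Rightarrow> 'a poly \<Rightarrow> 'a) y)))
          \<le> c * real (lpf Q) powr (- \<gamma>)"
    using periodic_phase_average_bound[where ?'a = 'a and B = exponent_bound] by blast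
  show ?thesis
  proof (rule exI[of _ c], rule exI[of _ \<gamma>], intro conjI ballI impI c)
    fix Q m :: "'a poly" assume Q: "Q \<in> moduli" and m: "m \<in> residue_ring Q" "m \<noteq> 0"
    define L where "L = residue_functional Q m"
    have L: "additive_map L" "periodic Q L"
      unfolding L_def by (rule residue_functional_additive residue_functional_periodic)+
    have "\<not> Q dvd m" using m residue_ring_dvd_diff_iff[of m Q 0] by (simp add: mem_residue_ring)
    then obtain z where "\<psi> (L z) \<noteq> 1"
      using residue_functional_nondegenerate[OF Q] residue_functional_commute unfolding L_def by metis
    hence "\<not> periodic 1 L" unfolding periodic_def by auto
    then obtain i where i: "i \<in> {1..n}" "\<not> periodic 1 (pullback L (r i))"
      using periodic_if_pullbacks_periodic[OF g L(1)] by blast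
    have "cmod (average (residue_ring Q) (\<lambda>y. \<psi> (phase exponent_bound (pullback L) y)))
        \<le> c * real (lpf Q) powr (- \<gamma>)"
      using i r_in_exponents by (intro bound Q allI pullback_additive pullback_periodic L) blast
    thus "cmod (average (residue_ring Q) (\<lambda>y. \<psi> (residue_functional Q m (P \<circ>\<^sub>p y))))
        \<le> c * real (lpf Q) powr (- \<gamma>)"
      by (simp add: phase_pullback[OF L(1)]) (simp add: L_def)
  qed
qed

text \<open>The identity of (iii), evaluated at x / a, solves x = \<Sum> \<eta>_i(y_i) already in
  F[t]; reducing the y_i modulo Q changes each term by a multiple of Q.\<close>

lemma sum_image_subgroups_full:
  assumes g: generates and Q: "Q \<in> moduli"
  shows "sum_image_subgroups Q \<eta> n = residue_ring Q"
proof
  show "sum_image_subgroups Q \<eta> n \<subseteq> residue_ring Q" by (auto simp: sum_image_subgroups_def)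
  from g obtain \<zeta> a where a: "a \<noteq> 0" and sum: "(\<Sum>i=1..n. \<eta> i \<circ>\<^sub>p \<zeta> i) = monom a 1"
    unfolding generates_def by blast
  show "residue_ring Q \<subseteq> sum_image_subgroups Q \<eta> n"
  proof
    fix x assume x: "x \<in> residue_ring Q"
    define w where "w = smult (inverse a) x"
    have "x = monom a 1 \<circ>\<^sub>p w" using a by (simp only: pcompose_linear_monom) (simp add: w_def)
    also have "\<dots> = (\<Sum>i=1..n. \<eta> i \<circ>\<^sub>p (\<zeta> i \<circ>\<^sub>p w))"
      by (simp only: sum[symmetric] pcompose_sum pcompose_assoc)
    finally have xs: "x = (\<Sum>i=1..n. \<eta> i \<circ>\<^sub>p (\<zeta> i \<circ>\<^sub>p w))" .
    define h where "h i = (\<eta> i \<circ>\<^sub>p (\<zeta> i \<circ>\<^sub>p w mod Q)) mod Q" for i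
    have "(\<Sum>i=1..n. h i) mod Q = (\<Sum>i=1..n. \<eta> i \<circ>\<^sub>p (\<zeta> i \<circ>\<^sub>p w)) mod Q"
    proof -
      have "Q dvd h i - \<eta> i \<circ>\<^sub>p (\<zeta> i \<circ>\<^sub>p w)" if i: "i \<in> {1..n}" for i
      proof -
        have "\<eta> i \<circ>\<^sub>p (\<zeta> i \<circ>\<^sub>p w mod Q) - \<eta> i \<circ>\<^sub>p (\<zeta> i \<circ>\<^sub>p w)
            = \<eta> i \<circ>\<^sub>p (\<zeta> i \<circ>\<^sub>p w mod Q - \<zeta> i \<circ>\<^sub>p w)"
          by (simp add: additive.diff[OF \<eta>_additive[OF i]])
        moreover have "coeff (\<eta> i) 0 = 0"
          using frobenius_supported_coeff_0 additive_polys_supported \<eta> i by blast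
        ultimately have "Q dvd \<eta> i \<circ>\<^sub>p (\<zeta> i \<circ>\<^sub>p w mod Q) - \<eta> i \<circ>\<^sub>p (\<zeta> i \<circ>\<^sub>p w)"
          using dvd_pcompose dvd_mod_diff dvd_trans by metis
        from dvd_add[OF dvd_mod_diff[of Q "\<eta> i \<circ>\<^sub>p (\<zeta> i \<circ>\<^sub>p w mod Q)"] this]
        show ?thesis by (simp add: h_def)
      qed
      hence "Q dvd (\<Sum>i=1..n. h i - \<eta> i \<circ>\<^sub>p (\<zeta> i \<circ>\<^sub>p w))" by (intro dvd_sum) auto
      thus ?thesis by (simp add: sum_subtractf mod_eq_dvd_iff)
    qed
    also have "\<dots> = x" using x xs by (simp add: mem_residue_ring)
    finally have "x = (\<Sum>i=1..n. h i) mod Q" ..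
    moreover have "\<forall>i\<in>{1..n}. h i \<in> image_subgroup Q (\<eta> i)"
      by (simp add: h_def image_subgroup_def)
    ultimately show "x \<in> sum_image_subgroups Q \<eta> n" unfolding sum_image_subgroups_def by blast
  qed
qed

end


section \<open>Obstructions to surjectivity\<close>

lemma normalize_monic:
  fixes f :: "'a::field poly"
  assumes "degree f > 0"
  defines "g \<equiv> smult (inverse (lead_coeff f)) f"
  shows "lead_coeff g = 1" "degree g = degree f" "h dvd g \<longleftrightarrow> h dvd f" "g dvd h \<longleftrightarrow> f dvd h"
proof -
  have "f \<noteq> 0" using assms by auto
  hence "lead_coeff f \<noteq> 0" by simp
  thus "lead_coeff g = 1" "degree g = degree f" "h dvd g \<longleftrightarrow> h dvd f" "g dvd h \<longleftrightarrow> f dvd h"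
    by (simp_all add: g_def dvd_smult_iff smult_dvd_iff)
qed

lemma not_dvd_const:
  fixes R :: "'a::field poly"
  assumes "R dvd [:c:]" "c \<noteq> 0"
  shows "degree R = 0"
  using dvd_imp_degree_le[OF assms(1)] assms(2) by simp

text \<open>A modulus without small prime factors modulo which \<open>d\<close> is not injective: a large factor of
  \<open>d(f)/f\<close> if \<open>d\<close> is separable, and the square of a polynomial otherwise.\<close>

lemma ex_noninjective_modulus:
  fixes d :: "'a::finite_field poly"
  assumes d: "coeff d 0 = 0" "degree d > 1"
  shows "\<exists>Q\<in>moduli. D < lpf Q \<and> (\<exists>g. \<not> Q dvd g \<and> Q dvd d \<circ>\<^sub>p g)"
proof -
  \<comment> \<open>The product f of these polynomials is divisible by every irreducible R with |R|
    \<le> D, because deg R < |R|. The bound D + 2 keeps t itself in the set, so f is nonconstant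
    even for D = 0.\<close>
  define S where "S = {g \<in> polys_below (D + 2) :: 'a poly set. degree g > 0}"
  define f where "f = (\<Prod>g\<in>S. g)"
  have finS: "finite S" by (simp add: S_def)
  have "f \<noteq> 0" using finS by (auto simp: f_def S_def)
  have "[:0, 1:] \<in> S" by (auto simp: S_def intro: degree_less_imp_polys_below)
  hence "[:0, 1:] dvd f" unfolding f_def using finS by (intro dvd_prodI)
  hence degf: "degree f > 0" using dvd_imp_degree_le[of "[:0, 1:]" f] \<open>f \<noteq> 0\<close> by simp
  have dvdf: "R dvd f" if R: "irreducible R" "poly_abs R \<le> D" for R
  proof -
    have "degree R > 0"
      using R(1) irreducible_not_unit[OF R(1)] by (cases "R = 0") (auto simp: is_unit_iff_degree)
    moreover have "degree R < CARD('a) ^ degree R"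
      using power_gt_expt[of "CARD('a)" "degree R"] card_mono[of "UNIV :: 'a set" "{0, 1}"] by simp
    ultimately have "R \<in> S" using R(2) by (auto simp: S_def poly_abs_def intro!: degree_less_imp_polys_below)
    thus ?thesis unfolding f_def using finS by (intro dvd_prodI)
  qed
  show ?thesis
  proof (cases "coeff d 1 = 0")
    case False
    obtain e where e: "d = pCons 0 e" using d(1) by (cases d) auto
    obtain c e' where e': "e = pCons c e'" by (cases e)
    have c: "c \<noteq> 0" using False by (simp add: e e')
    define Q0 where "Q0 = e \<circ>\<^sub>p f"
    have "degree Q0 = degree e * degree f" by (simp add: Q0_def degree_pcompose)
    moreover have "degree e > 0" using d(2) by (auto simp: e split: if_splits)
    ultimately have degQ0: "degree Q0 > 0" using degf by simp
    define Q where "Q = smult (inverse (lead_coeff Q0)) Q0"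
    note Q = normalize_monic[OF degQ0, folded Q_def]
    have Qmod: "Q \<in> moduli" using Q degQ0 by (simp add: moduli_def)
    have no_common: "degree R = 0" if "R dvd Q0" "R dvd f" for R
    proof -
      \<comment> \<open>Q0 = d(f) / f is congruent modulo f to the linear coefficient c of d, a
        nonzero constant; hence Q0 and f have no common factor and Q0 no small prime factor.\<close>
      have "[:c:] = Q0 - f * (e' \<circ>\<^sub>p f)" by (simp add: Q0_def e' pcompose_pCons)
      hence "R dvd [:c:]" using that by (metis dvd_diff dvd_mult2)
      thus ?thesis using not_dvd_const c by blast
    qed
    have "D < lpf Q"
      unfolding lpf_gt_iff[OF Qmod]
    proof (intro allI impI, rule ccontr)
      fix R assume R: "irreducible R" "R dvd Q" "\<not> D < poly_abs R"
      hence "degree R = 0" using no_common dvdf Q(3) by simp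
      thus False using R(1) irreducible_not_unit[OF R(1)] by (cases "R = 0") (auto simp: is_unit_iff_degree)
    qed
    moreover have "\<not> Q dvd f"
    proof
      assume "Q dvd f"
      hence "degree Q0 = 0" using no_common[of Q0] Q(4) by simp
      thus False using degQ0 by simp
    qed
    moreover have "Q dvd d \<circ>\<^sub>p f" by (simp add: Q(4) e pcompose_pCons Q0_def)
    ultimately show ?thesis using Qmod by blast
  next
    case True
    obtain e where "d = pCons 0 e" using d(1) by (cases d) auto
    then obtain e' where e': "d = pCons 0 (pCons 0 e')" using True by (cases e) auto
    \<comment> \<open>The normalised g = f + 1 has no small prime factor, being prime to f. As the
      two lowest coefficients of d vanish, g^2 divides d(g), although it does not divide g.\<close>
    have deg1: "degree (f + 1) = degree f" by (rule degree_add_eq_left) (use degf in simp)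
    hence deg1': "degree (f + 1) > 0" using degf by simp
    define g where "g = smult (inverse (lead_coeff (f + 1))) (f + 1)"
    note g = normalize_monic[OF deg1', folded g_def]
    have g0: "g \<noteq> 0" using g(1) by auto
    define Q where "Q = g\<^sup>2"
    have degQ: "degree Q = 2 * degree g" using g0 by (simp add: Q_def degree_power_eq)
    have "lead_coeff Q = 1" by (simp only: Q_def lead_coeff_power g(1) power_one)
    hence Qmod: "Q \<in> moduli" using degQ g(2) deg1' by (simp add: moduli_def)
    have "D < lpf Q"
      unfolding lpf_gt_iff[OF Qmod]
    proof (intro allI impI, rule ccontr)
      fix R assume R: "irreducible R" "R dvd Q" "\<not> D < poly_abs R"
      define c where "c = inverse (lead_coeff (f + 1))"
      have "f + 1 \<noteq> 0" using deg1' by auto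
      hence "lead_coeff (f + 1) \<noteq> 0" by (simp only: leading_coeff_0_iff not_False_eq_True)
      hence "c \<noteq> 0" unfolding c_def by (rule nonzero_imp_inverse_nonzero)
      define C where "C = [:c:]"
      have "g = C * (f + 1)" by (simp add: g_def c_def C_def)
      hence "Q = C * C + f * (C * C * (f + 2))" by (simp add: Q_def power2_eq_square algebra_simps)
      hence "C * C = Q - f * (C * C * (f + 2))" by simp
      moreover have "C * C = [:c * c:]" by (simp add: C_def)
      ultimately have "[:c * c:] = Q - f * (C * C * (f + 2))" by (simp only:)
      moreover have "R dvd f" using dvdf R by simp
      ultimately have "R dvd [:c * c:]" using R(2) by (metis dvd_diff dvd_mult2)
      hence "degree R = 0" using not_dvd_const \<open>c \<noteq> 0\<close> by (metis mult_eq_0_iff)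
      thus False using R(1) irreducible_not_unit[OF R(1)] by (cases "R = 0") (auto simp: is_unit_iff_degree)
    qed
    moreover have "\<not> Q dvd g"
      using dvd_imp_degree_le[of Q g] degQ g0 g(2) deg1' by auto
    moreover have "Q dvd d \<circ>\<^sub>p g"
      by (simp add: e' pcompose_pCons Q_def power2_eq_square mult.assoc[symmetric])
    ultimately show ?thesis using Qmod by blast
  qed
qed

text \<open>Duality between kernel and cokernel: if no nonzero m annihilated the image of d, summing
  the character averages over all m in two ways would give exactly one z modulo Q with Q dividing
  d(z), but both 0 and g are such.\<close>

lemma ex_annihilating_residue_functional:
  fixes d Q :: "'a::finite_field poly"
  assumes d: "frobenius_supported d" and Q: "Q \<in> moduli" and g: "\<not> Q dvd g" "Q dvd d \<circ>\<^sub>p g"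
  shows "\<exists>m\<in>residue_ring Q. m \<noteq> 0 \<and> (\<forall>z. \<psi> (residue_functional Q m (d \<circ>\<^sub>p z)) = 1)"
proof (rule ccontr)
  assume no: "\<not> ?thesis"
  let ?G = "residue_ring Q"
  note fin = finite_residue_ring[OF Q] residue_ring_nonempty[OF Q]
  have add: "additive_map (\<lambda>z. d \<circ>\<^sub>p z)" by (rule frobenius_supported_additive[OF d])
  have dvd: "z dvd d \<circ>\<^sub>p z" for z using dvd_pcompose frobenius_supported_coeff_0[OF d] by blast
  define A where "A m = average ?G (\<lambda>z. \<psi> (residue_functional Q m (d \<circ>\<^sub>p z)))" for m
  have A: "A m = of_bool (m = 0)" if m: "m \<in> ?G" for m
  proof (cases "m = 0")
    case True
    thus ?thesis using average_const[OF fin] by (simp add: A_def)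
  next
    case False
    then obtain z where "\<psi> (residue_functional Q m (d \<circ>\<^sub>p z)) \<noteq> 1" using no m by blast
    moreover have "additive_map (\<lambda>z. residue_functional Q m (d \<circ>\<^sub>p z))"
      using additive_comp[OF residue_functional_additive add] .
    moreover have "periodic Q (\<lambda>z. residue_functional Q m (d \<circ>\<^sub>p z))"
      unfolding periodic_def
      by (intro allI periodicD[OF residue_functional_periodic] dvd_trans[OF dvd_triv_left dvd])
    ultimately show ?thesis using average_additive_char_eq_0 False by (simp add: A_def)
  qed
  have "(\<Sum>m\<in>?G. A m) = (\<Sum>m\<in>?G. of_bool (m = 0))" by (intro sum.cong refl A)
  also have "\<dots> = 1" using fin(1) by (simp add: of_bool_def mem_residue_ring)
  finally have "1 = (\<Sum>m\<in>?G. A m)" ..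
  also have "\<dots> = (\<Sum>z\<in>?G. average ?G (\<lambda>m. \<psi> (residue_functional Q m (d \<circ>\<^sub>p z))))"
    unfolding A_def average_def sum_divide_distrib by (rule sum.swap)
  also have "\<dots> = (\<Sum>z\<in>?G. of_bool (Q dvd d \<circ>\<^sub>p z))"
    by (simp add: average_residue_functional[OF Q])
  also have "\<dots> = of_nat (card {z \<in> ?G. Q dvd d \<circ>\<^sub>p z})"
    using fin by (simp add: of_bool_def sum.If_cases Int_def)
  finally have "card {z \<in> ?G. Q dvd d \<circ>\<^sub>p z} = 1" by (metis of_nat_1 of_nat_eq_iff)
  moreover have "0 \<in> {z \<in> ?G. Q dvd d \<circ>\<^sub>p z}"
    using additive.zero[OF add] by (simp add: mem_residue_ring)
  moreover have "g mod Q \<in> {z \<in> ?G. Q dvd d \<circ>\<^sub>p z}"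
  proof -
    have "Q dvd d \<circ>\<^sub>p (g mod Q - g)" using dvd dvd_mod_diff dvd_trans by blast
    hence "Q dvd d \<circ>\<^sub>p (g mod Q - g) + d \<circ>\<^sub>p g" using g(2) by simp
    thus ?thesis by (simp add: additive.diff[OF add])
  qed
  moreover have "g mod Q \<noteq> 0" using g(1) by (simp add: dvd_eq_mod_eq_0)
  ultimately show False by (metis card_1_singletonE singletonD)
qed

text \<open>Every fibre of the functional embeds by translation into the kernel of the character, so
  the kernel has at least |Q| / |F| elements; a translate of the kernel lies in the complement,
  which is thus at least as large. If the character is trivial on the values of P, no step by P(y)
  leads from the kernel to the complement.\<close>

lemma ex_dense_avoiding_pair:
  fixes Q m :: "'a::finite_field poly"
  assumes Q: "Q \<in> moduli" and m: "m \<in> residue_ring Q" "m \<noteq> 0"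
  defines "e \<equiv> (\<lambda>x. \<psi> (residue_functional Q m x))"
  shows "real (card {x \<in> residue_ring Q. e x = 1}) * real (card {x \<in> residue_ring Q. e x \<noteq> 1})
    \<ge> 1 / (CARD('a))\<^sup>2 * (real (poly_abs Q))\<^sup>2"
proof -
  let ?G = "residue_ring Q"
  define A where "A = {x \<in> ?G. e x = 1}"
  define B where "B = {x \<in> ?G. e x \<noteq> 1}"
  define q where "q = CARD('a)"
  note fin = finite_residue_ring[OF Q] residue_ring_nonempty[OF Q]
  have finAB: "finite A" "finite B" using fin by (auto simp: A_def B_def)
  have e_mod: "e (x mod Q) = e x" for x
    unfolding e_def by (rule psi_additive_mod[OF residue_functional_additive residue_functional_periodic dvd_mod_diff])
  have e_diff: "e (x - y) = e x * cnj (e y)" and e_add: "e (x + y) = e x * e y" for x y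
    by (simp_all add: e_def additive.diff[OF residue_functional_additive]
        additive.add[OF residue_functional_additive] psi_diff psi_add)
  have fibre: "card {x \<in> ?G. residue_functional Q m x = c} \<le> card A" for c
  proof (cases "{x \<in> ?G. residue_functional Q m x = c} = {}")
    case False
    then obtain x1 where x1: "x1 \<in> ?G" "residue_functional Q m x1 = c" by blast
    show ?thesis
    proof (rule card_inj_on_le[of "\<lambda>x. (x - x1) mod Q"])
      show "inj_on (\<lambda>x. (x - x1) mod Q) {x \<in> ?G. residue_functional Q m x = c}"
      proof (rule inj_onI)
        fix x y assume xy: "x \<in> {x \<in> ?G. residue_functional Q m x = c}"
          "y \<in> {x \<in> ?G. residue_functional Q m x = c}" "(x - x1) mod Q = (y - x1) mod Q"
        hence "Q dvd (x - x1) - (y - x1)" by (simp only: mod_eq_dvd_iff)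
        thus "x = y" using xy residue_ring_dvd_diff_iff[of x Q y] by simp
      qed
      show "(\<lambda>x. (x - x1) mod Q) ` {x \<in> ?G. residue_functional Q m x = c} \<subseteq> A"
        using x1 by (auto simp: A_def e_mod) (simp add: e_diff, simp add: e_def)
    qed (rule finAB)
  next
    case True
    show ?thesis by (simp only: True card.empty)
  qed
  have "?G = (\<Union>c\<in>UNIV. {x \<in> ?G. residue_functional Q m x = c})" by auto
  hence "card ?G \<le> (\<Sum>c\<in>(UNIV :: 'a set). card {x \<in> ?G. residue_functional Q m x = c})"
    by (metis card_UN_le finite_class.finite_UNIV)
  also have "\<dots> \<le> (\<Sum>c\<in>(UNIV :: 'a set). card A)" by (intro sum_mono fibre)
  finally have GA: "poly_abs Q \<le> q * card A" by (simp add: card_residue_ring[OF Q] q_def)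
  have "\<not> Q dvd m" using m residue_ring_dvd_diff_iff[of m Q 0] by (simp add: mem_residue_ring)
  then obtain z where z: "e z \<noteq> 1"
    using residue_functional_nondegenerate[OF Q] residue_functional_commute unfolding e_def by metis
  have "card A \<le> card B"
  proof (rule card_inj_on_le[of "\<lambda>x. (x + z) mod Q"])
    show "inj_on (\<lambda>x. (x + z) mod Q) A"
    proof (rule inj_onI)
      fix x y assume xy: "x \<in> A" "y \<in> A" "(x + z) mod Q = (y + z) mod Q"
      hence "Q dvd (x + z) - (y + z)" by (simp only: mod_eq_dvd_iff)
      thus "x = y" using xy residue_ring_dvd_diff_iff[of x Q y] by (simp add: A_def)
    qed
    show "(\<lambda>x. (x + z) mod Q) ` A \<subseteq> B" using z by (auto simp: A_def B_def e_mod e_add)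
  qed (rule finAB)
  hence "(poly_abs Q)\<^sup>2 \<le> (q * card A) * (q * card B)"
    unfolding power2_eq_square by (intro mult_mono GA order_trans[OF GA]) auto
  hence "real ((poly_abs Q)\<^sup>2) \<le> real ((q * card A) * (q * card B))" by (rule of_nat_mono)
  hence "(real (poly_abs Q))\<^sup>2 \<le> (real q)\<^sup>2 * (real (card A) * real (card B))"
    by (simp add: power2_eq_square mult_ac)
  moreover have "real q > 0" by (simp add: q_def)
  ultimately have "1 / (real q)\<^sup>2 * (real (poly_abs Q))\<^sup>2 \<le> real (card A) * real (card B)"
    by (simp add: field_simps)
  thus ?thesis by (simp add: A_def B_def q_def)
qed

context separable_sum
begin

lemma left_factor:
  assumes "\<not> generates"
  obtains d \<xi> P' where "frobenius_supported d" "degree d > 1" "\<forall>i\<in>{1..n}. \<eta> i = d \<circ>\<^sub>p \<xi> i"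
    "\<forall>y. P \<circ>\<^sub>p y = d \<circ>\<^sub>p P' y"
proof (rule common_left_factor[OF \<eta> assms[unfolded generates_def]])
  fix d \<xi>
  assume d: "frobenius_supported d" "degree d > 1" "\<And>i. i \<in> {1..n} \<Longrightarrow> \<eta> i = d \<circ>\<^sub>p \<xi> i"
  have "P \<circ>\<^sub>p y = d \<circ>\<^sub>p (\<Sum>i=1..n. \<xi> i \<circ>\<^sub>p (y ^ r i))" for y
  proof -
    have "P \<circ>\<^sub>p y = (\<Sum>i=1..n. d \<circ>\<^sub>p (\<xi> i \<circ>\<^sub>p (y ^ r i)))"
      unfolding P_pcompose by (intro sum.cong refl) (simp add: d(3) pcompose_assoc)
    thus ?thesis by (simp add: additive.sum[OF frobenius_supported_additive[OF d(1)]])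
  qed
  thus ?thesis
    using d by (intro that[of d \<xi> "\<lambda>y. \<Sum>i=1..n. \<xi> i \<circ>\<^sub>p (y ^ r i)"]) auto
qed

lemma ex_obstructed_modulus:
  assumes "\<not> generates"
  obtains Q m where "Q \<in> moduli" "D < lpf Q" "m \<in> residue_ring Q" "m \<noteq> 0"
    "\<And>y. \<psi> (residue_functional Q m (P \<circ>\<^sub>p y)) = 1"
    "\<And>i y. i \<in> {1..n} \<Longrightarrow> \<psi> (residue_functional Q m (\<eta> i \<circ>\<^sub>p y)) = 1"
proof -
  obtain d \<xi> P' where d: "frobenius_supported d" "degree d > 1" "\<forall>i\<in>{1..n}. \<eta> i = d \<circ>\<^sub>p \<xi> i"
    "\<forall>y. P \<circ>\<^sub>p y = d \<circ>\<^sub>p P' y" by (rule left_factor[OF assms])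
  obtain Q g where Q: "Q \<in> moduli" "D < lpf Q" "\<not> Q dvd g" "Q dvd d \<circ>\<^sub>p g"
    using ex_noninjective_modulus[OF frobenius_supported_coeff_0[OF d(1)] d(2)] by blast
  obtain m where m: "m \<in> residue_ring Q" "m \<noteq> 0" "\<And>z. \<psi> (residue_functional Q m (d \<circ>\<^sub>p z)) = 1"
    using ex_annihilating_residue_functional[OF d(1) Q(1,3,4)] by blast
  have "\<psi> (residue_functional Q m (\<eta> i \<circ>\<^sub>p y)) = 1" if "i \<in> {1..n}" for i y
    using d(3) that by (simp add: pcompose_assoc[symmetric] m(3))
  thus ?thesis using that[OF Q(1,2) m(1,2)] m(3) d(4) by simp
qed

text \<open>The character e given by m is invariant under x |-> x + P(y) but has mean zero. It is
  itself the extremal test function, its kernel contains all the images of the \<eta>_i, and its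
  kernel and complement form the pair of sets.\<close>

lemma obstruction:
  assumes Q: "Q \<in> moduli" and m: "m \<in> residue_ring Q" "m \<noteq> 0"
    and P1: "\<And>y. \<psi> (residue_functional Q m (P \<circ>\<^sub>p y)) = 1"
    and \<eta>1: "\<And>i y. i \<in> {1..n} \<Longrightarrow> \<psi> (residue_functional Q m (\<eta> i \<circ>\<^sub>p y)) = 1"
  shows obstruction_mean_deviation: "mean_deviation P Q \<ge> 1"
    and obstruction_subgroups: "sum_image_subgroups Q \<eta> n \<noteq> residue_ring Q"
    and obstruction_sets: "\<exists>A B. A \<subseteq> residue_ring Q \<and> B \<subseteq> residue_ring Q \<and>
          real (card A) * real (card B) \<ge> 1 / (CARD('a))\<^sup>2 * (real (poly_abs Q))\<^sup>2 \<and>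
          \<not> (\<exists>x\<in>residue_ring Q. \<exists>y\<in>residue_ring Q. x \<in> A \<and> (x + P \<circ>\<^sub>p y) mod Q \<in> B)"
proof -
  let ?G = "residue_ring Q"
  note fin = finite_residue_ring[OF Q] residue_ring_nonempty[OF Q]
  define e where "e x = \<psi> (residue_functional Q m x)" for x
  have e_mod: "e (x mod Q) = e x" for x
    unfolding e_def by (rule psi_additive_mod[OF residue_functional_additive residue_functional_periodic dvd_mod_diff])
  have e_add: "e (x + y) = e x * e y" for x y
    by (simp add: e_def additive.add[OF residue_functional_additive] psi_add)
  have eP: "e ((x + P \<circ>\<^sub>p y) mod Q) = e x" for x y
    unfolding e_mod e_add by (simp add: P1 e_def)
  have "\<not> Q dvd m" using m residue_ring_dvd_diff_iff[of m Q 0] by (simp add: mem_residue_ring)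
  then obtain z where z: "e z \<noteq> 1"
    using residue_functional_nondegenerate[OF Q] residue_functional_commute unfolding e_def by metis
  have "average ?G e = 0" unfolding e_def[abs_def]
    using average_additive_char_eq_0[OF residue_functional_additive residue_functional_periodic] z e_def by metis
  hence "deviation P Q e x = e x" for x
    using average_const[OF fin] by (simp add: deviation_def eP)
  hence "L2_norm_residue Q (deviation P Q e) = 1"
    by (intro L2_norm_residue_unimodular[OF Q]) (simp add: e_def)
  moreover have "L2_norm_residue Q e = 1"
    by (intro L2_norm_residue_unimodular[OF Q]) (simp add: e_def)
  ultimately show "mean_deviation P Q \<ge> 1" using mean_deviation_ge[OF Q, of e P] by simp
  show "sum_image_subgroups Q \<eta> n \<noteq> ?G"
  proof
    assume "sum_image_subgroups Q \<eta> n = ?G"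
    hence "z mod Q \<in> sum_image_subgroups Q \<eta> n" by simp
    then obtain h where h: "z mod Q = (\<Sum>i=1..n. h i) mod Q" "\<forall>i\<in>{1..n}. h i \<in> image_subgroup Q (\<eta> i)"
      unfolding sum_image_subgroups_def by blast
    have "e (h i) = 1" if i: "i \<in> {1..n}" for i
    proof -
      obtain y where "h i = (\<eta> i \<circ>\<^sub>p y) mod Q" using bspec[OF h(2) i] unfolding image_subgroup_def by blast
      thus ?thesis using \<eta>1[OF i] by (simp add: e_mod) (simp add: e_def)
    qed
    moreover have "e (\<Sum>i=1..n. h i) = (\<Prod>i=1..n. e (h i))"
      by (simp add: e_def additive.sum[OF residue_functional_additive] psi_sum)
    ultimately have "e (z mod Q) = 1" unfolding h(1) e_mod by simp
    thus False using z by (simp add: e_mod)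
  qed
  show "\<exists>A B. A \<subseteq> ?G \<and> B \<subseteq> ?G \<and>
          real (card A) * real (card B) \<ge> 1 / (CARD('a))\<^sup>2 * (real (poly_abs Q))\<^sup>2 \<and>
          \<not> (\<exists>x\<in>?G. \<exists>y\<in>?G. x \<in> A \<and> (x + P \<circ>\<^sub>p y) mod Q \<in> B)"
    using ex_dense_avoiding_pair[OF Q m] eP
    by (intro exI[of _ "{x \<in> ?G. e x = 1}"] exI[of _ "{x \<in> ?G. e x \<noteq> 1}"]) (auto simp: e_def)
qed

end


section \<open>The torus: coordinates and topology\<close>

unbundle fps_syntax

lemma fls_of_poly_pCons:
  "fls_of_poly (pCons c p) = fls_const c + fls_X_inv * fls_of_poly (p :: 'a::field poly)"
  by (simp add: fls_of_poly_def map_poly_pCons)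

lemma fls_of_poly_nth:
  "fls_of_poly p $$ k = (if k \<le> 0 then coeff (p :: 'a::field poly) (nat (- k)) else 0)"
proof (induction p arbitrary: k)
  case 0
  show ?case by (simp add: fls_of_poly_0)
next
  case (pCons c p)
  have "nat (- k) = Suc (nat (- (k + 1)))" if "k < 0" using that by simp
  thus ?case
    by (cases "k < 0"; cases "k = 0")
       (auto simp: fls_of_poly_pCons fls_X_inv_times_conv_shift pCons.IH coeff_pCons)
qed

lemma fls_of_poly_inject: "fls_of_poly p = fls_of_poly q \<longleftrightarrow> p = q"
proof
  assume eq: "fls_of_poly p = fls_of_poly q"
  show "p = q"
  proof (rule poly_eqI)
    fix j show "coeff p j = coeff q j"
      using arg_cong[OF eq, of "\<lambda>f. f $$ (- int j)"] by (simp add: fls_of_poly_nth)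
  qed
qed simp

lemma fls_of_poly_smult: "fls_of_poly (smult c p) = fls_const c * fls_of_poly p"
  by (rule fls_eqI) (simp add: fls_of_poly_nth)

lemma fls_of_poly_mult: "fls_of_poly (p * q) = fls_of_poly p * fls_of_poly q"
  by (induction p) (simp_all add: fls_of_poly_0 fls_of_poly_pCons fls_of_poly_add fls_of_poly_smult algebra_simps)

lemma range_fls_of_poly_iff: "f \<in> range fls_of_poly \<longleftrightarrow> (\<forall>j. f $$ (int j + 1) = (0 :: 'a::field))"
proof
  assume f: "\<forall>j. f $$ (int j + 1) = 0"
  define n where "n = nat (- fls_subdegree f)"
  define p where "p = (\<Sum>j\<le>n. monom (f $$ (- int j)) j)"
  have cp: "coeff p j = (if j \<le> n then f $$ (- int j) else 0)" for j
    by (simp add: p_def coeff_sum coeff_monom)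
  have "f = fls_of_poly p"
  proof (rule fls_eqI)
    fix k
    show "f $$ k = fls_of_poly p $$ k"
    proof (cases "k \<le> 0")
      case True
      have "f $$ k = 0" if "nat (- k) > n"
        using that True by (intro fls_eq0_below_subdegree) (simp add: n_def)
      thus ?thesis using True by (auto simp: fls_of_poly_nth cp not_le)
    next
      case False
      hence "k = int (nat (k - 1)) + 1" by simp
      hence "f $$ k = 0" using f by metis
      thus ?thesis using False by (simp add: fls_of_poly_nth)
    qed
  qed
  thus "f \<in> range fls_of_poly" by blast
qed (auto simp: fls_of_poly_nth)

text \<open>Digit j is the coefficient of t^(-j-1). The formal variable is 1/t, so the indices up to
  0 form the polynomial part that the quotient forgets.\<close>

lift_definition torus_coeff :: "'a::field laurent_torus \<Rightarrow> nat \<Rightarrow> 'a" is "\<lambda>f j. f $$ (int j + 1)"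
proof -
  fix f g :: "'a fls" assume "f - g \<in> range fls_of_poly"
  hence "\<forall>j. (f - g) $$ (int j + 1) = 0" using range_fls_of_poly_iff by blast
  thus "(\<lambda>j. f $$ (int j + 1)) = (\<lambda>j. g $$ (int j + 1))" by (auto simp: fun_eq_iff)
qed

lemma torus_coeff_abs [simp]: "torus_coeff (abs_laurent_torus f) j = f $$ (int j + 1)"
  by (rule torus_coeff.abs_eq[THEN fun_cong])

lemma torus_coeff_0 [simp]: "torus_coeff 0 j = 0"
  by transfer simp

lemma torus_coeff_add [simp]: "torus_coeff (x + y) j = torus_coeff x j + torus_coeff y j"
  by transfer simp

lemma torus_coeff_uminus [simp]: "torus_coeff (- x) j = - torus_coeff x j"
  by transfer simp

lemma torus_coeff_diff [simp]: "torus_coeff (x - y) j = torus_coeff x j - torus_coeff y j"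
  by (simp add: diff_conv_add_uminus del: add_uminus_conv_diff)

lemma torus_eqI: "(\<And>j. torus_coeff x j = torus_coeff y j) \<Longrightarrow> x = y"
  by transfer (simp add: range_fls_of_poly_iff)

definition fls_of_digits :: "(nat \<Rightarrow> 'a::field) \<Rightarrow> 'a fls" where
  "fls_of_digits a = fps_to_fls (Abs_fps (\<lambda>n. if n = 0 then 0 else a (n - 1)))"

lemma fls_of_digits_nth [simp]: "fls_of_digits a $$ k = (if k \<le> 0 then 0 else a (nat k - 1))"
  by (auto simp: fls_of_digits_def fps_to_fls_nth)

lemma fls_of_digits_nth_Suc [simp]: "fls_of_digits a $$ (int j + 1) = a j"
  by (simp add: nat_add_distrib)

definition torus_of_digits :: "(nat \<Rightarrow> 'a::field) \<Rightarrow> 'a laurent_torus" where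
  "torus_of_digits a = abs_laurent_torus (fls_of_digits a)"

lemma torus_coeff_of_digits [simp]: "torus_coeff (torus_of_digits a) j = a j"
  by (simp add: torus_of_digits_def del: fls_of_digits_nth)

lemma torus_exhaust: obtains f where "x = abs_laurent_torus f"
  by (metis Quotient3_abs_rep Quotient3_laurent_torus)

lemma abs_laurent_torus_add: "abs_laurent_torus (f + g) = abs_laurent_torus f + abs_laurent_torus g"
  by (rule torus_eqI) simp

lemma open_torus_iff:
  "open U \<longleftrightarrow> (\<forall>x\<in>U. \<exists>k. \<forall>y. (\<forall>j<k. torus_coeff y j = torus_coeff x j) \<longrightarrow> y \<in> (U :: 'a::field laurent_torus set))"
proof
  assume U: "open U"
  show "\<forall>x\<in>U. \<exists>k. \<forall>y. (\<forall>j<k. torus_coeff y j = torus_coeff x j) \<longrightarrow> y \<in> U"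
  proof
    fix x assume x: "x \<in> U"
    obtain f where f: "x = abs_laurent_torus f" by (rule torus_exhaust)
    have "open (abs_laurent_torus -` U)" using U by (simp add: open_laurent_torus_def)
    moreover have "f \<in> abs_laurent_torus -` U" using x f by simp
    ultimately obtain r where r: "r > 0" "{g. dist g f < r} \<subseteq> abs_laurent_torus -` U"
      unfolding open_fls_def by blast
    obtain k where k: "inverse (2 ^ k) < r"
      using r(1) real_arch_pow_inv[of r "1/2"] by (auto simp: power_one_over inverse_eq_divide)
    show "\<exists>k. \<forall>y. (\<forall>j<k. torus_coeff y j = torus_coeff x j) \<longrightarrow> y \<in> U"
    proof (intro exI[of _ k] allI impI)
      fix y assume y: "\<forall>j<k. torus_coeff y j = torus_coeff x j"
      \<comment> \<open>A lift of y is reached from the given lift f of x by changing fractional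
        digits only, so it stays as close to f as y is to x.\<close>
      define h where "h = fls_of_digits (\<lambda>j. torus_coeff y j - torus_coeff x j)"
      have abs: "abs_laurent_torus (f + h) = y" by (rule torus_eqI) (simp add: f h_def del: fls_of_digits_nth)
      have "dist (f + h) f < r"
      proof (cases "h = 0")
        case False
        have "fls_subdegree h \<ge> int k"
        proof (rule fls_subdegree_geI[OF False])
          fix i assume "i < int k"
          hence "i \<le> 0 \<or> nat i - 1 < k" by arith
          thus "h $$ i = 0" using y by (auto simp: h_def)
        qed
        hence "dist (f + h) f \<le> inverse (2 ^ k)"
          using False by (auto simp: dist_fls_def intro!: le_imp_inverse_le power_increasing)
        thus ?thesis using k by simp
      qed (use r in simp)
      hence "f + h \<in> abs_laurent_torus -` U" using r(2) by blast
      thus "y \<in> U" by (simp add: abs)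
    qed
  qed
next
  assume U: "\<forall>x\<in>U. \<exists>k. \<forall>y. (\<forall>j<k. torus_coeff y j = torus_coeff x j) \<longrightarrow> y \<in> U"
  show "open U"
    unfolding open_laurent_torus_def open_fls_def
  proof
    fix f assume "f \<in> abs_laurent_torus -` U"
    then obtain k where k: "\<And>y. (\<forall>j<k. torus_coeff y j = torus_coeff (abs_laurent_torus f) j) \<Longrightarrow> y \<in> U"
      using U by blast
    show "\<exists>r>0. {g. dist g f < r} \<subseteq> abs_laurent_torus -` U"
    proof (intro exI[of _ "inverse (2 ^ k)"] conjI subsetI)
      fix g assume "g \<in> {g. dist g f < inverse (2 ^ k)}"
      hence g: "dist g f < inverse (2 ^ k)" by simp
      have "g $$ (int j + 1) = f $$ (int j + 1)" if j: "j < k" for j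
      proof (cases "g = f")
        case False
        have le1: "inverse (2 ^ k :: real) \<le> 1" by (simp add: inverse_le_1_iff)
        have ge0: "fls_subdegree (g - f) \<ge> 0"
        proof (rule ccontr)
          assume "\<not> ?thesis"
          hence "dist g f = 2 ^ nat (- fls_subdegree (g - f))" using False by (simp add: dist_fls_def)
          moreover have "(1 :: real) \<le> 2 ^ nat (- fls_subdegree (g - f))" by simp
          ultimately show False using g le1 by linarith
        qed
        hence "inverse (2 ^ nat (fls_subdegree (g - f))) < inverse (2 ^ k :: real)"
          using g False by (simp add: dist_fls_def)
        hence "(2 :: real) ^ k < 2 ^ nat (fls_subdegree (g - f))"
          by (metis inverse_less_imp_less zero_less_numeral zero_less_power)
        hence "k < nat (fls_subdegree (g - f))" by simp
        hence "(g - f) $$ (int j + 1) = 0" using j by (intro fls_eq0_below_subdegree) simp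
        thus ?thesis by simp
      qed simp
      thus "g \<in> abs_laurent_torus -` U" by (auto intro: k)
    qed simp
  qed
qed

section \<open>Prefixes, cylinders and compactness\<close>

definition torus_prefix :: "nat \<Rightarrow> 'a::field laurent_torus \<Rightarrow> 'a list" where
  "torus_prefix k x = map (torus_coeff x) [0..<k]"

lemma length_torus_prefix [simp]: "length (torus_prefix k x) = k"
  by (simp add: torus_prefix_def)

lemma torus_prefix_eq_iff: "torus_prefix k x = torus_prefix k y \<longleftrightarrow> (\<forall>j<k. torus_coeff x j = torus_coeff y j)"
  by (auto simp: torus_prefix_def)

lemma torus_prefix_Suc: "torus_prefix (Suc k) x = torus_prefix k x @ [torus_coeff x k]"
  by (simp add: torus_prefix_def)

lemma torus_prefix_0 [simp]: "torus_prefix 0 x = []"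
  by (simp add: torus_prefix_def)

lemma ex_torus_prefix: obtains x where "torus_prefix (length xs) x = (xs :: 'a::field list)"
proof -
  have "torus_prefix (length xs) (torus_of_digits (\<lambda>j. xs ! j)) = xs"
    by (rule nth_equalityI) (simp_all add: torus_prefix_def)
  thus ?thesis by (rule that)
qed

text \<open>The cosets of the open subgroups of points whose first digits vanish. Indexing them by
  lists makes them a countable base with a tree structure, in which \<open>xs @ [c]\<close> runs
  over the children of \<open>xs\<close>.\<close>

definition cylinder :: "'a::field list \<Rightarrow> 'a laurent_torus set" where
  "cylinder xs = {x. torus_prefix (length xs) x = xs}"

lemma cylinder_prefix [simp]: "x \<in> cylinder (torus_prefix k x)"
  by (simp add: cylinder_def)

lemma cylinder_nonempty: "cylinder xs \<noteq> {}"
  using ex_torus_prefix[of xs] by (auto simp: cylinder_def)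

lemma cylinder_Nil [simp]: "cylinder [] = UNIV"
  by (simp add: cylinder_def)

lemma cylinder_snoc: "cylinder (xs @ [c]) = {x \<in> cylinder xs. torus_coeff x (length xs) = c}"
  by (auto simp: cylinder_def torus_prefix_Suc)

lemma open_cylinder: "open (cylinder xs)"
  unfolding open_torus_iff
proof
  fix x assume x: "x \<in> cylinder xs"
  show "\<exists>k. \<forall>y. (\<forall>j<k. torus_coeff y j = torus_coeff x j) \<longrightarrow> y \<in> cylinder xs"
  proof (intro exI[of _ "length xs"] allI impI)
    fix y assume "\<forall>j<length xs. torus_coeff y j = torus_coeff x j"
    hence "torus_prefix (length xs) y = torus_prefix (length xs) x" by (simp only: torus_prefix_eq_iff)
    thus "y \<in> cylinder xs" using x by (simp add: cylinder_def)
  qed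
qed

lemma open_torus_cylinder:
  assumes "open U" "x \<in> U"
  obtains k where "cylinder (torus_prefix k x) \<subseteq> U"
proof -
  obtain k where k: "\<forall>y. (\<forall>j<k. torus_coeff y j = torus_coeff x j) \<longrightarrow> y \<in> U"
    using assms unfolding open_torus_iff by blast
  have "cylinder (torus_prefix k x) \<subseteq> U"
    using k by (auto simp: cylinder_def torus_prefix_eq_iff)
  thus ?thesis using that by blast
qed

text \<open>Koenig's lemma: a cylinder without a finite subcover has such a child, as there are
  finitely many digits. The infinite branch is a point; an open set of the cover around it contains
  some cylinder of the branch.\<close>

lemma compact_torus: "compact (UNIV :: 'a::finite_field laurent_torus set)"
  unfolding compact_eq_Heine_Borel
proof (intro allI impI, elim conjE)
  fix \<C> :: "'a laurent_torus set set"
  assume op: "\<forall>c\<in>\<C>. open c" and cover: "UNIV \<subseteq> \<Union>\<C>"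
  define good where "good xs \<longleftrightarrow> (\<exists>\<D>\<subseteq>\<C>. finite \<D> \<and> cylinder xs \<subseteq> \<Union>\<D>)" for xs :: "'a list"
  have ext: "\<exists>c. \<not> good (xs @ [c])" if "\<not> good xs" for xs
  proof (rule ccontr)
    assume "\<nexists>c. \<not> good (xs @ [c])"
    hence "\<forall>c. good (xs @ [c])" by blast
    then obtain \<D> where D: "\<And>c. \<D> c \<subseteq> \<C>" "\<And>c. finite (\<D> c)" "\<And>c. cylinder (xs @ [c]) \<subseteq> \<Union>(\<D> c)"
      unfolding good_def by metis
    have "cylinder xs \<subseteq> \<Union>(\<Union>c. \<D> c)"
    proof
      fix x assume "x \<in> cylinder xs"
      hence "x \<in> cylinder (xs @ [torus_coeff x (length xs)])" by (simp add: cylinder_snoc)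
      thus "x \<in> \<Union>(\<Union>c. \<D> c)" using D(3) by blast
    qed
    hence "good xs" unfolding good_def using D by (intro exI[of _ "\<Union>c. \<D> c"]) auto
    thus False using that by simp
  qed
  have "good []"
  proof (rule ccontr)
    assume "\<not> good []"
    then obtain s where s: "\<And>n. \<not> good (s n) \<and> length (s n) = n" "\<And>n. \<exists>c. s (Suc n) = s n @ [c]"
      using dependent_nat_choice[of "\<lambda>n xs. \<not> good xs \<and> length xs = n" "\<lambda>n xs ys. \<exists>c. ys = xs @ [c]"] ext
      by (metis length_append_singleton list.size(3))
    define x where "x = torus_of_digits (\<lambda>j. last (s (Suc j)))"
    have pre: "torus_prefix n x = s n" for n
    proof (induction n)
      case 0
      show ?case using s(1)[of 0] by simp
    next
      case (Suc n)
      obtain c where c: "s (Suc n) = s n @ [c]" using s(2) by blast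
      have "torus_coeff x n = c" by (simp add: x_def c)
      thus ?case by (simp only: torus_prefix_Suc Suc.IH c)
    qed
    obtain c where c: "c \<in> \<C>" "x \<in> c" using cover by blast
    then obtain k where "cylinder (torus_prefix k x) \<subseteq> c" using op open_torus_cylinder by metis
    hence "good (s k)" unfolding good_def pre using c by (intro exI[of _ "{c}"]) auto
    thus False using s(1) by blast
  qed
  thus "\<exists>\<D>\<subseteq>\<C>. finite \<D> \<and> UNIV \<subseteq> \<Union>\<D>" by (simp add: good_def)
qed

text \<open>A Lebesgue number argument: finitely many cylinders on which g varies little cover the
  torus, and k is their largest length.\<close>

lemma continuous_torus_uniform:
  fixes g :: "'a::finite_field laurent_torus \<Rightarrow> complex"
  assumes g: "continuous_on UNIV g" and e: "e > 0"
  obtains k where "\<And>x y. torus_prefix k x = torus_prefix k y \<Longrightarrow> dist (g x) (g y) < e"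
proof -
  have "\<exists>k. cylinder (torus_prefix k x) \<subseteq> g -` ball (g x) (e / 2)" for x
  proof -
    have "open (g -` ball (g x) (e / 2))" using g by (simp add: continuous_on_open_vimage)
    moreover have "x \<in> g -` ball (g x) (e / 2)" using e by simp
    ultimately show ?thesis using open_torus_cylinder by metis
  qed
  then obtain k where k: "\<And>x. cylinder (torus_prefix (k x) x) \<subseteq> g -` ball (g x) (e / 2)" by metis
  have "UNIV \<subseteq> \<Union>(range (\<lambda>x. cylinder (torus_prefix (k x) x)))" by auto
  then obtain T where T: "T \<subseteq> UNIV" "finite T" "UNIV \<subseteq> (\<Union>x\<in>T. cylinder (torus_prefix (k x) x))"
    using compactE_image[OF compact_torus, of UNIV "\<lambda>x. cylinder (torus_prefix (k x) x)"] open_cylinder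
    by (metis UNIV_I)
  define K where "K = Max (k ` T)"
  have "dist (g x) (g y) < e" if xy: "torus_prefix K x = torus_prefix K y" for x y
  proof -
    obtain z where z: "z \<in> T" "x \<in> cylinder (torus_prefix (k z) z)" using T(3) by blast
    have "k z \<le> K" unfolding K_def using z T by (intro Max_ge) auto
    hence "torus_prefix (k z) y = torus_prefix (k z) x" using xy by (auto simp: torus_prefix_eq_iff)
    hence "y \<in> cylinder (torus_prefix (k z) z)" using z by (simp add: cylinder_def)
    hence "x \<in> g -` ball (g z) (e / 2)" "y \<in> g -` ball (g z) (e / 2)" using k z by blast+
    hence "dist (g x) (g z) < e / 2" "dist (g y) (g z) < e / 2" by (auto simp: dist_commute)
    thus ?thesis by (rule dist_triangle_half_l)
  qed
  thus ?thesis using that by blast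
qed


section \<open>Measures on the torus\<close>

lemma countable_lists_finite: "countable (UNIV :: 'a::finite list set)"
proof -
  have "finite {xs :: 'a list. length xs = k}" for k
    using finite_lists_length_eq[of "UNIV :: 'a set" k] by simp
  hence "countable (\<Union>k. {xs :: 'a list. length xs = k})" by (intro countable_UN) (auto intro: countable_finite)
  moreover have "(\<Union>k. {xs :: 'a list. length xs = k}) = UNIV" by auto
  ultimately show ?thesis by simp
qed

lemma open_torus_Union:
  assumes "open U"
  shows "U = \<Union>(cylinder ` {xs. cylinder xs \<subseteq> U})"
proof
  show "U \<subseteq> \<Union>(cylinder ` {xs. cylinder xs \<subseteq> U})"
  proof
    fix x assume "x \<in> U"
    then obtain k where "cylinder (torus_prefix k x) \<subseteq> U" using open_torus_cylinder[OF assms] by metis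
    thus "x \<in> \<Union>(cylinder ` {xs. cylinder xs \<subseteq> U})" using cylinder_prefix by blast
  qed
qed blast

lemma sets_borel_torus_eq:
  fixes \<A> :: "'a::finite_field laurent_torus set set"
  assumes "range cylinder \<subseteq> \<A>" "\<And>A. A \<in> \<A> \<Longrightarrow> open A"
  shows "sets borel = sigma_sets UNIV \<A>"
proof
  have "sets borel = sigma_sets UNIV {U :: 'a laurent_torus set. open U}"
    by (simp add: borel_def)
  moreover have "U \<in> sigma_sets UNIV \<A>" if "open U" for U
  proof -
    have "\<Union>(cylinder ` {xs. cylinder xs \<subseteq> U}) \<in> sigma_sets UNIV \<A>"
      using assms(1) countable_lists_finite[where 'a = 'a]
      by (intro sigma_sets_UNION) (auto intro!: sigma_sets.Basic intro: countable_subset)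
    thus ?thesis using open_torus_Union[OF that] by simp
  qed
  ultimately show "sets borel \<subseteq> sigma_sets UNIV \<A>"
    using sigma_sets_mono[of "{U. open U}" UNIV \<A>] by auto
  show "sigma_sets UNIV \<A> \<subseteq> sets (borel :: 'a laurent_torus measure)"
    using assms(2) by (intro sets.sigma_sets_subset[of _ borel, simplified]) auto
qed

lemma cylinder_Int:
  assumes "length xs \<le> length ys"
  shows "cylinder xs \<inter> cylinder ys = (if take (length xs) ys = xs then cylinder ys else {})"
proof -
  have "torus_prefix (length xs) y = take (length xs) ys" if "y \<in> cylinder ys" for y
    using that assms unfolding cylinder_def torus_prefix_def
    by (metis (mono_tags, lifting) add_0 mem_Collect_eq take_map take_upt)
  thus ?thesis by (auto simp: cylinder_def)
qed

lemma measure_torus_eqI: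
  fixes M N :: "'a::finite_field laurent_torus measure"
  assumes "sets M = sets borel" "sets N = sets borel" "finite_measure M"
    and eq: "\<And>xs. emeasure M (cylinder xs) = emeasure N (cylinder xs)"
  shows "M = N"
proof (rule measure_eqI_generator_eq[where E = "insert {} (range cylinder)" and \<Omega> = UNIV and A = "\<lambda>_. UNIV"])
  have "cylinder xs \<inter> cylinder ys \<in> insert {} (range cylinder)" for xs ys :: "'a list"
    using cylinder_Int[of xs ys] cylinder_Int[of ys xs] by (cases "length xs \<le> length ys") (auto simp: Int_commute)
  thus "Int_stable (insert {} (range cylinder) :: 'a laurent_torus set set)"
    by (auto simp: Int_stable_def)
  have "sets borel = sigma_sets UNIV (insert {} (range cylinder) :: 'a laurent_torus set set)"
    by (rule sets_borel_torus_eq) (auto simp: open_cylinder)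
  thus "sets M = sigma_sets UNIV (insert {} (range cylinder))"
    "sets N = sigma_sets UNIV (insert {} (range cylinder))" using assms by simp_all
  show "range (\<lambda>_. UNIV) \<subseteq> insert {} (range (cylinder :: 'a list \<Rightarrow> _))"
    using cylinder_Nil by (metis image_subset_iff insertCI rangeI)
qed (use eq finite_measure.emeasure_finite[OF assms(3)] in auto)

text \<open>The weights define a finitely additive function on the sets that depend on finitely many
  digits, and Caratheodory's theorem extends it to the Borel sets. Both the Haar measure and the
  spectral measures arise in this way.\<close>

lemma ex_cylinder_measure:
  fixes w :: "'a::finite_field list \<Rightarrow> real"
  assumes nonneg: "\<And>xs. w xs \<ge> 0" and cons: "\<And>xs. w xs = (\<Sum>c\<in>UNIV. w (xs @ [c]))"
  obtains M :: "'a laurent_torus measure"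
  where "sets M = sets borel" "\<And>xs. emeasure M (cylinder xs) = ennreal (w xs)"
proof -
  define level where "level k U \<longleftrightarrow> (\<forall>x y. torus_prefix k x = torus_prefix k y \<longrightarrow> (x \<in> U \<longleftrightarrow> y \<in> U))"
    for k and U :: "'a laurent_torus set"
  define \<A> where "\<A> = {U. \<exists>k. level k U}"
  define S where "S k U = {xs. length xs = k \<and> cylinder xs \<subseteq> U}" for k and U :: "'a laurent_torus set"
  define m where "m k U = (\<Sum>xs\<in>S k U. w xs)" for k U
  have finS: "finite (S k U)" for k U
    using finite_lists_length_eq[of "UNIV :: 'a set" k] by (auto simp: S_def intro: finite_subset[rotated])
  have level_mono: "level l U" if "level k U" "k \<le> l" for k l U
    using that unfolding level_def torus_prefix_eq_iff by (meson less_le_trans)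
  have in_iff: "cylinder xs \<subseteq> U \<longleftrightarrow> x \<in> U" if "level (length xs) U" "x \<in> cylinder xs" for xs U x
  proof
    assume "x \<in> U"
    show "cylinder xs \<subseteq> U"
    proof
      fix y assume "y \<in> cylinder xs"
      hence "torus_prefix (length xs) x = torus_prefix (length xs) y" using that(2) by (simp add: cylinder_def)
      thus "y \<in> U" using that(1) \<open>x \<in> U\<close> unfolding level_def by blast
    qed
  qed (use that in blast)
  have m_Suc: "m (Suc k) U = m k U" if U: "level k U" for k U
  proof -
    have "S (Suc k) U = (\<lambda>(xs, c). xs @ [c]) ` (S k U \<times> UNIV)"
    proof (intro equalityI subsetI)
      fix ys assume ys: "ys \<in> S (Suc k) U"
      then obtain xs c where xc: "ys = xs @ [c]" "length xs = k"
        unfolding S_def length_Suc_conv_rev by blast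
      obtain x where x: "x \<in> cylinder ys" using cylinder_nonempty by blast
      hence "x \<in> U" "x \<in> cylinder xs" using ys by (auto simp: S_def xc cylinder_snoc)
      hence "xs \<in> S k U" using in_iff[of xs U x] U xc by (simp add: S_def)
      thus "ys \<in> (\<lambda>(xs, c). xs @ [c]) ` (S k U \<times> UNIV)" using xc by auto
    qed (auto simp: S_def cylinder_snoc)
    hence "m (Suc k) U = (\<Sum>(xs, c)\<in>S k U \<times> UNIV. w (xs @ [c]))"
      by (simp add: m_def sum.reindex inj_on_def case_prod_unfold)
    also have "\<dots> = (\<Sum>xs\<in>S k U. \<Sum>c\<in>UNIV. w (xs @ [c]))" by (rule sum.cartesian_product[symmetric])
    finally show ?thesis by (simp add: m_def cons[symmetric])
  qed
  have m_mono: "m l U = m k U" if "level k U" "k \<le> l" for k l U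
    using that(2)
  proof (induction l rule: dec_induct)
    case (step l)
    thus ?case using m_Suc[of l U] level_mono[OF that(1), of l] by simp
  qed simp
  \<comment> \<open>The least level is merely a canonical choice: by \<open>m_mono\<close> every
    level of U gives the same value.\<close>
  define \<mu> where "\<mu> U = ennreal (m (LEAST k. level k U) U)" for U
  have \<mu>: "\<mu> U = ennreal (m k U)" if "level k U" for k U
    using m_mono[of "LEAST k. level k U" U k] LeastI[of "\<lambda>k. level k U" k] Least_le[of "\<lambda>k. level k U" k] that
    by (simp add: \<mu>_def)
  have open_A: "open U" if U: "U \<in> \<A>" for U
  proof -
    obtain k where "level k U" using U by (auto simp: \<A>_def)
    thus ?thesis unfolding open_torus_iff level_def torus_prefix_eq_iff by blast
  qed
  have common: "\<exists>k. level k U \<and> level k V" if UV: "U \<in> \<A>" "V \<in> \<A>" for U V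
  proof -
    obtain k l where "level k U" "level l V" using UV by (auto simp: \<A>_def)
    hence "level (max k l) U" "level (max k l) V" using level_mono by (meson max.cobounded1 max.cobounded2)+
    thus ?thesis by blast
  qed
  have level_empty: "level 0 {}" by (simp add: level_def)
  have level_Un: "level k (U \<union> V)" and level_Diff: "level k (U - V)" and level_Compl: "level k (- U)"
    if "level k U" "level k V" for k U V
    using that unfolding level_def by blast+
  interpret ring_of_sets UNIV \<A>
  proof (rule ring_of_setsI)
    show "{} \<in> \<A>" using level_empty by (auto simp: \<A>_def)
    show "U \<union> V \<in> \<A>" if "U \<in> \<A>" "V \<in> \<A>" for U V
      using common[OF that] level_Un unfolding \<A>_def by blast
    show "U - V \<in> \<A>" if "U \<in> \<A>" "V \<in> \<A>" for U V
      using common[OF that] level_Diff unfolding \<A>_def by blast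
  qed simp
  have "S 0 {} = {}" using cylinder_nonempty by (auto simp: S_def)
  hence \<mu>_empty: "\<mu> {} = 0" using \<mu>[OF level_empty] by (simp add: m_def)
  have pos: "positive \<A> \<mu>" by (simp add: positive_def \<mu>_empty)
  have add: "Measure_Space.additive \<A> \<mu>"
    unfolding Measure_Space.additive_def
  proof (intro ballI impI)
    fix U V assume UV: "U \<in> \<A>" "V \<in> \<A>" "U \<inter> V = {}"
    then obtain k where k: "level k U" "level k V" using common by blast
    hence kUV: "level k (U \<union> V)" by (rule level_Un)
    have "S k (U \<union> V) = S k U \<union> S k V"
    proof -
      have "cylinder xs \<subseteq> U \<union> V \<longleftrightarrow> cylinder xs \<subseteq> U \<or> cylinder xs \<subseteq> V" if "length xs = k" for xs
      proof -
        obtain x where "x \<in> cylinder xs" using cylinder_nonempty by blast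
        thus ?thesis using in_iff[of xs _ x] k kUV that by simp
      qed
      thus ?thesis by (auto simp: S_def)
    qed
    moreover have "S k U \<inter> S k V = {}"
      using UV(3) cylinder_nonempty unfolding S_def by blast
    ultimately have "m k (U \<union> V) = m k U + m k V" by (simp add: m_def sum.union_disjoint finS)
    moreover have "m k U \<ge> 0" "m k V \<ge> 0" unfolding m_def by (intro sum_nonneg nonneg)+
    ultimately show "\<mu> (U \<union> V) = \<mu> U + \<mu> V" using \<mu> k kUV by (simp add: ennreal_plus)
  qed
  have "\<exists>\<mu>' :: 'a laurent_torus set \<Rightarrow> ennreal. (\<forall>s\<in>\<A>. \<mu>' s = \<mu> s) \<and> measure_space UNIV (sigma_sets UNIV \<A>) \<mu>'"
  proof (rule caratheodory_empty_continuous[OF pos add])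
    show "\<mu> A \<noteq> \<infinity>" for A by (simp add: \<mu>_def)
    fix A :: "nat \<Rightarrow> 'a laurent_torus set"
    assume A: "range A \<subseteq> \<A>" "decseq A" "(\<Inter>i. A i) = {}"
    \<comment> \<open>The sets of the ring are clopen, so by compactness a decreasing sequence with
      empty intersection is eventually empty, which gives continuity at the empty set.\<close>
    have "open (- A i)" for i
    proof -
      obtain k where "level k (A i)" using A(1) by (auto simp: \<A>_def)
      hence "- A i \<in> \<A>" using level_Compl unfolding \<A>_def by blast
      thus ?thesis by (rule open_A)
    qed
    moreover have "UNIV \<subseteq> (\<Union>i. - A i)" using A(3) by auto
    ultimately obtain T where T: "finite T" "UNIV \<subseteq> (\<Union>i\<in>T. - A i)"
      using compactE_image[OF compact_torus, of UNIV "\<lambda>i. - A i"] by (metis UNIV_I)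
    have "A n = {}" if n: "n \<ge> Max (insert 0 T)" for n
    proof -
      have "A n \<subseteq> A i" if "i \<in> T" for i
      proof -
        have "i \<le> n" using n T(1) that by simp
        thus ?thesis using A(2) by (auto simp: decseq_def)
      qed
      thus ?thesis using T(2) by blast
    qed
    hence "eventually (\<lambda>n. \<mu> (A n) = 0) sequentially"
      unfolding eventually_sequentially using \<mu>_empty by metis
    thus "(\<lambda>i. \<mu> (A i)) \<longlonglongrightarrow> 0" by (rule tendsto_eventually)
  qed
  then obtain \<mu>' where \<mu>': "\<forall>s\<in>\<A>. \<mu>' s = \<mu> s" "measure_space UNIV (sigma_sets UNIV \<A>) \<mu>'" by blast
  define M where "M = measure_of UNIV (sigma_sets UNIV \<A>) \<mu>'"
  have cyl_level: "level (length xs) (cylinder xs)" for xs by (auto simp: level_def cylinder_def)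
  hence cylA: "cylinder xs \<in> \<A>" for xs by (auto simp: \<A>_def)
  have borel: "sets borel = sigma_sets UNIV \<A>"
    by (rule sets_borel_torus_eq) (use cylA open_A in auto)
  have "sets M = sets borel"
    unfolding M_def borel by (subst sets_measure_of) (auto simp: sigma_sets_sigma_sets_eq)
  moreover have "emeasure M (cylinder xs) = ennreal (w xs)" for xs
  proof -
    have "emeasure M (cylinder xs) = \<mu>' (cylinder xs)"
      unfolding M_def using \<mu>'(2) cylA
      by (intro emeasure_measure_of_sigma) (auto simp: measure_space_def)
    also have "\<dots> = ennreal (m (length xs) (cylinder xs))" using \<mu>'(1) cylA \<mu>[OF cyl_level] by simp
    also have "S (length xs) (cylinder xs) = {xs}"
    proof -
      have "ys = xs" if ys: "length ys = length xs" "cylinder ys \<subseteq> cylinder xs" for ys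
      proof -
        obtain y where "y \<in> cylinder ys" using cylinder_nonempty by blast
        thus ?thesis using ys by (auto simp: cylinder_def)
      qed
      thus ?thesis by (auto simp: S_def)
    qed
    hence "m (length xs) (cylinder xs) = w xs" by (simp add: m_def)
    finally show ?thesis .
  qed
  ultimately show ?thesis using that by blast
qed


section \<open>Haar measure\<close>

lemma cylinder_translate:
  "(\<lambda>y. y + c) -` cylinder (torus_prefix k x) = cylinder (torus_prefix k (x - c))"
  by (auto simp: cylinder_def torus_prefix_eq_iff eq_diff_eq)

lemma measurable_torus_translation [measurable]:
  "(\<lambda>x. x + c) \<in> borel_measurable (borel :: 'a::field laurent_torus measure)"
proof (rule borel_measurableI)
  fix U :: "'a laurent_torus set" assume U: "open U"
  have "open ((\<lambda>x. x + c) -` U)"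
    unfolding open_torus_iff
  proof
    fix x assume "x \<in> (\<lambda>x. x + c) -` U"
    hence "x + c \<in> U" by simp
    then obtain k where k: "\<forall>y. (\<forall>j<k. torus_coeff y j = torus_coeff (x + c) j) \<longrightarrow> y \<in> U"
      using U unfolding open_torus_iff by blast
    show "\<exists>k. \<forall>y. (\<forall>j<k. torus_coeff y j = torus_coeff x j) \<longrightarrow> y \<in> (\<lambda>x. x + c) -` U"
      by (rule exI[of _ k]) (use k in auto)
  qed
  thus "(\<lambda>x. x + c) -` U \<inter> space borel \<in> sets borel" by simp
qed

lemma cylinder_sets [measurable]: "cylinder xs \<in> sets borel"
  using open_cylinder by (rule borel_open)

lemma space_torus: "sets M = sets borel \<Longrightarrow> space M = (UNIV :: 'a::field laurent_torus set)"
  using sets_eq_imp_space_eq[of M borel] by simp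

lemma finite_lists_of_length [simp]: "finite {xs :: 'a::finite list. length xs = k}"
  using finite_lists_length_eq[of "UNIV :: 'a set" k] by simp

lemma card_lists_of_length: "card {xs :: 'a::finite list. length xs = k} = CARD('a) ^ k"
  using card_lists_length_eq[of "UNIV :: 'a set" k] by simp

lemma function_of_prefix:
  fixes h :: "'a::finite_field list \<Rightarrow> complex"
  shows "h (torus_prefix k x) = (\<Sum>xs\<in>{xs. length xs = k}. h xs * indicator (cylinder xs) x)"
proof -
  have "(\<Sum>xs\<in>{xs. length xs = k}. h xs * indicator (cylinder xs) x)
      = (\<Sum>xs\<in>{xs. length xs = k}. if xs = torus_prefix k x then h xs else 0)"
    by (intro sum.cong refl) (auto simp: cylinder_def indicator_def)
  also have "\<dots> = h (torus_prefix k x)" by simp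
  finally show ?thesis ..
qed

lemma measurable_function_of_prefix:
  fixes h :: "'a::finite_field list \<Rightarrow> complex"
  shows "(\<lambda>x. h (torus_prefix k x)) \<in> borel_measurable borel"
  unfolding function_of_prefix by measurable

lemma integral_function_of_prefix:
  fixes h :: "'a::finite_field list \<Rightarrow> complex"
  assumes M: "sets M = sets borel" "finite_measure M"
  shows "(\<integral>x. h (torus_prefix k x) \<partial>M) = (\<Sum>xs\<in>{xs. length xs = k}. h xs * measure M (cylinder xs))"
    and "integrable M (\<lambda>x. h (torus_prefix k x))"
proof -
  interpret finite_measure M by (rule M)
  have [measurable]: "cylinder xs \<in> sets M" for xs :: "'a list" using M(1) by simp
  have int: "integrable M (\<lambda>x. h xs * indicator (cylinder xs) x :: complex)" for xs
  proof -
    have "integrable M (\<lambda>x. complex_of_real (indicator (cylinder xs) x))"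
      by (intro integrable_of_real integrable_real_indicator) (auto simp: emeasure_eq_measure)
    moreover have "(\<lambda>x. complex_of_real (indicator (cylinder xs) x)) = indicator (cylinder xs)"
      by (auto simp: indicator_def)
    ultimately show ?thesis by simp
  qed
  show "integrable M (\<lambda>x. h (torus_prefix k x))"
    unfolding function_of_prefix by (intro Bochner_Integration.integrable_sum int)
  have "(\<integral>x. h (torus_prefix k x) \<partial>M)
      = (\<Sum>xs\<in>{xs. length xs = k}. \<integral>x. h xs * indicator (cylinder xs) x \<partial>M)"
    unfolding function_of_prefix by (intro Bochner_Integration.integral_sum int)
  also have "\<dots> = (\<Sum>xs\<in>{xs. length xs = k}. h xs * measure M (cylinder xs))"
  proof (intro sum.cong refl)
    fix xs :: "'a list"
    have "(\<integral>x. indicator (cylinder xs) x \<partial>M) = complex_of_real (measure M (cylinder xs))"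
    proof -
      have "(\<integral>x. complex_of_real (indicator (cylinder xs) x) \<partial>M) = complex_of_real (measure M (cylinder xs))"
        by (simp only: integral_complex_of_real integral_indicator) (simp add: space_torus[OF M(1)])
      moreover have "(\<lambda>x. complex_of_real (indicator (cylinder xs) x)) = indicator (cylinder xs)"
        by (auto simp: indicator_def)
      ultimately show ?thesis by simp
    qed
    thus "(\<integral>x. h xs * indicator (cylinder xs) x \<partial>M) = h xs * measure M (cylinder xs)" by simp
  qed
  finally show "(\<integral>x. h (torus_prefix k x) \<partial>M) = (\<Sum>xs\<in>{xs. length xs = k}. h xs * measure M (cylinder xs))" .
qed

text \<open>Any two cylinders of the same length are translates, so invariance makes them share the
  total mass equally; conversely translations permute the cylinders of each length, and these
  determine the measure.\<close>

lemma is_haar_probability_iff: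
  fixes M :: "'a::finite_field laurent_torus measure"
  shows "is_haar_probability M \<longleftrightarrow>
    sets M = sets borel \<and> (\<forall>xs. emeasure M (cylinder xs) = ennreal (1 / CARD('a) ^ length xs))"
proof
  assume M: "is_haar_probability M"
  then interpret prob_space M by (simp add: is_haar_probability_def)
  have sM [measurable_cong]: "sets M = sets borel" and inv: "\<And>c. distr M borel (\<lambda>x. x + c) = M"
    using M by (auto simp: is_haar_probability_def)
  have sp: "space M = UNIV" by (rule space_torus[OF sM])
  have shift: "measure M (cylinder (torus_prefix k x)) = measure M (cylinder (torus_prefix k y))" for k x y
  proof -
    have "measure M (cylinder (torus_prefix k x)) = measure (distr M borel (\<lambda>z. z + (x - y))) (cylinder (torus_prefix k x))"
      by (simp only: inv)
    also have "\<dots> = measure M ((\<lambda>z. z + (x - y)) -` cylinder (torus_prefix k x) \<inter> space M)"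
      by (rule measure_distr) measurable
    also have "\<dots> = measure M (cylinder (torus_prefix k y))" by (simp add: cylinder_translate sp)
    finally show ?thesis .
  qed
  have "measure M (cylinder xs) = 1 / CARD('a) ^ length xs" for xs
  proof -
    define k where "k = length xs"
    have "measure M (cylinder ys) = measure M (cylinder xs)" if ys: "length ys = k" for ys
    proof -
      obtain x where "torus_prefix k x = xs" using ex_torus_prefix[of xs] unfolding k_def by blast
      moreover obtain y where "torus_prefix k y = ys" using ex_torus_prefix[of ys] ys by blast
      ultimately show ?thesis using shift[of k y x] by (simp only:)
    qed
    note shifted = this
    have "1 = (\<integral>x. (1 :: complex) \<partial>M)" by (simp only: lebesgue_integral_const prob_space scaleR_one)
    also have "\<dots> = (\<Sum>ys\<in>{ys. length ys = k}. 1 * complex_of_real (measure M (cylinder ys)))"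
      by (rule integral_function_of_prefix(1)[OF sM finite_measure_axioms, where h = "\<lambda>_. 1"])
    also have "\<dots> = (\<Sum>ys\<in>{ys :: 'a list. length ys = k}. complex_of_real (measure M (cylinder xs)))"
      by (intro sum.cong refl) (simp add: shifted)
    also have "\<dots> = of_nat (CARD('a) ^ k) * complex_of_real (measure M (cylinder xs))"
      by (simp only: sum_constant card_lists_of_length)
    finally have "1 = of_nat (CARD('a) ^ k) * complex_of_real (measure M (cylinder xs))" .
    hence "complex_of_real 1 = complex_of_real (real (CARD('a) ^ k) * measure M (cylinder xs))"
      by simp
    hence "1 = real (CARD('a) ^ k) * measure M (cylinder xs)" by (simp only: of_real_eq_iff)
    thus ?thesis by (simp add: k_def field_simps)
  qed
  thus "sets M = sets borel \<and> (\<forall>xs. emeasure M (cylinder xs) = ennreal (1 / CARD('a) ^ length xs))"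
    using sM by (simp add: emeasure_eq_measure)
next
  assume M: "sets M = sets borel \<and> (\<forall>xs. emeasure M (cylinder xs) = ennreal (1 / CARD('a) ^ length xs))"
  hence sM [measurable_cong]: "sets M = sets borel" by simp
  have sp: "space M = UNIV" by (rule space_torus[OF sM])
  interpret prob_space M
    by standard (use M[THEN conjunct2, THEN spec, of "[]"] in \<open>simp add: sp\<close>)
  have "distr M borel (\<lambda>x. x + c) = M" for c
  proof (rule measure_torus_eqI)
    show "finite_measure (distr M borel (\<lambda>x. x + c))"
      by (rule finite_measure_distr) measurable
    fix xs :: "'a list"
    obtain x where x: "torus_prefix (length xs) x = xs" by (rule ex_torus_prefix)
    have "emeasure (distr M borel (\<lambda>x. x + c)) (cylinder xs)
        = emeasure M ((\<lambda>x. x + c) -` cylinder (torus_prefix (length xs) x) \<inter> space M)"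
      unfolding x by (rule emeasure_distr) measurable
    also have "\<dots> = emeasure M (cylinder xs)"
      unfolding cylinder_translate sp using M by simp
    finally show "emeasure (distr M borel (\<lambda>x. x + c)) (cylinder xs) = emeasure M (cylinder xs)" .
  qed (simp_all add: sM)
  thus "is_haar_probability M" using sM prob_space_axioms by (simp add: is_haar_probability_def)
qed

lemma haar_is_haar: "is_haar_probability (haar :: 'a::finite_field laurent_torus measure)"
proof -
  have "(1 :: real) / CARD('a) ^ length xs = (\<Sum>c\<in>(UNIV :: 'a set). 1 / CARD('a) ^ length (xs @ [c]))"
    for xs :: "'a list" by simp
  then obtain M :: "'a laurent_torus measure"
    where M: "sets M = sets borel" "\<And>xs. emeasure M (cylinder xs) = ennreal (1 / CARD('a) ^ length xs)"
    using ex_cylinder_measure[of "\<lambda>xs :: 'a list. 1 / CARD('a) ^ length xs"] by auto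
  hence hM: "is_haar_probability M" by (simp add: is_haar_probability_iff)
  show ?thesis unfolding haar_def
  proof (rule theI[of _ M])
    fix N :: "'a laurent_torus measure" assume N: "is_haar_probability N"
    hence "finite_measure N" by (simp add: is_haar_probability_def prob_space.finite_measure)
    thus "N = M" using N hM unfolding is_haar_probability_iff by (intro measure_torus_eqI) auto
  qed (rule hM)
qed

lemma sets_haar [simp, measurable_cong]: "sets (haar :: 'a::finite_field laurent_torus measure) = sets borel"
  by (rule haar_is_haar[unfolded is_haar_probability_def, THEN conjunct2, THEN conjunct1])

lemma prob_space_haar: "prob_space (haar :: 'a::finite_field laurent_torus measure)"
  by (rule haar_is_haar[unfolded is_haar_probability_def, THEN conjunct1])

lemma haar_translation: "distr haar borel (\<lambda>x. x + c) = (haar :: 'a::finite_field laurent_torus measure)"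
  by (rule haar_is_haar[unfolded is_haar_probability_def, THEN conjunct2, THEN conjunct2, THEN spec])

lemma haar_cylinder: "measure (haar :: 'a::finite_field laurent_torus measure) (cylinder xs) = 1 / CARD('a) ^ length xs"
proof -
  have "emeasure haar (cylinder xs) = ennreal (1 / CARD('a) ^ length xs)"
    by (rule haar_is_haar[unfolded is_haar_probability_iff, THEN conjunct2, THEN spec])
  thus ?thesis unfolding measure_def by (simp only: enn2real_ennreal) simp
qed

lemma space_haar [simp]: "space (haar :: 'a::finite_field laurent_torus measure) = UNIV"
  by (rule space_torus) simp


section \<open>Characters of the torus\<close>

definition list_pairing :: "'a::field list \<Rightarrow> 'a poly \<Rightarrow> 'a" where
  "list_pairing xs z = (\<Sum>j<length xs. xs ! j * coeff z j)"

text \<open>The coefficient of t^(-1) in z times a lift of x; only fractional digits enter, so no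
  lift has to be chosen. Composed with \<psi> it gives the characters of the torus.\<close>

definition torus_pairing :: "'a::field laurent_torus \<Rightarrow> 'a poly \<Rightarrow> 'a" where
  "torus_pairing x z = (\<Sum>j\<le>degree z. torus_coeff x j * coeff z j)"

lemma torus_pairing_prefix:
  assumes "z \<in> polys_below k"
  shows "torus_pairing x z = list_pairing (torus_prefix k x) z"
proof -
  have "(\<Sum>j\<in>{..degree z} \<union> {..<k}. torus_coeff x j * coeff z j) = torus_pairing x z"
    unfolding torus_pairing_def by (rule sum.mono_neutral_right) (auto simp: coeff_eq_0)
  moreover have "(\<Sum>j\<in>{..degree z} \<union> {..<k}. torus_coeff x j * coeff z j) = (\<Sum>j<k. torus_coeff x j * coeff z j)"
    by (rule sum.mono_neutral_right) (use assms in \<open>auto simp: polys_below_def not_less\<close>)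
  ultimately show ?thesis by (simp add: list_pairing_def torus_prefix_def)
qed

lemma list_pairing_additive: "additive_map (list_pairing xs)"
  by (simp add: list_pairing_def Modules.additive_def distrib_left sum.distrib)

lemma torus_pairing_additive: "additive_map (torus_pairing x)"
  unfolding Modules.additive_def
proof (intro allI)
  fix y z :: "'a poly"
  define k where "k = max (Suc (degree y)) (Suc (degree z))"
  have "y \<in> polys_below k" "z \<in> polys_below k"
    by (auto simp: k_def intro!: degree_less_imp_polys_below)
  thus "torus_pairing x (y + z) = torus_pairing x y + torus_pairing x z"
    by (simp add: torus_pairing_prefix[of _ k] polys_below_add additive.add[OF list_pairing_additive])
qed

lemma torus_pairing_add: "torus_pairing (x + y) z = torus_pairing x z + torus_pairing y z"
  by (simp add: torus_pairing_def distrib_right sum.distrib)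

lemma torus_pairing_diff: "torus_pairing (x - y) z = torus_pairing x z - torus_pairing y z"
  by (simp add: torus_pairing_def left_diff_distrib sum_subtractf)

lemma torus_pairing_smult: "torus_pairing x (smult c z) = c * torus_pairing x z"
  by (cases "c = 0") (simp_all add: torus_pairing_def sum_distrib_left mult_ac)

lemma torus_pairing_abs: "torus_pairing (abs_laurent_torus f) z = (fls_of_poly z * f) $$ 1"
proof (induction z arbitrary: f)
  case 0
  show ?case by (simp add: torus_pairing_def fls_of_poly_0)
next
  case (pCons c z)
  have "torus_pairing (abs_laurent_torus f) (pCons c z)
      = torus_pairing (abs_laurent_torus f) [:c:] + torus_pairing (abs_laurent_torus f) (pCons 0 z)"
    using additive.add[OF torus_pairing_additive, of "abs_laurent_torus f" "[:c:]" "pCons 0 z"] by simp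
  also have "torus_pairing (abs_laurent_torus f) [:c:] = c * f $$ 1"
    by (simp add: torus_pairing_def mult.commute)
  also have "torus_pairing (abs_laurent_torus f) (pCons 0 z) = torus_pairing (abs_laurent_torus (fls_X_inv * f)) z"
  proof (cases "z = 0")
    case False
    have "(\<Sum>j\<le>Suc (degree z). torus_coeff (abs_laurent_torus f) j * coeff (pCons 0 z) j)
        = (\<Sum>j\<le>degree z. torus_coeff (abs_laurent_torus f) (Suc j) * coeff z j)"
      by (subst sum.atMost_Suc_shift) simp
    thus ?thesis using False
      by (simp add: torus_pairing_def fls_X_inv_times_conv_shift add_ac)
  qed (simp add: torus_pairing_def)
  also have "\<dots> = (fls_of_poly z * (fls_X_inv * f)) $$ 1" by (rule pCons.IH)
  finally show ?case by (simp add: fls_of_poly_pCons distrib_left distrib_right mult_ac)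
qed

lemma torus_pairing_mult:
  "torus_pairing (abs_laurent_torus (fls_of_poly m * f)) z = torus_pairing (abs_laurent_torus f) (z * m)"
  by (simp add: torus_pairing_abs fls_of_poly_mult mult.assoc)

text \<open>A period W allows scalar multiples in its argument, so the pairing itself, not just
  \<psi> of it, vanishes on multiples of W. Testing W t^j shows that every fractional digit of W
  \<alpha> is zero, hence \<alpha> is rational.\<close>

lemma irrational_torus_pairing:
  fixes \<alpha> :: "'a::finite_field fls"
  assumes "\<alpha> \<notin> rational_fls"
  shows "\<not> rational_functional (torus_pairing (abs_laurent_torus \<alpha>))"
proof
  assume "rational_functional (torus_pairing (abs_laurent_torus \<alpha>))"
  then obtain W where W: "W \<noteq> 0" "periodic W (torus_pairing (abs_laurent_torus \<alpha>))"
    by (auto simp: rational_functional_def)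
  have zero: "torus_pairing (abs_laurent_torus \<alpha>) (W * z) = 0" for z
  proof (rule ccontr)
    assume "torus_pairing (abs_laurent_torus \<alpha>) (W * z) \<noteq> 0"
    then obtain c where "\<psi> (c * torus_pairing (abs_laurent_torus \<alpha>) (W * z)) \<noteq> 1"
      by (rule psi_nontrivial_multiple)
    moreover have "c * torus_pairing (abs_laurent_torus \<alpha>) (W * z) = torus_pairing (abs_laurent_torus \<alpha>) (W * smult c z)"
      by (simp add: torus_pairing_smult)
    ultimately show False using W(2) unfolding periodic_def by (metis mult_smult_right)
  qed
  have "(fls_of_poly W * \<alpha>) $$ (int j + 1) = 0" for j
  proof -
    have "fls_of_poly (monom 1 j :: 'a poly) = fls_X_inv ^ j" for j
      by (induction j) (simp_all add: monom_Suc fls_of_poly_pCons monom_0 fls_of_poly_0)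
    hence "(fls_of_poly W * \<alpha>) $$ (int j + 1) = (fls_of_poly (monom 1 j) * (fls_of_poly W * \<alpha>)) $$ 1"
      by (simp add: fls_X_inv_power_times_conv_shift add.commute)
    also have "\<dots> = torus_pairing (abs_laurent_torus \<alpha>) (W * monom 1 j)"
      by (simp add: torus_pairing_abs fls_of_poly_mult mult_ac)
    finally show ?thesis by (simp add: zero)
  qed
  hence "fls_of_poly W * \<alpha> \<in> range fls_of_poly" using range_fls_of_poly_iff by blast
  then obtain u where "fls_of_poly W * \<alpha> = fls_of_poly u" by blast
  moreover have "fls_of_poly W \<noteq> 0" using W(1) fls_of_poly_inject[of W 0] by (simp add: fls_of_poly_0)
  ultimately have "\<alpha> = fls_of_poly u / fls_of_poly W" by (simp add: nonzero_eq_divide_eq mult.commute)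
  thus False using assms W(1) unfolding rational_fls_def by blast
qed

lemma average_list_pairing:
  fixes xs :: "'a::finite_field list"
  shows "average (polys_below (length xs)) (\<lambda>z. \<psi> (list_pairing xs z)) = of_bool (\<forall>j<length xs. xs ! j = 0)"
proof (cases "\<forall>j<length xs. xs ! j = 0")
  case True
  hence "list_pairing xs z = 0" for z by (simp add: list_pairing_def)
  thus ?thesis using True average_const[OF finite_polys_below polys_below_nonempty] by simp
next
  case False
  then obtain j where j: "j < length xs" "xs ! j \<noteq> 0" by blast
  then obtain c where c: "\<psi> (c * xs ! j) \<noteq> 1" using psi_nontrivial_multiple by blast
  have "list_pairing xs (monom c j) = (\<Sum>i<length xs. if i = j then xs ! j * c else 0)"
    unfolding list_pairing_def by (intro sum.cong) (auto simp: coeff_monom)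
  hence lp: "list_pairing xs (monom c j) = c * xs ! j" using j(1) by (simp add: mult.commute)
  have "(\<Sum>z\<in>polys_below (length xs). \<psi> (list_pairing xs z)) = 0"
  proof (rule sum_multiplicative_eq_0)
    have "monom c j \<in> polys_below (length xs)" using j(1) by (auto simp: polys_below_def coeff_monom)
    thus "monom c j + z \<in> polys_below (length xs)" if "z \<in> polys_below (length xs)" for z
      using that by (rule polys_below_add)
  qed (simp_all add: additive.add[OF list_pairing_additive] psi_add lp c)
  thus ?thesis using False by (simp add: average_def)
qed

text \<open>This expands the indicator of a cylinder as a finite combination of characters, the only
  Fourier inversion on the torus that is used.\<close>

lemma average_torus_pairing:
  fixes x y :: "'a::finite_field laurent_torus"
  shows "average (polys_below k) (\<lambda>z. \<psi> (torus_pairing x z) * cnj (\<psi> (torus_pairing y z)))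
    = of_bool (torus_prefix k x = torus_prefix k y)"
proof -
  have "average (polys_below k) (\<lambda>z. \<psi> (torus_pairing x z) * cnj (\<psi> (torus_pairing y z)))
      = average (polys_below k) (\<lambda>z. \<psi> (list_pairing (torus_prefix k (x - y)) z))"
  proof (rule average_cong)
    fix z :: "'a poly" assume "z \<in> polys_below k"
    from torus_pairing_prefix[OF this, of "x - y", symmetric]
    show "\<psi> (torus_pairing x z) * cnj (\<psi> (torus_pairing y z)) = \<psi> (list_pairing (torus_prefix k (x - y)) z)"
      by (simp only: torus_pairing_diff psi_diff)
  qed
  also have "\<dots> = of_bool (\<forall>j<k. torus_prefix k (x - y) ! j = 0)"
    using average_list_pairing[of "torus_prefix k (x - y)"] by (simp add: torus_prefix_def)
  also have "\<dots> = of_bool (torus_prefix k x = torus_prefix k y)"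
    unfolding torus_prefix_eq_iff by (simp add: torus_prefix_def)
  finally show ?thesis .
qed

lemma measurable_torus_pairing [measurable]:
  fixes h :: "'a::finite_field \<Rightarrow> complex"
  shows "(\<lambda>x. h (torus_pairing x z)) \<in> borel_measurable borel"
  using measurable_function_of_prefix[of "\<lambda>xs. h (list_pairing xs z)" "Suc (degree z)"]
  by (simp add: torus_pairing_prefix[OF mem_polys_below_degree])


section \<open>The Weyl criterion\<close>

text \<open>Convergence passes from characters to indicators of cylinders, then to functions of
  finitely many digits, and by uniform approximation to all continuous functions.\<close>

lemma weyl_criterion:
  fixes a :: "'b \<Rightarrow> 'a::finite_field laurent_torus" and g :: "'a laurent_torus \<Rightarrow> complex"
  assumes \<Phi>: "\<And>N. finite (\<Phi> N)" "\<And>N. \<Phi> N \<noteq> {}"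
    and weyl: "\<And>z. z \<noteq> 0 \<Longrightarrow> (\<lambda>N. average (\<Phi> N) (\<lambda>n. \<psi> (torus_pairing (a n) z))) \<longlonglongrightarrow> 0"
    and g: "continuous_on UNIV g"
  shows "(\<lambda>N. average (\<Phi> N) (\<lambda>n. g (a n))) \<longlonglongrightarrow> (\<integral>x. g x \<partial>haar)"
proof -
  interpret prob_space "haar :: 'a laurent_torus measure" by (rule prob_space_haar)
  have weyl': "(\<lambda>N. average (\<Phi> N) (\<lambda>n. \<psi> (torus_pairing (a n) z))) \<longlonglongrightarrow> of_bool (z = 0)" for z
  proof (cases "z = 0")
    case True
    thus ?thesis using average_const[OF \<Phi>] by (simp add: torus_pairing_def)
  qed (use weyl in simp)
  have cyl: "(\<lambda>N. average (\<Phi> N) (\<lambda>n. of_bool (torus_prefix k (a n) = torus_prefix k y)))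
      \<longlonglongrightarrow> complex_of_real (1 / CARD('a) ^ k)" for k y
  proof -
    have "(\<lambda>N. \<Sum>z\<in>polys_below k. 1 / of_nat (CARD('a) ^ k) * cnj (\<psi> (torus_pairing y z)) *
          average (\<Phi> N) (\<lambda>n. \<psi> (torus_pairing (a n) z)))
        \<longlonglongrightarrow> (\<Sum>z\<in>polys_below k. 1 / of_nat (CARD('a) ^ k) * cnj (\<psi> (torus_pairing y z)) * of_bool (z = 0))"
      by (intro tendsto_sum tendsto_mult tendsto_const weyl')
    moreover have "(\<Sum>z\<in>polys_below k. 1 / of_nat (CARD('a) ^ k) * cnj (\<psi> (torus_pairing y z)) * of_bool (z = 0))
        = complex_of_real (1 / CARD('a) ^ k)"
      by (simp add: of_bool_def if_distrib[of "\<lambda>t. _ * t"] torus_pairing_def cong: if_cong)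
    moreover have "(\<Sum>z\<in>polys_below k. 1 / of_nat (CARD('a) ^ k) * cnj (\<psi> (torus_pairing y z)) *
          average (\<Phi> N) (\<lambda>n. \<psi> (torus_pairing (a n) z)))
        = average (\<Phi> N) (\<lambda>n. of_bool (torus_prefix k (a n) = torus_prefix k y))" for N
    proof -
      have "(\<Sum>z\<in>polys_below k. 1 / of_nat (CARD('a) ^ k) * cnj (\<psi> (torus_pairing y z)) *
          average (\<Phi> N) (\<lambda>n. \<psi> (torus_pairing (a n) z)))
        = average (\<Phi> N) (\<lambda>n. \<Sum>z\<in>polys_below k. 1 / of_nat (CARD('a) ^ k) * cnj (\<psi> (torus_pairing y z)) *
            \<psi> (torus_pairing (a n) z))"
        by (simp only: average_sum average_cmult)
      also have "\<dots> = average (\<Phi> N) (\<lambda>n. average (polys_below k)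
            (\<lambda>z. \<psi> (torus_pairing (a n) z) * cnj (\<psi> (torus_pairing y z))))"
        by (intro average_cong)
           (simp add: average_def[of "polys_below k"] card_polys_below sum_divide_distrib mult.commute)
      finally show ?thesis by (simp only: average_torus_pairing)
    qed
    ultimately show ?thesis by simp
  qed
  have level: "(\<lambda>N. average (\<Phi> N) (\<lambda>n. h (torus_prefix k (a n)))) \<longlonglongrightarrow> (\<integral>x. h (torus_prefix k x) \<partial>haar)"
    for h :: "'a list \<Rightarrow> complex" and k
  proof -
    have "(\<lambda>N. \<Sum>xs\<in>{xs. length xs = k}. h xs * average (\<Phi> N) (\<lambda>n. indicator (cylinder xs) (a n)))
        \<longlonglongrightarrow> (\<Sum>xs\<in>{xs. length xs = k}. h xs * complex_of_real (measure haar (cylinder xs)))"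
    proof (intro tendsto_sum tendsto_mult tendsto_const)
      fix xs :: "'a list" assume xs: "xs \<in> {xs. length xs = k}"
      obtain y where y: "torus_prefix k y = xs" using ex_torus_prefix[of xs] xs by blast
      have "(indicator (cylinder xs) x :: complex) = of_bool (torus_prefix k x = torus_prefix k y)" for x
        using xs by (simp add: y cylinder_def indicator_def)
      thus "(\<lambda>N. average (\<Phi> N) (\<lambda>n. indicator (cylinder xs) (a n))) \<longlonglongrightarrow> complex_of_real (measure haar (cylinder xs))"
        using cyl[of k y] xs by (simp add: haar_cylinder)
    qed
    moreover have "average (\<Phi> N) (\<lambda>n. h (torus_prefix k (a n)))
        = (\<Sum>xs\<in>{xs. length xs = k}. h xs * average (\<Phi> N) (\<lambda>n. indicator (cylinder xs) (a n)))" for N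
      by (simp only: function_of_prefix average_sum average_cmult)
    ultimately show ?thesis
      using integral_function_of_prefix(1)[OF sets_haar finite_measure_axioms, of h k] by simp
  qed
  show ?thesis
  proof (rule tendstoI)
    fix e :: real assume e: "e > 0"
    obtain k where k: "\<And>x y. torus_prefix k x = torus_prefix k y \<Longrightarrow> dist (g x) (g y) < e / 3"
      using continuous_torus_uniform[OF g, of "e / 3"] e by auto
    \<comment> \<open>\<open>g\<close> is replaced by its value at one point of each cylinder of
      length k.\<close>
    define h where "h xs = g (SOME y. torus_prefix k y = xs)" for xs
    have near: "dist (g x) (h (torus_prefix k x)) < e / 3" for x
    proof -
      have "torus_prefix k (SOME y. torus_prefix k y = torus_prefix k x) = torus_prefix k x"
        by (rule someI[where x = x]) simp
      thus ?thesis unfolding h_def by (intro k) simp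
    qed
    have near': "cmod (g x - h (torus_prefix k x)) \<le> e / 3" for x
      using near[of x] by (simp add: dist_norm)
    have meas: "g \<in> borel_measurable haar"
      using borel_measurable_continuous_onI[OF g] by (simp add: measurable_def)
    have hint: "integrable haar (\<lambda>x. h (torus_prefix k x))"
      by (rule integral_function_of_prefix(2)[OF sets_haar finite_measure_axioms])
    have dint: "integrable haar (\<lambda>x. g x - h (torus_prefix k x))"
      by (rule integrable_const_bound[of _ "e / 3", OF AE_I2[OF near']])
         (rule borel_measurable_diff[OF meas borel_measurable_integrable[OF hint]])
    have gint: "integrable haar g"
      using Bochner_Integration.integrable_add[OF dint hint] by simp
    have nint: "integrable haar (\<lambda>x. cmod (g x - h (torus_prefix k x)))"
      using dint by (rule integrable_norm)
    have "dist (\<integral>x. g x \<partial>haar) (\<integral>x. h (torus_prefix k x) \<partial>haar) = cmod (\<integral>x. g x - h (torus_prefix k x) \<partial>haar)"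
      by (simp only: dist_norm Bochner_Integration.integral_diff[OF gint hint])
    also have "\<dots> \<le> (\<integral>x. cmod (g x - h (torus_prefix k x)) \<partial>haar)" by (rule integral_norm_bound)
    also have "\<dots> \<le> integral\<^sup>L haar (\<lambda>x :: 'a laurent_torus. e / 3)"
      by (rule integral_mono) (use nint near' in simp_all)
    finally have I: "dist (\<integral>x. g x \<partial>haar) (\<integral>x. h (torus_prefix k x) \<partial>haar) \<le> e / 3" by (simp add: prob_space[unfolded space_haar])
    have A: "dist (average (\<Phi> N) (\<lambda>n. g (a n))) (average (\<Phi> N) (\<lambda>n. h (torus_prefix k (a n)))) \<le> e / 3" for N
    proof -
      have "average (\<Phi> N) (\<lambda>n. g (a n)) - average (\<Phi> N) (\<lambda>n. h (torus_prefix k (a n)))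
          = average (\<Phi> N) (\<lambda>n. g (a n) - h (torus_prefix k (a n)))"
        by (simp add: average_def sum_subtractf diff_divide_distrib)
      also have "cmod \<dots> \<le> e / 3" by (intro norm_average_le \<Phi> near')
      finally show ?thesis by (simp add: dist_norm)
    qed
    have "eventually (\<lambda>N. dist (average (\<Phi> N) (\<lambda>n. h (torus_prefix k (a n)))) (\<integral>x. h (torus_prefix k x) \<partial>haar) < e / 3) sequentially"
      using tendstoD[OF level, of "e / 3"] e by simp
    thus "eventually (\<lambda>N. dist (average (\<Phi> N) (\<lambda>n. g (a n))) (\<integral>x. g x \<partial>haar) < e) sequentially"
    proof eventually_elim
      case (elim N)
      let ?H = "\<integral>x. h (torus_prefix k x) \<partial>haar" and ?B = "average (\<Phi> N) (\<lambda>n. h (torus_prefix k (a n)))"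
      have "dist (average (\<Phi> N) (\<lambda>n. g (a n))) (\<integral>x. g x \<partial>haar)
          \<le> dist (average (\<Phi> N) (\<lambda>n. g (a n))) ?B + dist ?B (\<integral>x. g x \<partial>haar)"
        by (rule dist_triangle)
      moreover have "dist ?B (\<integral>x. g x \<partial>haar) \<le> dist ?B ?H + dist (\<integral>x. g x \<partial>haar) ?H"
        by (rule dist_triangle2)
      ultimately show ?case using elim A[of N] I by linarith
    qed
  qed
qed


section \<open>Spectral measures\<close>

lemma integral_torus_character:
  "(\<integral>x. \<psi> (torus_pairing x z) \<partial>haar) = of_bool (z = (0 :: 'a::finite_field poly))"
proof (cases "z = 0")
  case True
  thus ?thesis using prob_space.prob_space[OF prob_space_haar[where 'a = 'a]] by (simp add: torus_pairing_def)
next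
  case False
  define j where "j = degree z"
  obtain c where c: "\<psi> (c * coeff z j) \<noteq> 1"
    using psi_nontrivial_multiple[of "coeff z j"] False unfolding j_def by auto
  define y :: "'a laurent_torus" where "y = torus_of_digits (\<lambda>i. if i = j then c else 0)"
  have "torus_pairing y z = (\<Sum>i\<le>j. if i = j then c * coeff z j else 0)"
    unfolding torus_pairing_def j_def[symmetric] by (intro sum.cong refl) (simp add: y_def)
  hence y: "\<psi> (torus_pairing y z) \<noteq> 1" using c by simp
  have "(\<integral>x. \<psi> (torus_pairing x z) \<partial>haar) = (\<integral>x. \<psi> (torus_pairing x z) \<partial>distr haar borel (\<lambda>x. x + y))"
    by (simp only: haar_translation)
  also have "\<dots> = (\<integral>x. \<psi> (torus_pairing (x + y) z) \<partial>haar)"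
    by (rule integral_distr) (simp_all add: measurable_torus_pairing)
  also have "\<dots> = \<psi> (torus_pairing y z) * (\<integral>x. \<psi> (torus_pairing x z) \<partial>haar)"
    by (simp add: torus_pairing_add psi_add mult.commute)
  finally show ?thesis using y False by auto
qed

lemma sum_list_characters:
  fixes z :: "'a::finite_field poly"
  assumes "z \<in> polys_below k"
  shows "(\<Sum>xs\<in>{xs. length xs = k}. \<psi> (list_pairing xs z)) = of_nat (CARD('a) ^ k) * of_bool (z = 0)"
proof -
  have "of_bool (z = 0) = (\<integral>x. \<psi> (list_pairing (torus_prefix k x) z) \<partial>haar)"
    using integral_torus_character[of z] by (simp add: torus_pairing_prefix[OF assms])
  also have "\<dots> = (\<Sum>xs\<in>{xs. length xs = k}. \<psi> (list_pairing xs z) * complex_of_real (measure haar (cylinder xs)))"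
    by (rule integral_function_of_prefix(1)[OF sets_haar prob_space.finite_measure[OF prob_space_haar]])
  also have "\<dots> = (\<Sum>xs\<in>{xs. length xs = k}. \<psi> (list_pairing xs z) * (1 / of_nat (CARD('a) ^ k)))"
    by (intro sum.cong refl) (simp add: haar_cylinder)
  finally show ?thesis by (simp add: field_simps flip: sum_distrib_right sum_divide_distrib)
qed

lemma sum_field_characters: "(\<Sum>c\<in>UNIV. \<psi> (c * a)) = of_nat CARD('a) * of_bool (a = (0 :: 'a::finite_field))"
proof (cases "a = 0")
  case False
  then obtain c where "\<psi> (c * a) \<noteq> 1" by (rule psi_nontrivial_multiple)
  hence "(\<Sum>c\<in>UNIV. \<psi> (c * a)) = 0"
    by (intro sum_multiplicative_eq_0[of UNIV c]) (simp_all add: psi_add distrib_right)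
  thus ?thesis using False by simp
qed simp

lemma list_pairing_snoc: "list_pairing (xs @ [c]) z = list_pairing xs z + c * coeff z (length xs)"
  by (simp add: list_pairing_def nth_append)

lemma sum_differences:
  fixes h :: "'a::finite_field poly \<Rightarrow> complex"
  shows "(\<Sum>y\<in>polys_below k. \<Sum>z\<in>polys_below k. h (y - z)) = of_nat (CARD('a) ^ k) * (\<Sum>d\<in>polys_below k. h d)"
proof -
  have "(\<Sum>y\<in>polys_below k. h (y - z)) = (\<Sum>d\<in>polys_below k. h d)" if "z \<in> polys_below k" for z
    by (rule sum.reindex_bij_witness[of _ "\<lambda>d. d + z" "\<lambda>y. y - z"])
       (auto intro: polys_below_add polys_below_diff that)
  note shift = this
  have "(\<Sum>z\<in>polys_below k. \<Sum>y\<in>polys_below k. h (y - z)) = (\<Sum>z\<in>(polys_below k :: 'a poly set). \<Sum>d\<in>polys_below k. h d)"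
    by (rule sum.cong[OF refl shift])
  thus ?thesis by (subst sum.swap) (simp add: card_polys_below)
qed

text \<open>The norm of a linear combination depends only on the correlations. It is used both on
  the system and on the torus, so that equality of correlations transfers norms from one to the
  other.\<close>

lemma integral_norm_sum_squared:
  fixes u :: "'b \<Rightarrow> 'x \<Rightarrow> complex"
  assumes int: "\<And>i j. i \<in> I \<Longrightarrow> j \<in> I \<Longrightarrow> integrable M (\<lambda>x. u i x * cnj (u j x))"
  shows "integrable M (\<lambda>x. (cmod (\<Sum>i\<in>I. c i * u i x))\<^sup>2)"
    and "complex_of_real (\<integral>x. (cmod (\<Sum>i\<in>I. c i * u i x))\<^sup>2 \<partial>M)
      = (\<Sum>i\<in>I. \<Sum>j\<in>I. c i * cnj (c j) * (\<integral>x. u i x * cnj (u j x) \<partial>M))"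
proof -
  have expand: "complex_of_real ((cmod (\<Sum>i\<in>I. c i * u i x))\<^sup>2)
      = (\<Sum>i\<in>I. \<Sum>j\<in>I. c i * cnj (c j) * (u i x * cnj (u j x)))" for x
    unfolding complex_norm_square by (simp add: sum_product mult_ac)
  have int': "integrable M (\<lambda>x. \<Sum>j\<in>I. c i * cnj (c j) * (u i x * cnj (u j x)))" if "i \<in> I" for i
    using that by (intro Bochner_Integration.integrable_sum integrable_mult_right int)
  have "integrable M (\<lambda>x. complex_of_real ((cmod (\<Sum>i\<in>I. c i * u i x))\<^sup>2))"
    unfolding expand by (intro Bochner_Integration.integrable_sum int')
  thus "integrable M (\<lambda>x. (cmod (\<Sum>i\<in>I. c i * u i x))\<^sup>2)" by (simp only: complex_of_real_integrable_eq)
  have "complex_of_real (\<integral>x. (cmod (\<Sum>i\<in>I. c i * u i x))\<^sup>2 \<partial>M)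
      = (\<integral>x. (\<Sum>i\<in>I. \<Sum>j\<in>I. c i * cnj (c j) * (u i x * cnj (u j x))) \<partial>M)"
    unfolding integral_complex_of_real[symmetric] by (simp only: expand)
  also have "\<dots> = (\<Sum>i\<in>I. \<integral>x. (\<Sum>j\<in>I. c i * cnj (c j) * (u i x * cnj (u j x))) \<partial>M)"
    by (rule Bochner_Integration.integral_sum) (rule int')
  also have "\<dots> = (\<Sum>i\<in>I. \<Sum>j\<in>I. \<integral>x. c i * cnj (c j) * (u i x * cnj (u j x)) \<partial>M)"
    by (intro sum.cong refl Bochner_Integration.integral_sum integrable_mult_right int)
  finally show "complex_of_real (\<integral>x. (cmod (\<Sum>i\<in>I. c i * u i x))\<^sup>2 \<partial>M)
      = (\<Sum>i\<in>I. \<Sum>j\<in>I. c i * cnj (c j) * (\<integral>x. u i x * cnj (u j x) \<partial>M))"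
    by (simp only: integral_mult_right_zero)
qed

lemma borel_measurable_cnj [measurable (raw)]:
  "f \<in> borel_measurable M \<Longrightarrow> (\<lambda>x. cnj (f x)) \<in> borel_measurable M"
  by (erule measurable_compose) (intro borel_measurable_continuous_onI continuous_intros)

locale square_integrable_system =
  fixes M :: "'x measure" and T :: "'a::finite_field poly \<Rightarrow> 'x \<Rightarrow> 'x" and f :: "'x \<Rightarrow> complex"
  assumes system: "mp_system M T" and square: "square_integrable M f"
begin

sublocale prob_space M using system by (simp add: mp_system_def)

lemma T_measurable [measurable]: "T y \<in> measurable M M"
  and T_distr: "distr M M (T y) = M"
  and T_add: "\<omega> \<in> space M \<Longrightarrow> T (y + z) \<omega> = T y (T z \<omega>)"
  using system by (simp_all add: mp_system_def)

lemma T_space: "\<omega> \<in> space M \<Longrightarrow> T y \<omega> \<in> space M"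
  by (rule measurable_space[OF T_measurable])

lemma f_measurable [measurable]: "f \<in> borel_measurable M"
  using square by (simp add: square_integrable_def)

lemma integral_shift:
  fixes h :: "'x \<Rightarrow> complex"
  assumes "h \<in> borel_measurable M"
  shows "(\<integral>\<omega>. h (T y \<omega>) \<partial>M) = (\<integral>\<omega>. h \<omega> \<partial>M)"
  using integral_distr[OF T_measurable[of y] assms] by (simp add: T_distr)

lemma integrable_shift:
  fixes h :: "'x \<Rightarrow> 'b::{banach, second_countable_topology}"
  assumes "integrable M h"
  shows "integrable M (\<lambda>\<omega>. h (T y \<omega>))"
  using integrable_distr[OF T_measurable[of y], of h] assms by (simp add: T_distr)

lemma integrable_products: "integrable M (\<lambda>\<omega>. f (T y \<omega>) * cnj (f (T z \<omega>)))"
proof (rule Bochner_Integration.integrable_bound)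
  have "integrable M (\<lambda>\<omega>. (cmod (f \<omega>))\<^sup>2)" using square by (simp add: square_integrable_def)
  thus "integrable M (\<lambda>\<omega>. (cmod (f (T y \<omega>)))\<^sup>2 + (cmod (f (T z \<omega>)))\<^sup>2)"
    by (intro Bochner_Integration.integrable_add integrable_shift)
  have "a * b \<le> a\<^sup>2 + b\<^sup>2" for a b :: real
    using sum_squares_bound[of a b] zero_le_power2[of a] zero_le_power2[of b] by linarith
  thus "AE \<omega> in M. norm (f (T y \<omega>) * cnj (f (T z \<omega>))) \<le> norm ((cmod (f (T y \<omega>)))\<^sup>2 + (cmod (f (T z \<omega>)))\<^sup>2)"
    by (simp add: norm_mult)
qed measurable

definition autocorrelation :: "'a poly \<Rightarrow> complex" where
  "autocorrelation z = (\<integral>\<omega>. f (T z \<omega>) * cnj (f \<omega>) \<partial>M)"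

lemma correlation_eq: "(\<integral>\<omega>. f (T y \<omega>) * cnj (f (T z \<omega>)) \<partial>M) = autocorrelation (y - z)"
proof -
  have "autocorrelation (y - z) = (\<integral>\<omega>. f (T (y - z) (T z \<omega>)) * cnj (f (T z \<omega>)) \<partial>M)"
    unfolding autocorrelation_def by (rule integral_shift[symmetric]) measurable
  also have "\<dots> = (\<integral>\<omega>. f (T y \<omega>) * cnj (f (T z \<omega>)) \<partial>M)"
    by (intro Bochner_Integration.integral_cong refl) (simp add: T_add[symmetric])
  finally show ?thesis ..
qed

text \<open>The mass that the spectral measure must give to the cylinder, obtained by Fourier
  inversion from its prospective Fourier coefficients.\<close>

definition spectral_weight :: "'a list \<Rightarrow> complex" where
  "spectral_weight xs = (\<Sum>z\<in>polys_below (length xs). cnj (\<psi> (list_pairing xs z)) * autocorrelation z) / of_nat (CARD('a) ^ length xs)"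

text \<open>|F|^(2k) times the weight is the integral of a squared absolute value. As
  \<open>polys_below k\<close> is a group, every difference occurs equally often, so no Fejer
  weights arise.\<close>

lemma spectral_weight_nonneg: "\<exists>v\<ge>0. spectral_weight xs = complex_of_real v"
proof -
  define k where "k = length xs"
  define v where "v = (\<integral>\<omega>. (cmod (\<Sum>y\<in>polys_below k. cnj (\<psi> (list_pairing xs y)) * f (T y \<omega>)))\<^sup>2 \<partial>M)"
  define h where "h d = cnj (\<psi> (list_pairing xs d)) * autocorrelation d" for d
  have "complex_of_real v = (\<Sum>y\<in>polys_below k. \<Sum>z\<in>polys_below k.
      cnj (\<psi> (list_pairing xs y)) * cnj (cnj (\<psi> (list_pairing xs z))) * (\<integral>\<omega>. f (T y \<omega>) * cnj (f (T z \<omega>)) \<partial>M))"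
    unfolding v_def by (rule integral_norm_sum_squared(2)) (rule integrable_products)
  also have "\<dots> = (\<Sum>y\<in>polys_below k. \<Sum>z\<in>polys_below k. h (y - z))"
    by (intro sum.cong refl) (simp add: h_def correlation_eq additive.diff[OF list_pairing_additive] psi_diff)
  also have "\<dots> = of_nat (CARD('a) ^ k) * (of_nat (CARD('a) ^ k) * spectral_weight xs)"
    unfolding sum_differences by (simp add: spectral_weight_def h_def k_def)
  finally have "spectral_weight xs = complex_of_real (v / (of_nat (CARD('a) ^ k) * of_nat (CARD('a) ^ k)))"
    by (simp add: field_simps)
  moreover have "v \<ge> 0" by (simp add: v_def)
  ultimately show ?thesis by (intro exI[of _ "v / (of_nat (CARD('a) ^ k) * of_nat (CARD('a) ^ k))"]) simp
qed

text \<open>Summation over the last digit removes all z with nonzero coefficient at k and gives the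
  factor |F|. This is the consistency condition for weights on the tree of cylinders.\<close>

lemma spectral_weight_snoc: "(\<Sum>c\<in>UNIV. spectral_weight (xs @ [c])) = spectral_weight xs"
proof -
  define k where "k = length xs"
  have "(\<Sum>c\<in>UNIV. \<Sum>z\<in>polys_below (Suc k). cnj (\<psi> (list_pairing (xs @ [c]) z)) * autocorrelation z)
      = (\<Sum>z\<in>polys_below (Suc k). \<Sum>c\<in>UNIV. cnj (\<psi> (list_pairing (xs @ [c]) z)) * autocorrelation z)"
    by (rule sum.swap)
  also have "\<dots> = (\<Sum>z\<in>polys_below (Suc k). cnj (\<psi> (list_pairing xs z)) * autocorrelation z *
      cnj (\<Sum>c\<in>UNIV. \<psi> (c * coeff z k)))"
    by (simp add: list_pairing_snoc psi_add sum_distrib_left k_def mult_ac)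
  also have "\<dots> = (\<Sum>z\<in>polys_below (Suc k). if z \<in> polys_below k
      then cnj (\<psi> (list_pairing xs z)) * autocorrelation z * of_nat CARD('a) else 0)"
  proof (rule sum.cong[OF refl])
    fix z :: "'a poly" assume z: "z \<in> polys_below (Suc k)"
    have "z \<in> polys_below k \<longleftrightarrow> coeff z k = 0"
    proof
      assume "coeff z k = 0"
      hence "coeff z i = 0" if "k \<le> i" for i
        using z that by (cases "i = k") (auto simp: polys_below_def)
      thus "z \<in> polys_below k" by (simp add: polys_below_def)
    qed (simp add: polys_below_def)
    thus "cnj (\<psi> (list_pairing xs z)) * autocorrelation z * cnj (\<Sum>c\<in>UNIV. \<psi> (c * coeff z k))
        = (if z \<in> polys_below k then cnj (\<psi> (list_pairing xs z)) * autocorrelation z * of_nat CARD('a) else 0)"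
      by (simp add: sum_field_characters)
  qed
  also have "\<dots> = (\<Sum>z\<in>{z \<in> polys_below (Suc k). z \<in> polys_below k}. cnj (\<psi> (list_pairing xs z)) * autocorrelation z * of_nat CARD('a))"
    by (rule sum.inter_filter[symmetric]) (rule finite_polys_below)
  also have "{z \<in> polys_below (Suc k). z \<in> polys_below k} = (polys_below k :: 'a poly set)"
    by (auto simp: polys_below_def)
  finally show ?thesis
    by (simp add: spectral_weight_def k_def[symmetric] sum_divide_distrib[symmetric] sum_distrib_right[symmetric])
qed

lemma spectral_weight_inversion:
  assumes y: "y \<in> polys_below k"
  shows "(\<Sum>xs\<in>{xs. length xs = k}. \<psi> (list_pairing xs y) * spectral_weight xs) = autocorrelation y"
proof -
  have "(\<Sum>xs\<in>{xs. length xs = k}. \<psi> (list_pairing xs y) * spectral_weight xs)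
      = (\<Sum>xs\<in>{xs. length xs = k}. \<Sum>z\<in>polys_below k. \<psi> (list_pairing xs (y - z)) * autocorrelation z / of_nat (CARD('a) ^ k))"
    by (intro sum.cong refl)
       (simp add: spectral_weight_def sum_divide_distrib sum_distrib_left additive.diff[OF list_pairing_additive] psi_diff mult_ac)
  also have "\<dots> = (\<Sum>z\<in>polys_below k. \<Sum>xs\<in>{xs. length xs = k}. \<psi> (list_pairing xs (y - z)) * autocorrelation z / of_nat (CARD('a) ^ k))"
    by (rule sum.swap)
  also have "\<dots> = (\<Sum>z\<in>polys_below k. (\<Sum>xs\<in>{xs. length xs = k}. \<psi> (list_pairing xs (y - z))) * autocorrelation z / of_nat (CARD('a) ^ k))"
    by (simp only: sum_distrib_right sum_divide_distrib)
  also have "\<dots> = (\<Sum>z\<in>polys_below k. if z = y then autocorrelation y else 0)"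
    by (intro sum.cong refl) (auto simp: sum_list_characters polys_below_diff y)
  also have "\<dots> = autocorrelation y" using y by simp
  finally show ?thesis .
qed

text \<open>The Herglotz-Bochner theorem for the positive definite function
  \<open>autocorrelation\<close> on F[t], whose dual group is the torus. It is recorded as the
  isometry that later steps use.\<close>

lemma ex_spectral_measure:
  "\<exists>\<nu> :: 'a laurent_torus measure. sets \<nu> = sets borel \<and> finite_measure \<nu> \<and>
    (\<forall>(I :: 'b set) c y. (\<integral>\<omega>. (cmod (\<Sum>i\<in>I. c i * f (T (y i) \<omega>)))\<^sup>2 \<partial>M)
       = (\<integral>x. (cmod (\<Sum>i\<in>I. c i * \<psi> (torus_pairing x (y i))))\<^sup>2 \<partial>\<nu>))"
proof -
  define w where "w xs = Re (spectral_weight xs)" for xs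
  have w: "w xs \<ge> 0" "spectral_weight xs = complex_of_real (w xs)" for xs
    using spectral_weight_nonneg[of xs] unfolding w_def by auto
  have rec: "w xs = (\<Sum>c\<in>UNIV. w (xs @ [c]))" for xs
    unfolding w_def using spectral_weight_snoc[of xs] by (metis Re_sum)
  obtain \<nu> :: "'a laurent_torus measure"
    where \<nu>0: "sets \<nu> = sets borel \<and> (\<forall>xs. emeasure \<nu> (cylinder xs) = ennreal (w xs))"
    by (rule ex_cylinder_measure[OF w(1) rec]) blast
  have \<nu>: "sets \<nu> = sets borel" "\<And>xs. emeasure \<nu> (cylinder xs) = ennreal (w xs)"
    using \<nu>0 by auto
  have sp: "space \<nu> = UNIV" by (rule space_torus[OF \<nu>(1)])
  have fin: "finite_measure \<nu>"
    by (rule finite_measureI) (use \<nu>(2)[of "[]"] in \<open>simp add: sp\<close>)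
  interpret \<nu>: finite_measure \<nu> by (rule fin)
  have meas: "measure \<nu> (cylinder xs) = w xs" for xs
    using \<nu>(2)[of xs] w(1)[of xs] by (simp add: measure_def)
  have char: "(\<integral>x. \<psi> (torus_pairing x y) \<partial>\<nu>) = autocorrelation y" "integrable \<nu> (\<lambda>x. \<psi> (torus_pairing x y))" for y
  proof -
    define k where "k = Suc (degree y)"
    have y: "y \<in> polys_below k" unfolding k_def by (rule mem_polys_below_degree)
    show "integrable \<nu> (\<lambda>x. \<psi> (torus_pairing x y))"
      unfolding torus_pairing_prefix[OF y] by (rule integral_function_of_prefix(2)[OF \<nu>(1) fin])
    have "(\<integral>x. \<psi> (torus_pairing x y) \<partial>\<nu>)
        = (\<Sum>xs\<in>{xs. length xs = k}. \<psi> (list_pairing xs y) * complex_of_real (measure \<nu> (cylinder xs)))"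
      unfolding torus_pairing_prefix[OF y] by (rule integral_function_of_prefix(1)[OF \<nu>(1) fin])
    also have "\<dots> = autocorrelation y"
      using spectral_weight_inversion[OF y] by (simp add: meas w(2))
    finally show "(\<integral>x. \<psi> (torus_pairing x y) \<partial>\<nu>) = autocorrelation y" .
  qed
  have prod: "\<psi> (torus_pairing x y) * cnj (\<psi> (torus_pairing x z)) = \<psi> (torus_pairing x (y - z))" for x y z
    by (simp add: additive.diff[OF torus_pairing_additive] psi_diff)
  have "(\<integral>\<omega>. (cmod (\<Sum>i\<in>I. c i * f (T (y i) \<omega>)))\<^sup>2 \<partial>M)
      = (\<integral>x. (cmod (\<Sum>i\<in>I. c i * \<psi> (torus_pairing x (y i))))\<^sup>2 \<partial>\<nu>)" for I :: "'b set" and c y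
  proof -
    have "complex_of_real (\<integral>\<omega>. (cmod (\<Sum>i\<in>I. c i * f (T (y i) \<omega>)))\<^sup>2 \<partial>M)
        = (\<Sum>i\<in>I. \<Sum>j\<in>I. c i * cnj (c j) * (\<integral>\<omega>. f (T (y i) \<omega>) * cnj (f (T (y j) \<omega>)) \<partial>M))"
      by (rule integral_norm_sum_squared(2)[where u = "\<lambda>i \<omega>. f (T (y i) \<omega>)"]) (rule integrable_products)
    also have "\<dots> = (\<Sum>i\<in>I. \<Sum>j\<in>I. c i * cnj (c j) * (\<integral>x. \<psi> (torus_pairing x (y i)) * cnj (\<psi> (torus_pairing x (y j))) \<partial>\<nu>))"
      by (simp only: prod char correlation_eq)
    also have "\<dots> = complex_of_real (\<integral>x. (cmod (\<Sum>i\<in>I. c i * \<psi> (torus_pairing x (y i))))\<^sup>2 \<partial>\<nu>)"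
      by (rule integral_norm_sum_squared(2)[where u = "\<lambda>i x. \<psi> (torus_pairing x (y i))", symmetric])
         (simp only: prod char)
    finally show ?thesis by (simp only: of_real_eq_iff)
  qed
  thus ?thesis using \<nu>(1) fin by (intro exI[of _ \<nu>] conjI allI)
qed

end


section \<open>The mean ergodic theorem\<close>

text \<open>Fatou's lemma, which carries a Cauchy estimate in L^2 over to an almost everywhere
  limit.\<close>

lemma L2_limit_bound:
  fixes u :: "nat \<Rightarrow> 'x \<Rightarrow> complex"
  assumes meas [measurable]: "\<And>j. u j \<in> borel_measurable M" "v \<in> borel_measurable M" "g \<in> borel_measurable M"
    and int: "\<And>j. integrable M (\<lambda>x. (cmod (v x - u j x))\<^sup>2)"
    and bound: "\<And>j. j \<ge> N \<Longrightarrow> (\<integral>x. (cmod (v x - u j x))\<^sup>2 \<partial>M) \<le> e" "0 \<le> e"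
    and lim: "AE x in M. (\<lambda>j. u j x) \<longlonglongrightarrow> g x"
  shows "integrable M (\<lambda>x. (cmod (v x - g x))\<^sup>2)" "(\<integral>x. (cmod (v x - g x))\<^sup>2 \<partial>M) \<le> e"
proof -
  have "(\<integral>\<^sup>+x. ennreal ((cmod (v x - g x))\<^sup>2) \<partial>M) = (\<integral>\<^sup>+x. liminf (\<lambda>j. ennreal ((cmod (v x - u j x))\<^sup>2)) \<partial>M)"
  proof (rule nn_integral_cong_AE, use lim in eventually_elim)
    fix x assume "(\<lambda>j. u j x) \<longlonglongrightarrow> g x"
    hence "(\<lambda>j. ennreal ((cmod (v x - u j x))\<^sup>2)) \<longlonglongrightarrow> ennreal ((cmod (v x - g x))\<^sup>2)"
      by (intro tendsto_ennrealI tendsto_intros)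
    thus "ennreal ((cmod (v x - g x))\<^sup>2) = liminf (\<lambda>j. ennreal ((cmod (v x - u j x))\<^sup>2))"
      by (intro lim_imp_Liminf[symmetric]) simp_all
  qed
  also have "\<dots> \<le> liminf (\<lambda>j. \<integral>\<^sup>+x. ennreal ((cmod (v x - u j x))\<^sup>2) \<partial>M)"
    by (rule nn_integral_liminf) measurable
  also have "\<dots> \<le> limsup (\<lambda>j. \<integral>\<^sup>+x. ennreal ((cmod (v x - u j x))\<^sup>2) \<partial>M)"
    by (rule Liminf_le_Limsup) simp
  also have "\<dots> \<le> ennreal e"
  proof (rule Limsup_bounded, rule eventually_sequentiallyI)
    fix j assume "N \<le> j"
    have "(\<integral>\<^sup>+x. ennreal ((cmod (v x - u j x))\<^sup>2) \<partial>M) = ennreal (\<integral>x. (cmod (v x - u j x))\<^sup>2 \<partial>M)"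
      by (rule nn_integral_eq_integral[OF int]) simp
    thus "(\<integral>\<^sup>+x. ennreal ((cmod (v x - u j x))\<^sup>2) \<partial>M) \<le> ennreal e"
      using bound(1)[OF \<open>N \<le> j\<close>] by (simp add: ennreal_leI)
  qed
  finally have le: "(\<integral>\<^sup>+x. ennreal ((cmod (v x - g x))\<^sup>2) \<partial>M) \<le> ennreal e" .
  show int': "integrable M (\<lambda>x. (cmod (v x - g x))\<^sup>2)"
    by (rule integrableI_nonneg) (use le_less_trans[OF le ennreal_less_top] in simp_all)
  have "ennreal (\<integral>x. (cmod (v x - g x))\<^sup>2 \<partial>M) \<le> ennreal e"
    using le nn_integral_eq_integral[OF int'] by simp
  thus "(\<integral>x. (cmod (v x - g x))\<^sup>2 \<partial>M) \<le> e" using bound(2) by (simp add: ennreal_le_iff)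
qed

text \<open>The pointwise inequality |h| \<le> \<delta>/2 + |h|^2 / (2 \<delta>) does the work of
  Cauchy-Schwarz and gives integrability at the same time.\<close>

lemma (in prob_space) integral_norm_less:
  fixes h :: "'a \<Rightarrow> complex"
  assumes h: "h \<in> borel_measurable M" "integrable M (\<lambda>x. (cmod (h x))\<^sup>2)"
    and \<delta>: "\<delta> > 0" "(\<integral>x. (cmod (h x))\<^sup>2 \<partial>M) < \<delta>\<^sup>2"
  shows "integrable M h" "(\<integral>x. cmod (h x) \<partial>M) < \<delta>"
proof -
  have le: "cmod (h x) \<le> \<delta> / 2 + (cmod (h x))\<^sup>2 / (2 * \<delta>)" for x
  proof -
    have "2 * \<delta> * cmod (h x) \<le> \<delta>\<^sup>2 + (cmod (h x))\<^sup>2"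
      using sum_squares_bound[of \<delta> "cmod (h x)"] by simp
    thus ?thesis using \<delta>(1) by (simp add: field_simps power2_eq_square)
  qed
  have int: "integrable M (\<lambda>x. \<delta> / 2 + (cmod (h x))\<^sup>2 / (2 * \<delta>))"
    using h(2) by (intro Bochner_Integration.integrable_add integrable_divide_zero integrable_const) simp_all
  show hint: "integrable M h"
  proof (rule Bochner_Integration.integrable_bound[OF int h(1)], rule AE_I2)
    fix x
    have "0 \<le> (cmod (h x))\<^sup>2 / (2 * \<delta>)" using \<delta>(1) by simp
    thus "norm (h x) \<le> norm (\<delta> / 2 + (cmod (h x))\<^sup>2 / (2 * \<delta>))"
      using le[of x] \<delta>(1) by simp
  qed
  have "(\<integral>x. cmod (h x) \<partial>M) \<le> (\<integral>x. \<delta> / 2 + (cmod (h x))\<^sup>2 / (2 * \<delta>) \<partial>M)"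
    by (rule integral_mono[OF integrable_norm[OF hint] int le])
  also have "\<dots> = \<delta> / 2 + (\<integral>x. (cmod (h x))\<^sup>2 \<partial>M) / (2 * \<delta>)"
    using h(2) by (subst Bochner_Integration.integral_add) (simp_all add: prob_space)
  also have "\<dots> < \<delta> / 2 + \<delta>\<^sup>2 / (2 * \<delta>)"
    using \<delta> by (intro add_strict_left_mono divide_strict_right_mono) simp_all
  also have "\<dots> = \<delta>" using \<delta>(1) by (simp add: power2_eq_square)
  finally show "(\<integral>x. cmod (h x) \<partial>M) < \<delta>" .
qed

lemma (in prob_space) integrable_of_square:
  assumes f: "square_integrable M f"
  shows "integrable M f"
proof -
  define I where "I = (\<integral>\<omega>. (cmod (f \<omega>))\<^sup>2 \<partial>M)"
  have I: "I \<ge> 0" by (simp add: I_def)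
  have "I < (I + 1)\<^sup>2" using I by (simp add: power2_sum add_nonneg_pos)
  moreover have "0 < I + 1" using I by simp
  ultimately show ?thesis using f
    by (intro integral_norm_less(1)[of f "I + 1"]) (auto simp: square_integrable_def I_def)
qed

lemma countable_polys: "countable (UNIV :: 'a::finite_field poly set)"
proof -
  have "z \<in> (\<Union>k. polys_below k)" for z :: "'a poly" using mem_polys_below_degree by blast
  hence "UNIV = (\<Union>k. polys_below k :: 'a poly set)" by blast
  moreover have "countable (\<Union>k. polys_below k :: 'a poly set)"
    by (intro countable_UN) (auto intro: countable_finite finite_polys_below)
  ultimately show ?thesis by simp
qed

text \<open>A single linear combination with the same coefficients in the system and on the torus,
  so that the spectral isometry applies to differences of ergodic averages.\<close>

lemma difference_of_averages:
  fixes h :: "'a::finite_field poly \<Rightarrow> complex"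
  assumes "n \<le> l"
  shows "average (polys_below n) h - average (polys_below l) h
    = (\<Sum>z\<in>polys_below l. (of_bool (z \<in> polys_below n) / of_nat (CARD('a) ^ n) - 1 / of_nat (CARD('a) ^ l)) * h z)"
proof -
  have "(\<Sum>z\<in>polys_below l. of_bool (z \<in> polys_below n) / of_nat (CARD('a) ^ n) * h z)
      = (\<Sum>z\<in>polys_below l. if z \<in> polys_below n then h z / of_nat (CARD('a) ^ n) else 0)"
    by (intro sum.cong refl) simp
  also have "\<dots> = (\<Sum>z\<in>{z \<in> polys_below l. z \<in> polys_below n}. h z / of_nat (CARD('a) ^ n))"
    by (rule sum.inter_filter[symmetric]) (rule finite_polys_below)
  also have "{z \<in> polys_below l. z \<in> polys_below n} = (polys_below n :: 'a poly set)"
    using polys_below_mono[OF assms] by blast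
  finally show ?thesis
    by (simp add: average_def card_polys_below left_diff_distrib sum_subtractf sum_divide_distrib)
qed

locale ergodic_mean_zero = square_integrable_system M T f
  for M :: "'x measure" and T :: "'a::finite_field poly \<Rightarrow> 'x \<Rightarrow> 'x" and f +
  fixes m :: "'a poly"
  assumes ergodic: "ergodic_action M (\<lambda>y. T (m * y))" and mean_zero: "(\<integral>\<omega>. f \<omega> \<partial>M) = 0"
begin

definition ergodic_average :: "nat \<Rightarrow> 'x \<Rightarrow> complex" where
  "ergodic_average n \<omega> = average (polys_below n) (\<lambda>z. f (T (m * z) \<omega>))"

lemma ergodic_average_measurable [measurable]: "ergodic_average n \<in> borel_measurable M"
proof -
  have "ergodic_average n = (\<lambda>\<omega>. average (polys_below n) (\<lambda>z. f (T (m * z) \<omega>)))"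
    by (rule ext) (rule ergodic_average_def)
  thus ?thesis unfolding average_def by simp
qed

text \<open>\<open>polys_below n\<close> is a group, so the invariance is exact at every point and
  not merely asymptotic.\<close>

lemma ergodic_average_invariant:
  assumes \<omega>: "\<omega> \<in> space M" and u: "u \<in> polys_below n"
  shows "ergodic_average n (T (m * u) \<omega>) = ergodic_average n \<omega>"
proof -
  have "(\<Sum>z\<in>polys_below n. f (T (m * z) (T (m * u) \<omega>))) = (\<Sum>z\<in>polys_below n. f (T (m * (z + u)) \<omega>))"
    by (intro sum.cong refl) (simp add: distrib_left T_add[OF \<omega>])
  also have "\<dots> = (\<Sum>z\<in>polys_below n. f (T (m * z) \<omega>))"
    by (rule sum.reindex_bij_witness[of _ "\<lambda>z. z - u" "\<lambda>z. z + u"])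
       (auto intro: polys_below_add polys_below_diff u)
  finally show ?thesis by (simp add: ergodic_average_def average_def)
qed

lemma f_integrable: "integrable M f"
  using square by (rule integrable_of_square)

lemma ergodic_average_integrable: "integrable M (ergodic_average n)"
  and ergodic_average_mean: "(\<integral>\<omega>. ergodic_average n \<omega> \<partial>M) = 0"
proof -
  have eq: "ergodic_average n = (\<lambda>\<omega>. (\<Sum>z\<in>polys_below n. f (T (m * z) \<omega>)) / of_nat (card (polys_below n :: 'a poly set)))"
    by (rule ext) (simp add: ergodic_average_def average_def)
  have int: "integrable M (\<lambda>\<omega>. f (T y \<omega>))" for y by (rule integrable_shift[OF f_integrable])
  show "integrable M (ergodic_average n)"
    unfolding eq by (intro integrable_divide_zero Bochner_Integration.integrable_sum int)
  have "(\<integral>\<omega>. f (T y \<omega>) \<partial>M) = 0" for y using integral_shift[OF f_measurable, of y] mean_zero by simp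
  thus "(\<integral>\<omega>. ergodic_average n \<omega> \<partial>M) = 0"
    unfolding eq by (simp add: Bochner_Integration.integral_sum[OF int])
qed

text \<open>The limes superior makes the set \<open>E\<close> invariant at every point, as ergodicity is formulated for
  strictly invariant sets; sets defined by \<open>g\<close> are only invariant almost everywhere.\<close>

lemma invariant_limit_zero:
  assumes r: "strict_mono r" and g: "g \<in> borel_measurable M" "integrable M g" "(\<integral>\<omega>. g \<omega> \<partial>M) = 0"
    and lim: "AE \<omega> in M. (\<lambda>i. ergodic_average (r i) \<omega>) \<longlonglongrightarrow> g \<omega>"
  shows "AE \<omega> in M. g \<omega> = 0"
proof -
  have le0: "AE \<omega> in M. Re (c * g \<omega>) \<le> 0" for c
  proof -
    define E where "E = {\<omega> \<in> space M. 0 < limsup (\<lambda>i. ereal (Re (c * ergodic_average (r i) \<omega>)))}"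
    have E [measurable]: "E \<in> sets M" unfolding E_def by measurable
    have "T (m * u) -` E \<inter> space M = E" for u
    proof -
      have "limsup (\<lambda>i. ereal (Re (c * ergodic_average (r i) (T (m * u) \<omega>))))
          = limsup (\<lambda>i. ereal (Re (c * ergodic_average (r i) \<omega>)))" if \<omega>: "\<omega> \<in> space M" for \<omega>
      proof (rule Limsup_eq, rule eventually_sequentiallyI[of "Suc (degree u)"])
        fix i assume "Suc (degree u) \<le> i"
        also have "i \<le> r i" by (rule seq_suble[OF r])
        finally have "u \<in> polys_below (r i)"
          using mem_polys_below_degree polys_below_mono by blast
        thus "ereal (Re (c * ergodic_average (r i) (T (m * u) \<omega>))) = ereal (Re (c * ergodic_average (r i) \<omega>))"
          by (simp add: ergodic_average_invariant[OF \<omega>])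
      qed
      thus ?thesis using T_space by (auto simp: E_def)
    qed
    hence "prob E = 0 \<or> prob E = 1"
      using ergodic E unfolding ergodic_action_def by blast
    moreover have limE: "AE \<omega> in M. \<omega> \<in> E \<longleftrightarrow> Re (c * g \<omega>) > 0"
      using lim AE_space
    proof eventually_elim
      case (elim \<omega>)
      have "(\<lambda>i. ereal (Re (c * ergodic_average (r i) \<omega>))) \<longlonglongrightarrow> ereal (Re (c * g \<omega>))"
        by (intro tendsto_intros elim(1))
      hence "limsup (\<lambda>i. ereal (Re (c * ergodic_average (r i) \<omega>))) = ereal (Re (c * g \<omega>))"
        by (intro lim_imp_Limsup) simp_all
      thus ?case using elim(2) by (simp add: E_def)
    qed
    ultimately show ?thesis
    proof (elim disjE)
      assume "prob E = 0"
      hence "AE \<omega> in M. \<omega> \<notin> E" using E by (simp add: prob_eq_0)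
      with limE show ?thesis by eventually_elim auto
    next
      assume "prob E = 1"
      hence "AE \<omega> in M. \<omega> \<in> E" using E by (simp add: prob_eq_1)
      with limE have pos: "AE \<omega> in M. Re (c * g \<omega>) > 0" by eventually_elim auto
      have cg: "integrable M (\<lambda>\<omega>. c * g \<omega>)" using g(2) by (rule integrable_mult_right)
      hence int: "integrable M (\<lambda>\<omega>. Re (c * g \<omega>))" by (rule integrable_Re)
      have "(\<integral>\<omega>. Re (c * g \<omega>) \<partial>M) = Re (\<integral>\<omega>. c * g \<omega> \<partial>M)" by (rule integral_Re[OF cg])
      also have "\<dots> = 0" using g(3) by simp
      finally have "(\<integral>\<omega>. Re (c * g \<omega>) \<partial>M) = 0" .
      moreover have "AE \<omega> in M. 0 \<le> Re (c * g \<omega>)" using pos by eventually_elim simp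
      ultimately have "AE \<omega> in M. Re (c * g \<omega>) = 0"
        using integral_nonneg_eq_0_iff_AE[OF int] by blast
      thus ?thesis by eventually_elim simp
    qed
  qed
  \<comment> \<open>The four multipliers bound the real and the imaginary part of g from both
    sides.\<close>
  show ?thesis using le0[of 1] le0[of "-1"] le0[of \<i>] le0[of "- \<i>"]
    by eventually_elim (simp add: complex_eq_iff)
qed

text \<open>The mean ergodic theorem on the spectral side: the squared norms \<open>b n\<close> of
  the averages are the measures of sets decreasing to the points of period m. Their convergence
  makes the averages Cauchy in L^2; the limit is invariant with mean zero, hence zero by ergodicity,
  and \<open>b n\<close> tends to 0.\<close>

lemma spectral_periodic_null:
  fixes \<nu> :: "'a laurent_torus measure"
  assumes \<nu>: "sets \<nu> = sets borel" "finite_measure \<nu>"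
    and spectral: "\<And>(I :: 'a poly set) c y. (\<integral>\<omega>. (cmod (\<Sum>i\<in>I. c i * f (T (y i) \<omega>)))\<^sup>2 \<partial>M)
       = (\<integral>x. (cmod (\<Sum>i\<in>I. c i * \<psi> (torus_pairing x (y i))))\<^sup>2 \<partial>\<nu>)"
  shows "AE x in \<nu>. \<not> periodic m (torus_pairing x)"
proof -
  interpret \<nu>: finite_measure \<nu> by (rule \<nu>)
  have sp: "space \<nu> = UNIV" by (rule space_torus[OF \<nu>(1)])
  let ?A = ergodic_average
  \<comment> \<open>The points whose character is trivial on the subgroup m
    \<open>polys_below n\<close>; its indicator is the average of characters that corresponds to
    \<open>ergodic_average n\<close>.\<close>
  define S where "S n = {x. \<forall>z\<in>polys_below n. \<psi> (torus_pairing x (m * z)) = 1}" for n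
  have S_sets [measurable]: "S n \<in> sets \<nu>" for n
  proof -
    have 1: "{x \<in> space \<nu>. \<psi> (torus_pairing x (m * z)) = 1} \<in> sets \<nu>" for z
    proof -
      have "(\<lambda>x. \<psi> (torus_pairing x (m * z))) \<in> borel_measurable \<nu>"
        unfolding measurable_cong_sets[OF \<nu>(1) refl] by (rule measurable_torus_pairing[of \<psi>])
      moreover have "{x \<in> space \<nu>. \<psi> (torus_pairing x (m * z)) = 1} = (\<lambda>x. \<psi> (torus_pairing x (m * z))) -` {1} \<inter> space \<nu>"
        by auto
      ultimately show ?thesis
        using measurable_sets[of "\<lambda>x. \<psi> (torus_pairing x (m * z))" \<nu> borel "{1}"] by simp
    qed
    have "{x \<in> space \<nu>. \<forall>z\<in>polys_below n. \<psi> (torus_pairing x (m * z)) = 1} \<in> sets \<nu>"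
      by (rule sets.sets_Collect_finite_All[OF 1 finite_polys_below])
    thus ?thesis by (simp add: S_def sp)
  qed
  have S_dec: "decseq S"
    unfolding decseq_def S_def using polys_below_mono by blast
  define b where "b n = measure \<nu> (S n)" for n
  have S_Inter: "(\<Inter>n. S n) = {x. periodic m (torus_pairing x)}"
  proof (intro set_eqI iffI)
    fix x assume x: "x \<in> (\<Inter>n. S n)"
    have "\<psi> (torus_pairing x (m * z)) = 1" for z
      using x mem_polys_below_degree[of z] unfolding S_def by blast
    thus "x \<in> {x. periodic m (torus_pairing x)}" by (simp add: periodic_def)
  qed (simp add: S_def periodic_def)
  have b_lim: "b \<longlonglongrightarrow> measure \<nu> {x. periodic m (torus_pairing x)}"
    unfolding b_def S_Inter[symmetric] by (rule \<nu>.finite_Lim_measure_decseq) (use S_sets S_dec in auto)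
  have char_average: "average (polys_below n) (\<lambda>z. \<psi> (torus_pairing x (m * z))) = of_bool (x \<in> S n)" for n x
  proof (cases "x \<in> S n")
    case True
    hence "average (polys_below n) (\<lambda>z. \<psi> (torus_pairing x (m * z))) = average (polys_below n) (\<lambda>_ :: 'a poly. 1)"
      by (intro average_cong) (simp add: S_def)
    thus ?thesis using True average_const[OF finite_polys_below polys_below_nonempty] by simp
  next
    case False
    then obtain z0 where z0: "z0 \<in> polys_below n" "\<psi> (torus_pairing x (m * z0)) \<noteq> 1" by (auto simp: S_def)
    have "(\<Sum>z\<in>polys_below n. \<psi> (torus_pairing x (m * z))) = 0"
      by (rule sum_multiplicative_eq_0[of _ z0])
         (use z0 in \<open>simp_all add: finite_polys_below polys_below_add distrib_left additive.add[OF torus_pairing_additive] psi_add\<close>)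
    thus ?thesis using False by (simp add: average_def)
  qed
  have diff_sq: "integrable M (\<lambda>\<omega>. (cmod (?A i \<omega> - ?A j \<omega>))\<^sup>2) \<and> (\<integral>\<omega>. (cmod (?A i \<omega> - ?A j \<omega>))\<^sup>2 \<partial>M) = \<bar>b i - b j\<bar>"
    if ij: "i \<le> j" for i j
  proof
    define c :: "'a poly \<Rightarrow> complex" where
      "c z = of_bool (z \<in> polys_below i) / of_nat (CARD('a) ^ i) - 1 / of_nat (CARD('a) ^ j)" for z
    have dA: "?A i \<omega> - ?A j \<omega> = (\<Sum>z\<in>polys_below j. c z * f (T (m * z) \<omega>))" for \<omega>
      unfolding ergodic_average_def c_def by (rule difference_of_averages[OF ij])
    have dS: "of_bool (x \<in> S i) - of_bool (x \<in> S j) = (\<Sum>z\<in>polys_below j. c z * \<psi> (torus_pairing x (m * z)))" for x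
      unfolding char_average[symmetric] c_def by (rule difference_of_averages[OF ij])
    show "integrable M (\<lambda>\<omega>. (cmod (?A i \<omega> - ?A j \<omega>))\<^sup>2)"
      unfolding dA by (rule integral_norm_sum_squared(1)) (rule integrable_products)
    have sub: "S j \<subseteq> S i" using S_dec ij by (rule decseqD)
    have "(\<integral>\<omega>. (cmod (?A i \<omega> - ?A j \<omega>))\<^sup>2 \<partial>M) = (\<integral>x. (cmod (of_bool (x \<in> S i) - of_bool (x \<in> S j)))\<^sup>2 \<partial>\<nu>)"
      unfolding dA dS by (rule spectral)
    also have "\<dots> = (\<integral>x. indicator (S i - S j) x \<partial>\<nu>)"
      by (rule Bochner_Integration.integral_cong) (use sub in \<open>auto simp: indicator_def\<close>)
    also have "\<dots> = measure \<nu> (S i - S j)" by (simp add: sp)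
    also have "\<dots> = b i - b j" unfolding b_def by (rule \<nu>.finite_measure_Diff) (use sub in simp_all)
    also have "\<dots> = \<bar>b i - b j\<bar>"
      unfolding b_def using \<nu>.finite_measure_mono[OF sub S_sets] by simp
    finally show "(\<integral>\<omega>. (cmod (?A i \<omega> - ?A j \<omega>))\<^sup>2 \<partial>M) = \<bar>b i - b j\<bar>" .
  qed
  have diff: "integrable M (\<lambda>\<omega>. (cmod (?A i \<omega> - ?A j \<omega>))\<^sup>2)" 
      "(\<integral>\<omega>. (cmod (?A i \<omega> - ?A j \<omega>))\<^sup>2 \<partial>M) = \<bar>b i - b j\<bar>" for i j
    using diff_sq[of i j] diff_sq[of j i] by (cases "i \<le> j"; simp add: norm_minus_commute abs_minus_commute)+
  have single: "(\<integral>\<omega>. (cmod (?A n \<omega>))\<^sup>2 \<partial>M) = b n" for n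
  proof -
    define c :: "'a poly \<Rightarrow> complex" where "c z = 1 / of_nat (CARD('a) ^ n)" for z
    have "average (polys_below n) h = (\<Sum>z\<in>polys_below n. c z * h z)" for h
      by (simp add: average_def c_def card_polys_below sum_divide_distrib)
    note eq = this
    have "(\<integral>\<omega>. (cmod (?A n \<omega>))\<^sup>2 \<partial>M) = (\<integral>x. (cmod (of_bool (x \<in> S n)))\<^sup>2 \<partial>\<nu>)"
      unfolding ergodic_average_def char_average[symmetric] eq by (rule spectral)
    also have "\<dots> = (\<integral>x. indicator (S n) x \<partial>\<nu>)"
      by (rule Bochner_Integration.integral_cong) (auto simp: indicator_def)
    also have "\<dots> = b n" by (simp add: sp b_def)
    finally show ?thesis .
  qed
  have cauchy: "\<exists>N. \<forall>i\<ge>N. \<forall>j\<ge>N. \<bar>b i - b j\<bar> < e" if "e > 0" for e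
    using metric_CauchyD[OF LIMSEQ_imp_Cauchy[OF b_lim] that] by (simp add: dist_real_def)
  have "\<exists>N. \<forall>i\<ge>N. \<forall>j\<ge>N. (\<integral>\<omega>. norm (?A i \<omega> - ?A j \<omega>) \<partial>M) < e" if e: "e > 0" for e :: real
  proof -
    obtain N where N: "\<forall>i\<ge>N. \<forall>j\<ge>N. \<bar>b i - b j\<bar> < e\<^sup>2" using cauchy[of "e\<^sup>2"] e by auto
    have "(\<integral>\<omega>. norm (?A i \<omega> - ?A j \<omega>) \<partial>M) < e" if "i \<ge> N" "j \<ge> N" for i j
      by (rule integral_norm_less(2)[OF _ diff(1) e]) (use N that in \<open>simp_all add: diff(2)\<close>)
    thus ?thesis by blast
  qed
  \<comment> \<open>An almost everywhere convergent subsequence supplies a pointwise limit, to which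
    the invariance argument can be applied.\<close>
  then obtain r where r: "strict_mono r" "AE \<omega> in M. Cauchy (\<lambda>i. ?A (r i) \<omega>)"
    using cauchy_L1_AE_cauchy_subseq[of M ?A] ergodic_average_integrable by blast
  define g where "g \<omega> = lim (\<lambda>i. ?A (r i) \<omega>)" for \<omega>
  have g [measurable]: "g \<in> borel_measurable M"
    unfolding g_def by (rule borel_measurable_lim_metric) simp
  have lim: "AE \<omega> in M. (\<lambda>i. ?A (r i) \<omega>) \<longlonglongrightarrow> g \<omega>"
    using r(2) by eventually_elim (simp add: g_def Cauchy_convergent convergent_LIMSEQ_iff[symmetric])
  have near: "\<exists>N. \<forall>i\<ge>N. integrable M (\<lambda>\<omega>. (cmod (?A i \<omega> - g \<omega>))\<^sup>2) \<and> (\<integral>\<omega>. (cmod (?A i \<omega> - g \<omega>))\<^sup>2 \<partial>M) < e"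
    if e: "e > 0" for e
  proof -
    obtain N where N: "\<forall>i\<ge>N. \<forall>j\<ge>N. \<bar>b i - b j\<bar> < e / 2" using cauchy[of "e / 2"] e by auto
    have "integrable M (\<lambda>\<omega>. (cmod (?A i \<omega> - g \<omega>))\<^sup>2)" "(\<integral>\<omega>. (cmod (?A i \<omega> - g \<omega>))\<^sup>2 \<partial>M) \<le> e / 2" if i: "i \<ge> N" for i
    proof -
      have bd: "(\<integral>\<omega>. (cmod (?A i \<omega> - ?A (r j) \<omega>))\<^sup>2 \<partial>M) \<le> e / 2" if j: "j \<ge> N" for j
      proof -
        have "N \<le> r j" using j seq_suble[OF r(1), of j] by simp
        thus ?thesis using N i by (simp add: diff(2) less_imp_le)
      qed
      show "integrable M (\<lambda>\<omega>. (cmod (?A i \<omega> - g \<omega>))\<^sup>2)" "(\<integral>\<omega>. (cmod (?A i \<omega> - g \<omega>))\<^sup>2 \<partial>M) \<le> e / 2"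
        using e by (intro L2_limit_bound[where u = "\<lambda>j. ?A (r j)" and N = N, OF _ _ g diff(1) bd _ lim]; simp)+
    qed
    thus ?thesis using e by (intro exI[of _ N]) force
  qed
  have gint: "integrable M g" and gmean: "(\<integral>\<omega>. g \<omega> \<partial>M) = 0"
  proof -
    have close: "integrable M g \<and> cmod (\<integral>\<omega>. g \<omega> \<partial>M) < e" if e: "e > 0" for e
    proof -
      obtain i where i: "integrable M (\<lambda>\<omega>. (cmod (?A i \<omega> - g \<omega>))\<^sup>2)" "(\<integral>\<omega>. (cmod (?A i \<omega> - g \<omega>))\<^sup>2 \<partial>M) < e\<^sup>2"
        using near[of "e\<^sup>2"] e by auto
      have m: "(\<lambda>\<omega>. ?A i \<omega> - g \<omega>) \<in> borel_measurable M" by simp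
      note d = integral_norm_less[OF m i(1) e i(2)]
      have gi: "integrable M g"
        using Bochner_Integration.integrable_diff[OF ergodic_average_integrable[of i] d(1)] by simp
      have "(\<integral>\<omega>. ?A i \<omega> - g \<omega> \<partial>M) = - (\<integral>\<omega>. g \<omega> \<partial>M)"
        by (simp add: Bochner_Integration.integral_diff[OF ergodic_average_integrable gi] ergodic_average_mean)
      moreover have "cmod (\<integral>\<omega>. ?A i \<omega> - g \<omega> \<partial>M) \<le> (\<integral>\<omega>. cmod (?A i \<omega> - g \<omega>) \<partial>M)"
        by (rule integral_norm_bound)
      ultimately show ?thesis using d(2) gi by simp
    qed
    show "integrable M g" using close[of 1] by simp
    show "(\<integral>\<omega>. g \<omega> \<partial>M) = 0"
      using close[of "cmod (\<integral>\<omega>. g \<omega> \<partial>M)"] by (cases "(\<integral>\<omega>. g \<omega> \<partial>M) = 0") auto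
  qed
  have g0: "AE \<omega> in M. g \<omega> = 0"
    by (rule invariant_limit_zero[OF r(1) g gint gmean lim])
  have "b \<longlonglongrightarrow> 0"
  proof (rule LIMSEQ_I)
    fix e :: real assume "e > 0"
    then obtain N where N: "\<forall>i\<ge>N. (\<integral>\<omega>. (cmod (?A i \<omega> - g \<omega>))\<^sup>2 \<partial>M) < e" using near[of e] by blast
    have "b i < e" if "i \<ge> N" for i
    proof -
      have "b i = (\<integral>\<omega>. (cmod (?A i \<omega> - g \<omega>))\<^sup>2 \<partial>M)"
        unfolding single[symmetric] by (rule integral_cong_AE) (use g0 in auto)
      thus ?thesis using N that by simp
    qed
    thus "\<exists>N. \<forall>n\<ge>N. norm (b n - 0) < e" by (intro exI[of _ N]) (simp add: b_def)
  qed
  hence "measure \<nu> {x. periodic m (torus_pairing x)} = 0"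
    using b_lim LIMSEQ_unique by blast
  moreover have "{x. periodic m (torus_pairing x)} \<in> sets \<nu>"
    unfolding S_Inter[symmetric] by (rule sets.countable_INT) (use S_sets in auto)
  ultimately have "{x. periodic m (torus_pairing x)} \<in> null_sets \<nu>"
    by (simp add: \<nu>.emeasure_eq_measure null_sets_def)
  thus ?thesis by (rule AE_I'[of _ \<nu>]) blast
qed

end

text \<open>After subtracting the mean, the norms become integrals of squared exponential sums
  against the spectral measure. These sums tend to 0 at every irrational point and are bounded by 1,
  so dominated convergence applies.\<close>

theorem (in separable_sum) generates_imp_averages_converge:
  fixes T :: "'a poly \<Rightarrow> 'x \<Rightarrow> 'x"
  assumes g: generates and erg: "totally_ergodic M T"
  shows "polynomial_averages_converge M T P"
  unfolding polynomial_averages_converge_def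
proof (intro allI impI)
  fix \<Phi> :: "nat \<Rightarrow> 'a poly set" and f :: "'x \<Rightarrow> complex"
  assume "folner \<Phi> \<and> square_integrable M f"
  hence \<Phi>: "folner \<Phi>" and f: "square_integrable M f" by auto
  have \<Phi>': "finite (\<Phi> N)" "\<Phi> N \<noteq> {}" for N using \<Phi> by (auto simp: folner_def)
  have sys: "mp_system M T" using erg by (simp add: totally_ergodic_def)
  interpret prob_space M using sys by (simp add: mp_system_def)
  have fm [measurable]: "f \<in> borel_measurable M" and fi: "integrable M (\<lambda>\<omega>. (cmod (f \<omega>))\<^sup>2)"
    using f by (auto simp: square_integrable_def)
  define e where "e = (\<integral>\<omega>. f \<omega> \<partial>M)"
  define f0 where "f0 \<omega> = f \<omega> - e" for \<omega>
  have f0m [measurable]: "f0 \<in> borel_measurable M" unfolding f0_def by simp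
  have f0: "square_integrable M f0"
  proof -
    have "integrable M (\<lambda>\<omega>. 2 * (cmod (f \<omega>))\<^sup>2 + 2 * (cmod e)\<^sup>2)" using fi by simp
    hence "integrable M (\<lambda>\<omega>. (cmod (f0 \<omega>))\<^sup>2)"
    proof (rule Bochner_Integration.integrable_bound)
      have "(cmod (a - e))\<^sup>2 \<le> 2 * (cmod a)\<^sup>2 + 2 * (cmod e)\<^sup>2" for a
      proof -
        have "(cmod (a - e))\<^sup>2 \<le> (cmod a + cmod e)\<^sup>2"
          by (intro power_mono norm_triangle_ineq4 norm_ge_zero)
        also have "\<dots> \<le> 2 * (cmod a)\<^sup>2 + 2 * (cmod e)\<^sup>2"
          using sum_squares_bound[of "cmod a" "cmod e"] by (simp add: power2_sum)
        finally show ?thesis .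
      qed
      thus "AE \<omega> in M. norm ((cmod (f0 \<omega>))\<^sup>2) \<le> norm (2 * (cmod (f \<omega>))\<^sup>2 + 2 * (cmod e)\<^sup>2)"
        by (simp add: f0_def)
    qed simp
    thus ?thesis by (simp add: square_integrable_def)
  qed
  interpret S: square_integrable_system M T f0 by standard (rule sys f0)+
  have f_int: "integrable M f" using f by (rule integrable_of_square)
  have mean0: "(\<integral>\<omega>. f0 \<omega> \<partial>M) = 0"
    unfolding f0_def using f_int by (simp add: e_def prob_space)
  obtain \<nu> :: "'a laurent_torus measure" where \<nu>0: "sets \<nu> = sets borel \<and> finite_measure \<nu> \<and>
      (\<forall>(I :: 'a poly set) c y. (\<integral>\<omega>. (cmod (\<Sum>i\<in>I. c i * f0 (T (y i) \<omega>)))\<^sup>2 \<partial>M)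
       = (\<integral>x. (cmod (\<Sum>i\<in>I. c i * \<psi> (torus_pairing x (y i))))\<^sup>2 \<partial>\<nu>))"
    using S.ex_spectral_measure by (rule exE)
  note \<nu> = \<nu>0[THEN conjunct1] \<nu>0[THEN conjunct2, THEN conjunct1]
    and spectral = \<nu>0[THEN conjunct2, THEN conjunct2, rule_format]
  interpret \<nu>: finite_measure \<nu> by (rule \<nu>)
  have "AE x in \<nu>. \<not> periodic W (torus_pairing x)" if "W \<noteq> 0" for W
  proof -
    interpret ergodic_mean_zero M T f0 W
      by standard (use erg that mean0 in \<open>auto simp: totally_ergodic_def\<close>)
    show ?thesis by (rule spectral_periodic_null[OF \<nu> spectral])
  qed
  \<comment> \<open>There are countably many W, so the null sets of points of period W combine into
    one.\<close>
  hence "AE x in \<nu>. \<forall>W\<in>UNIV - {0}. \<not> periodic W (torus_pairing x)"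
    by (subst AE_ball_countable) (auto intro: countable_subset[OF _ countable_polys])
  hence irr: "AE x in \<nu>. \<not> rational_functional (torus_pairing x)"
    by eventually_elim (auto simp: rational_functional_def)
  define h where "h N x = (cmod (average (\<Phi> N) (\<lambda>y. \<psi> (torus_pairing x (P \<circ>\<^sub>p y)))))\<^sup>2" for N x
  have hm: "h N \<in> borel_measurable \<nu>" for N
  proof -
    have [measurable]: "(\<lambda>x. \<psi> (torus_pairing x z)) \<in> borel_measurable \<nu>" for z
      unfolding measurable_cong_sets[OF \<nu>(1) refl] by (rule measurable_torus_pairing[of \<psi>])
    show ?thesis unfolding h_def average_def by measurable
  qed
  have key: "(L2_norm M (\<lambda>x. average (\<Phi> N) (\<lambda>y. f (T (P \<circ>\<^sub>p y) x)) - (\<integral>z. f z \<partial>M)))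
      = sqrt (\<integral>x. h N x \<partial>\<nu>)" for N
  proof -
    define c :: "'a poly \<Rightarrow> complex" where "c z = 1 / of_nat (card (\<Phi> N))" for z
    have eq: "average (\<Phi> N) u = (\<Sum>z\<in>\<Phi> N. c z * u z)" for u
      by (simp add: average_def c_def sum_divide_distrib)
    have "average (\<Phi> N) (\<lambda>y. f (T (P \<circ>\<^sub>p y) x)) - e = average (\<Phi> N) (\<lambda>y. f0 (T (P \<circ>\<^sub>p y) x))" for x
      using average_const[OF \<Phi>'(1) \<Phi>'(2), of N e]
      by (simp add: average_def f0_def sum_subtractf diff_divide_distrib)
    hence "L2_norm M (\<lambda>x. average (\<Phi> N) (\<lambda>y. f (T (P \<circ>\<^sub>p y) x)) - e)
        = sqrt (\<integral>x. (cmod (average (\<Phi> N) (\<lambda>y. f0 (T (P \<circ>\<^sub>p y) x))))\<^sup>2 \<partial>M)"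
      by (simp add: L2_norm_def)
    also have "(\<integral>x. (cmod (average (\<Phi> N) (\<lambda>y. f0 (T (P \<circ>\<^sub>p y) x))))\<^sup>2 \<partial>M) = (\<integral>x. h N x \<partial>\<nu>)"
      unfolding eq h_def by (rule spectral)
    finally show ?thesis by (simp add: e_def)
  qed
  have "(\<lambda>N. \<integral>x. h N x \<partial>\<nu>) \<longlonglongrightarrow> (\<integral>x. 0 \<partial>\<nu>)"
  proof (rule integral_dominated_convergence[where w = "\<lambda>_. 1"])
    show "AE x in \<nu>. (\<lambda>N. h N x) \<longlonglongrightarrow> 0" using irr
    proof eventually_elim
      case (elim x)
      have "(\<lambda>N. average (\<Phi> N) (\<lambda>y. \<psi> (torus_pairing x (P \<circ>\<^sub>p y)))) \<longlonglongrightarrow> 0"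
        by (rule irrational_average[OF g torus_pairing_additive elim \<Phi>])
      from tendsto_power[OF tendsto_norm[OF this], of 2] show ?case by (simp add: h_def)
    qed
    have "cmod (average (\<Phi> N) (\<lambda>y. \<psi> (torus_pairing x (P \<circ>\<^sub>p y)))) \<le> 1" for N x
      by (rule norm_average_le[OF \<Phi>']) simp
    thus "AE x in \<nu>. norm (h N x) \<le> 1" for N by (simp add: h_def power_le_one)
  qed (use hm in simp_all)
  hence "(\<lambda>N. sqrt (\<integral>x. h N x \<partial>\<nu>)) \<longlonglongrightarrow> sqrt 0" by (intro tendsto_real_sqrt) simp
  thus "(\<lambda>N. L2_norm M (\<lambda>x. average (\<Phi> N) (\<lambda>y. f (T (P \<circ>\<^sub>p y) x)) - (\<integral>z. f z \<partial>M))) \<longlonglongrightarrow> 0"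
    by (simp add: key)
qed


section \<open>Rotations of the torus\<close>

definition rotation :: "'a::finite_field fls \<Rightarrow> 'a poly \<Rightarrow> 'a laurent_torus \<Rightarrow> 'a laurent_torus" where
  "rotation \<alpha> y x = x + abs_laurent_torus (fls_of_poly y * \<alpha>)"

lemma torus_pairing_rotation:
  "torus_pairing (rotation \<alpha> y x) z = torus_pairing x z + torus_pairing (abs_laurent_torus \<alpha>) (z * y)"
  by (simp add: rotation_def torus_pairing_add torus_pairing_mult)

lemma mp_system_rotation: "mp_system haar (rotation \<alpha>)"
proof -
  have meas: "rotation \<alpha> y \<in> measurable haar haar" for y
  proof -
    have "rotation \<alpha> y \<in> borel_measurable borel"
      unfolding rotation_def[abs_def] by (rule measurable_torus_translation)
    thus ?thesis by (simp cong: measurable_cong_sets)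
  qed
  have "distr haar haar (rotation \<alpha> y) = haar" for y
  proof -
    have "distr haar haar (rotation \<alpha> y) = distr haar borel (\<lambda>x. x + abs_laurent_torus (fls_of_poly y * \<alpha>))"
      by (rule distr_cong) (simp_all add: rotation_def)
    thus ?thesis by (simp only: haar_translation)
  qed
  moreover have "rotation \<alpha> 0 x = x" for x :: "'a laurent_torus"
    by (rule torus_eqI) (simp add: rotation_def fls_of_poly_0)
  moreover have "rotation \<alpha> (y + z) x = rotation \<alpha> y (rotation \<alpha> z x)" for y z x
    by (simp add: rotation_def fls_of_poly_add distrib_right abs_laurent_torus_add add_ac)
  ultimately show ?thesis using meas prob_space_haar by (simp add: mp_system_def)
qed

text \<open>The nontrivial Fourier coefficients of an invariant set vanish, so it is independent of every
  cylinder, hence of itself.\<close>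

lemma totally_ergodic_rotation:
  fixes \<alpha> :: "'a::finite_field fls"
  assumes \<alpha>: "\<alpha> \<notin> rational_fls"
  shows "totally_ergodic haar (rotation \<alpha>)"
proof -
  interpret prob_space "haar :: 'a laurent_torus measure" by (rule prob_space_haar)
  have "prob A = 0 \<or> prob A = 1"
    if m: "m \<noteq> 0" and A: "A \<in> sets haar" and inv: "\<And>y. rotation \<alpha> (m * y) -` A \<inter> space haar = A"
    for m :: "'a poly" and A
  proof -
    have [measurable]: "A \<in> sets borel" using A by simp
    define f :: "'a poly \<Rightarrow> 'a laurent_torus \<Rightarrow> complex"
      where "f z x = of_real (indicator A x) * \<psi> (torus_pairing x z)" for z x
    have [measurable]: "f z \<in> borel_measurable borel" for z
      unfolding f_def using measurable_torus_pairing[of \<psi> z] by measurable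
    have f_int: "integrable haar (f z)" for z
      by (rule integrable_const_bound[of _ 1]) (auto simp: f_def norm_mult indicator_def)
    have f0: "(\<integral>x. f z x \<partial>haar) = 0" if z: "z \<noteq> 0" for z
    proof -
      \<comment> \<open>As z m is not a period of the pairing with \<alpha>, some element of m F[t]
        rotates the Fourier mode z nontrivially, while A is invariant under it.\<close>
      have "z * m \<noteq> 0" using z m by simp
      hence "\<not> periodic (z * m) (torus_pairing (abs_laurent_torus \<alpha>))"
        using irrational_torus_pairing[OF \<alpha>] unfolding rational_functional_def by blast
      then obtain y where y: "\<psi> (torus_pairing (abs_laurent_torus \<alpha>) (z * (m * y))) \<noteq> 1"
        by (auto simp: periodic_def mult.assoc)
      define \<theta> where "\<theta> = abs_laurent_torus (fls_of_poly (m * y) * \<alpha>)"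
      have "x + \<theta> \<in> A \<longleftrightarrow> x \<in> A" for x
        using inv[of y] by (auto simp: rotation_def \<theta>_def)
      hence shift: "f z (x + \<theta>) = \<psi> (torus_pairing \<theta> z) * f z x" for x
        by (simp add: f_def torus_pairing_add psi_add indicator_def)
      have "(\<integral>x. f z x \<partial>haar) = (\<integral>x. f z x \<partial>distr haar borel (\<lambda>x. x + \<theta>))"
        by (simp only: haar_translation)
      also have "\<dots> = (\<integral>x. f z (x + \<theta>) \<partial>haar)" by (rule integral_distr) simp_all
      also have "\<dots> = \<psi> (torus_pairing \<theta> z) * (\<integral>x. f z x \<partial>haar)"
        unfolding shift by (rule integral_mult_right_zero)
      finally show ?thesis using y by (auto simp: \<theta>_def torus_pairing_mult)
    qed
    have indep: "prob (A \<inter> cylinder xs) = prob A * prob (cylinder xs)" for xs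
    proof -
      define k where "k = length xs"
      obtain y where y: "torus_prefix k y = xs" using ex_torus_prefix[of xs] unfolding k_def by blast
      have pt: "complex_of_real (indicator (A \<inter> cylinder xs) x)
          = (\<Sum>z\<in>polys_below k. cnj (\<psi> (torus_pairing y z)) / of_nat (CARD('a) ^ k) * f z x)" for x
      proof -
        have "complex_of_real (indicator (A \<inter> cylinder xs) x)
            = of_real (indicator A x) * of_bool (torus_prefix k x = torus_prefix k y)"
          by (simp add: y cylinder_def k_def[symmetric] indicator_def)
        also have "\<dots> = (\<Sum>z\<in>polys_below k. cnj (\<psi> (torus_pairing y z)) / of_nat (CARD('a) ^ k) * f z x)"
          unfolding average_torus_pairing[symmetric] average_def card_polys_below
          by (simp add: f_def sum_divide_distrib sum_distrib_left mult_ac)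
        finally show ?thesis .
      qed
      have "complex_of_real (prob (A \<inter> cylinder xs)) = complex_of_real (\<integral>x. indicator (A \<inter> cylinder xs) x \<partial>haar)"
        by simp
      also have "\<dots> = (\<integral>x. complex_of_real (indicator (A \<inter> cylinder xs) x) \<partial>haar)"
        by (rule integral_complex_of_real[symmetric])
      also have "\<dots> = (\<Sum>z\<in>polys_below k. cnj (\<psi> (torus_pairing y z)) / of_nat (CARD('a) ^ k) * (\<integral>x. f z x \<partial>haar))"
        unfolding pt
        by (subst Bochner_Integration.integral_sum) (intro integrable_mult_right f_int, simp only: integral_mult_right_zero)
      also have "\<dots> = (\<Sum>z\<in>(polys_below k :: 'a poly set). if z = 0 then (\<integral>x. f 0 x \<partial>haar) / of_nat (CARD('a) ^ k) else 0)"
        by (intro sum.cong refl) (auto simp: f0 torus_pairing_def)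
      also have "\<dots> = (\<integral>x. f 0 x \<partial>haar) / of_nat (CARD('a) ^ k)"
        using zero_in_polys_below by (simp add: finite_polys_below)
      also have "(\<integral>x. f 0 x \<partial>haar) = complex_of_real (\<integral>x. indicator A x \<partial>haar)"
        unfolding integral_complex_of_real[symmetric] by (simp add: f_def torus_pairing_def)
      also have "\<dots> / of_nat (CARD('a) ^ k) = complex_of_real (prob A * prob (cylinder xs))"
        by (simp add: haar_cylinder k_def)
      finally show ?thesis by (simp only: of_real_eq_iff)
    qed
    \<comment> \<open>Independence from cylinders extends to all Borel sets, because cylinders
      determine a measure; applied to A itself it gives that prob A is its own square.\<close>
    have "density haar (indicator A) = scale_measure (emeasure haar A) (haar :: 'a laurent_torus measure)"
    proof (rule measure_torus_eqI)
      have dens: "emeasure (density haar (indicator A)) B = emeasure haar (A \<inter> B)" if "B \<in> sets borel" for B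
        using that by (simp add: emeasure_density nn_integral_set_ennreal flip: indicator_inter_arith)
      show "finite_measure (density haar (indicator A))"
        by (rule finite_measureI) (simp add: dens)
      fix xs :: "'a list"
      have "emeasure haar (A \<inter> cylinder xs) = emeasure haar A * emeasure haar (cylinder xs)"
        by (simp add: emeasure_eq_measure indep ennreal_mult)
      thus "emeasure (density haar (indicator A)) (cylinder xs)
          = emeasure (scale_measure (emeasure haar A) haar) (cylinder xs)"
        by (simp add: dens cylinder_sets)
    qed simp_all
    hence "emeasure (density haar (indicator A)) A = emeasure (scale_measure (emeasure haar A) haar) A" by simp
    hence "emeasure haar A = emeasure haar A * emeasure haar A"
      by (simp add: emeasure_density flip: indicator_inter_arith)
    hence "prob A = prob A * prob A"
      by (simp add: emeasure_eq_measure flip: ennreal_mult)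
    thus ?thesis by simp
  qed
  thus ?thesis unfolding totally_ergodic_def ergodic_action_def using mp_system_rotation by blast
qed


section \<open>Irrational points annihilated by a nonlinear additive polynomial\<close>

text \<open>The correlations of \<psi> o L with the characters x |-> \<psi>(b x) add up to |F|, so
  some b has nonzero correlation; orthogonality then makes the two characters equal.\<close>

lemma additive_field_character:
  fixes L :: "'a::finite_field \<Rightarrow> 'a"
  assumes L: "additive_map L"
  obtains b where "\<And>x. \<psi> (L x) = \<psi> (b * x)"
proof -
  have "(\<Sum>b\<in>UNIV. \<Sum>x\<in>UNIV. \<psi> (L x) * cnj (\<psi> (b * x))) = (\<Sum>x\<in>UNIV. \<psi> (L x) * cnj (\<Sum>b\<in>UNIV. \<psi> (b * x)))"
    by (subst sum.swap) (simp add: sum_distrib_left)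
  also have "\<dots> = (\<Sum>x\<in>(UNIV :: 'a set). if x = 0 then of_nat CARD('a) else 0)"
    by (intro sum.cong refl) (simp add: sum_field_characters additive.zero[OF L])
  also have "\<dots> \<noteq> 0" by simp
  finally obtain b where b: "(\<Sum>x\<in>UNIV. \<psi> (L x) * cnj (\<psi> (b * x))) \<noteq> 0" by (meson sum.neutral)
  have "\<psi> (L x) * cnj (\<psi> (b * x)) = 1" for x
  proof (rule ccontr)
    assume "\<psi> (L x) * cnj (\<psi> (b * x)) \<noteq> 1"
    hence "(\<Sum>x\<in>UNIV. \<psi> (L x) * cnj (\<psi> (b * x))) = 0"
      by (intro sum_multiplicative_eq_0[of UNIV x]) (simp_all add: additive.add[OF L] psi_add distrib_left)
    thus False using b by simp
  qed
  hence "\<psi> (L x) = \<psi> (b * x)" for x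
    by (metis mult.assoc mult.left_neutral mult.right_neutral psi_mult_cnj(2))
  thus ?thesis by (rule that)
qed

lemma countable_rational_fls: "countable (rational_fls :: 'a::finite_field fls set)"
proof -
  have "rational_fls \<subseteq> (\<lambda>(u, v). fls_of_poly u / fls_of_poly v) ` (UNIV \<times> (UNIV :: 'a poly set))"
    by (auto simp: rational_fls_def)
  thus ?thesis
    by (rule countable_subset) (intro countable_image countable_SIGMA countable_polys)
qed

lemma torus_pairing_monom: "torus_pairing x (monom c i) = torus_coeff x i * c"
proof -
  have "monom c i \<in> polys_below (Suc i)" by (auto simp: polys_below_def coeff_monom)
  hence "torus_pairing x (monom c i) = (\<Sum>j<Suc i. torus_coeff x j * coeff (monom c i) j)"
    by (simp add: torus_pairing_prefix list_pairing_def torus_prefix_def del: upt_Suc sum.lessThan_Suc)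
  also have "\<dots> = (\<Sum>j<Suc i. if j = i then torus_coeff x i * c else 0)"
    by (intro sum.cong refl) (simp add: coeff_monom)
  finally show ?thesis by simp
qed

lemma torus_pairing_pcompose_monom:
  "torus_pairing x (d \<circ>\<^sub>p monom c j) = (\<Sum>e\<le>degree d. torus_coeff x (j * e) * (coeff d e * c ^ e))"
  by (simp add: pcompose_as_sum additive.sum[OF torus_pairing_additive] monom_power smult_monom torus_pairing_monom)

text \<open>The digits of \<open>\<alpha>\<close> are chosen recursively. The digit at \<open>j deg d\<close> is determined by the previous
  ones through the condition for \<open>z \<in> \<F> t\<^sup>j\<close>; the digits at \<open>k deg d + 1\<close> are free and diagonalise
  against an enumeration of the rational elements.\<close>

lemma ex_irrational_annihilator:
  fixes d :: "'a::finite_field poly"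
  assumes d: "frobenius_supported d" "degree d > 1"
  obtains \<alpha> where "\<alpha> \<notin> rational_fls" "\<And>z. \<psi> (torus_pairing (abs_laurent_torus \<alpha>) (d \<circ>\<^sub>p z)) = 1"
proof -
  define D where "D = degree d"
  have D: "D > 1" "coeff d D \<noteq> 0" using d(2) by (auto simp: D_def)
  then obtain m where m: "D = CHAR('a) ^ m" using d(1) unfolding frobenius_supported_def by blast
  define bad where "bad k = torus_coeff (abs_laurent_torus (from_nat_into rational_fls k :: 'a fls)) (k * D + 1)" for k
  define R :: "(nat \<Rightarrow> 'a) \<Rightarrow> nat \<Rightarrow> 'a \<Rightarrow> bool" where
    "R a i v \<longleftrightarrow> (if i = 0 then v = 0
       else if D dvd i then \<forall>x. \<psi> ((\<Sum>e<D. a (i div D * e) * (coeff d e * x ^ e)) + v * (coeff d D * x ^ D)) = 1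
       else if i mod D = 1 then v \<noteq> bad (i div D) else True)" for a i v
  \<comment> \<open>The condition at i = j D involves only the digits at j e with e < D, all earlier
    since j > 0. The digit 0 is set to 0, which settles j = 0, that is, constant z.\<close>
  have "\<exists>a. \<forall>i. R a i (a i)"
  proof (rule dependent_wellorder_choice)
    fix v :: 'a and f g :: "nat \<Rightarrow> 'a" and i :: nat assume fg: "\<And>j. j < i \<Longrightarrow> f j = g j"
    have "f (i div D * e) = g (i div D * e)" if i: "i \<noteq> 0" "D dvd i" and e: "e < D" for e
    proof (rule fg)
      have "i div D * D = i" using i(2) by simp
      moreover have "i div D \<noteq> 0" using \<open>i div D * D = i\<close> i(1) by (metis mult_0)
      hence "i div D * e < i div D * D" using e by simp
      ultimately show "i div D * e < i" by simp
    qed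
    hence "(\<Sum>e<D. f (i div D * e) * (coeff d e * x ^ e)) = (\<Sum>e<D. g (i div D * e) * (coeff d e * x ^ e))"
      if "i \<noteq> 0" "D dvd i" for x
      using that by (intro sum.cong refl) simp
    thus "R f i v = R g i v" by (cases "i = 0"; cases "D dvd i") (simp_all add: R_def)
  next
    fix i :: nat and f :: "nat \<Rightarrow> 'a"
    show "\<exists>v. R f i v"
    proof (cases "i \<noteq> 0 \<and> D dvd i")
      case True
      define S where "S x = (\<Sum>e<D. f (i div D * e) * (coeff d e * x ^ e))" for x :: 'a
      have S: "additive_map S"
        unfolding Modules.additive_def
      proof (intro allI)
        fix x y
        have "coeff d e * (x + y) ^ e = coeff d e * x ^ e + coeff d e * y ^ e" for e
        proof (cases "coeff d e = 0")
          case False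
          then obtain j where "e = CHAR('a) ^ j" using d(1) unfolding frobenius_supported_def by blast
          thus ?thesis by (simp add: frobenius_field_add distrib_left)
        qed simp
        thus "S (x + y) = S x + S y" by (simp add: S_def distrib_left sum.distrib)
      qed
      \<comment> \<open>Since D is a power of p, x |-> x^D has an additive inverse function. In the
        variable x^D the contribution of the earlier digits is a character x^D |-> \<psi>(b x^D),
        and the new digit cancels it.\<close>
      define \<phi> where "\<phi> = inv (\<lambda>x :: 'a. x ^ D)"
      have bij: "bij (\<lambda>x :: 'a. x ^ D)" unfolding m by (rule frobenius_field_bij)
      have \<phi>1: "\<phi> (x ^ D) = x" for x
        unfolding \<phi>_def by (rule inv_f_f[OF bij_is_inj[OF bij]])
      have \<phi>2: "(\<phi> x) ^ D = x" for x
        unfolding \<phi>_def by (rule surj_f_inv_f[OF bij_is_surj[OF bij]])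
      have \<phi>add: "\<phi> (x + y) = \<phi> x + \<phi> y" for x y
      proof -
        have "(\<phi> x + \<phi> y) ^ D = x + y" using frobenius_field_add[of "\<phi> x" "\<phi> y" m] by (simp add: m[symmetric] \<phi>2)
        thus ?thesis using \<phi>1[of "\<phi> x + \<phi> y"] by simp
      qed
      have "additive_map (\<lambda>x. S (\<phi> x))"
        by (simp add: Modules.additive_def \<phi>add additive.add[OF S])
      then obtain b where b: "\<And>x. \<psi> (S (\<phi> x)) = \<psi> (b * x)" by (rule additive_field_character) blast
      have "\<psi> (S x + (- b / coeff d D) * (coeff d D * x ^ D)) = 1" for x
        using b[of "x ^ D"] D(2) by (simp add: \<phi>1 psi_diff)
      hence "R f i (- b / coeff d D)" using True by (simp add: R_def S_def)
      thus ?thesis by blast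
    next
      case False
      hence "R f i (if i = 0 then 0 else bad (i div D) + 1)" by (cases "i = 0") (auto simp: R_def)
      thus ?thesis by blast
    qed
  qed
  then obtain a where a: "\<And>i. R a i (a i)" by blast
  define \<alpha> where "\<alpha> = fls_of_digits a"
  have coeff_\<alpha>: "torus_coeff (abs_laurent_torus \<alpha>) i = a i" for i
    using torus_coeff_of_digits[of a i] unfolding torus_of_digits_def \<alpha>_def .
  have "\<alpha> \<notin> rational_fls"
  proof
    assume \<alpha>: "\<alpha> \<in> rational_fls"
    from from_nat_into_surj[OF countable_rational_fls \<alpha>]
    obtain k where k: "from_nat_into rational_fls k = \<alpha>" by (rule exE)
    have "a (k * D + 1) = bad k" unfolding bad_def k coeff_\<alpha> ..
    moreover have dm: "(k * D + 1) mod D = 1" "(k * D + 1) div D = k"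
      using D(1) mod_mult_self3[of k D 1] div_mult_self3[of D k 1] by simp_all
    moreover have "\<not> D dvd k * D + 1" unfolding dvd_eq_mod_eq_0 dm(1) by simp
    ultimately show False using a[of "k * D + 1"] by (simp add: R_def)
  qed
  moreover have "\<psi> (torus_pairing (abs_laurent_torus \<alpha>) (d \<circ>\<^sub>p z)) = 1" for z
  proof (rule poly_multiplicative_trivial[where f = "\<lambda>z. \<psi> (torus_pairing (abs_laurent_torus \<alpha>) (d \<circ>\<^sub>p z))"])
    have add: "additive_map (\<lambda>z. torus_pairing (abs_laurent_torus \<alpha>) (d \<circ>\<^sub>p z))"
      by (rule additive_comp[OF torus_pairing_additive frobenius_supported_additive[OF d(1)]])
    show "\<psi> (torus_pairing (abs_laurent_torus \<alpha>) (d \<circ>\<^sub>p (x + y)))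
        = \<psi> (torus_pairing (abs_laurent_torus \<alpha>) (d \<circ>\<^sub>p x)) * \<psi> (torus_pairing (abs_laurent_torus \<alpha>) (d \<circ>\<^sub>p y))" for x y
      using additive.add[OF add, of x y] by (simp add: psi_add)
    show "\<psi> (torus_pairing (abs_laurent_torus \<alpha>) (d \<circ>\<^sub>p 0)) = 1"
      using additive.zero[OF add] by simp
    show "\<psi> (torus_pairing (abs_laurent_torus \<alpha>) (d \<circ>\<^sub>p monom c j)) = 1" for c j
    proof -
      have eq: "torus_pairing (abs_laurent_torus \<alpha>) (d \<circ>\<^sub>p monom c j)
          = (\<Sum>e<D. a (j * e) * (coeff d e * c ^ e)) + a (j * D) * (coeff d D * c ^ D)"
        unfolding torus_pairing_pcompose_monom coeff_\<alpha> D_def[symmetric] lessThan_Suc_atMost[symmetric] by simp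
      show ?thesis
      proof (cases "j = 0")
        case True
        have "a 0 = 0" using a[of 0] by (simp add: R_def)
        thus ?thesis unfolding eq by (simp add: True)
      next
        case False
        have "j * D \<noteq> 0" "D dvd j * D" and div: "j * D div D = j" using False D(1) by auto
        hence "\<forall>x. \<psi> ((\<Sum>e<D. a (j * D div D * e) * (coeff d e * x ^ e)) + a (j * D) * (coeff d D * x ^ D)) = 1"
          using a[of "j * D"] unfolding R_def by presburger
        thus ?thesis unfolding eq div by blast
      qed
    qed
  qed
  ultimately show ?thesis by (rule that)
qed


section \<open>The equivalences\<close>

lemma folner_polys_below: "folner polys_below"
  unfolding folner_def
proof (intro conjI allI)
  fix n :: "'a poly"
  have "(\<lambda>x. x + n) ` polys_below N = polys_below N" if "N \<ge> Suc (degree n)" for N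
  proof -
    have n: "n \<in> polys_below N" using mem_polys_below_degree polys_below_mono[OF that] by blast
    have "x \<in> (\<lambda>x. x + n) ` polys_below N" if "x \<in> polys_below N" for x
      by (rule image_eqI[of _ _ "x - n"]) (simp_all add: polys_below_diff that n)
    thus ?thesis using polys_below_add n by blast
  qed
  hence "eventually (\<lambda>N. real (card (sym_diff ((\<lambda>x. x + n) ` polys_below N) (polys_below N))) / real (card (polys_below N)) = 0) sequentially"
    unfolding eventually_sequentially by (intro exI[of _ "Suc (degree n)"]) simp
  thus "(\<lambda>N. real (card (sym_diff ((\<lambda>x. x + n) ` polys_below N) (polys_below N))) / real (card (polys_below N))) \<longlonglongrightarrow> 0"
    by (rule tendsto_eventually)
qed (simp_all add: finite_polys_below)

lemma continuous_on_torus_coeff_0: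
  "continuous_on UNIV (\<lambda>x. \<psi> (torus_pairing x (1 :: 'a::finite_field poly)))"
proof -
  have "open ((\<lambda>x. \<psi> (torus_pairing x (1 :: 'a poly))) -` B)" for B
    unfolding open_torus_iff by (auto intro!: exI[of _ 1] simp: torus_pairing_def)
  thus ?thesis by (simp add: continuous_on_open_vimage)
qed

context separable_sum begin

lemma ex_annihilating_rotation:
  assumes "\<not> generates"
  obtains \<alpha> where "\<alpha> \<notin> rational_fls" "\<And>y. \<psi> (torus_pairing (abs_laurent_torus \<alpha>) (P \<circ>\<^sub>p y)) = 1"
proof -
  obtain d \<xi> P' where d: "frobenius_supported d" "degree d > 1" "\<forall>i\<in>{1..n}. \<eta> i = d \<circ>\<^sub>p \<xi> i"
    "\<forall>y. P \<circ>\<^sub>p y = d \<circ>\<^sub>p P' y" by (rule left_factor[OF assms])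
  obtain \<alpha> where "\<alpha> \<notin> rational_fls" "\<And>z. \<psi> (torus_pairing (abs_laurent_torus \<alpha>) (d \<circ>\<^sub>p z)) = 1"
    by (rule ex_irrational_annihilator[OF d(1,2)]) blast
  thus ?thesis using d(4) by (intro that[of \<alpha>]) simp_all
qed

lemma generates_imp_good:
  assumes g: generates
  shows "good_for_irrational_equidistribution P"
  unfolding good_for_irrational_equidistribution_def well_distributed_def
proof (intro allI impI, elim conjE)
  fix \<alpha> :: "'a fls" and h :: "'a laurent_torus \<Rightarrow> complex" and \<Phi> :: "nat \<Rightarrow> 'a poly set"
  assume \<alpha>: "\<alpha> \<notin> rational_fls" and h: "continuous_on UNIV h" and \<Phi>: "folner \<Phi>"
  show "(\<lambda>N. average (\<Phi> N) (\<lambda>n. h (abs_laurent_torus (fls_of_poly (P \<circ>\<^sub>p n) * \<alpha>)))) \<longlonglongrightarrow> (\<integral>x. h x \<partial>haar)"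
  proof (rule weyl_criterion[OF _ _ _ h])
    show "finite (\<Phi> N)" "\<Phi> N \<noteq> {}" for N using \<Phi> by (auto simp: folner_def)
    fix z :: "'a poly" assume z: "z \<noteq> 0"
    define L where "L w = torus_pairing (abs_laurent_torus \<alpha>) (z * w)" for w
    have L: "additive_map L"
      by (simp add: L_def Modules.additive_def distrib_left additive.add[OF torus_pairing_additive])
    have "\<not> rational_functional L"
    proof
      assume "rational_functional L"
      then obtain W where "W \<noteq> 0" "periodic W L" by (auto simp: rational_functional_def)
      hence "z * W \<noteq> 0" "periodic (z * W) (torus_pairing (abs_laurent_torus \<alpha>))"
        using z by (simp_all add: periodic_def L_def mult.assoc)
      thus False using irrational_torus_pairing[OF \<alpha>] unfolding rational_functional_def by blast
    qed
    from irrational_average[OF g L this \<Phi>]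
    show "(\<lambda>N. average (\<Phi> N) (\<lambda>n. \<psi> (torus_pairing (abs_laurent_torus (fls_of_poly (P \<circ>\<^sub>p n) * \<alpha>)) z))) \<longlonglongrightarrow> 0"
      by (simp add: torus_pairing_mult L_def)
  qed
qed

text \<open>For the annihilated irrational \<alpha>, the character at 1 is constantly 1 along the
  sequence, while its Haar integral is 0.\<close>

lemma not_generates_imp_not_good:
  assumes "\<not> generates"
  shows "\<not> good_for_irrational_equidistribution P"
proof
  assume good: "good_for_irrational_equidistribution P"
  obtain \<alpha> where \<alpha>: "\<alpha> \<notin> rational_fls" "\<And>y. \<psi> (torus_pairing (abs_laurent_torus \<alpha>) (P \<circ>\<^sub>p y)) = 1"
    by (rule ex_annihilating_rotation[OF assms]) blast
  have "well_distributed (\<lambda>n. fls_of_poly (P \<circ>\<^sub>p n) * \<alpha>)"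
    using good \<alpha>(1) by (simp add: good_for_irrational_equidistribution_def)
  hence "(\<lambda>N. average (polys_below N) (\<lambda>n. \<psi> (torus_pairing (abs_laurent_torus (fls_of_poly (P \<circ>\<^sub>p n) * \<alpha>)) 1)))
      \<longlonglongrightarrow> (\<integral>x. \<psi> (torus_pairing x (1 :: 'a poly)) \<partial>haar)"
    unfolding well_distributed_def using continuous_on_torus_coeff_0 folner_polys_below by blast
  hence "(\<lambda>N. 1 :: complex) \<longlonglongrightarrow> 0"
    by (simp add: torus_pairing_mult \<alpha>(2) average_const[OF finite_polys_below polys_below_nonempty] integral_torus_character)
  thus False using LIMSEQ_unique tendsto_const zero_neq_one by metis
qed

text \<open>In the rotation by the annihilated \<alpha>, the character at 1 is fixed by all T_(P(y))
  but has mean zero and norm one. This counterexample lives on the torus, whence the type in the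
  statement.\<close>

lemma not_generates_imp_not_averages_converge:
  assumes "\<not> generates"
  shows "\<not> averages_converge_on_type TYPE('a laurent_torus) P"
proof
  assume conv: "averages_converge_on_type TYPE('a laurent_torus) P"
  interpret prob_space "haar :: 'a laurent_torus measure" by (rule prob_space_haar)
  obtain \<alpha> where \<alpha>: "\<alpha> \<notin> rational_fls" "\<And>y. \<psi> (torus_pairing (abs_laurent_torus \<alpha>) (P \<circ>\<^sub>p y)) = 1"
    by (rule ex_annihilating_rotation[OF assms]) blast
  define f where "f x = \<psi> (torus_pairing x (1 :: 'a poly))" for x
  have pac: "polynomial_averages_converge haar (rotation \<alpha>) P"
    using conv totally_ergodic_rotation[OF \<alpha>(1)] by (simp add: averages_converge_on_type_def)
  have "f \<in> borel_measurable borel" unfolding f_def by (rule measurable_torus_pairing)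
  hence f: "square_integrable haar f" by (simp add: square_integrable_def f_def)
  have inv: "f (rotation \<alpha> (P \<circ>\<^sub>p y) x) = f x" for x y
    by (simp add: f_def torus_pairing_rotation psi_add \<alpha>(2))
  have "(\<lambda>N. L2_norm haar (\<lambda>x. average (polys_below N) (\<lambda>y. f (rotation \<alpha> (P \<circ>\<^sub>p y) x)) - (\<integral>z. f z \<partial>haar))) \<longlonglongrightarrow> 0"
    using pac folner_polys_below f unfolding polynomial_averages_converge_def by blast
  moreover have "(\<integral>z. f z \<partial>haar) = 0" unfolding f_def by (simp add: integral_torus_character)
  moreover have "average (polys_below N) (\<lambda>_ :: 'a poly. c) = c" for N and c :: complex
    by (rule average_const[OF finite_polys_below polys_below_nonempty])
  moreover have "L2_norm haar f = 1" by (simp add: L2_norm_def f_def prob_space[unfolded space_haar])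
  ultimately have "(\<lambda>N :: nat. 1 :: real) \<longlonglongrightarrow> 0" unfolding inv by simp
  thus False using LIMSEQ_unique tendsto_const zero_neq_one by metis
qed

text \<open>One modulus, with lpf as large as desired, refutes several conditions at once, so each
  of them separately implies \<open>generates\<close>.\<close>

lemma ex_bad_modulus:
  assumes "\<not> generates"
  shows "\<exists>Q\<in>moduli. C \<le> real (lpf Q) \<and> mean_deviation P Q \<ge> 1 \<and> sum_image_subgroups Q \<eta> n \<noteq> residue_ring Q \<and>
    (\<exists>A B. A \<subseteq> residue_ring Q \<and> B \<subseteq> residue_ring Q \<and>
      real (card A) * real (card B) \<ge> 1 / (CARD('a))\<^sup>2 * (real (poly_abs Q))\<^sup>2 \<and>
      \<not> (\<exists>x\<in>residue_ring Q. \<exists>y\<in>residue_ring Q. x \<in> A \<and> (x + P \<circ>\<^sub>p y) mod Q \<in> B))"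
proof -
  obtain Q m where Q: "Q \<in> moduli" "nat \<lceil>C\<rceil> < lpf Q" and m: "m \<in> residue_ring Q" "m \<noteq> 0"
    "\<And>y. \<psi> (residue_functional Q m (P \<circ>\<^sub>p y)) = 1"
    "\<And>i y. i \<in> {1..n} \<Longrightarrow> \<psi> (residue_functional Q m (\<eta> i \<circ>\<^sub>p y)) = 1"
    by (rule ex_obstructed_modulus[OF assms, of "nat \<lceil>C\<rceil>"]) blast
  have "C \<le> real (lpf Q)" using Q(2) by linarith
  thus ?thesis
    using Q(1) obstruction_mean_deviation[OF Q(1) m] obstruction_subgroups[OF Q(1) m] obstruction_sets[OF Q(1) m]
    by (intro bexI[of _ Q] conjI)
qed

definition power_saving_deviation :: bool where
  "power_saving_deviation \<longleftrightarrow> (\<exists>C1 C2 \<gamma> :: real. C1 > 0 \<and> C2 > 0 \<and> \<gamma> > 0 \<and>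
     (\<forall>Q\<in>moduli. real (lpf Q) \<ge> C1 \<longrightarrow> mean_deviation P Q \<le> C2 * real (lpf Q) powr (- \<gamma>)))"

definition power_saving_correlation :: bool where
  "power_saving_correlation \<longleftrightarrow> (\<exists>C1 C2 \<gamma> :: real. C1 > 0 \<and> C2 > 0 \<and> \<gamma> > 0 \<and>
     (\<forall>Q\<in>moduli. real (lpf Q) \<ge> C1 \<longrightarrow>
        (\<forall>A B. A \<subseteq> residue_ring Q \<and> B \<subseteq> residue_ring Q \<longrightarrow>
           \<bar>real (card {(x, y). x \<in> residue_ring Q \<and> y \<in> residue_ring Q \<and>
                          x \<in> A \<and> (x + P \<circ>\<^sub>p y) mod Q \<in> B})
              - real (card A) * real (card B)\<bar>
           \<le> C2 * sqrt (real (card A)) * sqrt (real (card B)) * real (poly_abs Q) * real (lpf Q) powr (- \<gamma>))))"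

definition dense_recurrence :: bool where
  "dense_recurrence \<longleftrightarrow> (\<forall>\<delta> :: real. \<delta> > 0 \<longrightarrow>
     (\<exists>N :: real. N > 0 \<and>
        (\<forall>Q\<in>moduli. real (lpf Q) \<ge> N \<longrightarrow>
           (\<forall>A B. A \<subseteq> residue_ring Q \<and> B \<subseteq> residue_ring Q \<and>
              real (card A) * real (card B) \<ge> \<delta> * (real (poly_abs Q))\<^sup>2 \<longrightarrow>
              (\<exists>x\<in>residue_ring Q. \<exists>y\<in>residue_ring Q. x \<in> A \<and> (x + P \<circ>\<^sub>p y) mod Q \<in> B)))))"

lemma generates_imp_power_saving:
  assumes g: generates
  shows power_saving_deviation power_saving_correlation
proof -
  obtain c \<gamma> where c\<gamma>: "c > 0 \<and> \<gamma> > 0 \<and> (\<forall>Q\<in>moduli. \<forall>m\<in>residue_ring Q. m \<noteq> 0 \<longrightarrow>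
    cmod (average (residue_ring Q) (\<lambda>y. \<psi> (residue_functional Q m (P \<circ>\<^sub>p y)))) \<le> c * real (lpf Q) powr (- \<gamma>))"
    using residue_character_sum_bound[OF g] by iprover
  note c = c\<gamma>[THEN conjunct1] c\<gamma>[THEN conjunct2, THEN conjunct1]
    and bound = c\<gamma>[THEN conjunct2, THEN conjunct2, rule_format]
  have nonneg: "c * real (lpf Q) powr (- \<gamma>) \<ge> 0" for Q :: "'a poly" using c by simp
  have dev: "mean_deviation P Q \<le> c * real (lpf Q) powr (- \<gamma>)" if Q: "Q \<in> moduli" for Q
    by (rule mean_deviation_le[OF Q nonneg]) (rule bound[OF Q])
  show power_saving_deviation
    unfolding power_saving_deviation_def
    by (rule exI[of _ 1], rule exI[of _ c], rule exI[of _ \<gamma>]) (intro conjI ballI impI zero_less_one c dev)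
  have corr: "\<bar>real (card {(x, y). x \<in> residue_ring Q \<and> y \<in> residue_ring Q \<and> x \<in> A \<and> (x + P \<circ>\<^sub>p y) mod Q \<in> B})
        - real (card A) * real (card B)\<bar>
      \<le> c * sqrt (real (card A)) * sqrt (real (card B)) * real (poly_abs Q) * real (lpf Q) powr (- \<gamma>)"
    if Q: "Q \<in> moduli" and AB: "A \<subseteq> residue_ring Q \<and> B \<subseteq> residue_ring Q" for Q A B
  proof -
    have "\<bar>real (card {(x, y). x \<in> residue_ring Q \<and> y \<in> residue_ring Q \<and> x \<in> A \<and> (x + P \<circ>\<^sub>p y) mod Q \<in> B})
        - real (card A) * real (card B)\<bar>
      \<le> (c * real (lpf Q) powr (- \<gamma>)) * sqrt (real (card A)) * sqrt (real (card B)) * real (poly_abs Q)"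
      by (rule correlation_count_le[OF Q nonneg bound[OF Q]]) (use AB in simp_all)
    thus ?thesis by (simp only: mult_ac)
  qed
  show power_saving_correlation
    unfolding power_saving_correlation_def
    by (rule exI[of _ 1], rule exI[of _ c], rule exI[of _ \<gamma>]) (intro conjI zero_less_one c, intro ballI allI impI, rule corr)
qed

lemma power_saving_deviation_imp_tendsto:
  assumes power_saving_deviation
  shows "(mean_deviation P \<longlongrightarrow> 0) (inf (filtercomap lpf at_top) (principal moduli))"
proof -
  obtain C1 C2 \<gamma> :: real where C\<gamma>: "C1 > 0 \<and> C2 > 0 \<and> \<gamma> > 0 \<and>
      (\<forall>Q\<in>moduli. real (lpf Q) \<ge> C1 \<longrightarrow> mean_deviation P Q \<le> C2 * real (lpf Q) powr (- \<gamma>))"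
    using assms unfolding power_saving_deviation_def by iprover
  hence C: "C1 > 0" "C2 > 0" "\<gamma> > 0" by auto
  note bound = C\<gamma>[THEN conjunct2, THEN conjunct2, THEN conjunct2, rule_format]
  let ?F = "inf (filtercomap lpf at_top) (principal (moduli :: 'a poly set))"
  have lpf: "filterlim lpf at_top ?F"
    by (rule filterlim_mono[OF filterlim_filtercomap order.refl inf_le1])
  have "((\<lambda>k. C2 * real k powr (- \<gamma>)) \<longlongrightarrow> C2 * 0) at_top"
    by (intro tendsto_mult tendsto_const tendsto_neg_powr filterlim_real_sequentially) (use C in simp)
  from filterlim_compose[OF this lpf]
  have lim: "((\<lambda>Q. C2 * real (lpf Q) powr (- \<gamma>)) \<longlongrightarrow> 0) ?F" by simp
  have mod: "eventually (\<lambda>Q. Q \<in> moduli) ?F"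
    by (simp add: eventually_inf_principal)
  have "eventually (\<lambda>Q. real (lpf Q) \<ge> C1) ?F"
    by (rule eventually_compose_filterlim[OF _ lpf, of "\<lambda>k. real k \<ge> C1"])
       (auto intro!: eventually_sequentiallyI[of "nat \<lceil>C1\<rceil>"] simp: nat_ceiling_le_eq)
  with mod have "eventually (\<lambda>Q. mean_deviation P Q \<le> C2 * real (lpf Q) powr (- \<gamma>)) ?F"
    by eventually_elim (rule bound)
  moreover from mod have "eventually (\<lambda>Q. 0 \<le> mean_deviation P Q) ?F"
    by eventually_elim (rule mean_deviation_nonneg)
  ultimately show ?thesis by (intro tendsto_sandwich[OF _ _ tendsto_const lim])
qed

lemma tendsto_imp_generates:
  assumes lim: "(mean_deviation P \<longlongrightarrow> 0) (inf (filtercomap lpf at_top) (principal moduli))"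
  shows generates
proof (rule ccontr)
  assume ng: "\<not> generates"
  have "eventually (\<lambda>Q. mean_deviation P Q < 1) (inf (filtercomap lpf at_top) (principal moduli))"
    using lim by (rule order_tendstoD) simp
  then obtain N where N: "\<forall>Q. N \<le> lpf Q \<longrightarrow> Q \<in> moduli \<longrightarrow> mean_deviation P Q < 1"
    unfolding eventually_inf_principal eventually_filtercomap eventually_at_top_linorder by blast
  obtain Q where "Q \<in> moduli" "real N \<le> real (lpf Q)" "mean_deviation P Q \<ge> 1"
    using ex_bad_modulus[OF ng, of "real N"] by blast
  thus False using N by force
qed

text \<open>If there were no pair, the error term would have to exceed |A| |B|; with s the square
  root of that product this means s \<le> C2 |Q| lpf(Q)^(-\<gamma>), which for large lpf(Q) is below
  sqrt \<delta> |Q| \<le> s.\<close>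

lemma power_saving_correlation_imp_dense_recurrence:
  assumes power_saving_correlation
  shows dense_recurrence
  unfolding dense_recurrence_def
proof (intro allI impI)
  fix \<delta> :: real assume \<delta>: "\<delta> > 0"
  obtain C1 C2 \<gamma> :: real where C\<gamma>: "C1 > 0 \<and> C2 > 0 \<and> \<gamma> > 0 \<and>
     (\<forall>Q\<in>moduli. real (lpf Q) \<ge> C1 \<longrightarrow>
        (\<forall>A B. A \<subseteq> residue_ring Q \<and> B \<subseteq> residue_ring Q \<longrightarrow>
           \<bar>real (card {(x, y). x \<in> residue_ring Q \<and> y \<in> residue_ring Q \<and>
                          x \<in> A \<and> (x + P \<circ>\<^sub>p y) mod Q \<in> B})
              - real (card A) * real (card B)\<bar>
           \<le> C2 * sqrt (real (card A)) * sqrt (real (card B)) * real (poly_abs Q) * real (lpf Q) powr (- \<gamma>)))"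
    using assms unfolding power_saving_correlation_def by iprover
  hence C: "C1 > 0" "C2 > 0" "\<gamma> > 0" by auto
  note bound = C\<gamma>[THEN conjunct2, THEN conjunct2, THEN conjunct2, THEN bspec, THEN mp, THEN spec, THEN spec, THEN mp]
  have "((\<lambda>k. C2 * real k powr (- \<gamma>)) \<longlongrightarrow> C2 * 0) at_top"
    by (intro tendsto_mult tendsto_const tendsto_neg_powr filterlim_real_sequentially) (use C in simp)
  moreover have "C2 * 0 < sqrt \<delta>" using \<delta> by simp
  ultimately have "eventually (\<lambda>k. C2 * real k powr (- \<gamma>) < sqrt \<delta>) at_top" by (rule order_tendstoD)
  then obtain K where K: "\<And>k. k \<ge> K \<Longrightarrow> C2 * real k powr (- \<gamma>) < sqrt \<delta>"
    unfolding eventually_at_top_linorder by blast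
  show "\<exists>N>0. \<forall>Q\<in>moduli. N \<le> real (lpf Q) \<longrightarrow> (\<forall>A B. A \<subseteq> residue_ring Q \<and> B \<subseteq> residue_ring Q \<and>
      \<delta> * (real (poly_abs Q))\<^sup>2 \<le> real (card A) * real (card B) \<longrightarrow>
      (\<exists>x\<in>residue_ring Q. \<exists>y\<in>residue_ring Q. x \<in> A \<and> (x + P \<circ>\<^sub>p y) mod Q \<in> B))"
  proof (rule exI[of _ "max C1 (real K)"], intro conjI ballI allI impI, goal_cases)
    case 1
    show ?case using C(1) by simp
  next
    case (2 Q A B)
    hence Q: "Q \<in> moduli" "real (lpf Q) \<ge> C1" "lpf Q \<ge> K" and AB: "A \<subseteq> residue_ring Q \<and> B \<subseteq> residue_ring Q"
      and dense: "\<delta> * (real (poly_abs Q))\<^sup>2 \<le> real (card A) * real (card B)" by auto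
    define S where "S = {(x, y). x \<in> residue_ring Q \<and> y \<in> residue_ring Q \<and> x \<in> A \<and> (x + P \<circ>\<^sub>p y) mod Q \<in> B}"
    define s where "s = sqrt (real (card A)) * sqrt (real (card B))"
    have q: "real (poly_abs Q) > 0" by (simp add: poly_abs_def)
    have "sqrt (\<delta> * (real (poly_abs Q))\<^sup>2) \<le> s"
      unfolding s_def real_sqrt_mult[symmetric] using dense by (rule real_sqrt_le_mono)
    hence s1: "sqrt \<delta> * real (poly_abs Q) \<le> s" by (simp add: real_sqrt_mult)
    moreover have "0 < sqrt \<delta> * real (poly_abs Q)" using \<delta> q by simp
    ultimately have s: "s > 0" by linarith
    have "S \<noteq> {}"
    proof
      assume "S = {}"
      hence "s * s \<le> C2 * s * real (poly_abs Q) * real (lpf Q) powr (- \<gamma>)"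
        using bound[OF Q(1,2) AB] unfolding S_def[symmetric] by (simp add: s_def mult_ac)
      also have "\<dots> = s * ((C2 * real (lpf Q) powr (- \<gamma>)) * real (poly_abs Q))" by (simp only: mult_ac)
      also have "\<dots> < s * (sqrt \<delta> * real (poly_abs Q))"
        using s q K[OF Q(3)] by (intro mult_strict_left_mono mult_strict_right_mono)
      also have "\<dots> \<le> s * s" using s s1 by simp
      finally show False by simp
    qed
    thus ?case unfolding S_def by blast
  qed
qed

lemma dense_recurrence_imp_generates:
  assumes dense_recurrence
  shows generates
proof (rule ccontr)
  assume ng: "\<not> generates"
  define \<delta> where "\<delta> = 1 / (real CARD('a))\<^sup>2"
  have "\<delta> > 0" by (simp add: \<delta>_def)
  from assms[unfolded dense_recurrence_def, THEN spec, THEN mp, OF this]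
  obtain N where N0: "N > 0 \<and> (\<forall>Q\<in>moduli. real (lpf Q) \<ge> N \<longrightarrow>
     (\<forall>A B. A \<subseteq> residue_ring Q \<and> B \<subseteq> residue_ring Q \<and>
        real (card A) * real (card B) \<ge> \<delta> * (real (poly_abs Q))\<^sup>2 \<longrightarrow>
        (\<exists>x\<in>residue_ring Q. \<exists>y\<in>residue_ring Q. x \<in> A \<and> (x + P \<circ>\<^sub>p y) mod Q \<in> B)))"
    by (rule exE)
  note N = N0[THEN conjunct2, THEN bspec, THEN mp, THEN spec, THEN spec, THEN mp]
  from ex_bad_modulus[OF ng, of N] obtain Q where Q: "Q \<in> moduli" "N \<le> real (lpf Q)"
    and bad: "\<exists>A B. A \<subseteq> residue_ring Q \<and> B \<subseteq> residue_ring Q \<and>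
      real (card A) * real (card B) \<ge> 1 / (CARD('a))\<^sup>2 * (real (poly_abs Q))\<^sup>2 \<and>
      \<not> (\<exists>x\<in>residue_ring Q. \<exists>y\<in>residue_ring Q. x \<in> A \<and> (x + P \<circ>\<^sub>p y) mod Q \<in> B)"
    by blast
  from bad obtain A B where AB: "A \<subseteq> residue_ring Q" "B \<subseteq> residue_ring Q"
      "real (card A) * real (card B) \<ge> 1 / (CARD('a))\<^sup>2 * (real (poly_abs Q))\<^sup>2"
      "\<not> (\<exists>x\<in>residue_ring Q. \<exists>y\<in>residue_ring Q. x \<in> A \<and> (x + P \<circ>\<^sub>p y) mod Q \<in> B)"
    by iprover
  have "\<exists>x\<in>residue_ring Q. \<exists>y\<in>residue_ring Q. x \<in> A \<and> (x + P \<circ>\<^sub>p y) mod Q \<in> B"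
    by (rule N[OF Q]) (use AB(1-3) in \<open>simp add: \<delta>_def\<close>)
  with AB(4) show False by (rule notE)
qed

theorem equivalences:
  shows "good_for_irrational_equidistribution P \<longleftrightarrow> generates"
    and "averages_converge_on_type TYPE('x) P \<and> averages_converge_on_type TYPE('a laurent_torus) P \<longleftrightarrow> generates"
    and "(mean_deviation P \<longlongrightarrow> 0) (inf (filtercomap lpf at_top) (principal moduli)) \<longleftrightarrow> generates"
    and "power_saving_deviation \<longleftrightarrow> generates"
    and "(\<exists>C :: real. C > 0 \<and> (\<forall>Q\<in>moduli. real (lpf Q) \<ge> C \<longrightarrow> sum_image_subgroups Q \<eta> n = residue_ring Q)) \<longleftrightarrow> generates"
    and "dense_recurrence \<longleftrightarrow> generates"
    and "power_saving_correlation \<longleftrightarrow> generates"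
proof -
  show "good_for_irrational_equidistribution P \<longleftrightarrow> generates"
    using generates_imp_good not_generates_imp_not_good by blast
  have "averages_converge_on_type TYPE('a laurent_torus) P" if generates
    unfolding averages_converge_on_type_def using generates_imp_averages_converge[OF that] by blast
  moreover have "averages_converge_on_type TYPE('x) P" if generates
    unfolding averages_converge_on_type_def using generates_imp_averages_converge[OF that] by blast
  ultimately show "averages_converge_on_type TYPE('x) P \<and> averages_converge_on_type TYPE('a laurent_torus) P \<longleftrightarrow> generates"
    using not_generates_imp_not_averages_converge by blast
  show "(mean_deviation P \<longlongrightarrow> 0) (inf (filtercomap lpf at_top) (principal moduli)) \<longleftrightarrow> generates"
    using tendsto_imp_generates power_saving_deviation_imp_tendsto generates_imp_power_saving(1) by blast
  show "power_saving_deviation \<longleftrightarrow> generates"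
    using tendsto_imp_generates power_saving_deviation_imp_tendsto generates_imp_power_saving(1) by blast
  show "(\<exists>C :: real. C > 0 \<and> (\<forall>Q\<in>moduli. real (lpf Q) \<ge> C \<longrightarrow> sum_image_subgroups Q \<eta> n = residue_ring Q)) \<longleftrightarrow> generates"
    using sum_image_subgroups_full ex_bad_modulus zero_less_one by meson
  show "dense_recurrence \<longleftrightarrow> generates"
    using dense_recurrence_imp_generates power_saving_correlation_imp_dense_recurrence generates_imp_power_saving(2) by blast
  show "power_saving_correlation \<longleftrightarrow> generates"
    using dense_recurrence_imp_generates power_saving_correlation_imp_dense_recurrence generates_imp_power_saving(2) by blast
qed

end

(* In the second equivalence 'x is an arbitrary type, so that every totally ergodic system is
   covered, while the systems on the torus make the condition nonvacuous whichever 'x is taken. *)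

theorem theorem1p18:
  fixes \<eta> :: "nat \<Rightarrow> 'a::finite_field poly"
    and r :: "nat \<Rightarrow> nat"
    and n p :: nat
    and P :: "'a poly"
  assumes p: "p = CHAR('a)"
    and \<eta>: "\<And>i. i \<in> {1..n} \<Longrightarrow> \<eta> i \<in> prime_field_polys \<and> additive_poly (\<eta> i)"
    and r: "\<And>i. i \<in> {1..n} \<Longrightarrow> r i > 0 \<and> \<not> p dvd r i"
    and r_distinct: "inj_on r {1..n}"
    and P: "P = (\<Sum>i=1..n. \<eta> i \<circ>\<^sub>p monom 1 (r i))"
  shows
    "(good_for_irrational_equidistribution P \<longleftrightarrow>
        averages_converge_on_type TYPE('x) P \<and>
        averages_converge_on_type TYPE('a laurent_torus) P)
   \<and> (good_for_irrational_equidistribution P \<longleftrightarrow>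
        (\<exists>(\<zeta> :: nat \<Rightarrow> 'a poly) a.
           (\<forall>i\<in>{1..n}. \<zeta> i \<in> prime_field_polys \<and> additive_poly (\<zeta> i)) \<and>
           a \<in> prime_field \<and> a \<noteq> 0 \<and> (\<Sum>i=1..n. \<eta> i \<circ>\<^sub>p \<zeta> i) = monom a 1))
   \<and> (good_for_irrational_equidistribution P \<longleftrightarrow>
        (mean_deviation P \<longlongrightarrow> 0) (inf (filtercomap lpf at_top) (principal moduli)))
   \<and> (good_for_irrational_equidistribution P \<longleftrightarrow>
        (\<exists>C1 C2 \<gamma> :: real. C1 > 0 \<and> C2 > 0 \<and> \<gamma> > 0 \<and>
           (\<forall>Q\<in>moduli. real (lpf Q) \<ge> C1 \<longrightarrow>
              mean_deviation P Q \<le> C2 * real (lpf Q) powr (- \<gamma>))))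
   \<and> (good_for_irrational_equidistribution P \<longleftrightarrow>
        (\<exists>C :: real. C > 0 \<and>
           (\<forall>Q\<in>moduli. real (lpf Q) \<ge> C \<longrightarrow> sum_image_subgroups Q \<eta> n = residue_ring Q)))
   \<and> (good_for_irrational_equidistribution P \<longleftrightarrow>
        (\<forall>\<delta> :: real. \<delta> > 0 \<longrightarrow>
           (\<exists>N :: real. N > 0 \<and>
              (\<forall>Q\<in>moduli. real (lpf Q) \<ge> N \<longrightarrow>
                 (\<forall>A B. A \<subseteq> residue_ring Q \<and> B \<subseteq> residue_ring Q \<and>
                    real (card A) * real (card B) \<ge> \<delta> * (real (poly_abs Q))\<^sup>2 \<longrightarrow>
                    (\<exists>x\<in>residue_ring Q. \<exists>y\<in>residue_ring Q.
                       x \<in> A \<and> (x + P \<circ>\<^sub>p y) mod Q \<in> B))))))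
   \<and> (good_for_irrational_equidistribution P \<longleftrightarrow>
        (\<exists>C1 C2 \<gamma> :: real. C1 > 0 \<and> C2 > 0 \<and> \<gamma> > 0 \<and>
           (\<forall>Q\<in>moduli. real (lpf Q) \<ge> C1 \<longrightarrow>
              (\<forall>A B. A \<subseteq> residue_ring Q \<and> B \<subseteq> residue_ring Q \<longrightarrow>
                 \<bar>real (card {(x, y). x \<in> residue_ring Q \<and> y \<in> residue_ring Q \<and>
                                x \<in> A \<and> (x + P \<circ>\<^sub>p y) mod Q \<in> B})
                    - real (card A) * real (card B)\<bar>
                 \<le> C2 * sqrt (real (card A)) * sqrt (real (card B)) * real (poly_abs Q)
                     * real (lpf Q) powr (- \<gamma>)))))"
proof -
  have \<eta>': "\<eta> i \<in> additive_polys" if "i \<in> {1..n}" for i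
    using \<eta>[OF that] by (simp add: additive_polys_def additive_poly_iff)
  interpret separable_sum \<eta> r n P
    by unfold_locales (use \<eta>' r r_distinct P p in simp_all)
  have gen: "(\<exists>(\<zeta> :: nat \<Rightarrow> 'a poly) a.
           (\<forall>i\<in>{1..n}. \<zeta> i \<in> prime_field_polys \<and> additive_poly (\<zeta> i)) \<and>
           a \<in> prime_field \<and> a \<noteq> 0 \<and> (\<Sum>i=1..n. \<eta> i \<circ>\<^sub>p \<zeta> i) = monom a 1) \<longleftrightarrow> generates"
    unfolding generates_def additive_polys_def additive_poly_iff by simp
  note good = equivalences(1)
  show ?thesis
    by (intro conjI)
       (rule trans[OF good equivalences(2)[symmetric]] trans[OF good gen[symmetric]]
          trans[OF good equivalences(3)[symmetric]]
          trans[OF good equivalences(4)[unfolded power_saving_deviation_def, symmetric]]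
          trans[OF good equivalences(5)[symmetric]]
          trans[OF good equivalences(6)[unfolded dense_recurrence_def, symmetric]]
          trans[OF good equivalences(7)[unfolded power_saving_correlation_def, symmetric]])+
qed

end
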